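(* There exists $\alpha_0\in(0,1]$, depending only on $\gamma$, $d$ and $b$, such that for every $0<\alpha<\alpha_0$ there is an explicit constant $\overline M$, depending only on $\alpha,\gamma,b$ and $d$, with the following property. Let $p>1$, let $\psi_0\in L^1_{2+\gamma}(\mathbb{R}^d)\cap L^p(\mathbb{R}^d)$ be nonnegative with $\int_{\mathbb{R}^d}\psi_0\,d\xi=1$ and $\int_{\mathbb{R}^d}\psi_0|\xi|^2\,d\xi=\frac d2$, and let $\psi\in\mathcal{C}([0,\infty);w\text{-}L^1(\mathbb{R}^d))\cap L^\infty_{\mathrm{loc}}((0,\infty),L^1_{2+\gamma}(\mathbb{R}^d))$ be a nonnegative solution to the annihilation equation $\partial_t\psi+\mathbf{A}_\psi(t)\psi+\mathbf{B}_\psi(t)\,\xi\cdot\nabla_\xi\psi=\mathbb{B}(\psi,\psi)$ with $\psi(0,\cdot)=\psi_0$. Then $$\sup_{t\ge0}\int_{\mathbb{R}^d}\psi(t,\xi)|\xi|^{2+\gamma}\,d\xi\le\max\left\{\int_{\mathbb{R}^d}\psi_0(\xi)|\xi|^{2+\gamma}\,d\xi,\ \overline M\right\}.$$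
   Context: Fix $d\ge2$, $\gamma\in(0,1]$, $\alpha\in(0,1)$ and a measurable $b:[-1,1]\to[0,\infty)$ with $|\mathbb{S}^{d-2}|\int_{-1}^1 b(t)(1-t^2)^{(d-3)/2}\,dt=1$. For $\xi,\xi_*\in\mathbb{R}^d$, $\sigma\in\mathbb{S}^{d-1}$ put $\xi'=\frac{\xi+\xi_*}2+\frac{|\xi-\xi_*|}2\sigma$, $\xi'_*=\frac{\xi+\xi_*}2-\frac{|\xi-\xi_*|}2\sigma$, $\cos\theta=\langle\frac{\xi-\xi_*}{|\xi-\xi_*|},\sigma\rangle$. Define $$\mathcal{Q}_+(f,f)(\xi)=\int_{\mathbb{R}^d\times\mathbb{S}^{d-1}}|\xi-\xi_*|^\gamma b(\cos\theta)f(\xi')f(\xi'_* )\,d\xi_*d\sigma,\qquad \mathcal{Q}_-(f,f)(\xi)=f(\xi)\int_{\mathbb{R}^d}|\xi-\xi_*|^\gamma f(\xi_* )\,d\xi_*,$$ $\mathbb{B}(f,f)=(1-\alpha)\mathcal{Q}_+(f,f)-\mathcal{Q}_-(f,f)$, and $$\mathbf{A}_\psi(t)=-\frac\alpha2\int(d+2-2|\xi|^2)\mathcal{Q}_-(\psi,\psi)(t,\xi)\,d\xi,\qquad \mathbf{B}_\psi(t)=-\frac{\alpha}{2d}\int(d-2|\xi|^2)\mathcal{Q}_-(\psi,\psi)(t,\xi)\,d\xi.$$ Spaces: $\langle\xi\rangle=\sqrt{1+|\xi|^2}$; $\|f\|_{L^1_\eta}=\int|f|\langle\xi\rangle^{\eta}d\xi$;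 $w\text{-}L^1$ is $L^1(\mathbb{R}^d)$ with its weak topology. Solution: a nonnegative $\psi$ on $[0,T]\times\mathbb{R}^d$ is a solution on $[0,T]$ with initial datum $\psi_0$ (nonnegative, mass $1$, $\int\psi_0|\xi|^2=\frac d2$) if $\psi\in\mathcal{C}([0,T];w\text{-}L^1)\cap L^\infty(0,T;L^1_2)\cap L^1(0,T;L^1_{2+\gamma})$ and, for all $\varrho\in\mathcal{C}^1_c(\mathbb{R}^d)$ and $t\in(0,T)$, $$\int\psi(t,\xi)\varrho\,d\xi+\int_0^t[\mathbf{A}_\psi(s)-d\mathbf{B}_\psi(s)]\int\varrho\,\psi(s,\xi)\,d\xi ds=\int_0^t\mathbf{B}_\psi(s)\int\psi(s,\xi)\,\xi\cdot\nabla\varrho\,d\xi ds+\int\varrho\,\psi_0\,d\xi+\int_0^t\int\mathbb{B}(\psi,\psi)(s,\xi)\varrho\,d\xi ds.$$ A solution on $[0,\infty)$ is a solution on $[0,T]$ for every $T>0$. Solutions conserve mass and energy: $\int\psi(t,\xi)d\xi=1$ and $\int\psi(t,\xi)|\xi|^2d\xi=\frac d2$ for all $t\ge0$. *)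

theory Defs
  imports "HOL-Analysis.Analysis"
begin

text \<open>
  Throughout, \<open>'a\<close> plays the role of \<open>\<real>\<^sup>d\<close> with \<open>d = DIM('a)\<close>.  Elements of \<open>L\<^sup>1\<close> are represented by
  Borel functions; hypotheses and conclusions only depend on them up to null sets.
\<close>

text \<open>
  Surface measure as the cone measure: \<open>\<bar>A\<bar> = d \<cdot> Leb {r \<omega> | 0 < r < 1, \<omega> \<in> A}\<close>.
  The space of this measure is the sphere itself (not the ambient space), so that functions
  only known to be measurable there can be integrated.
\<close>
definition sphere_measure :: "'a::euclidean_space measure" where
  "sphere_measure =
     scale_measure (of_nat DIM('a))
       (distr (restrict_space lborel (ball 0 1 - {0})) (restrict_space borel (sphere 0 1)) sgn)"

text \<open>\<open>\<bar>S\<^sup>n\<bar>\<close>, the total surface measure of the unit sphere of \<open>\<real>\<^bsup>n+1\<^esup>\<close>; in particular \<open>\<bar>S\<^sup>0\<bar> = 2\<close>.\<close>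
definition sphere_area :: "nat \<Rightarrow> real" where
  "sphere_area n = real (n + 1) * unit_ball_vol (real (n + 1))"

lemma space_sphere_measure [simp]:
  "space (sphere_measure :: 'a::euclidean_space measure) = sphere 0 1"
  by (simp add: sphere_measure_def space_scale_measure space_restrict_space)

lemma emeasure_sphere_measure_space:
  "emeasure sphere_measure (sphere 0 1 :: 'a::euclidean_space set)
     = ennreal (sphere_area (DIM('a) - 1))"
proof -
  have m: "sgn \<in> measurable (restrict_space lborel (ball 0 1 - {0 :: 'a}))
      (restrict_space borel (sphere 0 1))"
    by (rule measurable_restrict_space3)
       (auto simp: sgn_div_norm[abs_def] norm_sgn)
  have s: "sphere 0 1 \<in> sets (restrict_space borel (sphere 0 (1::real) :: 'a set))"
    by (auto simp: sets_restrict_space)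
  have e: "emeasure lborel (ball 0 1 - {0 :: 'a}) = ennreal (unit_ball_vol (real DIM('a)))"
    by (subst emeasure_Diff) (auto simp: emeasure_ball)
  have v: "sgn -` sphere 0 1 \<inter> (ball 0 1 - {0 :: 'a}) = ball 0 1 - {0}"
    by (auto simp: norm_sgn)
  show ?thesis
    unfolding sphere_measure_def sphere_area_def
    by (simp add: emeasure_distr[OF m s] space_restrict_space v emeasure_restrict_space e
        ennreal_mult' ennreal_of_nat_eq_real_of_nat)
qed

definition bracket :: "'a::euclidean_space \<Rightarrow> real" where
  "bracket \<xi> = sqrt (1 + (norm \<xi>)\<^sup>2)"

definition weighted_L1 :: "real \<Rightarrow> ('a::euclidean_space \<Rightarrow> real) set" where
  "weighted_L1 \<eta> = {f. integrable lborel (\<lambda>\<xi>. f \<xi> * bracket \<xi> powr \<eta>)}"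

definition weighted_L1_norm :: "real \<Rightarrow> ('a::euclidean_space \<Rightarrow> real) \<Rightarrow> real" where
  "weighted_L1_norm \<eta> f = (LINT \<xi>|lborel. \<bar>f \<xi>\<bar> * bracket \<xi> powr \<eta>)"

definition Lp_space :: "real \<Rightarrow> ('a::euclidean_space \<Rightarrow> real) set" where
  "Lp_space p = {f \<in> borel_measurable lborel. integrable lborel (\<lambda>\<xi>. \<bar>f \<xi>\<bar> powr p)}"

text \<open>Continuous linear functionals on \<open>L\<^sup>1\<close>; the bound makes \<open>\<Lambda>\<close> constant on classes modulo null sets.\<close>
definition L1_functional :: "(('a::euclidean_space \<Rightarrow> real) \<Rightarrow> real) \<Rightarrow> bool" where
  "L1_functional \<Lambda> \<longleftrightarrow>
     (\<forall>f g. integrable lborel f \<longrightarrow> integrable lborel g \<longrightarrow> \<Lambda> (\<lambda>\<xi>. f \<xi> + g \<xi>) = \<Lambda> f + \<Lambda> g) \<and>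
     (\<forall>c f. integrable lborel f \<longrightarrow> \<Lambda> (\<lambda>\<xi>. c * f \<xi>) = c * \<Lambda> f) \<and>
     (\<exists>C. \<forall>f. integrable lborel f \<longrightarrow> \<bar>\<Lambda> f\<bar> \<le> C * (LINT \<xi>|lborel. \<bar>f \<xi>\<bar>))"

definition weakly_continuous_L1 :: "real set \<Rightarrow> (real \<Rightarrow> 'a::euclidean_space \<Rightarrow> real) \<Rightarrow> bool" where
  "weakly_continuous_L1 I \<psi> \<longleftrightarrow>
     (\<forall>t\<in>I. integrable lborel (\<psi> t)) \<and>
     (\<forall>\<Lambda>. L1_functional \<Lambda> \<longrightarrow> continuous_on I (\<lambda>t. \<Lambda> (\<psi> t)))"

text \<open>
  \<open>L\<^sup>\<infinity>(I; L\<^sup>1\<^sub>\<eta>)\<close> and \<open>L\<^sup>1(I; L\<^sup>1\<^sub>\<eta>)\<close>.  Strong measurability in time is not repeated here: these are only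
  used for weakly continuous \<open>\<psi>\<close>, where it is automatic because \<open>L\<^sup>1\<close> is separable (Pettis).
\<close>
definition Linf_L1 :: "real set \<Rightarrow> real \<Rightarrow> (real \<Rightarrow> 'a::euclidean_space \<Rightarrow> real) \<Rightarrow> bool" where
  "Linf_L1 I \<eta> \<psi> \<longleftrightarrow>
     (\<exists>C. AE t in lborel. t \<in> I \<longrightarrow> \<psi> t \<in> weighted_L1 \<eta> \<and> weighted_L1_norm \<eta> (\<psi> t) \<le> C)"

definition L1_L1 :: "real set \<Rightarrow> real \<Rightarrow> (real \<Rightarrow> 'a::euclidean_space \<Rightarrow> real) \<Rightarrow> bool" where
  "L1_L1 I \<eta> \<psi> \<longleftrightarrow>
     (AE t in lborel. t \<in> I \<longrightarrow> \<psi> t \<in> weighted_L1 \<eta>) \<and>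
     set_integrable lborel I (\<lambda>t. weighted_L1_norm \<eta> (\<psi> t))"

text \<open>\<open>L\<^sup>\<infinity>\<^sub>l\<^sub>o\<^sub>c((0,\<infinity>); L\<^sup>1\<^sub>\<eta>)\<close>: no bound near \<open>t = 0\<close> is imposed.\<close>
definition Linf_loc_L1 :: "real \<Rightarrow> (real \<Rightarrow> 'a::euclidean_space \<Rightarrow> real) \<Rightarrow> bool" where
  "Linf_loc_L1 \<eta> \<psi> \<longleftrightarrow> (\<forall>K. compact K \<and> K \<subseteq> {0<..} \<longrightarrow> Linf_L1 K \<eta> \<psi>)"

text \<open>At \<open>\<xi> = \<xi>\<^sub>*\<close>, where \<open>cos \<theta>\<close> is undefined, the factor \<open>\<bar>\<xi> - \<xi>\<^sub>*\<bar>\<^sup>\<gamma>\<close> vanishes.\<close>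
definition Q_plus ::
  "real \<Rightarrow> (real \<Rightarrow> real) \<Rightarrow> ('a::euclidean_space \<Rightarrow> real) \<Rightarrow> 'a \<Rightarrow> real" where
  "Q_plus \<gamma> b f \<xi> =
     (LINT (\<xi>s, \<sigma>)|(lborel \<Otimes>\<^sub>M sphere_measure).
       (let \<xi>' = (1/2) *\<^sub>R (\<xi> + \<xi>s) + (norm (\<xi> - \<xi>s) / 2) *\<^sub>R \<sigma>;
            \<xi>s' = (1/2) *\<^sub>R (\<xi> + \<xi>s) - (norm (\<xi> - \<xi>s) / 2) *\<^sub>R \<sigma>;
            cos\<theta> = ((\<xi> - \<xi>s) /\<^sub>R norm (\<xi> - \<xi>s)) \<bullet> \<sigma>
        in norm (\<xi> - \<xi>s) powr \<gamma> * b cos\<theta> * f \<xi>' * f \<xi>s'))"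

definition Q_minus :: "real \<Rightarrow> ('a::euclidean_space \<Rightarrow> real) \<Rightarrow> 'a \<Rightarrow> real" where
  "Q_minus \<gamma> f \<xi> = f \<xi> * (LINT \<xi>s|lborel. norm (\<xi> - \<xi>s) powr \<gamma> * f \<xi>s)"

definition collision ::
  "real \<Rightarrow> real \<Rightarrow> (real \<Rightarrow> real) \<Rightarrow> ('a::euclidean_space \<Rightarrow> real) \<Rightarrow> 'a \<Rightarrow> real" where
  "collision \<alpha> \<gamma> b f \<xi> = (1 - \<alpha>) * Q_plus \<gamma> b f \<xi> - Q_minus \<gamma> f \<xi>"

definition A_coeff :: "real \<Rightarrow> real \<Rightarrow> ('a::euclidean_space \<Rightarrow> real) \<Rightarrow> real" where
  "A_coeff \<alpha> \<gamma> f =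
     - (\<alpha> / 2) * (LINT \<xi>|lborel. (real DIM('a) + 2 - 2 * (norm \<xi>)\<^sup>2) * Q_minus \<gamma> f \<xi>)"

definition B_coeff :: "real \<Rightarrow> real \<Rightarrow> ('a::euclidean_space \<Rightarrow> real) \<Rightarrow> real" where
  "B_coeff \<alpha> \<gamma> f =
     - (\<alpha> / (2 * real DIM('a))) *
       (LINT \<xi>|lborel. (real DIM('a) - 2 * (norm \<xi>)\<^sup>2) * Q_minus \<gamma> f \<xi>)"

definition C1c_gradient ::
  "('a::euclidean_space \<Rightarrow> real) \<Rightarrow> ('a \<Rightarrow> 'a) \<Rightarrow> bool" where
  "C1c_gradient \<rho> g \<longleftrightarrow>
     (\<forall>\<xi>. GDERIV \<rho> \<xi> :> g \<xi>) \<and> continuous_on UNIV g \<and> compact (closure {\<xi>. \<rho> \<xi> \<noteq> 0})"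

text \<open>Since \<open>d/2\<close> and \<open>1\<close> are nonzero, the two equations include the integrability of the integrands.\<close>
definition initial_datum :: "('a::euclidean_space \<Rightarrow> real) \<Rightarrow> bool" where
  "initial_datum \<psi>0 \<longleftrightarrow>
     (AE \<xi> in lborel. 0 \<le> \<psi>0 \<xi>) \<and>
     (LINT \<xi>|lborel. \<psi>0 \<xi>) = 1 \<and>
     (LINT \<xi>|lborel. \<psi>0 \<xi> * (norm \<xi>)\<^sup>2) = real DIM('a) / 2"

definition solution_on ::
  "real \<Rightarrow> real \<Rightarrow> (real \<Rightarrow> real) \<Rightarrow> real \<Rightarrow> ('a::euclidean_space \<Rightarrow> real)
     \<Rightarrow> (real \<Rightarrow> 'a \<Rightarrow> real) \<Rightarrow> bool" where
  "solution_on \<alpha> \<gamma> b T \<psi>0 \<psi> \<longleftrightarrow>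
     initial_datum \<psi>0 \<and>
     (\<forall>t\<in>{0..T}. AE \<xi> in lborel. 0 \<le> \<psi> t \<xi>) \<and>
     weakly_continuous_L1 {0..T} \<psi> \<and>
     Linf_L1 {0<..<T} 2 \<psi> \<and>
     L1_L1 {0<..<T} (2 + \<gamma>) \<psi> \<and>
     (\<forall>\<rho> g. C1c_gradient \<rho> g \<longrightarrow> (\<forall>t\<in>{0<..<T}.
        (LINT \<xi>|lborel. \<psi> t \<xi> * \<rho> \<xi>)
        + (LINT s:{0..t}|lborel.
             (A_coeff \<alpha> \<gamma> (\<psi> s) - real DIM('a) * B_coeff \<alpha> \<gamma> (\<psi> s))
               * (LINT \<xi>|lborel. \<rho> \<xi> * \<psi> s \<xi>))
        = (LINT s:{0..t}|lborel.
             B_coeff \<alpha> \<gamma> (\<psi> s) * (LINT \<xi>|lborel. \<psi> s \<xi> * (\<xi> \<bullet> g \<xi>)))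
        + (LINT \<xi>|lborel. \<rho> \<xi> * \<psi>0 \<xi>)
        + (LINT s:{0..t}|lborel. (LINT \<xi>|lborel. collision \<alpha> \<gamma> b (\<psi> s) \<xi> * \<rho> \<xi>))))"

definition global_solution ::
  "real \<Rightarrow> real \<Rightarrow> (real \<Rightarrow> real) \<Rightarrow> ('a::euclidean_space \<Rightarrow> real) \<Rightarrow> (real \<Rightarrow> 'a \<Rightarrow> real) \<Rightarrow> bool" where
  "global_solution \<alpha> \<gamma> b \<psi>0 \<psi> \<longleftrightarrow> (\<forall>T>0. solution_on \<alpha> \<gamma> b T \<psi>0 \<psi>)"

end

theory Submission
  imports Defs "HOL-Probability.Giry_Monad"
begin

text \<open>Let \<open>m(t)\<close> be the integral of \<open>\<psi>(t, \<xi>) |\<xi>|\<^bsup>2+\<gamma>\<^esup>\<close>, and let \<open>a\<close>, \<open>e\<close> be the integrals of \<open>|\<xi> - \<xi>\<^sub>*|\<^sup>\<gamma>\<close> and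
  \<open>|\<xi> - \<xi>\<^sub>*|\<^sup>\<gamma> |\<xi>|\<^sup>2\<close> against \<open>\<psi> \<otimes> \<psi>\<close>. The coefficients of the equation are \<open>A - d B = - \<alpha> a\<close> and
  \<open>B = - \<alpha> a / 2 + \<alpha> e / d\<close>. Testing with \<open>1\<close> and \<open>|\<xi>|\<^sup>2\<close> gives linear homogeneous equations for the
  deviations of mass and energy from \<open>1\<close> and \<open>d / 2\<close>, so both are conserved. Testing with \<open>|\<xi>|\<^bsup>2+\<gamma>\<^esup>\<close>
  gives, formally,
  \<open>m' = - (\<gamma> / 2) \<alpha> a m + \<alpha> ((2 + \<gamma>) / d) e m + \<close> collision terms.

  The collision terms are estimated by a Povzner inequality. With \<open>E = |\<xi>|\<^sup>2 + |\<xi>\<^sub>*|\<^sup>2\<close>, the energies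
  of the two outgoing particles add up to \<open>E\<close>, and neither exceeds \<open>(1 + \<tau>) E / 2\<close>, where \<open>\<tau>\<close> is the
  cosine between \<open>\<sigma>\<close> and the line of \<open>\<xi> + \<xi>\<^sub>*\<close>. Hence the outgoing moments are at most a factor
  \<open>((1 + \<tau>) / 2)\<^bsup>\<gamma>/2\<^esup>\<close> times \<open>E\<^bsup>1+\<gamma>/2\<^esup>\<close>, strictly less unless \<open>\<sigma>\<close> is close to two poles; and an
  integrable \<open>b\<close> puts uniformly little mass on small caps around them, wherever they are
  (\<open>uniformly_small_polar_caps\<close>). Averaging over \<open>\<sigma>\<close> yields a factor \<open>\<kappa> < 1\<close> depending only on \<open>b\<close>, \<open>\<gamma>\<close> and \<open>d\<close>
  (\<open>povzner\<close>). So the collision terms are at most cross terms, which are affine in \<open>m\<close>, minus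
  \<open>1 - \<kappa>\<close> times the integral of \<open>|\<xi> - \<xi>\<^sub>*|\<^sup>\<gamma> |\<xi>|\<^bsup>2+\<gamma>\<^esup>\<close>. By Cauchy-Schwarz and conservation of energy the
  latter is at least \<open>(2 / d) m\<^sup>2 - C m\<close>, while \<open>e \<le> m + C\<close>. If \<open>\<alpha> (2 + \<gamma>) \<le> 1 - \<kappa>\<close>, the gain
  \<open>\<alpha> ((2 + \<gamma>) / d) e m\<close> eats at most half of the dissipation and
  \<open>m' \<le> - ((1 - \<kappa>) / d) m\<^sup>2 + C m + C\<close> (\<open>limit_rate_le\<close>), which is negative as soon as \<open>m\<close> exceeds a
  constant. That constant is the barrier (\<open>barrier\<close>, \<open>moment_le\<close>).

  To make this rigorous, \<open>|\<xi>|\<^bsup>2+\<gamma>\<^esup>\<close> is replaced by \<open>|\<xi>|\<^sup>2 (|\<xi>|\<^sup>2 / (1 + \<epsilon> |\<xi>|\<^sup>2))\<^bsup>\<gamma>/2\<^esup>\<close>. It has quadratic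
  growth, for which the collision terms of a density with a moment of order \<open>2 + \<gamma>\<close> converge, and the
  weak formulation extends to such functions (\<open>weak_source\<close>). The factor \<open>\<kappa>\<close> survives, uniformly in
  \<open>\<epsilon>\<close>, for \<open>\<epsilon> E \<le> 1\<close>; elsewhere the factor one remains, so only the dissipation from pairs with
  \<open>\<epsilon> E \<le> 1\<close> is kept. Discarding the dissipation, Gronwall's lemma bounds \<open>m\<close> on bounded time
  intervals (\<open>moment_bounded\<close>). This justifies letting \<open>\<epsilon>\<close> tend to zero in the full inequality
  (\<open>moment_increment\<close>), in which the Cauchy-Schwarz inequality has been linearized so that no moment
  above the order \<open>2 + \<gamma>\<close> occurs (\<open>dissipation_ge\<close>).

  The weak form of \<open>Q_plus\<close> rests on two facts about the sphere: \<open>(\<xi>, \<xi>\<^sub>*, \<sigma>)\<close> is mapped by a collision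
  in a measure preserving way (\<open>distr_collision_map\<close>), and zonal functions integrate by slices
  (\<open>nn_integral_sphere_slice\<close>), which turns the normalization of \<open>b\<close> into mass one on the sphere.\<close>

section \<open>Isometry invariance of Lebesgue measure\<close>

lemma nn_integral_lborel_translate:
  fixes c :: "'a::euclidean_space"
  assumes [measurable]: "f \<in> borel_measurable borel"
  shows "(\<integral>\<^sup>+x. f (x + c) \<partial>lborel) = (\<integral>\<^sup>+x. f x \<partial>lborel)"
proof -
  have "(\<integral>\<^sup>+x. f x \<partial>lborel) = (\<integral>\<^sup>+x. f x \<partial>(distr lborel borel ((+) c)))"
    by (simp only: lborel_distr_plus)
  also have "\<dots> = (\<integral>\<^sup>+x. f (x + c) \<partial>lborel)"
    by (subst nn_integral_distr) (auto simp: add.commute)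
  finally show ?thesis by simp
qed

lemma nn_integral_lborel_reflect:
  fixes c :: "'a::euclidean_space"
  assumes [measurable]: "f \<in> borel_measurable borel"
  shows "(\<integral>\<^sup>+x. f (c - x) \<partial>lborel) = (\<integral>\<^sup>+x. f x \<partial>lborel)"
proof -
  have "(\<integral>\<^sup>+x. f x \<partial>lborel)
      = (\<integral>\<^sup>+x. f x \<partial>(density (distr lborel borel (\<lambda>x. c - x)) (\<lambda>_. 1)))"
    using lborel_affine[of "-1" c] by simp
  also have "\<dots> = (\<integral>\<^sup>+x. f (c - x) \<partial>lborel)"
    by (simp add: nn_integral_density nn_integral_distr density_1)
  finally show ?thesis by simp
qed

lemma nn_integral_lborel_scale:
  fixes f :: "'a::euclidean_space \<Rightarrow> ennreal"
  assumes [measurable]: "f \<in> borel_measurable borel" and c: "c > 0"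
  shows "(\<integral>\<^sup>+x. f x \<partial>lborel) = ennreal (c ^ DIM('a)) * (\<integral>\<^sup>+x. f (c *\<^sub>R x) \<partial>lborel)"
proof -
  have "(\<integral>\<^sup>+x. f x \<partial>lborel)
      = (\<integral>\<^sup>+x. f x \<partial>(density (distr lborel borel (\<lambda>x. 0 + c *\<^sub>R x)) (\<lambda>_. \<bar>c\<bar>^DIM('a))))"
    using lborel_affine[of c "0::'a"] c by simp
  also have "\<dots> = (\<integral>\<^sup>+x. ennreal (c ^ DIM('a)) * f (c *\<^sub>R x) \<partial>lborel)"
    using c by (simp add: nn_integral_density nn_integral_distr)
  also have "\<dots> = ennreal (c ^ DIM('a)) * (\<integral>\<^sup>+x. f (c *\<^sub>R x) \<partial>lborel)"
    by (rule nn_integral_cmult) measurable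
  finally show ?thesis .
qed

text \<open>The invariance under translations determines a measure up to a factor, and the unit ball \<open>B\<close>, which
  \<open>f\<close> preserves, fixes the factor: integrate \<open>1\<^sub>A(f x) 1\<^sub>B(y + f x)\<close> over \<open>x\<close> and \<open>y\<close> in both orders.\<close>
lemma lborel_distr_orthogonal_transformation:
  fixes f :: "'a::euclidean_space \<Rightarrow> 'a"
  assumes f: "orthogonal_transformation f"
  shows "distr lborel borel f = lborel"
proof (rule measure_eqI)
  have lin: "linear f" and nf: "\<And>x. norm (f x) = norm x"
    using f by (auto simp: orthogonal_transformation)
  have [measurable]: "f \<in> borel_measurable borel"
    using lin by (intro borel_measurable_continuous_onI linear_continuous_on linear_conv_bounded_linear[THEN iffD1])
  fix A assume "A \<in> sets (distr lborel borel f)"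
  then have [measurable]: "A \<in> sets borel" by simp
  let ?B = "ball 0 1 :: 'a set"
  have [measurable]: "?B \<in> sets borel" by simp
  have B1: "(indicator ?B (f x) :: ennreal) = indicator ?B x" for x
    by (simp add: nf indicator_def)
  have "(\<integral>\<^sup>+x. indicator A (f x) \<partial>lborel) * emeasure lborel ?B
      = (\<integral>\<^sup>+x. indicator A (f x) * (\<integral>\<^sup>+y. indicator ?B y \<partial>lborel) \<partial>lborel)"
    by (subst nn_integral_multc) auto
  also have "\<dots> = (\<integral>\<^sup>+x. indicator A (f x) * (\<integral>\<^sup>+y. indicator ?B (y + f x) \<partial>lborel) \<partial>lborel)"
    by (subst nn_integral_lborel_translate) (auto intro!: borel_measurable_indicator)
  also have "\<dots> = (\<integral>\<^sup>+x. (\<integral>\<^sup>+y. indicator A (f x) * indicator ?B (y + f x) \<partial>lborel) \<partial>lborel)"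
    by (simp add: nn_integral_cmult)
  also have "\<dots> = (\<integral>\<^sup>+y. (\<integral>\<^sup>+x. indicator A (f x) * indicator ?B (y + f x) \<partial>lborel) \<partial>lborel)"
    by (rule lborel_pair.Fubini') measurable
  also have "\<dots> = (\<integral>\<^sup>+y. (\<integral>\<^sup>+x. indicator A (f x - y) * indicator ?B (f x) \<partial>lborel) \<partial>lborel)"
  proof (rule nn_integral_cong)
    fix y
    obtain z where z: "f z = y"
      using orthogonal_transformation_surj[OF f] by (metis surj_def)
    have "(\<integral>\<^sup>+x. indicator A (f x - y) * indicator ?B (f x) \<partial>lborel)
        = (\<integral>\<^sup>+x. indicator A (f (x + z) - y) * indicator ?B (f (x + z)) \<partial>lborel)"
      by (rule nn_integral_lborel_translate[symmetric]) measurable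
    also have "\<dots> = (\<integral>\<^sup>+x. indicator A (f x) * indicator ?B (y + f x) \<partial>lborel)"
      by (simp add: linear_add[OF lin] z add.commute)
    finally show "(\<integral>\<^sup>+x. indicator A (f x) * indicator ?B (y + f x) \<partial>lborel)
        = (\<integral>\<^sup>+x. indicator A (f x - y) * indicator ?B (f x) \<partial>lborel)" by simp
  qed
  also have "\<dots> = (\<integral>\<^sup>+x. (\<integral>\<^sup>+y. indicator A (f x - y) * indicator ?B (f x) \<partial>lborel) \<partial>lborel)"
    by (rule lborel_pair.Fubini') measurable
  also have "\<dots> = (\<integral>\<^sup>+x. (\<integral>\<^sup>+y. indicator A y \<partial>lborel) * indicator ?B x \<partial>lborel)"
    by (subst nn_integral_multc, measurable, subst nn_integral_lborel_reflect) (auto simp: B1)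
  also have "\<dots> = emeasure lborel A * emeasure lborel ?B"
    by (subst nn_integral_cmult) auto
  also have "(\<integral>\<^sup>+x. indicator A (f x) \<partial>lborel) = emeasure (distr lborel borel f) A"
    by (subst nn_integral_distr[symmetric, of f lborel borel "indicator A"]) auto
  finally have "emeasure (distr lborel borel f) A * emeasure lborel ?B = emeasure lborel A * emeasure lborel ?B" .
  moreover have "emeasure lborel ?B = ennreal (unit_ball_vol (DIM('a)))" by (simp add: emeasure_ball)
  moreover have "unit_ball_vol (real DIM('a)) > 0" by simp
  ultimately show "emeasure (distr lborel borel f) A = emeasure lborel A"
    by (simp add: ennreal_mult_cancel_left mult.commute[of _ "ennreal _"])
qed simp

text \<open>The reflection in the hyperplane orthogonal to \<open>e - e'\<close>.\<close>
lemma orthogonal_transformation_unit_vector: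
  fixes e e' :: "'a::euclidean_space"
  assumes "norm e = 1" "norm e' = 1"
  obtains f where "orthogonal_transformation f" "f e = e'"
proof (cases "e = e'")
  case True
  then show ?thesis using that[of "\<lambda>x. x"] by simp
next
  case False
  define w where "w = e - e'"
  have ww: "w \<bullet> w \<noteq> 0" using False by (simp add: w_def)
  have e: "e \<bullet> e = 1" "e' \<bullet> e' = 1" using assms by (simp_all add: norm_eq_1)
  have we: "w \<bullet> w = 2 * (w \<bullet> e)"
    by (simp add: w_def algebra_simps inner_commute e)
  define f where "f = (\<lambda>x. x - (2 * (w \<bullet> x) / (w \<bullet> w)) *\<^sub>R w)"
  have "linear f"
    unfolding f_def by (rule linearI) (auto simp: algebra_simps add_divide_distrib)
  moreover have "f x \<bullet> f y = x \<bullet> y" for x y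
  proof -
    have "f x \<bullet> f y = x \<bullet> y - 4 * (w \<bullet> x) * (w \<bullet> y) / (w \<bullet> w) + 4 * (w \<bullet> x) * (w \<bullet> y) / (w \<bullet> w)"
      using ww by (simp add: f_def algebra_simps inner_commute power2_eq_square)
    then show ?thesis by simp
  qed
  moreover have "f e = e'"
    using ww by (simp add: f_def we) (simp add: w_def)
  ultimately show ?thesis using that by (auto simp: orthogonal_transformation_def)
qed

section \<open>Polar coordinates\<close>

lemma nn_integral_sphere_measure:
  fixes h :: "'a::euclidean_space \<Rightarrow> ennreal"
  assumes [measurable]: "h \<in> borel_measurable borel"
  shows "(\<integral>\<^sup>+\<sigma>. h \<sigma> \<partial>sphere_measure)
    = of_nat DIM('a) * (\<integral>\<^sup>+v. h (sgn v) * indicator (ball 0 1) v \<partial>lborel)"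
proof -
  have m: "sgn \<in> measurable (restrict_space lborel (ball 0 1 - {0 :: 'a}))
      (restrict_space borel (sphere 0 1))"
    by (rule measurable_restrict_space3)
       (auto simp: sgn_div_norm[abs_def] norm_sgn)
  have "(\<integral>\<^sup>+\<sigma>. h \<sigma> \<partial>sphere_measure) = of_nat DIM('a) *
      (\<integral>\<^sup>+v. h (sgn v) * indicator (ball 0 1 - {0}) v \<partial>lborel)"
    unfolding sphere_measure_def
    by (subst nn_integral_scale_measure, simp add: measurable_restrict_space1)
       (simp add: nn_integral_distr[OF m] nn_integral_restrict_space measurable_restrict_space1)
  also have "(\<integral>\<^sup>+v. h (sgn v) * indicator (ball 0 1 - {0}) v \<partial>lborel)
      = (\<integral>\<^sup>+v. h (sgn v) * indicator (ball 0 1) v \<partial>lborel)"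
    by (rule nn_integral_cong_AE, rule eventually_mono[OF AE_lborel_singleton[of "0::'a"]])
       (auto simp: indicator_def)
  finally show ?thesis .
qed

lemma emeasure_cone_scale:
  fixes A :: "'a::euclidean_space set"
  assumes [measurable]: "A \<in> sets borel" and r: "r > 0"
  shows "emeasure lborel {u. norm u < r \<and> sgn u \<in> A}
    = ennreal (r ^ DIM('a)) * emeasure lborel {u. norm u < 1 \<and> sgn u \<in> A}"
proof -
  have "emeasure lborel {u. norm u < r \<and> sgn u \<in> A}
      = (\<integral>\<^sup>+u. indicator {u. norm u < r \<and> sgn u \<in> A} u \<partial>lborel)"
    by simp
  also have "\<dots> = ennreal (r ^ DIM('a)) *
      (\<integral>\<^sup>+u. indicator {u. norm u < r \<and> sgn u \<in> A} (r *\<^sub>R u) \<partial>lborel)"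
    by (rule nn_integral_lborel_scale) (use r in measurable)
  also have "(\<integral>\<^sup>+u. indicator {u. norm u < r \<and> sgn u \<in> A} (r *\<^sub>R u) \<partial>lborel)
      = (\<integral>\<^sup>+u. indicator {u. norm u < 1 \<and> sgn u \<in> A} u \<partial>lborel)"
    using r by (intro nn_integral_cong) (auto simp: indicator_def sgn_scaleR)
  finally show ?thesis by simp
qed

text \<open>Length and direction are independent under Lebesgue measure. For a fixed set \<open>A\<close> of directions this
  is an identity of two measures of the set of lengths; on \<open>{..<r}\<close> it is the scaling of a cone.\<close>
lemma polar_product_measure:
  defines "B \<equiv> ball 0 1 :: 'a::euclidean_space set"
  shows "distr (lborel :: 'a measure) borel norm \<Otimes>\<^sub>M distr (density lborel (indicator B)) borel sgn
    = scale_measure (ennreal (unit_ball_vol (real DIM('a))))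
        (distr (lborel :: 'a measure) (borel \<Otimes>\<^sub>M borel) (\<lambda>u. (norm u, sgn u)))"
proof (rule pair_measure_eqI)
  have Bm[measurable]: "B \<in> sets borel" by (simp add: B_def)
  have \<omega>: "emeasure lborel B = ennreal (unit_ball_vol (real DIM('a)))"
    by (simp add: B_def emeasure_ball)
  have fin: "emeasure (distr (lborel :: 'a measure) borel norm) {..<r} \<noteq> \<infinity>" for r
  proof -
    have "norm -` {..<r} = (ball 0 r :: 'a set)" by auto
    then have "emeasure (distr (lborel :: 'a measure) borel norm) {..<r} = emeasure lborel (ball 0 r :: 'a set)"
      by (subst emeasure_distr) auto
    then show ?thesis using emeasure_lborel_ball_finite[of "0::'a" r] by (simp add: less_top)
  qed
  show "sigma_finite_measure (distr (lborel :: 'a measure) borel norm)"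
    by (rule sigma_finite_measure.intro, rule exI[of _ "range (\<lambda>n::nat. {..<real n})"])
       (use fin reals_Archimedean2 in auto)
  have "finite_measure (distr (density lborel (indicator B)) borel (sgn :: 'a \<Rightarrow> 'a))"
  proof (rule finite_measureI)
    show "emeasure (distr (density lborel (indicator B)) borel (sgn :: 'a \<Rightarrow> 'a))
        (space (distr (density lborel (indicator B)) borel sgn)) \<noteq> \<infinity>"
      by (subst emeasure_distr) (simp_all add: emeasure_density \<omega>)
  qed
  then show "sigma_finite_measure (distr (density lborel (indicator B)) borel (sgn :: 'a \<Rightarrow> 'a))"
    by (simp add: finite_measure_def)
  show "sets (distr (lborel :: 'a measure) borel norm \<Otimes>\<^sub>M distr (density lborel (indicator B)) borel sgn)
    = sets (scale_measure (ennreal (unit_ball_vol (real DIM('a))))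
        (distr (lborel :: 'a measure) (borel \<Otimes>\<^sub>M borel) (\<lambda>u. (norm u, sgn u))))"
    by (simp cong: sets_pair_measure_cong)
  fix X :: "real set" and A :: "'a set"
  assume "X \<in> sets (distr (lborel :: 'a measure) borel norm)"
    and "A \<in> sets (distr (density lborel (indicator B)) borel sgn)"
  then have X: "X \<in> sets borel" and [measurable]: "A \<in> sets borel" by simp_all
  have sA[measurable]: "sgn -` A \<in> sets (borel :: 'a measure)"
    using measurable_sets_borel[of sgn borel A] by simp
  have nX[measurable]: "norm -` X \<in> sets (borel :: 'a measure)"
    using measurable_sets_borel[of norm borel X] X by simp
  define c where "c = emeasure (distr (density lborel (indicator B)) borel sgn) A"
  have c: "c = emeasure lborel {u. norm u < 1 \<and> sgn u \<in> A}"
  proof -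
    have "c = (\<integral>\<^sup>+u. indicator B u * indicator (sgn -` A) u \<partial>lborel)"
      unfolding c_def by (subst emeasure_distr) (simp_all add: emeasure_density)
    also have "\<dots> = (\<integral>\<^sup>+u. indicator {u. norm u < 1 \<and> sgn u \<in> A} u \<partial>lborel)"
      by (intro nn_integral_cong) (auto simp: indicator_def B_def)
    finally show ?thesis by simp
  qed
  define N1 where "N1 = scale_measure c (distr (lborel :: 'a measure) borel norm)"
  define N2 where "N2 = scale_measure (ennreal (unit_ball_vol (real DIM('a))))
    (distr (density lborel (indicator (sgn -` A))) borel (norm :: 'a \<Rightarrow> real))"
  have "c \<le> emeasure lborel B"
    unfolding c by (intro emeasure_mono) (auto simp: B_def)
  then have cfin: "c < top" using \<omega> by (simp add: le_less_trans)
  have N12: "emeasure N1 {..<r} = emeasure N2 {..<r}" for r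
  proof -
    have b: "norm -` {..<r} = (ball 0 r :: 'a set)" by auto
    have "emeasure (distr (density lborel (indicator (sgn -` A))) borel (norm :: 'a \<Rightarrow> real)) {..<r}
        = (\<integral>\<^sup>+u. indicator (sgn -` A) u * indicator (ball 0 r :: 'a set) u \<partial>lborel)"
      by (subst emeasure_distr) (simp_all add: emeasure_density b)
    also have "\<dots> = (\<integral>\<^sup>+u. indicator {u. norm u < r \<and> sgn u \<in> A} u \<partial>lborel)"
      by (intro nn_integral_cong) (auto simp: indicator_def)
    finally have 2: "emeasure N2 {..<r} = ennreal (unit_ball_vol (real DIM('a))) *
        emeasure lborel {u. norm u < r \<and> sgn u \<in> A}"
      by (simp add: N2_def)
    have 1: "emeasure N1 {..<r} = c * emeasure lborel (ball 0 r :: 'a set)"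
      by (simp add: N1_def emeasure_distr b)
    show ?thesis
    proof (cases "r > 0")
      case True
      have "emeasure lborel (ball 0 r :: 'a set) = ennreal (r ^ DIM('a)) * ennreal (unit_ball_vol (real DIM('a)))"
        using True by (simp add: emeasure_ball ennreal_mult' mult.commute)
      then show ?thesis using True unfolding 1 2 c
        by (subst emeasure_cone_scale) (simp_all add: mult_ac)
    next
      case False
      then have "ball 0 r = ({} :: 'a set)" "{u :: 'a. norm u < r \<and> sgn u \<in> A} = {}"
        using norm_ge_zero by (auto simp: not_less intro: order_trans)
      then show ?thesis unfolding 1 2 by (simp only: emeasure_empty mult_zero_right)
    qed
  qed
  have "N1 = N2"
  proof (rule measure_eqI_generator_eq[where E = "range lessThan" and \<Omega> = UNIV and A = "\<lambda>n::nat. {..<real n}"])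
    show "Int_stable (range (lessThan :: real \<Rightarrow> _))"
    proof (rule Int_stableI)
      fix a b :: "real set" assume "a \<in> range lessThan" "b \<in> range lessThan"
      then obtain x y where "a = {..<x}" "b = {..<y}" by auto
      then have "a \<inter> b = {..<min x y}" by auto
      then show "a \<inter> b \<in> range lessThan" by simp
    qed
    show "sets N1 = sigma_sets UNIV (range lessThan)" "sets N2 = sigma_sets UNIV (range lessThan)"
      by (simp_all add: N1_def N2_def borel_eq_lessThan eucl_less_def lessThan_def)
    show "(\<Union>i. {..<real i}) = UNIV" using reals_Archimedean2 by auto
    show "emeasure N1 {..<real i} \<noteq> \<infinity>" for i
      using cfin fin[of i] by (simp add: N1_def ennreal_mult_eq_top_iff less_top)
  qed (auto simp: N12)
  then have "emeasure N1 X = emeasure N2 X" by simp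
  moreover have "emeasure N2 X = emeasure (scale_measure (ennreal (unit_ball_vol (real DIM('a))))
        (distr (lborel :: 'a measure) (borel \<Otimes>\<^sub>M borel) (\<lambda>u. (norm u, sgn u)))) (X \<times> A)"
  proof -
    have "emeasure (distr (density lborel (indicator (sgn -` A))) borel (norm :: 'a \<Rightarrow> real)) X
        = (\<integral>\<^sup>+u. indicator (sgn -` A) u * indicator (norm -` X) (u::'a) \<partial>lborel)"
      using X by (subst emeasure_distr) (simp_all add: emeasure_density)
    also have "\<dots> = (\<integral>\<^sup>+u. indicator ((\<lambda>u::'a. (norm u, sgn u)) -` (X \<times> A)) u \<partial>lborel)"
      by (intro nn_integral_cong) (auto simp: indicator_def)
    also have "\<dots> = emeasure (distr (lborel :: 'a measure) (borel \<Otimes>\<^sub>M borel) (\<lambda>u. (norm u, sgn u))) (X \<times> A)"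
    proof -
      have "(\<lambda>u::'a. (norm u, sgn u)) -` (X \<times> A) = norm -` X \<inter> sgn -` A" by auto
      then show ?thesis using X by (subst emeasure_distr) simp_all
    qed
    finally show ?thesis by (simp add: N2_def)
  qed
  moreover have "emeasure N1 X = emeasure (distr (lborel :: 'a measure) borel norm) X * c"
    by (simp add: N1_def mult.commute)
  ultimately show "emeasure (distr (lborel :: 'a measure) borel norm) X *
      emeasure (distr (density lborel (indicator B)) borel sgn) A
    = emeasure (scale_measure (ennreal (unit_ball_vol (real DIM('a))))
        (distr (lborel :: 'a measure) (borel \<Otimes>\<^sub>M borel) (\<lambda>u. (norm u, sgn u)))) (X \<times> A)"
    by (simp add: c_def)
qed

text \<open>By independence the direction of \<open>u\<close> may be replaced by that of another vector \<open>w\<close>, uniform in the ball.\<close>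
lemma polar_nn_integral:
  fixes G :: "real \<Rightarrow> 'a::euclidean_space \<Rightarrow> ennreal"
  assumes G[measurable]: "(\<lambda>(r, x). G r x) \<in> borel_measurable (borel \<Otimes>\<^sub>M borel)"
  shows "ennreal (unit_ball_vol (real DIM('a))) * (\<integral>\<^sup>+u. G (norm u) (sgn u) \<partial>lborel)
    = (\<integral>\<^sup>+(u::'a). (\<integral>\<^sup>+w. G (norm u) (sgn w) * indicator (ball 0 1) w \<partial>lborel) \<partial>lborel)"
proof -
  let ?B = "ball 0 1 :: 'a set"
  let ?S = "distr (density lborel (indicator ?B)) borel (sgn :: 'a \<Rightarrow> 'a)"
  have [measurable]: "?B \<in> sets borel" by simp
  interpret S: finite_measure ?S
    by (rule finite_measureI, subst emeasure_distr) (simp_all add: emeasure_density emeasure_ball)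
  have "ennreal (unit_ball_vol (real DIM('a))) * (\<integral>\<^sup>+u. G (norm u) (sgn (u::'a)) \<partial>lborel)
      = (\<integral>\<^sup>+z. (case z of (r, x) \<Rightarrow> G r x) \<partial>(scale_measure (ennreal (unit_ball_vol (real DIM('a))))
        (distr (lborel :: 'a measure) (borel \<Otimes>\<^sub>M borel) (\<lambda>u. (norm u, sgn u)))))"
    by (subst nn_integral_scale_measure, measurable, subst nn_integral_distr) simp_all
  also have "\<dots> = (\<integral>\<^sup>+z. (case z of (r, x) \<Rightarrow> G r x) \<partial>(distr (lborel :: 'a measure) borel norm \<Otimes>\<^sub>M ?S))"
    by (simp only: polar_product_measure)
  also have "\<dots> = (\<integral>\<^sup>+r. \<integral>\<^sup>+x. G r x \<partial>?S \<partial>(distr (lborel :: 'a measure) borel norm))"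
    by (subst S.nn_integral_fst[symmetric]) simp_all
  also have "\<dots> = (\<integral>\<^sup>+(u::'a). (\<integral>\<^sup>+x. G (norm u) x \<partial>?S) \<partial>lborel)"
    by (subst nn_integral_distr) simp_all
  also have "\<dots> = (\<integral>\<^sup>+(u::'a). (\<integral>\<^sup>+w. G (norm u) (sgn w) * indicator (ball 0 1) w \<partial>lborel) \<partial>lborel)"
    by (simp add: nn_integral_distr nn_integral_density mult.commute)
  finally show ?thesis .
qed

lemma measurable_compose3:
  assumes F: "(\<lambda>(r, x, y). F r x y) \<in> measurable (A \<Otimes>\<^sub>M B \<Otimes>\<^sub>M C) N"
    and "f \<in> measurable M A" "g \<in> measurable M B" "h \<in> measurable M C"
  shows "(\<lambda>x. F (f x) (g x) (h x)) \<in> measurable M N"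
proof -
  have "(\<lambda>x. (f x, g x, h x)) \<in> measurable M (A \<Otimes>\<^sub>M B \<Otimes>\<^sub>M C)"
    using assms(2-) by simp
  from measurable_compose[OF this F] show ?thesis by simp
qed

text \<open>After the direction of \<open>u\<close> has been replaced by an independent uniform one, it and \<open>\<sigma>\<close> are
  exchangeable.\<close>
lemma sphere_swap:
  fixes F :: "real \<Rightarrow> 'a::euclidean_space \<Rightarrow> 'a \<Rightarrow> ennreal"
  assumes F[measurable]: "(\<lambda>(r, x, y). F r x y) \<in> borel_measurable (borel \<Otimes>\<^sub>M borel \<Otimes>\<^sub>M borel)"
  shows "(\<integral>\<^sup>+u. \<integral>\<^sup>+\<sigma>. F (norm u) (sgn u) \<sigma> \<partial>sphere_measure \<partial>lborel)
    = (\<integral>\<^sup>+u. \<integral>\<^sup>+\<sigma>. F (norm u) \<sigma> (sgn u) \<partial>sphere_measure \<partial>lborel)"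
proof -
  let ?B = "ball 0 1 :: 'a set"
  let ?\<omega> = "ennreal (unit_ball_vol (real DIM('a)))"
  have [measurable]: "?B \<in> sets borel" by simp
  have \<omega>0: "unit_ball_vol (real DIM('a)) \<noteq> 0"
    using unit_ball_vol_pos[of "real DIM('a)"] by linarith
  define J where "J = (\<lambda>F :: real \<Rightarrow> 'a \<Rightarrow> 'a \<Rightarrow> ennreal.
     (\<integral>\<^sup>+u. \<integral>\<^sup>+w. \<integral>\<^sup>+v. F (norm (u::'a)) (sgn w) (sgn v) * indicator ?B v * indicator ?B w \<partial>lborel \<partial>lborel \<partial>lborel))"
  have J: "?\<omega> * (\<integral>\<^sup>+u. \<integral>\<^sup>+v. F (norm u) (sgn u) (sgn v) * indicator ?B v \<partial>lborel \<partial>lborel) = J F"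
    if F: "(\<lambda>(r, x, y). F r x y) \<in> borel_measurable (borel \<Otimes>\<^sub>M borel \<Otimes>\<^sub>M borel)" for F
  proof -
    note [measurable (raw)] = measurable_compose3[OF F]
    show ?thesis
      unfolding J_def
      by (subst polar_nn_integral[where G="\<lambda>r x. \<integral>\<^sup>+v. F r x (sgn v) * indicator ?B v \<partial>lborel"])
         (simp_all add: nn_integral_multc split_beta')
  qed
  note [measurable (raw)] = measurable_compose3[OF F]
  have J2: "J F = J (\<lambda>r x y. F r y x)"
    unfolding J_def
    by (subst lborel_pair.Fubini') (auto simp: mult_ac)
  have "?\<omega> * (\<integral>\<^sup>+u. \<integral>\<^sup>+v. F (norm u) (sgn u) (sgn v) * indicator ?B v \<partial>lborel \<partial>lborel)
      = ?\<omega> * (\<integral>\<^sup>+u. \<integral>\<^sup>+v. F (norm u) (sgn v) (sgn u) * indicator ?B v \<partial>lborel \<partial>lborel)"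
    by (subst J, measurable, subst J[of "\<lambda>r x y. F r y x"], measurable, rule J2)
  then have "(\<integral>\<^sup>+u. \<integral>\<^sup>+v. F (norm u) (sgn u) (sgn v) * indicator ?B v \<partial>lborel \<partial>lborel)
      = (\<integral>\<^sup>+u. \<integral>\<^sup>+v. F (norm u) (sgn v) (sgn u) * indicator ?B v \<partial>lborel \<partial>lborel)"
    using \<omega>0 by (simp add: ennreal_mult_cancel_left)
  then show ?thesis
    by (simp add: nn_integral_sphere_measure nn_integral_cmult)
qed

lemma sphere_measure_orthogonal:
  fixes f :: "'a::euclidean_space \<Rightarrow> 'a"
  assumes f: "orthogonal_transformation f" and [measurable]: "h \<in> borel_measurable borel"
  shows "(\<integral>\<^sup>+\<sigma>. h (f \<sigma>) \<partial>sphere_measure) = (\<integral>\<^sup>+\<sigma>. h \<sigma> \<partial>sphere_measure)"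
proof -
  have lin: "linear f" and nf: "\<And>x. norm (f x) = norm x"
    using f by (auto simp: orthogonal_transformation)
  have [measurable]: "f \<in> borel_measurable borel"
    using lin by (intro borel_measurable_continuous_onI linear_continuous_on linear_conv_bounded_linear[THEN iffD1])
  have [measurable]: "ball 0 1 \<in> sets (borel :: 'a measure)" by simp
  have sf: "f (sgn v) = sgn (f v)" for v
    by (simp add: sgn_div_norm nf linear_scale[OF lin])
  have "(\<integral>\<^sup>+v. h (sgn v) * indicator (ball 0 1) v \<partial>lborel)
      = (\<integral>\<^sup>+v. h (sgn v) * indicator (ball 0 1) v \<partial>distr lborel borel f)"
    by (simp add: lborel_distr_orthogonal_transformation[OF f])
  also have "\<dots> = (\<integral>\<^sup>+v. h (f (sgn v)) * indicator (ball 0 1) v \<partial>lborel)"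
    by (subst nn_integral_distr) (simp_all add: sf nf indicator_def)
  finally show ?thesis by (simp add: nn_integral_sphere_measure)
qed

section \<open>Zonal integrals over the sphere\<close>

text \<open>The point \<open>(x, Y)\<close> of the half plane is seen from the origin under the cosine \<open>s = x / sqrt (x\<^sup>2 + Y\<^sup>2)\<close>;
  this is the substitution of \<open>s\<close> for \<open>x\<close>. It is carried out on compact intervals \<open>[-a n, a n]\<close>
  exhausting \<open>(-1, 1)\<close>, as the derivative blows up at the end points.\<close>
lemma nn_integral_inverse_slope:
  fixes k :: "real \<Rightarrow> ennreal"
  assumes [measurable]: "k \<in> borel_measurable borel" and Y: "Y > 0"
  shows "(\<integral>\<^sup>+x. k x \<partial>lborel)
    = (\<integral>\<^sup>+s. k (Y * s / sqrt (1 - s\<^sup>2)) * ennreal (Y * (1 - s\<^sup>2) powr (-3/2)) * indicator {-1<..<1} s \<partial>lborel)"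
proof -
  define g where "g = (\<lambda>s::real. Y * s / sqrt (1 - s\<^sup>2))"
  define g' where "g' = (\<lambda>s::real. Y * (1 - s\<^sup>2) powr (-3/2))"
  define a where "a = (\<lambda>n::nat. 1 - 1 / real (n + 2))"
  have a: "0 < a n" "a n < 1" for n by (auto simp: a_def field_simps)
  have a_mono: "a m \<le> a n" if "m \<le> n" for m n using that by (auto simp: a_def field_simps)
  have sq: "1 - s\<^sup>2 > 0" if "\<bar>s\<bar> < 1" for s :: real
    using that by (simp add: abs_square_less_1)
  have der: "(g has_real_derivative g' s) (at s)" if "\<bar>s\<bar> < 1" for s
  proof -
    define q where "q = 1 - s\<^sup>2"
    have q: "q > 0" using sq[OF that] by (simp add: q_def)
    have g'_eq: "g' s = (Y * sqrt q - Y * s * (- (2 * s) / (2 * sqrt q))) / (sqrt q * sqrt q)"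
    proof -
      have "g' s = Y / (q * sqrt q)"
      proof -
        have "q powr (3/2) = q powr 1 * q powr (1/2)" by (simp only: powr_add[symmetric]) simp
        also have "\<dots> = q * sqrt q" using q by (simp add: powr_half_sqrt)
        finally have "q powr (3/2) = q * sqrt q" .
        then have "q powr (-3/2) = 1 / (q * sqrt q)"
          using powr_minus_divide[of q "3/2"] by simp
        then show ?thesis by (simp add: g'_def q_def)
      qed
      also have "\<dots> = Y * (q + s\<^sup>2) / (q * sqrt q)" by (simp add: q_def)
      also have "\<dots> = (Y * sqrt q - Y * s * (- (2 * s) / (2 * sqrt q))) / (sqrt q * sqrt q)"
      proof -
        obtain w where w: "q = w\<^sup>2" "w > 0" using q by (intro that[of "sqrt q"]) auto
        then show ?thesis by (simp add: field_simps power2_eq_square)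
      qed
      finally show ?thesis .
    qed
    have "((\<lambda>s. 1 - s\<^sup>2) has_real_derivative - (2 * s)) (at s)"
      by (auto intro!: derivative_eq_intros)
    then have "((\<lambda>s. sqrt (1 - s\<^sup>2)) has_real_derivative inverse (sqrt (1 - s\<^sup>2)) / 2 * (- (2 * s))) (at s)"
      by (rule DERIV_chain2[OF DERIV_real_sqrt, rotated]) (rule sq[OF that])
    moreover have "inverse (sqrt (1 - s\<^sup>2)) / 2 * (- (2 * s)) = - (2 * s) / (2 * sqrt q)"
      unfolding q_def by (simp only: divide_inverse inverse_mult_distrib mult_ac)
    ultimately have dq: "((\<lambda>s. sqrt (1 - s\<^sup>2)) has_real_derivative - (2 * s) / (2 * sqrt q)) (at s)"
      by (simp only:)
    have "sqrt (1 - s\<^sup>2) \<noteq> 0" using sq[OF that] by simp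
    from DERIV_divide[OF DERIV_cmult_Id[of Y] dq this]
    have "(g has_real_derivative (Y * sqrt q - Y * s * (- (2 * s) / (2 * sqrt q))) / (sqrt q * sqrt q)) (at s)"
      unfolding g_def q_def .
    with g'_eq show ?thesis by (simp only:)
  qed
  have cont: "continuous_on {-a n..a n} g'" for n
  proof -
    have "1 - s\<^sup>2 \<noteq> 0" if "s \<in> {-a n..a n}" for s
      using sq[of s] that a[of n] by force
    then show ?thesis unfolding g'_def by (intro continuous_intros) auto
  qed
  have odd: "g (- s) = - g s" for s by (simp add: g_def)
  have g_mono: "g s \<le> g t" if "0 \<le> s" "s \<le> t" "t < 1" for s t
    unfolding g_def using that Y sq[of t]
    by (intro frac_le mult_left_mono mult_nonneg_nonneg real_sqrt_le_mono) (auto intro!: power_mono)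
  have step: "(\<integral>\<^sup>+x. k x * indicator {- g (a n)..g (a n)} x \<partial>lborel)
      = (\<integral>\<^sup>+s. k (g s) * g' s * indicator {-a n..a n} s \<partial>lborel)" for n
  proof -
    have "(\<integral>\<^sup>+x. k x * indicator {g (- a n)..g (a n)} x \<partial>lborel)
      = (\<integral>\<^sup>+s. k (g s) * g' s * indicator {-a n..a n} s \<partial>lborel)"
    proof (rule nn_integral_substitution_aux)
      show "(g has_real_derivative g' x) (at x)" if "x \<in> {- a n..a n}" for x
        using der[of x] that a[of n] by force
    qed (use cont a[of n] Y in \<open>auto simp: g'_def\<close>)
    then show ?thesis by (simp add: odd)
  qed
  have ga_mono: "g (a m) \<le> g (a n)" if "m \<le> n" for m n
    using g_mono[of "a m" "a n"] a[of m] a[of n] a_mono[OF that] by auto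
  have "(\<integral>\<^sup>+x. k x \<partial>lborel) = (\<integral>\<^sup>+x. (SUP n. k x * indicator {- g (a n)..g (a n)} x) \<partial>lborel)"
  proof (rule nn_integral_cong)
    fix x :: real
    define s where "s = \<bar>x\<bar> / sqrt (x\<^sup>2 + Y\<^sup>2)"
    have p: "x\<^sup>2 + Y\<^sup>2 > 0" using Y by (simp add: add_nonneg_pos)
    have "\<bar>x\<bar> < sqrt (x\<^sup>2 + Y\<^sup>2)" using Y by (simp add: real_less_rsqrt)
    then have s: "0 \<le> s" "s < 1" using p by (auto simp: s_def)
    have "1 - s\<^sup>2 = Y\<^sup>2 / (x\<^sup>2 + Y\<^sup>2)"
    proof -
      have "s\<^sup>2 = x\<^sup>2 / (x\<^sup>2 + Y\<^sup>2)" using p by (simp add: s_def power_divide)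
      moreover have "1 - x\<^sup>2 / (x\<^sup>2 + Y\<^sup>2) = (x\<^sup>2 + Y\<^sup>2 - x\<^sup>2) / (x\<^sup>2 + Y\<^sup>2)"
        using Y by (subst diff_divide_distrib) simp
      ultimately show ?thesis by simp
    qed
    then have "sqrt (1 - s\<^sup>2) = Y / sqrt (x\<^sup>2 + Y\<^sup>2)"
      using Y by (simp add: real_sqrt_divide)
    then have gs: "g s = \<bar>x\<bar>" using Y p by (simp add: g_def s_def)
    obtain n where n: "s \<le> a n"
    proof -
      obtain n where "1 / (1 - s) < real n" using reals_Archimedean2 by blast
      then have "s \<le> a n" using s by (simp add: a_def field_simps)
      then show ?thesis using that by blast
    qed
    have "\<bar>x\<bar> \<le> g (a n)" using g_mono[OF s(1) n] a gs by simp
    then have "k x = k x * indicator {- g (a n)..g (a n)} x" by (simp add: abs_le_iff)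
    also have "\<dots> \<le> (SUP n. k x * indicator {- g (a n)..g (a n)} x)" by (rule SUP_upper) simp
    finally have 1: "k x \<le> (SUP n. k x * indicator {- g (a n)..g (a n)} x)" .
    have "(SUP n. k x * indicator {- g (a n)..g (a n)} x) \<le> k x"
      by (rule SUP_least) (auto simp: indicator_def)
    with 1 show "k x = (SUP n. k x * indicator {- g (a n)..g (a n)} x)" by (rule antisym)
  qed
  also have "\<dots> = (SUP n. (\<integral>\<^sup>+x. k x * indicator {- g (a n)..g (a n)} x \<partial>lborel))"
  proof (rule nn_integral_monotone_convergence_SUP)
    show "incseq (\<lambda>n x. k x * indicator {- g (a n)..g (a n)} x)"
    proof (intro incseq_SucI le_funI)
      fix n x
      show "k x * indicator {- g (a n)..g (a n)} x \<le> k x * indicator {- g (a (Suc n))..g (a (Suc n))} x"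
        using ga_mono[of n "Suc n"] by (auto simp: indicator_def)
    qed
  qed measurable
  also have "\<dots> = (SUP n. (\<integral>\<^sup>+s. k (g s) * g' s * indicator {-a n..a n} s \<partial>lborel))"
    by (simp only: step)
  also have "\<dots> = (\<integral>\<^sup>+s. (SUP n. k (g s) * g' s * indicator {-a n..a n} s) \<partial>lborel)"
  proof (rule nn_integral_monotone_convergence_SUP[symmetric])
    show "incseq (\<lambda>n x. k (g x) * ennreal (g' x) * indicator {- a n..a n} x)"
    proof (intro incseq_SucI le_funI)
      fix n x
      show "k (g x) * ennreal (g' x) * indicator {- a n..a n} x
        \<le> k (g x) * ennreal (g' x) * indicator {- a (Suc n)..a (Suc n)} x"
        using a_mono[of n "Suc n"] by (auto simp: indicator_def)
    qed
  qed (unfold g_def g'_def, measurable)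
  also have "\<dots> = (\<integral>\<^sup>+s. k (g s) * g' s * indicator {-1<..<1} s \<partial>lborel)"
  proof (rule nn_integral_cong)
    fix s :: real
    show "(SUP n. k (g s) * g' s * indicator {-a n..a n} s) = k (g s) * g' s * indicator {-1<..<1} s"
    proof (cases "\<bar>s\<bar> < 1")
      case True
      obtain n where n: "\<bar>s\<bar> \<le> a n"
      proof -
        obtain n where "1 / (1 - \<bar>s\<bar>) < real n" using reals_Archimedean2 by blast
        then have "\<bar>s\<bar> \<le> a n" using True by (simp add: a_def field_simps)
        then show ?thesis using that by blast
      qed
      have "k (g s) * g' s \<le> k (g s) * g' s * indicator {-a n..a n} s" using n by (simp add: abs_le_iff)
      also have "\<dots> \<le> (SUP n. k (g s) * g' s * indicator {-a n..a n} s)" by (rule SUP_upper) simp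
      finally have 1: "k (g s) * g' s \<le> (SUP n. k (g s) * g' s * indicator {-a n..a n} s)" .
      have "(SUP n. k (g s) * g' s * indicator {-a n..a n} s) \<le> k (g s) * g' s"
        by (rule SUP_least) (auto simp: indicator_def)
      with 1 have "(SUP n. k (g s) * g' s * indicator {-a n..a n} s) = k (g s) * g' s" by (simp add: antisym)
      then show ?thesis using True by (simp add: abs_less_iff)
    next
      case False
      have *: "s \<notin> {-a n..a n}" for n using False a[of n] by auto
      have "s \<notin> {-1<..<1}" using False by auto
      with * show ?thesis by simp
    qed
  qed
  finally show ?thesis by (simp add: g_def g'_def)
qed

lemma PiM_euclidean_norm_less:
  fixes I :: "'i set"
  assumes "finite I" "I \<noteq> {}" and r: "r > 0"
  shows "emeasure (Pi\<^sub>M I (\<lambda>_. lborel)) {f \<in> space (Pi\<^sub>M I (\<lambda>_. lborel)). sqrt (\<Sum>i\<in>I. (f i)\<^sup>2) < r}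
    = ennreal (unit_ball_vol (card I) * r ^ card I)" (is "emeasure ?P (?U r) = _")
proof (rule antisym)
  let ?A = "\<lambda>r. {f. sqrt (\<Sum>i\<in>I. (f i)\<^sup>2) \<le> r} \<inter> space ?P"
  have A: "?A r \<in> sets ?P" for r
  proof -
    have "?A r = {f \<in> space ?P. sqrt (\<Sum>i\<in>I. (f i)\<^sup>2) \<le> r}" by auto
    also have "\<dots> \<in> sets ?P" by measurable
    finally show ?thesis .
  qed
  have U: "?U r \<in> sets ?P" for r by measurable
  have "emeasure ?P (?U r) \<le> emeasure ?P (?A r)"
    by (rule emeasure_mono[OF _ A]) auto
  then show "emeasure ?P (?U r) \<le> ennreal (unit_ball_vol (card I) * r ^ card I)"
    using emeasure_cball_aux[of I r] assms by simp
  have "(\<lambda>n::nat. ennreal (unit_ball_vol (card I) * (r * (1 - inverse (real (Suc n)))) ^ card I))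
      \<longlonglongrightarrow> ennreal (unit_ball_vol (card I) * (r * (1 - 0)) ^ card I)"
    by (intro tendsto_ennrealI tendsto_intros LIMSEQ_inverse_real_of_nat)
  then have lim: "(\<lambda>n::nat. ennreal (unit_ball_vol (card I) * (r * (1 - inverse (real (Suc n)))) ^ card I))
      \<longlonglongrightarrow> ennreal (unit_ball_vol (card I) * r ^ card I)" by simp
  have "ennreal (unit_ball_vol (card I) * (r * (1 - inverse (real (Suc n)))) ^ card I) \<le> emeasure ?P (?U r)"
    if "n \<ge> 1" for n
  proof -
    have p: "r * (1 - inverse (real (Suc n))) > 0" using r that by (simp add: field_simps)
    have l: "r * (1 - inverse (real (Suc n))) < r" using r by (simp add: field_simps)
    have "ennreal (unit_ball_vol (card I) * (r * (1 - inverse (real (Suc n)))) ^ card I)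
        = emeasure ?P (?A (r * (1 - inverse (real (Suc n)))))"
      using emeasure_cball_aux[OF assms(1) p] by simp
    also have "\<dots> \<le> emeasure ?P (?U r)"
      by (rule emeasure_mono[OF _ U]) (use l in auto)
    finally show ?thesis .
  qed
  then show "ennreal (unit_ball_vol (card I) * r ^ card I) \<le> emeasure ?P (?U r)"
    using LIMSEQ_le_const2[OF lim] by blast
qed

text \<open>Layer-cake formula: integrate the volumes of the shells \<open>{t < Y < r}\<close> over \<open>t\<close>.\<close>
lemma PiM_euclidean_norm_moment:
  fixes I :: "'i set"
  assumes I: "finite I" "I \<noteq> {}" and r: "r > 0"
  defines "Y \<equiv> \<lambda>f :: 'i \<Rightarrow> real. sqrt (\<Sum>i\<in>I. (f i)\<^sup>2)"
  shows "(\<integral>\<^sup>+f. ennreal (Y f) * indicator {..<r} (Y f) \<partial>Pi\<^sub>M I (\<lambda>_. lborel))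
    = ennreal (unit_ball_vol (card I) * (card I / (card I + 1)) * r ^ (card I + 1))"
proof -
  let ?P = "Pi\<^sub>M I (\<lambda>_. lborel :: real measure)"
  let ?n = "card I"
  interpret product_sigma_finite "\<lambda>_::'i. lborel :: real measure" ..
  interpret P: sigma_finite_measure ?P by (rule sigma_finite) (rule I)
  interpret PP: pair_sigma_finite ?P "lborel :: real measure" ..
  define F where "F = (\<lambda>x. unit_ball_vol ?n * (r ^ ?n * x - x ^ (?n + 1) / (?n + 1)))"
  have Y0: "Y f \<ge> 0" for f by (simp add: Y_def sum_nonneg)
  have [measurable]: "Y \<in> borel_measurable ?P" unfolding Y_def by measurable
  have n: "?n > 0" using I by (simp add: card_gt_0_iff)
  have "(\<integral>\<^sup>+f. ennreal (Y f) * indicator {..<r} (Y f) \<partial>?P)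
      = (\<integral>\<^sup>+f. (\<integral>\<^sup>+t. indicator {0<..<Y f} t * indicator {..<r} (Y f) \<partial>lborel) \<partial>?P)"
    by (subst nn_integral_multc) (simp_all add: Y0)
  also have "\<dots> = (\<integral>\<^sup>+t. (\<integral>\<^sup>+f. indicator {0<..<Y f} t * indicator {..<r} (Y f) \<partial>?P) \<partial>lborel)"
    by (rule PP.Fubini'[symmetric]) (simp add: indicator_def split_beta')
  also have "\<dots> = (\<integral>\<^sup>+t. ennreal (unit_ball_vol ?n * (r ^ ?n - t ^ ?n)) * indicator {0..r} t \<partial>lborel)"
  proof (rule nn_integral_cong_AE, rule eventually_mono[OF AE_lborel_singleton[of "0::real"]])
    fix t :: real assume t0: "t \<noteq> 0"
    show "(\<integral>\<^sup>+f. indicator {0<..<Y f} t * indicator {..<r} (Y f) \<partial>?P)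
      = ennreal (unit_ball_vol ?n * (r ^ ?n - t ^ ?n)) * indicator {0..r} t"
    proof (cases "0 < t \<and> t < r")
      case True
      let ?L = "\<lambda>t. {f \<in> space ?P. Y f < t}" and ?A = "{f. Y f \<le> t} \<inter> space ?P"
      have A: "?A \<in> sets ?P"
      proof -
        have "?A = {f \<in> space ?P. Y f \<le> t}" by auto
        also have "\<dots> \<in> sets ?P" by measurable
        finally show ?thesis .
      qed
      have eA: "emeasure ?P ?A = ennreal (unit_ball_vol ?n * t ^ ?n)"
        unfolding Y_def using emeasure_cball_aux[of I t] I True by simp
      have "(\<integral>\<^sup>+f. indicator {0<..<Y f} t * indicator {..<r} (Y f) \<partial>?P) = (\<integral>\<^sup>+f. indicator (?L r - ?A) f \<partial>?P)"
        using True by (intro nn_integral_cong) (auto simp: indicator_def)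
      also have "\<dots> = emeasure ?P (?L r - ?A)"
        using A by (intro nn_integral_indicator) measurable
      also have "\<dots> = emeasure ?P (?L r) - emeasure ?P ?A"
        using True A eA by (intro emeasure_Diff) auto
      also have "\<dots> = ennreal (unit_ball_vol ?n * r ^ ?n) - ennreal (unit_ball_vol ?n * t ^ ?n)"
        using PiM_euclidean_norm_less[OF I r] eA by (simp add: Y_def)
      also have "\<dots> = ennreal (unit_ball_vol ?n * (r ^ ?n - t ^ ?n))"
        using True by (subst ennreal_minus) (auto simp: algebra_simps)
      finally show ?thesis using True by simp
    next
      case False
      have z: "(indicator {0<..<Y f} t * indicator {..<r} (Y f) :: ennreal) = 0" for f
        using False by (auto simp: indicator_def)
      show ?thesis unfolding z
        using False t0 by (auto simp: indicator_def)
    qed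
  qed
  also have "\<dots> = ennreal (F r - F 0)"
  proof (rule nn_integral_FTC_Icc)
    fix x :: real assume x: "x \<in> {0..r}"
    then show "0 \<le> unit_ball_vol (real ?n) * (r ^ ?n - x ^ ?n)"
      by (simp add: power_mono)
    show "(F has_real_derivative unit_ball_vol (real ?n) * (r ^ ?n - x ^ ?n)) (at x)"
    proof -
      have "((\<lambda>x. x ^ (?n + 1) / real (?n + 1)) has_real_derivative x ^ ?n) (at x)"
        using DERIV_cdivide[OF DERIV_pow[of "?n + 1" x UNIV], of "real (?n + 1)"] by simp
      then show ?thesis
        unfolding F_def by (intro DERIV_cmult DERIV_diff DERIV_cmult_Id)
    qed
  qed (use r in auto)
  also have "F r - F 0 = unit_ball_vol (card I) * (card I / (card I + 1)) * r ^ (card I + 1)"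
    by (simp add: F_def field_simps)
  finally show ?thesis .
qed

text \<open>Rotate \<open>e\<close> to a coordinate axis, write the sphere integral as one over the unit ball, and split a point
  of the ball into its coordinate \<open>x\<close> along the axis and the rest, of length \<open>Y\<close>. Replacing \<open>x\<close> by the
  cosine \<open>s\<close> makes the ball \<open>{Y < sqrt (1 - s\<^sup>2)}\<close> and brings in the factor \<open>Y (1 - s\<^sup>2)\<^bsup>-3/2\<^esup>\<close>. The first
  moment of \<open>Y\<close> over a ball of \<open>\<real>\<^bsup>d-1\<^esup>\<close> contributes \<open>(1 - s\<^sup>2)\<^bsup>d/2\<^esup>\<close>.\<close>
theorem nn_integral_sphere_slice:
  fixes e :: "'a::euclidean_space" and h :: "real \<Rightarrow> ennreal"
  assumes d: "DIM('a) \<ge> 2" and e: "norm e = 1" and [measurable]: "h \<in> borel_measurable borel"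
  shows "(\<integral>\<^sup>+\<sigma>. h (e \<bullet> \<sigma>) \<partial>sphere_measure) = ennreal (sphere_area (DIM('a) - 2)) *
    (\<integral>\<^sup>+t. h t * ennreal ((1 - t\<^sup>2) powr ((real DIM('a) - 3) / 2)) * indicator {-1..1} t \<partial>lborel)"
proof -
  obtain e0 :: 'a where e0: "e0 \<in> Basis" using nonempty_Basis by blast
  obtain R where R: "orthogonal_transformation R" "R e = e0"
    using orthogonal_transformation_unit_vector[OF e, of e0] e0 by auto
  define I where "I = Basis - {e0}"
  define Y where "Y = (\<lambda>f :: 'a \<Rightarrow> real. sqrt (\<Sum>i\<in>I. (f i)\<^sup>2))"
  have I: "finite I" "e0 \<notin> I" "insert e0 I = Basis" using e0 by (auto simp: I_def)
  have cI: "card I = DIM('a) - 1" using e0 by (simp add: I_def)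
  have I0: "I \<noteq> {}" using cI d by auto
  let ?P = "Pi\<^sub>M I (\<lambda>_. lborel :: real measure)"
  interpret product_sigma_finite "\<lambda>_::'a. lborel :: real measure" ..
  interpret P: sigma_finite_measure ?P by (rule sigma_finite) (rule I)
  interpret PP: pair_sigma_finite ?P "lborel :: real measure" ..
  have [measurable]: "Y \<in> borel_measurable ?P" unfolding Y_def by measurable
  have Y0: "Y f \<ge> 0" for f by (simp add: Y_def sum_nonneg)
  have [measurable]: "ball 0 1 \<in> sets (borel :: 'a measure)" by simp
  let ?v = "\<lambda>f. \<Sum>b\<in>Basis. f b *\<^sub>R b :: 'a"
  have nv: "norm (?v f) = sqrt ((f e0)\<^sup>2 + (Y f)\<^sup>2)" for f
  proof -
    have "norm (?v f) = sqrt (\<Sum>i\<in>insert e0 I. (f i)\<^sup>2)"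
      unfolding I(3) norm_eq_sqrt_inner by (subst euclidean_inner) (simp add: power2_eq_square cong: sum.cong)
    also have "(\<Sum>i\<in>insert e0 I. (f i)\<^sup>2) = (f e0)\<^sup>2 + (Y f)\<^sup>2"
      using sum.insert[OF I(1,2), of "\<lambda>i. (f i)\<^sup>2"] by (simp add: Y_def sum_nonneg)
    finally show ?thesis .
  qed
  have ev: "e0 \<bullet> ?v f = f e0" for f by (subst inner_commute) (rule inner_sum_left_Basis[OF e0])
  have Yu: "Y (f(e0 := x)) = Y f" for f x
    unfolding Y_def using I(2) by (intro arg_cong[where f=sqrt] sum.cong) auto
  define k where "k = (\<lambda>y x. h (x / sqrt (x\<^sup>2 + y\<^sup>2)) * indicator {..<1} (x\<^sup>2 + y\<^sup>2))"
  have "(\<integral>\<^sup>+\<sigma>. h (e \<bullet> \<sigma>) \<partial>sphere_measure) = (\<integral>\<^sup>+\<sigma>. h (R e \<bullet> R \<sigma>) \<partial>sphere_measure)"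
    using R(1) by (simp add: orthogonal_transformation_def)
  also have "\<dots> = (\<integral>\<^sup>+\<sigma>. h (e0 \<bullet> \<sigma>) \<partial>sphere_measure)"
    unfolding R(2) by (rule sphere_measure_orthogonal[OF R(1), where h="\<lambda>\<sigma>. h (e0 \<bullet> \<sigma>)"]) measurable
  also have "\<dots> = of_nat DIM('a) * (\<integral>\<^sup>+v. h (e0 \<bullet> sgn v) * indicator (ball 0 1) v \<partial>lborel)"
    by (rule nn_integral_sphere_measure) measurable
  also have "(\<integral>\<^sup>+v. h (e0 \<bullet> sgn v) * indicator (ball 0 1) v \<partial>lborel)
      = (\<integral>\<^sup>+f. h (e0 \<bullet> sgn (?v f)) * indicator (ball 0 1) (?v f) \<partial>Pi\<^sub>M Basis (\<lambda>_. lborel))"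
    by (subst lborel_eq, subst nn_integral_distr) measurable
  also have "\<dots> = (\<integral>\<^sup>+f. k (Y f) (f e0) \<partial>Pi\<^sub>M (insert e0 I) (\<lambda>_. lborel))"
    unfolding I(3)
  proof (rule nn_integral_cong)
    fix f
    show "h (e0 \<bullet> sgn (?v f)) * indicator (ball 0 1) (?v f) = k (Y f) (f e0)"
      by (simp add: k_def sgn_div_norm ev nv indicator_def divide_inverse mult.commute)
  qed
  also have "\<dots> = (\<integral>\<^sup>+f. (\<integral>\<^sup>+x. k (Y f) x \<partial>lborel) \<partial>?P)"
  proof (subst product_nn_integral_insert[OF I(1,2)])
    let ?Q = "Pi\<^sub>M (insert e0 I) (\<lambda>_. lborel :: real measure)"
    have [measurable]: "(\<lambda>f. f e0) \<in> borel_measurable ?Q"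
      using measurable_component_singleton[of e0 "insert e0 I" "\<lambda>_. lborel :: real measure"] by simp
    have c: "(\<lambda>f. f i) \<in> borel_measurable ?Q" if "i \<in> I" for i
      using measurable_component_singleton[of i "insert e0 I" "\<lambda>_. lborel :: real measure"] that by simp
    have "(\<lambda>f. \<Sum>i\<in>I. (f i)\<^sup>2) \<in> borel_measurable ?Q"
      by (intro borel_measurable_sum borel_measurable_power c)
    then have [measurable]: "Y \<in> borel_measurable ?Q"
      unfolding Y_def by measurable
    show "(\<lambda>f. k (Y f) (f e0)) \<in> borel_measurable ?Q" unfolding k_def by measurable
  qed (simp add: Yu)
  also have "\<dots> = (\<integral>\<^sup>+f. (\<integral>\<^sup>+s. h s * indicator {..<1} ((Y f)\<^sup>2 / (1 - s\<^sup>2)) *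
      ennreal (Y f * (1 - s\<^sup>2) powr (-3/2)) * indicator {-1<..<1} s \<partial>lborel) \<partial>?P)"
  proof (rule nn_integral_cong_AE)
    have "emeasure ?P {f \<in> space ?P. Y f \<le> 0} = 0"
    proof -
      have "(\<lambda>n. ennreal (unit_ball_vol (card I) * inverse (real (Suc n)) ^ card I))
          \<longlonglongrightarrow> ennreal (unit_ball_vol (card I) * 0 ^ card I)"
        by (intro tendsto_ennrealI tendsto_intros LIMSEQ_inverse_real_of_nat)
      then have lim: "(\<lambda>n. ennreal (unit_ball_vol (card I) * inverse (real (Suc n)) ^ card I)) \<longlonglongrightarrow> 0"
        using I I0 by (simp add: card_gt_0_iff power_0_left)
      have "emeasure ?P {f \<in> space ?P. Y f \<le> 0} \<le> ennreal (unit_ball_vol (card I) * inverse (real (Suc n)) ^ card I)" for n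
      proof -
        have "emeasure ?P {f \<in> space ?P. Y f \<le> 0} \<le> emeasure ?P {f \<in> space ?P. Y f < inverse (real (Suc n))}"
          by (rule emeasure_mono) (auto intro: le_less_trans)
        also have "\<dots> = ennreal (unit_ball_vol (card I) * inverse (real (Suc n)) ^ card I)"
          unfolding Y_def by (rule PiM_euclidean_norm_less[OF I(1) I0]) simp
        finally show ?thesis .
      qed
      then have "emeasure ?P {f \<in> space ?P. Y f \<le> 0} \<le> 0"
        by (intro LIMSEQ_le_const[OF lim]) auto
      then show ?thesis by simp
    qed
    then have "AE f in ?P. \<not> Y f \<le> 0"
      by (subst AE_iff_measurable[OF _ refl]) auto
    then show "AE f in ?P. (\<integral>\<^sup>+x. k (Y f) x \<partial>lborel) = (\<integral>\<^sup>+s. h s * indicator {..<1} ((Y f)\<^sup>2 / (1 - s\<^sup>2)) *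
      ennreal (Y f * (1 - s\<^sup>2) powr (-3/2)) * indicator {-1<..<1} s \<partial>lborel)"
    proof (rule eventually_mono)
      fix f assume "\<not> Y f \<le> 0"
      then have y: "Y f > 0" by simp
      have "(\<integral>\<^sup>+x. k (Y f) x \<partial>lborel) = (\<integral>\<^sup>+s. k (Y f) (Y f * s / sqrt (1 - s\<^sup>2)) *
          ennreal (Y f * (1 - s\<^sup>2) powr (-3/2)) * indicator {-1<..<1} s \<partial>lborel)"
        by (rule nn_integral_inverse_slope[OF _ y]) (simp add: k_def)
      also have "\<dots> = (\<integral>\<^sup>+s. h s * indicator {..<1} ((Y f)\<^sup>2 / (1 - s\<^sup>2)) *
          ennreal (Y f * (1 - s\<^sup>2) powr (-3/2)) * indicator {-1<..<1} s \<partial>lborel)"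
      proof (rule nn_integral_cong)
        fix s :: real
        show "k (Y f) (Y f * s / sqrt (1 - s\<^sup>2)) * ennreal (Y f * (1 - s\<^sup>2) powr (-3/2)) * indicator {-1<..<1} s
          = h s * indicator {..<1} ((Y f)\<^sup>2 / (1 - s\<^sup>2)) * ennreal (Y f * (1 - s\<^sup>2) powr (-3/2)) * indicator {-1<..<1} s"
        proof (cases "s \<in> {-1<..<1}")
          case True
          then have q: "1 - s\<^sup>2 > 0" by (auto simp: abs_square_less_1)
          have 1: "(Y f * s / sqrt (1 - s\<^sup>2))\<^sup>2 + (Y f)\<^sup>2 = (Y f)\<^sup>2 / (1 - s\<^sup>2)"
            using q by (simp add: power_divide power_mult_distrib field_simps)
          have 2: "(Y f * s / sqrt (1 - s\<^sup>2)) / sqrt ((Y f)\<^sup>2 / (1 - s\<^sup>2)) = s"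
            using q y by (simp add: real_sqrt_divide)
          show ?thesis unfolding k_def 1 2 ..
        qed simp
      qed
      finally show "(\<integral>\<^sup>+x. k (Y f) x \<partial>lborel) = (\<integral>\<^sup>+s. h s * indicator {..<1} ((Y f)\<^sup>2 / (1 - s\<^sup>2)) *
          ennreal (Y f * (1 - s\<^sup>2) powr (-3/2)) * indicator {-1<..<1} s \<partial>lborel)" .
    qed
  qed
  also have "\<dots> = (\<integral>\<^sup>+s. (\<integral>\<^sup>+f. h s * indicator {..<1} ((Y f)\<^sup>2 / (1 - s\<^sup>2)) *
      ennreal (Y f * (1 - s\<^sup>2) powr (-3/2)) * indicator {-1<..<1} s \<partial>?P) \<partial>lborel)"
    by (rule PP.Fubini'[symmetric]) (simp add: split_beta')
  also have "\<dots> = (\<integral>\<^sup>+s. ennreal (unit_ball_vol (card I) * (card I / (card I + 1))) *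
      (h s * ennreal ((1 - s\<^sup>2) powr ((real DIM('a) - 3) / 2)) * indicator {-1..1} s) \<partial>lborel)"
  proof (rule nn_integral_cong_AE,
      rule eventually_mono[OF eventually_conj[OF AE_lborel_singleton[of "1::real"] AE_lborel_singleton[of "-1::real"]]])
    fix s :: real assume s1: "s \<noteq> 1 \<and> s \<noteq> -1"
    show "(\<integral>\<^sup>+f. h s * indicator {..<1} ((Y f)\<^sup>2 / (1 - s\<^sup>2)) *
        ennreal (Y f * (1 - s\<^sup>2) powr (-3/2)) * indicator {-1<..<1} s \<partial>?P)
      = ennreal (unit_ball_vol (card I) * (card I / (card I + 1))) *
      (h s * ennreal ((1 - s\<^sup>2) powr ((real DIM('a) - 3) / 2)) * indicator {-1..1} s)"
    proof (cases "s \<in> {-1<..<1}")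
      case True
      define q where "q = 1 - s\<^sup>2"
      have q: "q > 0" using True by (auto simp: q_def abs_square_less_1)
      have pw: "q powr (-3/2) * (sqrt q) ^ (card I + 1) = q powr ((real DIM('a) - 3) / 2)"
      proof -
        have "(sqrt q) ^ (card I + 1) = q powr (real DIM('a) / 2)"
          using q cI d by (simp add: powr_half_sqrt[symmetric] powr_realpow[symmetric] powr_powr)
        then show ?thesis using q by (simp add: powr_add[symmetric] field_simps)
      qed
      have "(\<integral>\<^sup>+f. h s * indicator {..<1} ((Y f)\<^sup>2 / (1 - s\<^sup>2)) *
          ennreal (Y f * (1 - s\<^sup>2) powr (-3/2)) * indicator {-1<..<1} s \<partial>?P)
        = (\<integral>\<^sup>+f. h s * ennreal (q powr (-3/2)) * (ennreal (Y f) * indicator {..<sqrt q} (Y f)) \<partial>?P)"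
      proof (rule nn_integral_cong)
        fix f
        have "(Y f)\<^sup>2 / q < 1 \<longleftrightarrow> Y f < sqrt q"
        proof -
          have "(Y f)\<^sup>2 / q < 1 \<longleftrightarrow> (Y f)\<^sup>2 < (sqrt q)\<^sup>2" using q by (simp add: field_simps)
          also have "\<dots> \<longleftrightarrow> Y f < sqrt q" using Y0[of f] q
            by (metis abs_of_nonneg power2_less_imp_less real_sqrt_ge_zero less_imp_le power_strict_mono zero_less_numeral)
          finally show ?thesis .
        qed
        then have "(indicator {..<1} ((Y f)\<^sup>2 / q) :: ennreal) = indicator {..<sqrt q} (Y f)"
          by (simp add: indicator_def)
        then show "h s * indicator {..<1} ((Y f)\<^sup>2 / (1 - s\<^sup>2)) *
          ennreal (Y f * (1 - s\<^sup>2) powr (-3/2)) * indicator {-1<..<1} s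
          = h s * ennreal (q powr (-3/2)) * (ennreal (Y f) * indicator {..<sqrt q} (Y f))"
          using True Y0[of f] unfolding q_def[symmetric] by (simp add: ennreal_mult' mult_ac)
      qed
      also have "\<dots> = h s * ennreal (q powr (-3/2)) * (\<integral>\<^sup>+f. (ennreal (Y f) * indicator {..<sqrt q} (Y f)) \<partial>?P)"
        by (rule nn_integral_cmult) measurable
      also have "(\<integral>\<^sup>+f. (ennreal (Y f) * indicator {..<sqrt q} (Y f)) \<partial>?P)
          = ennreal (unit_ball_vol (card I) * (card I / (card I + 1)) * (sqrt q) ^ (card I + 1))"
        unfolding Y_def using q by (intro PiM_euclidean_norm_moment[OF I(1) I0]) simp
      also have "\<dots> = ennreal (unit_ball_vol (card I) * (card I / (card I + 1))) * ennreal ((sqrt q) ^ (card I + 1))"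
        using q by (intro ennreal_mult) auto
      also have "h s * ennreal (q powr (-3/2)) * \<dots> = ennreal (unit_ball_vol (card I) * (card I / (card I + 1))) *
          (h s * ennreal (q powr (-3/2) * (sqrt q) ^ (card I + 1)))"
        using q by (subst ennreal_mult[of "q powr (-3/2)" "(sqrt q) ^ (card I + 1)"]) (simp_all only: mult_ac powr_ge_zero zero_le_power real_sqrt_ge_zero less_imp_le)
      finally show ?thesis using True unfolding pw by (simp add: q_def)
    next
      case False
      then have "s \<notin> {-1..1}" using s1 by auto
      then show ?thesis using False by simp
    qed
  qed
  also have "\<dots> = ennreal (unit_ball_vol (card I) * (card I / (card I + 1))) *
      (\<integral>\<^sup>+s. h s * ennreal ((1 - s\<^sup>2) powr ((real DIM('a) - 3) / 2)) * indicator {-1..1} s \<partial>lborel)"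
    by (rule nn_integral_cmult) measurable
  also have "of_nat DIM('a) * \<dots> = ennreal (sphere_area (DIM('a) - 2)) *
      (\<integral>\<^sup>+s. h s * ennreal ((1 - s\<^sup>2) powr ((real DIM('a) - 3) / 2)) * indicator {-1..1} s \<partial>lborel)"
  proof -
    have "sphere_area (DIM('a) - 2) = DIM('a) * (unit_ball_vol (card I) * (card I / (card I + 1)))"
    proof -
      have "DIM('a) - 2 + 1 = card I" "card I + 1 = DIM('a)" using cI d by auto
      then show ?thesis unfolding sphere_area_def by simp
    qed
    then have "ennreal (sphere_area (DIM('a) - 2))
      = of_nat DIM('a) * ennreal (unit_ball_vol (card I) * (card I / (card I + 1)))"
      by (simp only: ennreal_mult' ennreal_of_nat_eq_real_of_nat of_nat_0_le_iff)
    then show ?thesis by (simp add: mult.assoc)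
  qed
  finally show ?thesis .
qed

section \<open>The collision map\<close>

text \<open>The surface measure as a Borel measure on the ambient space, so that \<open>\<sigma>\<close> can be composed with Borel
  maps defined everywhere.\<close>
definition surface_measure :: "'a::euclidean_space measure" where
  "surface_measure = distr sphere_measure borel (\<lambda>\<sigma>. \<sigma>)"

lemma measurable_sphere_measure_id:
  "(\<lambda>\<sigma>. \<sigma>) \<in> measurable (sphere_measure :: 'a::euclidean_space measure) borel"
proof -
  have "sets (sphere_measure :: 'a measure) = sets (restrict_space borel (sphere 0 1))"
    by (simp add: sphere_measure_def)
  then have "measurable (sphere_measure :: 'a measure) borel
      = measurable (restrict_space borel (sphere 0 1)) (borel :: 'a measure)"
    by (rule measurable_cong_sets) simp
  then show ?thesis by (simp add: measurable_restrict_space1)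
qed

lemma sets_surface_measure [simp, measurable_cong]: "sets surface_measure = sets borel"
  by (simp add: surface_measure_def)

lemma space_surface_measure [simp]: "space surface_measure = UNIV"
  by (simp add: surface_measure_def)

lemma nn_integral_surface_measure:
  fixes h :: "'a::euclidean_space \<Rightarrow> ennreal"
  assumes [measurable]: "h \<in> borel_measurable borel"
  shows "(\<integral>\<^sup>+\<sigma>. h \<sigma> \<partial>surface_measure) = (\<integral>\<^sup>+\<sigma>. h \<sigma> \<partial>sphere_measure)"
  by (simp add: surface_measure_def nn_integral_distr measurable_sphere_measure_id)

lemma emeasure_surface_measure:
  "emeasure surface_measure (UNIV :: 'a::euclidean_space set) = ennreal (sphere_area (DIM('a) - 1))"
  unfolding surface_measure_def
  by (subst emeasure_distr) (simp_all add: emeasure_sphere_measure_space measurable_sphere_measure_id)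

interpretation surface_measure: finite_measure "surface_measure :: 'a::euclidean_space measure"
  by (rule finite_measureI) (simp add: emeasure_surface_measure)

interpretation lborel_surface: pair_sigma_finite "lborel :: 'a::euclidean_space measure"
    "surface_measure :: 'a::euclidean_space measure" ..

interpretation lborel_lborel_surface: pair_sigma_finite "lborel :: 'a::euclidean_space measure"
    "lborel \<Otimes>\<^sub>M surface_measure :: ('a::euclidean_space \<times> 'a) measure" ..

lemma AE_surface_measure_norm: "AE \<sigma> in (surface_measure :: 'a::euclidean_space measure). norm \<sigma> = 1"
  unfolding surface_measure_def
  by (subst AE_distr_iff) (auto intro: AE_I2 measurable_sphere_measure_id)

lemma surface_measure_uminus:
  fixes h :: "'a::euclidean_space \<Rightarrow> ennreal"
  assumes [measurable]: "h \<in> borel_measurable borel"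
  shows "(\<integral>\<^sup>+\<sigma>. h (- \<sigma>) \<partial>surface_measure) = (\<integral>\<^sup>+\<sigma>. h \<sigma> \<partial>surface_measure)"
  by (simp add: nn_integral_surface_measure sphere_measure_orthogonal[OF orthogonal_transformation_neg[THEN iffD2, OF orthogonal_transformation_id]])

lemma distr_surface_measure_uminus:
  "distr surface_measure borel uminus = (surface_measure :: 'a::euclidean_space measure)"
proof (rule measure_eqI)
  fix A assume "A \<in> sets (distr surface_measure borel (uminus :: 'a \<Rightarrow> 'a))"
  then have [measurable]: "A \<in> sets borel" by simp
  have "emeasure (distr surface_measure borel uminus) A = (\<integral>\<^sup>+\<sigma>. indicator A \<sigma> \<partial>distr surface_measure borel uminus)"
    by simp
  also have "\<dots> = (\<integral>\<^sup>+\<sigma>. indicator A (- \<sigma>) \<partial>surface_measure)"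
    by (rule nn_integral_distr) measurable
  also have "\<dots> = emeasure surface_measure A"
    by (subst surface_measure_uminus) auto
  finally show "emeasure (distr surface_measure borel uminus) A = emeasure surface_measure A" .
qed simp

text \<open>The velocities \<open>\<xi>'\<close> (\<open>post1\<close>) and \<open>\<xi>'\<^sub>*\<close> (\<open>post2\<close>) after the collision.\<close>
definition post1 :: "'a::euclidean_space \<Rightarrow> 'a \<Rightarrow> 'a \<Rightarrow> 'a" where
  "post1 \<xi> \<xi>s \<sigma> = (1/2) *\<^sub>R (\<xi> + \<xi>s) + (norm (\<xi> - \<xi>s) / 2) *\<^sub>R \<sigma>"

definition post2 :: "'a::euclidean_space \<Rightarrow> 'a \<Rightarrow> 'a \<Rightarrow> 'a" where
  "post2 \<xi> \<xi>s \<sigma> = (1/2) *\<^sub>R (\<xi> + \<xi>s) - (norm (\<xi> - \<xi>s) / 2) *\<^sub>R \<sigma>"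

lemma post_measurable [measurable (raw)]:
  assumes [measurable]: "f \<in> borel_measurable M" "g \<in> borel_measurable M" "h \<in> borel_measurable M"
  shows "(\<lambda>x. post1 (f x) (g x) (h x)) \<in> borel_measurable M"
    "(\<lambda>x. post2 (f x) (g x) (h x)) \<in> borel_measurable M"
  unfolding post1_def post2_def by measurable

lemma post2_swap: "post2 \<xi>s \<xi> \<sigma> = post1 \<xi> \<xi>s (- \<sigma>)" "post1 \<xi>s \<xi> (- \<sigma>) = post2 \<xi> \<xi>s \<sigma>"
  by (simp_all add: post1_def post2_def norm_minus_commute add.commute)

lemma post_energy:
  assumes "norm \<sigma> = 1"
  shows "(norm (post1 \<xi> \<xi>s \<sigma>))\<^sup>2 + (norm (post2 \<xi> \<xi>s \<sigma>))\<^sup>2 = (norm \<xi>)\<^sup>2 + (norm \<xi>s)\<^sup>2"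
proof -
  define r where "r = norm (\<xi> - \<xi>s)"
  have s: "\<sigma> \<bullet> \<sigma> = 1" using assms by (simp add: norm_eq_1)
  have r: "r * r = (\<xi> - \<xi>s) \<bullet> (\<xi> - \<xi>s)" by (simp add: r_def power2_norm_eq_inner[symmetric] power2_eq_square)
  show ?thesis
    unfolding post1_def post2_def power2_norm_eq_inner r_def[symmetric]
    using r s by (simp add: algebra_simps inner_commute)
qed

text \<open>The map \<open>(\<xi>, \<xi>\<^sub>*, \<sigma>) \<mapsto> (\<xi>', \<xi>'\<^sub>*, (\<xi> - \<xi>\<^sub>*) / |\<xi> - \<xi>\<^sub>*|)\<close> keeps the relative speed and is its own inverse.\<close>
lemma post_involution:
  assumes "norm \<sigma> = 1" "\<xi> \<noteq> \<xi>s"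
  shows "norm (post1 \<xi> \<xi>s \<sigma> - post2 \<xi> \<xi>s \<sigma>) = norm (\<xi> - \<xi>s)"
    "sgn (post1 \<xi> \<xi>s \<sigma> - post2 \<xi> \<xi>s \<sigma>) = \<sigma>"
    "post1 (post1 \<xi> \<xi>s \<sigma>) (post2 \<xi> \<xi>s \<sigma>) (sgn (\<xi> - \<xi>s)) = \<xi>"
proof -
  have d: "post1 \<xi> \<xi>s \<sigma> - post2 \<xi> \<xi>s \<sigma> = norm (\<xi> - \<xi>s) *\<^sub>R \<sigma>"
    by (simp add: post1_def post2_def scaleR_add_left[symmetric])
  show 1: "norm (post1 \<xi> \<xi>s \<sigma> - post2 \<xi> \<xi>s \<sigma>) = norm (\<xi> - \<xi>s)"
    using assms by (simp add: d)
  show "sgn (post1 \<xi> \<xi>s \<sigma> - post2 \<xi> \<xi>s \<sigma>) = \<sigma>"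
    using assms by (simp add: d sgn_scaleR) (simp add: sgn_div_norm)
  have s: "post1 \<xi> \<xi>s \<sigma> + post2 \<xi> \<xi>s \<sigma> = \<xi> + \<xi>s"
    by (simp add: post1_def post2_def scaleR_add_left[symmetric] flip: scaleR_add_right)
  have "norm (\<xi> - \<xi>s) *\<^sub>R sgn (\<xi> - \<xi>s) = \<xi> - \<xi>s" using assms(2) by (simp add: sgn_div_norm)
  then have "(norm (\<xi> - \<xi>s) / 2) *\<^sub>R sgn (\<xi> - \<xi>s) = (1/2) *\<^sub>R (\<xi> - \<xi>s)"
    by (metis divide_inverse inverse_eq_divide mult.commute scaleR_scaleR)
  then show "post1 (post1 \<xi> \<xi>s \<sigma>) (post2 \<xi> \<xi>s \<sigma>) (sgn (\<xi> - \<xi>s)) = \<xi>"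
    unfolding post1_def[of "post1 _ _ _"] 1 s
    by (simp add: scaleR_add_right[symmetric] scaleR_2[symmetric])
qed

lemma nn_integral_center_of_mass:
  fixes G :: "'a::euclidean_space \<Rightarrow> 'a \<Rightarrow> ennreal"
  assumes G: "(\<lambda>(x, y). G x y) \<in> borel_measurable (borel \<Otimes>\<^sub>M borel)"
  shows "(\<integral>\<^sup>+x. \<integral>\<^sup>+y. G x y \<partial>lborel \<partial>lborel)
    = (\<integral>\<^sup>+z. \<integral>\<^sup>+u. G (z + (1/2) *\<^sub>R u) (z - (1/2) *\<^sub>R u) \<partial>lborel \<partial>lborel)"
proof -
  note [measurable] = measurable_Pair_compose_split[OF G]
  have "(\<integral>\<^sup>+x. \<integral>\<^sup>+y. G x y \<partial>lborel \<partial>lborel) = (\<integral>\<^sup>+x. \<integral>\<^sup>+u. G x (x - u) \<partial>lborel \<partial>lborel)"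
    by (rule nn_integral_cong, rule nn_integral_lborel_reflect[symmetric]) measurable
  also have "\<dots> = (\<integral>\<^sup>+u. \<integral>\<^sup>+x. G x (x - u) \<partial>lborel \<partial>lborel)"
    by (rule lborel_pair.Fubini') measurable
  also have "\<dots> = (\<integral>\<^sup>+u. \<integral>\<^sup>+z. G (z + (1/2) *\<^sub>R u) (z - (1/2) *\<^sub>R u) \<partial>lborel \<partial>lborel)"
  proof (rule nn_integral_cong)
    fix u :: 'a
    have "z + (1/2) *\<^sub>R u - u = z - (1/2) *\<^sub>R u" for z
    proof -
      have "u = (1/2) *\<^sub>R u + (1/2) *\<^sub>R u" by (simp add: scaleR_add_left[symmetric])
      then show ?thesis by (metis add_diff_cancel_right add_diff_eq diff_diff_eq)
    qed
    then have "(\<integral>\<^sup>+z. G (z + (1/2) *\<^sub>R u) (z - (1/2) *\<^sub>R u) \<partial>lborel)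
        = (\<integral>\<^sup>+z. G (z + (1/2) *\<^sub>R u) (z + (1/2) *\<^sub>R u - u) \<partial>lborel)"
      by (simp only:)
    also have "\<dots> = (\<integral>\<^sup>+x. G x (x - u) \<partial>lborel)"
      by (rule nn_integral_lborel_translate[of "\<lambda>x. G x (x - u)"]) measurable
    finally show "(\<integral>\<^sup>+x. G x (x - u) \<partial>lborel) = (\<integral>\<^sup>+z. G (z + (1/2) *\<^sub>R u) (z - (1/2) *\<^sub>R u) \<partial>lborel)" ..
  qed
  also have "\<dots> = (\<integral>\<^sup>+z. \<integral>\<^sup>+u. G (z + (1/2) *\<^sub>R u) (z - (1/2) *\<^sub>R u) \<partial>lborel \<partial>lborel)"
    by (rule lborel_pair.Fubini') measurable
  finally show ?thesis .
qed

text \<open>The collision map preserves \<open>d\<xi> d\<xi>\<^sub>* d\<sigma>\<close>: in the variables centre of mass and relative velocity it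
  only exchanges \<open>\<sigma>\<close> with the direction of the relative velocity.\<close>
lemma nn_integral_collision_map:
  fixes F :: "'a::euclidean_space \<Rightarrow> 'a \<Rightarrow> 'a \<Rightarrow> ennreal"
  assumes F: "(\<lambda>(x, y, z). F x y z) \<in> borel_measurable (borel \<Otimes>\<^sub>M borel \<Otimes>\<^sub>M borel)"
  shows "(\<integral>\<^sup>+\<xi>. \<integral>\<^sup>+\<xi>s. \<integral>\<^sup>+\<sigma>. F (post1 \<xi> \<xi>s \<sigma>) (post2 \<xi> \<xi>s \<sigma>) (sgn (\<xi> - \<xi>s)) \<partial>surface_measure \<partial>lborel \<partial>lborel)
    = (\<integral>\<^sup>+\<xi>. \<integral>\<^sup>+\<xi>s. \<integral>\<^sup>+\<sigma>. F \<xi> \<xi>s \<sigma> \<partial>surface_measure \<partial>lborel \<partial>lborel)"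
proof -
  note [measurable (raw)] = measurable_compose3[OF F]
  have c: "(z + (1/2) *\<^sub>R u) + (z - (1/2) *\<^sub>R u) = 2 *\<^sub>R z" "(z + (1/2) *\<^sub>R u) - (z - (1/2) *\<^sub>R u) = u" for z u :: 'a
    by (simp_all add: scaleR_2 scaleR_add_left[symmetric])
  have "(\<integral>\<^sup>+\<xi>. \<integral>\<^sup>+\<xi>s. \<integral>\<^sup>+\<sigma>. F (post1 \<xi> \<xi>s \<sigma>) (post2 \<xi> \<xi>s \<sigma>) (sgn (\<xi> - \<xi>s)) \<partial>surface_measure \<partial>lborel \<partial>lborel)
    = (\<integral>\<^sup>+z. \<integral>\<^sup>+u. \<integral>\<^sup>+\<sigma>. F (z + (norm u / 2) *\<^sub>R \<sigma>) (z - (norm u / 2) *\<^sub>R \<sigma>) (sgn u) \<partial>surface_measure \<partial>lborel \<partial>lborel)"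
    by (subst nn_integral_center_of_mass) (simp_all add: split_beta' post1_def post2_def c)
  also have "\<dots> = (\<integral>\<^sup>+z. \<integral>\<^sup>+u. \<integral>\<^sup>+\<sigma>. F (z + (norm u / 2) *\<^sub>R sgn u) (z - (norm u / 2) *\<^sub>R sgn u) \<sigma> \<partial>surface_measure \<partial>lborel \<partial>lborel)"
  proof (rule nn_integral_cong)
    fix z :: 'a
    show "(\<integral>\<^sup>+u. \<integral>\<^sup>+\<sigma>. F (z + (norm u / 2) *\<^sub>R \<sigma>) (z - (norm u / 2) *\<^sub>R \<sigma>) (sgn u) \<partial>surface_measure \<partial>lborel)
      = (\<integral>\<^sup>+u. \<integral>\<^sup>+\<sigma>. F (z + (norm u / 2) *\<^sub>R sgn u) (z - (norm u / 2) *\<^sub>R sgn u) \<sigma> \<partial>surface_measure \<partial>lborel)"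
      using sphere_swap[of "\<lambda>r x y. F (z + (r / 2) *\<^sub>R y) (z - (r / 2) *\<^sub>R y) x"]
      by (simp add: nn_integral_surface_measure split_beta')
  qed
  also have "\<dots> = (\<integral>\<^sup>+z. \<integral>\<^sup>+u. \<integral>\<^sup>+\<sigma>. F (z + (1/2) *\<^sub>R u) (z - (1/2) *\<^sub>R u) \<sigma> \<partial>surface_measure \<partial>lborel \<partial>lborel)"
  proof -
    have "(norm u / 2) *\<^sub>R sgn u = (1/2) *\<^sub>R u" for u :: 'a by (cases "u = 0") (simp_all add: sgn_div_norm)
    then show ?thesis by simp
  qed
  also have "\<dots> = (\<integral>\<^sup>+\<xi>. \<integral>\<^sup>+\<xi>s. \<integral>\<^sup>+\<sigma>. F \<xi> \<xi>s \<sigma> \<partial>surface_measure \<partial>lborel \<partial>lborel)"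
    by (subst nn_integral_center_of_mass[symmetric]) (simp_all add: split_beta')
  finally show ?thesis .
qed

lemma distr_collision_map:
  "distr (lborel \<Otimes>\<^sub>M (lborel \<Otimes>\<^sub>M surface_measure)) (borel \<Otimes>\<^sub>M (borel \<Otimes>\<^sub>M borel))
     (\<lambda>(\<xi>, \<xi>s, \<sigma>). (post1 \<xi> \<xi>s \<sigma>, post2 \<xi> \<xi>s \<sigma>, sgn (\<xi> - \<xi>s)))
   = (lborel \<Otimes>\<^sub>M (lborel \<Otimes>\<^sub>M surface_measure) :: ('a::euclidean_space \<times> 'a \<times> 'a) measure)"
  (is "distr ?M ?B ?\<Theta> = ?M")
proof (rule measure_eqI)
  have sf: "sigma_finite_measure (lborel \<Otimes>\<^sub>M surface_measure :: ('a \<times> 'a) measure)" ..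
  have [measurable]: "?\<Theta> \<in> measurable ?M ?B" by measurable
  show s: "sets (distr ?M ?B ?\<Theta>) = sets ?M"
    by (simp cong: sets_pair_measure_cong)
  fix A assume "A \<in> sets (distr ?M ?B ?\<Theta>)"
  then have A[measurable]: "A \<in> sets ?B" by simp
  have A'[measurable]: "A \<in> sets ?M" using A s by simp
  have F: "(\<lambda>(x, y, z). indicator A (x, y, z) :: ennreal) \<in> borel_measurable (borel \<Otimes>\<^sub>M borel \<Otimes>\<^sub>M borel)"
    by measurable
  note [measurable (raw)] = measurable_compose3[OF F]
  have it: "integral\<^sup>N ?M G = (\<integral>\<^sup>+\<xi>. \<integral>\<^sup>+\<xi>s. \<integral>\<^sup>+\<sigma>. G (\<xi>, \<xi>s, \<sigma>) \<partial>surface_measure \<partial>lborel \<partial>lborel)"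
    if [measurable]: "G \<in> borel_measurable ?M" for G
  proof -
    have "integral\<^sup>N ?M G = (\<integral>\<^sup>+\<xi>. \<integral>\<^sup>+z. G (\<xi>, z) \<partial>(lborel \<Otimes>\<^sub>M surface_measure) \<partial>lborel)"
      by (rule sigma_finite_measure.nn_integral_fst[OF sf, symmetric]) measurable
    also have "\<dots> = (\<integral>\<^sup>+\<xi>. \<integral>\<^sup>+\<xi>s. \<integral>\<^sup>+\<sigma>. G (\<xi>, \<xi>s, \<sigma>) \<partial>surface_measure \<partial>lborel \<partial>lborel)"
    proof (rule nn_integral_cong)
      fix \<xi> :: 'a
      have "(\<lambda>z. G (\<xi>, z)) \<in> borel_measurable (lborel \<Otimes>\<^sub>M surface_measure)" by measurable
      from surface_measure.nn_integral_fst[OF this]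
      show "(\<integral>\<^sup>+z. G (\<xi>, z) \<partial>(lborel \<Otimes>\<^sub>M surface_measure))
        = (\<integral>\<^sup>+\<xi>s. \<integral>\<^sup>+\<sigma>. G (\<xi>, \<xi>s, \<sigma>) \<partial>surface_measure \<partial>lborel)" ..
    qed
    finally show ?thesis .
  qed
  have "emeasure (distr ?M ?B ?\<Theta>) A = (\<integral>\<^sup>+x. indicator A x \<partial>distr ?M ?B ?\<Theta>)" by simp
  also have "\<dots> = (\<integral>\<^sup>+x. indicator A (?\<Theta> x) \<partial>?M)" by (rule nn_integral_distr) measurable
  also have "\<dots> = (\<integral>\<^sup>+\<xi>. \<integral>\<^sup>+\<xi>s. \<integral>\<^sup>+\<sigma>. indicator A (post1 \<xi> \<xi>s \<sigma>, post2 \<xi> \<xi>s \<sigma>, sgn (\<xi> - \<xi>s)) \<partial>surface_measure \<partial>lborel \<partial>lborel)"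
    by (subst it) simp_all
  also have "\<dots> = (\<integral>\<^sup>+\<xi>. \<integral>\<^sup>+\<xi>s. \<integral>\<^sup>+\<sigma>. indicator A (\<xi>, \<xi>s, \<sigma>) \<partial>surface_measure \<partial>lborel \<partial>lborel)"
    by (rule nn_integral_collision_map[OF F])
  also have "\<dots> = integral\<^sup>N ?M (indicator A)" by (subst it) simp_all
  also have "\<dots> = emeasure ?M A" by simp
  finally show "emeasure (distr ?M ?B ?\<Theta>) A = emeasure ?M A" .
qed

section \<open>The weak form of the gain term\<close>

lemma lborel_prod_surface_measure:
  "lborel \<Otimes>\<^sub>M (surface_measure :: 'a::euclidean_space measure)
    = distr (lborel \<Otimes>\<^sub>M sphere_measure) (borel \<Otimes>\<^sub>M borel) (\<lambda>(x :: 'b::euclidean_space, y). (x, y))"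
proof -
  have "distr (lborel :: 'b measure) borel (\<lambda>x. x) \<Otimes>\<^sub>M distr sphere_measure borel (\<lambda>\<sigma> :: 'a. \<sigma>)
    = distr (lborel \<Otimes>\<^sub>M sphere_measure) (borel \<Otimes>\<^sub>M borel) (\<lambda>(x, y). (x, y))"
    by (rule pair_measure_distr)
       (use surface_measure.sigma_finite_measure_axioms in \<open>auto simp: measurable_sphere_measure_id surface_measure_def[symmetric]\<close>)
  moreover have "distr (lborel :: 'b measure) borel (\<lambda>x. x) = lborel"
    using distr_id[of "lborel :: 'b measure"] by (simp add: id_def cong: distr_cong)
  ultimately show ?thesis by (simp add: surface_measure_def)
qed

text \<open>Only cosines are inserted into \<open>b\<close>.\<close>
lemma Q_plus_cong:
  assumes "\<And>t. t \<in> {-1..1} \<Longrightarrow> b t = b' t"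
  shows "Q_plus \<gamma> b f \<xi> = Q_plus \<gamma> b' (f :: 'a::euclidean_space \<Rightarrow> real) \<xi>"
  unfolding Q_plus_def
proof (rule Bochner_Integration.integral_cong[OF refl])
  fix z assume "z \<in> space ((lborel :: 'a measure) \<Otimes>\<^sub>M (sphere_measure :: 'a measure))"
  then have n: "norm (snd z) = 1" by (auto simp: space_pair_measure)
  have "\<bar>((\<xi> - fst z) /\<^sub>R norm (\<xi> - fst z)) \<bullet> snd z\<bar> \<le> norm ((\<xi> - fst z) /\<^sub>R norm (\<xi> - fst z)) * norm (snd z)"
    by (rule Cauchy_Schwarz_ineq2)
  also have "\<dots> \<le> 1" using n by (simp add: sgn_div_norm[symmetric] norm_sgn del: norm_scaleR)
  finally have "b (((\<xi> - fst z) /\<^sub>R norm (\<xi> - fst z)) \<bullet> snd z) = b' (((\<xi> - fst z) /\<^sub>R norm (\<xi> - fst z)) \<bullet> snd z)"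
    by (intro assms) (auto simp: abs_le_iff)
  then show "(case z of (\<xi>s, \<sigma>) \<Rightarrow>
       (let \<xi>' = (1/2) *\<^sub>R (\<xi> + \<xi>s) + (norm (\<xi> - \<xi>s) / 2) *\<^sub>R \<sigma>;
            \<xi>s' = (1/2) *\<^sub>R (\<xi> + \<xi>s) - (norm (\<xi> - \<xi>s) / 2) *\<^sub>R \<sigma>;
            cos\<theta> = ((\<xi> - \<xi>s) /\<^sub>R norm (\<xi> - \<xi>s)) \<bullet> \<sigma>
        in norm (\<xi> - \<xi>s) powr \<gamma> * b cos\<theta> * f \<xi>' * f \<xi>s')) =
     (case z of (\<xi>s, \<sigma>) \<Rightarrow>
       (let \<xi>' = (1/2) *\<^sub>R (\<xi> + \<xi>s) + (norm (\<xi> - \<xi>s) / 2) *\<^sub>R \<sigma>;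
            \<xi>s' = (1/2) *\<^sub>R (\<xi> + \<xi>s) - (norm (\<xi> - \<xi>s) / 2) *\<^sub>R \<sigma>;
            cos\<theta> = ((\<xi> - \<xi>s) /\<^sub>R norm (\<xi> - \<xi>s)) \<bullet> \<sigma>
        in norm (\<xi> - \<xi>s) powr \<gamma> * b' cos\<theta> * f \<xi>' * f \<xi>s'))"
    by (simp add: split_beta' Let_def)
qed

text \<open>The growth up to which a test function can be paired with the collision terms of a density with a
  finite moment of order \<open>2 + \<gamma>\<close>: the factor \<open>|\<xi> - \<xi>\<^sub>*|\<^sup>\<gamma>\<close> takes up the remaining \<open>\<gamma>\<close>.\<close>
definition quadratic_growth :: "real \<Rightarrow> ('a::euclidean_space \<Rightarrow> real) \<Rightarrow> bool" where
  "quadratic_growth C \<rho> \<longleftrightarrow> \<rho> \<in> borel_measurable borel \<and> (\<forall>\<xi>. \<bar>\<rho> \<xi>\<bar> \<le> C * (1 + (norm \<xi>)\<^sup>2))"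

lemma quadratic_growth_measurable [measurable_dest]: "quadratic_growth C \<rho> \<Longrightarrow> \<rho> \<in> borel_measurable borel"
  by (simp add: quadratic_growth_def)

lemma quadratic_growth_nonneg: "quadratic_growth C (\<rho> :: 'a::euclidean_space \<Rightarrow> real) \<Longrightarrow> 0 \<le> C"
proof -
  assume "quadratic_growth C \<rho>"
  then have "\<bar>\<rho> 0\<bar> \<le> C * (1 + (norm (0::'a))\<^sup>2)" unfolding quadratic_growth_def by blast
  then show ?thesis by simp
qed

text \<open>Here \<open>b\<close> is a nonnegative Borel function on the whole line; a kernel given on \<open>{-1..1}\<close> is extended by zero.\<close>
locale angular_kernel =
  fixes b :: "real \<Rightarrow> real" and \<gamma> :: real and velocity_space :: "'a::euclidean_space itself"
  assumes dim: "DIM('a) \<ge> 2"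
    and \<gamma>_pos: "0 < \<gamma>" and \<gamma>_le: "\<gamma> \<le> 1"
    and b_measurable [measurable]: "b \<in> borel_measurable borel"
    and b_nonneg: "\<And>t. 0 \<le> b t"
    and b_mass: "ennreal (sphere_area (DIM('a) - 2)) *
      (\<integral>\<^sup>+t. ennreal (b t) * ennreal ((1 - t\<^sup>2) powr ((real DIM('a) - 3) / 2)) * indicator {-1..1} t \<partial>lborel) = 1"
begin

lemma nn_integral_b:
  fixes e :: 'a assumes "norm e = 1"
  shows "(\<integral>\<^sup>+\<sigma>. ennreal (b (e \<bullet> \<sigma>)) \<partial>surface_measure) = 1"
  using nn_integral_sphere_slice[OF dim assms, of "\<lambda>t. ennreal (b t)"] b_mass
  by (simp add: nn_integral_surface_measure)

lemma integrable_b: "integrable surface_measure (\<lambda>\<sigma>. b (sgn u \<bullet> (\<sigma> :: 'a)))"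
proof (cases "u = 0")
  case False
  then have "(\<integral>\<^sup>+\<sigma>. ennreal (norm (b (sgn u \<bullet> (\<sigma> :: 'a)))) \<partial>surface_measure) = 1"
    using nn_integral_b[of "sgn u"] b_nonneg by (simp add: norm_sgn)
  then show ?thesis by (intro integrableI_bounded) auto
qed simp

lemma integral_b: "u \<noteq> 0 \<Longrightarrow> (LINT \<sigma>|surface_measure. b (sgn u \<bullet> (\<sigma> :: 'a))) = 1"
  using nn_integral_b[of "sgn u"] b_nonneg
  by (subst integral_eq_nn_integral) (auto simp: norm_sgn)

text \<open>The mean of \<open>\<rho>(\<xi>')\<close> over the outcomes of a collision of \<open>\<xi>\<close> with \<open>\<xi>\<^sub>*\<close>.\<close>
definition average :: "('a \<Rightarrow> real) \<Rightarrow> 'a \<Rightarrow> 'a \<Rightarrow> real" where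
  "average \<rho> \<xi> \<xi>s = (LINT \<sigma>|surface_measure. b (sgn (\<xi> - \<xi>s) \<bullet> \<sigma>) * \<rho> (post1 \<xi> \<xi>s \<sigma>))"

lemma average_measurable [measurable (raw)]:
  assumes [measurable]: "\<rho> \<in> borel_measurable borel" "f \<in> borel_measurable M" "g \<in> borel_measurable M"
  shows "(\<lambda>x. average \<rho> (f x) (g x)) \<in> borel_measurable M"
  unfolding average_def
  by (rule surface_measure.borel_measurable_lebesgue_integral) measurable

lemma post_quadratic_growth:
  fixes \<rho> :: "'a \<Rightarrow> real"
  assumes "quadratic_growth C \<rho>" "norm \<sigma> = 1"
  shows "\<bar>\<rho> (post1 \<xi> \<xi>s \<sigma>)\<bar> \<le> C * (1 + (norm \<xi>)\<^sup>2 + (norm \<xi>s)\<^sup>2)"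
proof -
  have "\<bar>\<rho> (post1 \<xi> \<xi>s \<sigma>)\<bar> \<le> C * (1 + (norm (post1 \<xi> \<xi>s \<sigma>))\<^sup>2)"
    using assms(1) by (simp add: quadratic_growth_def)
  also have "\<dots> \<le> C * (1 + (norm \<xi>)\<^sup>2 + (norm \<xi>s)\<^sup>2)"
    using post_energy[OF assms(2), of \<xi> \<xi>s] quadratic_growth_nonneg[OF assms(1)]
    by (intro mult_left_mono) (auto, smt (verit) zero_le_power2)
  finally show ?thesis .
qed

lemma average_integrable:
  fixes \<rho> :: "'a \<Rightarrow> real"
  assumes \<rho>: "quadratic_growth C \<rho>"
  shows "integrable surface_measure (\<lambda>\<sigma>. b (sgn (\<xi> - \<xi>s) \<bullet> \<sigma>) * \<rho> (post1 \<xi> \<xi>s \<sigma>))"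
proof (rule Bochner_Integration.integrable_bound)
  note [measurable] = quadratic_growth_measurable[OF \<rho>]
  show "integrable surface_measure (\<lambda>\<sigma>. b (sgn (\<xi> - \<xi>s) \<bullet> \<sigma>) * (C * (1 + (norm \<xi>)\<^sup>2 + (norm \<xi>s)\<^sup>2)))"
    using integrable_b by simp
  show "(\<lambda>\<sigma>. b (sgn (\<xi> - \<xi>s) \<bullet> \<sigma>) * \<rho> (post1 \<xi> \<xi>s \<sigma>)) \<in> borel_measurable surface_measure"
    by measurable
  show "AE \<sigma> in surface_measure. norm (b (sgn (\<xi> - \<xi>s) \<bullet> \<sigma>) * \<rho> (post1 \<xi> \<xi>s \<sigma>))
      \<le> norm (b (sgn (\<xi> - \<xi>s) \<bullet> \<sigma>) * (C * (1 + (norm \<xi>)\<^sup>2 + (norm \<xi>s)\<^sup>2)))"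
    using AE_surface_measure_norm
  proof eventually_elim
    case (elim \<sigma>)
    from post_quadratic_growth[OF \<rho> this, of \<xi> \<xi>s] quadratic_growth_nonneg[OF \<rho>]
    show ?case by (simp add: abs_mult mult_left_mono b_nonneg)
  qed
qed

lemma average_bound:
  assumes \<rho>: "quadratic_growth C \<rho>" and "\<xi> \<noteq> \<xi>s"
  shows "\<bar>average \<rho> \<xi> \<xi>s\<bar> \<le> C * (1 + (norm \<xi>)\<^sup>2 + (norm \<xi>s)\<^sup>2)"
proof -
  note [measurable] = quadratic_growth_measurable[OF \<rho>]
  have "\<bar>average \<rho> \<xi> \<xi>s\<bar> \<le> (LINT \<sigma>|surface_measure. \<bar>b (sgn (\<xi> - \<xi>s) \<bullet> \<sigma>) * \<rho> (post1 \<xi> \<xi>s \<sigma>)\<bar>)"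
    unfolding average_def by (rule integral_abs_bound)
  also have "\<dots> \<le> (LINT \<sigma>|surface_measure. b (sgn (\<xi> - \<xi>s) \<bullet> \<sigma>) * (C * (1 + (norm \<xi>)\<^sup>2 + (norm \<xi>s)\<^sup>2)))"
  proof (rule integral_mono_AE)
    show "AE \<sigma> in surface_measure. \<bar>b (sgn (\<xi> - \<xi>s) \<bullet> \<sigma>) * \<rho> (post1 \<xi> \<xi>s \<sigma>)\<bar>
      \<le> b (sgn (\<xi> - \<xi>s) \<bullet> \<sigma>) * (C * (1 + (norm \<xi>)\<^sup>2 + (norm \<xi>s)\<^sup>2))"
      using AE_surface_measure_norm
    proof eventually_elim
      case (elim \<sigma>)
      from post_quadratic_growth[OF \<rho> this, of \<xi> \<xi>s]
      show ?case by (simp add: abs_mult mult_left_mono b_nonneg)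
    qed
  qed (use average_integrable[OF \<rho>] integrable_b in auto)
  also have "\<dots> = C * (1 + (norm \<xi>)\<^sup>2 + (norm \<xi>s)\<^sup>2)"
    using assms(2) by (simp add: integral_b)
  finally show ?thesis .
qed

lemma Q_plus_surface_measure:
  fixes f :: "'a \<Rightarrow> real"
  assumes [measurable]: "f \<in> borel_measurable borel"
  shows "Q_plus \<gamma> b f \<xi> = (LINT z|(lborel \<Otimes>\<^sub>M surface_measure).
    norm (\<xi> - fst z) powr \<gamma> * b (sgn (\<xi> - fst z) \<bullet> snd z) * f (post1 \<xi> (fst z) (snd z)) * f (post2 \<xi> (fst z) (snd z)))"
  unfolding lborel_prod_surface_measure
proof (subst integral_distr)
  have s: "sgn x = x /\<^sub>R norm x" for x :: 'a by (simp add: sgn_div_norm)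
  show "Q_plus \<gamma> b f \<xi> = (LINT z|(lborel \<Otimes>\<^sub>M sphere_measure).
    norm (\<xi> - fst (case z of (x, y) \<Rightarrow> (x, y))) powr \<gamma> * b (sgn (\<xi> - fst (case z of (x, y) \<Rightarrow> (x, y))) \<bullet> snd (case z of (x, y) \<Rightarrow> (x, y)))
      * f (post1 \<xi> (fst (case z of (x, y) \<Rightarrow> (x, y))) (snd (case z of (x, y) \<Rightarrow> (x, y))))
      * f (post2 \<xi> (fst (case z of (x, y) \<Rightarrow> (x, y))) (snd (case z of (x, y) \<Rightarrow> (x, y)))))"
    unfolding Q_plus_def by (simp add: split_beta' Let_def post1_def post2_def s)
  show "(\<lambda>(x, y). (x, y)) \<in> lborel \<Otimes>\<^sub>M sphere_measure \<rightarrow>\<^sub>M borel \<Otimes>\<^sub>M (borel :: 'a measure)"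
    unfolding split_beta'
    by (rule measurable_Pair) (simp, rule measurable_compose[OF measurable_snd measurable_sphere_measure_id])
qed measurable

text \<open>In \<open>Q_plus\<close> the density is evaluated at the outgoing and the test function at the incoming velocities;
  the collision map exchanges the roles, and the relative speed and the cosine are symmetric under it.\<close>
theorem weak_form_Q_plus:
  fixes f \<rho> :: "'a \<Rightarrow> real"
  assumes f[measurable]: "f \<in> borel_measurable borel" and \<rho>: "quadratic_growth C \<rho>"
    and fin: "integrable (lborel \<Otimes>\<^sub>M lborel) (\<lambda>(\<xi>, \<xi>s). f \<xi> * f \<xi>s * (norm (\<xi> - \<xi>s) powr \<gamma> * (1 + (norm \<xi>)\<^sup>2 + (norm \<xi>s)\<^sup>2)))"
  shows "integrable lborel (\<lambda>\<xi>. Q_plus \<gamma> b f \<xi> * \<rho> \<xi>)" (is ?int1)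
    and "integrable (lborel \<Otimes>\<^sub>M lborel) (\<lambda>(\<xi>, \<xi>s). f \<xi> * f \<xi>s * (norm (\<xi> - \<xi>s) powr \<gamma> * average \<rho> \<xi> \<xi>s))" (is ?int2)
    and "(LINT \<xi>|lborel. Q_plus \<gamma> b f \<xi> * \<rho> \<xi>)
      = (LINT (\<xi>, \<xi>s)|(lborel \<Otimes>\<^sub>M lborel). f \<xi> * f \<xi>s * (norm (\<xi> - \<xi>s) powr \<gamma> * average \<rho> \<xi> \<xi>s))" (is ?eq)
proof -
  note [measurable] = quadratic_growth_measurable[OF \<rho>]
  have C: "0 \<le> C" by (rule quadratic_growth_nonneg[OF \<rho>])
  let ?M = "lborel \<Otimes>\<^sub>M (lborel \<Otimes>\<^sub>M surface_measure) :: ('a \<times> 'a \<times> 'a) measure"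
  let ?B = "borel \<Otimes>\<^sub>M (borel \<Otimes>\<^sub>M borel) :: ('a \<times> 'a \<times> 'a) measure"
  let ?\<Theta> = "\<lambda>(\<xi> :: 'a, \<xi>s, \<sigma>). (post1 \<xi> \<xi>s \<sigma>, post2 \<xi> \<xi>s \<sigma>, sgn (\<xi> - \<xi>s))"
  have sf: "sigma_finite_measure (lborel \<Otimes>\<^sub>M surface_measure :: ('a \<times> 'a) measure)" ..
  define G where "G = (\<lambda>(\<xi>, \<xi>s, \<sigma>). f \<xi> * f \<xi>s * norm (\<xi> - \<xi>s) powr \<gamma> * b (sgn (\<xi> - \<xi>s) \<bullet> \<sigma>) * \<rho> (post1 \<xi> \<xi>s \<sigma>))"
  define G' where "G' = (\<lambda>(\<xi>, \<xi>s, \<sigma>). norm (\<xi> - \<xi>s) powr \<gamma> * b (sgn (\<xi> - \<xi>s) \<bullet> \<sigma>) * f (post1 \<xi> \<xi>s \<sigma>) * f (post2 \<xi> \<xi>s \<sigma>) * \<rho> \<xi>)"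
  have Gm[measurable]: "G \<in> borel_measurable ?M" unfolding G_def by measurable
  have GmB[measurable]: "G \<in> borel_measurable ?B" unfolding G_def by measurable
  have G'm[measurable]: "G' \<in> borel_measurable ?M" unfolding G'_def by measurable
  have \<Theta>m[measurable]: "?\<Theta> \<in> measurable ?M ?B" by measurable
  \<comment> \<open>\<open>G\<close> is the integrand after the exchange; it depends on \<open>\<sigma>\<close> through \<open>b\<close>, of mass one, and the bounded factor \<open>\<rho>(\<xi>')\<close>.\<close>
  have nn: "(\<integral>\<^sup>+\<sigma>. ennreal (norm (G (\<xi>, \<xi>s, \<sigma>))) \<partial>surface_measure)
      \<le> ennreal (C * norm (f \<xi> * f \<xi>s * (norm (\<xi> - \<xi>s) powr \<gamma> * (1 + (norm \<xi>)\<^sup>2 + (norm \<xi>s)\<^sup>2))))" for \<xi> \<xi>s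
  proof (cases "\<xi> = \<xi>s")
    case True
    then show ?thesis by (simp add: G_def)
  next
    case False
    define c where "c = C * norm (f \<xi> * f \<xi>s * (norm (\<xi> - \<xi>s) powr \<gamma> * (1 + (norm \<xi>)\<^sup>2 + (norm \<xi>s)\<^sup>2)))"
    have c0: "0 \<le> c" using C by (simp add: c_def)
    have "(\<integral>\<^sup>+\<sigma>. ennreal (norm (G (\<xi>, \<xi>s, \<sigma>))) \<partial>surface_measure)
        \<le> (\<integral>\<^sup>+\<sigma>. ennreal c * ennreal (b (sgn (\<xi> - \<xi>s) \<bullet> \<sigma>)) \<partial>surface_measure)"
    proof (rule nn_integral_mono_AE)
      show "AE \<sigma> in surface_measure. ennreal (norm (G (\<xi>, \<xi>s, \<sigma>))) \<le> ennreal c * ennreal (b (sgn (\<xi> - \<xi>s) \<bullet> \<sigma>))"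
        using AE_surface_measure_norm
      proof eventually_elim
        case (elim \<sigma>)
        have "norm (G (\<xi>, \<xi>s, \<sigma>)) = \<bar>f \<xi> * f \<xi>s\<bar> * norm (\<xi> - \<xi>s) powr \<gamma> * b (sgn (\<xi> - \<xi>s) \<bullet> \<sigma>) * \<bar>\<rho> (post1 \<xi> \<xi>s \<sigma>)\<bar>"
          by (simp add: G_def abs_mult b_nonneg)
        also have "\<dots> \<le> \<bar>f \<xi> * f \<xi>s\<bar> * norm (\<xi> - \<xi>s) powr \<gamma> * b (sgn (\<xi> - \<xi>s) \<bullet> \<sigma>) * (C * (1 + (norm \<xi>)\<^sup>2 + (norm \<xi>s)\<^sup>2))"
          by (intro mult_left_mono post_quadratic_growth[OF \<rho> elim]) (simp add: b_nonneg)
        also have "\<dots> = c * b (sgn (\<xi> - \<xi>s) \<bullet> \<sigma>)"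
          by (simp add: c_def abs_mult)
        finally show ?case
          using c0 b_nonneg by (simp add: ennreal_mult[symmetric] ennreal_leI)
      qed
    qed
    also have "\<dots> = ennreal c"
      using False by (simp add: nn_integral_cmult nn_integral_b norm_sgn)
    finally show ?thesis by (simp add: c_def)
  qed
  have intG: "integrable ?M G"
  proof (rule integrableI_bounded[OF Gm])
    have "(\<integral>\<^sup>+x. ennreal (norm (G x)) \<partial>?M)
        = (\<integral>\<^sup>+\<xi>. \<integral>\<^sup>+z. ennreal (norm (G (\<xi>, z))) \<partial>(lborel \<Otimes>\<^sub>M surface_measure) \<partial>lborel)"
      by (rule sigma_finite_measure.nn_integral_fst[OF sf, symmetric]) measurable
    also have "\<dots> = (\<integral>\<^sup>+\<xi>. \<integral>\<^sup>+\<xi>s. \<integral>\<^sup>+\<sigma>. ennreal (norm (G (\<xi>, \<xi>s, \<sigma>))) \<partial>surface_measure \<partial>lborel \<partial>lborel)"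
    proof (rule nn_integral_cong)
      fix \<xi> :: 'a
      have "(\<lambda>z. ennreal (norm (G (\<xi>, z)))) \<in> borel_measurable (lborel \<Otimes>\<^sub>M surface_measure)" by measurable
      from surface_measure.nn_integral_fst[OF this]
      show "(\<integral>\<^sup>+z. ennreal (norm (G (\<xi>, z))) \<partial>(lborel \<Otimes>\<^sub>M surface_measure))
        = (\<integral>\<^sup>+\<xi>s. \<integral>\<^sup>+\<sigma>. ennreal (norm (G (\<xi>, \<xi>s, \<sigma>))) \<partial>surface_measure \<partial>lborel)" ..
    qed
    also have "\<dots> \<le> (\<integral>\<^sup>+\<xi>. \<integral>\<^sup>+\<xi>s. ennreal (C * norm (f \<xi> * f \<xi>s * (norm (\<xi> - \<xi>s) powr \<gamma> * (1 + (norm \<xi>)\<^sup>2 + (norm \<xi>s)\<^sup>2)))) \<partial>lborel \<partial>lborel)"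
      by (intro nn_integral_mono nn)
    also have "\<dots> = (\<integral>\<^sup>+z. ennreal (C * norm (case z of (\<xi>, \<xi>s) \<Rightarrow> f \<xi> * f \<xi>s * (norm (\<xi> - \<xi>s) powr \<gamma> * (1 + (norm \<xi>)\<^sup>2 + (norm \<xi>s)\<^sup>2)))) \<partial>(lborel \<Otimes>\<^sub>M lborel))"
      by (subst lborel.nn_integral_fst[symmetric]) auto
    also have "\<dots> < \<infinity>"
      using fin C unfolding integrable_iff_bounded
      by (simp add: ennreal_mult' nn_integral_cmult ennreal_mult_less_top split_beta')
    finally show "(\<integral>\<^sup>+x. ennreal (norm (G x)) \<partial>?M) < \<infinity>" .
  qed
  have dist: "distr ?M ?B ?\<Theta> = ?M" by (rule distr_collision_map)
  have intG\<Theta>: "integrable ?M (\<lambda>x. G (?\<Theta> x))"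
    using intG by (subst (asm) dist[symmetric], subst (asm) integrable_distr_eq) (auto simp: split_beta')
  have eqG\<Theta>: "(LINT x|?M. G (?\<Theta> x)) = (LINT x|?M. G x)"
    by (subst (2) dist[symmetric], subst integral_distr) (auto simp: split_beta')
  have AE\<sigma>: "AE x in ?M. norm (snd (snd x)) = 1"
  proof -
    have s1: "AE z in (lborel :: 'a measure) \<Otimes>\<^sub>M surface_measure. norm (snd z :: 'a) = 1"
    proof (rule lborel_surface.AE_pair_measure)
      show "{z \<in> space (lborel \<Otimes>\<^sub>M surface_measure). norm (snd z :: 'a) = 1} \<in> sets ((lborel :: 'a measure) \<Otimes>\<^sub>M surface_measure)"
        by measurable
    qed (simp add: AE_surface_measure_norm)
    show ?thesis
    proof (rule lborel_lborel_surface.AE_pair_measure)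
      show "{x \<in> space ?M. norm (snd (snd x)) = 1} \<in> sets ?M" by measurable
    qed (use s1 in simp)
  qed
  have G': "AE x in ?M. G (?\<Theta> x) = G' x"
    using AE\<sigma>
  proof eventually_elim
    case (elim x)
    obtain \<xi> \<xi>s \<sigma> where x: "x = (\<xi>, \<xi>s, \<sigma>)" by (cases x) auto
    have \<sigma>: "norm \<sigma> = 1" using elim by (simp add: x)
    show ?case
    proof (cases "\<xi> = \<xi>s")
      case True
      then show ?thesis by (simp add: x G_def G'_def post1_def post2_def)
    next
      case False
      show ?thesis
        by (simp add: x G_def G'_def post_involution[OF \<sigma> False] inner_commute)
    qed
  qed
  have intG': "integrable ?M G'"
    by (rule integrable_cong_AE_imp[OF intG\<Theta> G'm]) (use G' in auto)
  have eqG': "(LINT x|?M. G' x) = (LINT x|?M. G x)"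
    unfolding eqG\<Theta>[symmetric] by (rule integral_cong_AE) (use G' in \<open>auto intro: AE_mp\<close>)
  \<comment> \<open>Integrating \<open>G'\<close> over \<open>(\<xi>\<^sub>*, \<sigma>)\<close> first gives back \<open>Q_plus\<close>, integrating \<open>G\<close> over \<open>\<sigma>\<close> first gives \<open>average\<close>.\<close>
  have Q: "(LINT z|(lborel \<Otimes>\<^sub>M surface_measure). G' (\<xi>, z)) = Q_plus \<gamma> b f \<xi> * \<rho> \<xi>" for \<xi>
    unfolding Q_plus_surface_measure[OF f] G'_def by (simp add: split_beta')
  show ?int1
    using lborel_lborel_surface.integrable_fst'[OF intG'] by (simp add: Q)
  have L: "(LINT \<xi>|lborel. Q_plus \<gamma> b f \<xi> * \<rho> \<xi>) = (LINT x|?M. G x)"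
    using lborel_lborel_surface.integral_fst'[OF intG'] by (simp add: Q eqG')
  show i2: ?int2
  proof (rule Bochner_Integration.integrable_bound)
    show "integrable (lborel \<Otimes>\<^sub>M lborel) (\<lambda>z. C * (case z of (\<xi>, \<xi>s) \<Rightarrow> f \<xi> * f \<xi>s * (norm (\<xi> - \<xi>s) powr \<gamma> * (1 + (norm \<xi>)\<^sup>2 + (norm \<xi>s)\<^sup>2))))"
      using fin by simp
    show "(\<lambda>(\<xi>, \<xi>s). f \<xi> * f \<xi>s * (norm (\<xi> - \<xi>s) powr \<gamma> * average \<rho> \<xi> \<xi>s)) \<in> borel_measurable (lborel \<Otimes>\<^sub>M lborel)"
      by measurable
    show "AE z in lborel \<Otimes>\<^sub>M lborel. norm (case z of (\<xi>, \<xi>s) \<Rightarrow> f \<xi> * f \<xi>s * (norm (\<xi> - \<xi>s) powr \<gamma> * average \<rho> \<xi> \<xi>s))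
      \<le> norm (C * (case z of (\<xi>, \<xi>s) \<Rightarrow> f \<xi> * f \<xi>s * (norm (\<xi> - \<xi>s) powr \<gamma> * (1 + (norm \<xi>)\<^sup>2 + (norm \<xi>s)\<^sup>2))))"
    proof (rule AE_I2, clarify)
      fix \<xi> \<xi>s :: 'a
      show "norm (f \<xi> * f \<xi>s * (norm (\<xi> - \<xi>s) powr \<gamma> * average \<rho> \<xi> \<xi>s))
        \<le> norm (C * (f \<xi> * f \<xi>s * (norm (\<xi> - \<xi>s) powr \<gamma> * (1 + (norm \<xi>)\<^sup>2 + (norm \<xi>s)\<^sup>2))))"
      proof (cases "\<xi> = \<xi>s")
        case False
        have "\<bar>f \<xi> * f \<xi>s\<bar> * norm (\<xi> - \<xi>s) powr \<gamma> * \<bar>average \<rho> \<xi> \<xi>s\<bar>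
          \<le> \<bar>f \<xi> * f \<xi>s\<bar> * norm (\<xi> - \<xi>s) powr \<gamma> * (C * (1 + (norm \<xi>)\<^sup>2 + (norm \<xi>s)\<^sup>2))"
          by (intro mult_left_mono average_bound[OF \<rho> False]) simp
        then show ?thesis using C by (simp add: abs_mult mult_ac)
      qed simp
    qed
  qed
  have "(LINT x|?M. G x) = (LINT \<xi>|lborel. LINT z|(lborel \<Otimes>\<^sub>M surface_measure). G (\<xi>, z))"
    by (rule lborel_lborel_surface.integral_fst'[OF intG, symmetric])
  also have "\<dots> = (LINT \<xi>|lborel. LINT \<xi>s|lborel. f \<xi> * f \<xi>s * (norm (\<xi> - \<xi>s) powr \<gamma> * average \<rho> \<xi> \<xi>s))"
  proof (rule integral_cong_AE)
    show "AE \<xi> in lborel. (LINT z|(lborel \<Otimes>\<^sub>M surface_measure). G (\<xi>, z))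
        = (LINT \<xi>s|lborel. f \<xi> * f \<xi>s * (norm (\<xi> - \<xi>s) powr \<gamma> * average \<rho> \<xi> \<xi>s))"
      using lborel_lborel_surface.AE_integrable_fst'[OF intG]
    proof eventually_elim
      case (elim \<xi>)
      have "(LINT z|(lborel \<Otimes>\<^sub>M surface_measure). G (\<xi>, z)) = (LINT \<xi>s|lborel. LINT \<sigma>|surface_measure. G (\<xi>, \<xi>s, \<sigma>))"
        using lborel_surface.integral_fst'[OF elim] by simp
      then show ?case by (simp add: G_def average_def mult.assoc)
    qed
  qed measurable
  also have "\<dots> = (LINT z|(lborel \<Otimes>\<^sub>M lborel). (case z of (\<xi>, \<xi>s) \<Rightarrow> f \<xi> * f \<xi>s * (norm (\<xi> - \<xi>s) powr \<gamma> * average \<rho> \<xi> \<xi>s)))"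
    using lborel_pair.integral_fst'[OF i2] by simp
  finally show ?eq unfolding L by simp
qed

end

section \<open>The Povzner inequality\<close>

lemma powr_subadditive:
  fixes x y p :: real
  assumes "0 \<le> x" "0 \<le> y" "0 < p" "p \<le> 1"
  shows "(x + y) powr p \<le> x powr p + y powr p"
proof (cases "x + y = 0")
  case True
  then show ?thesis by simp
next
  case False
  then have s: "x + y > 0" using assms by simp
  have le: "t \<le> t powr p" if "0 \<le> t" "t \<le> 1" for t :: real
    using powr_mono'[of p 1 t] that assms by simp
  have "1 = x / (x + y) + y / (x + y)" using s by (simp add: add_divide_distrib[symmetric])
  also have "\<dots> \<le> (x / (x + y)) powr p + (y / (x + y)) powr p"
    using assms s by (intro add_mono le) auto
  also have "\<dots> = (x powr p + y powr p) / (x + y) powr p"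
    using assms s by (simp add: powr_divide add_divide_distrib)
  finally show ?thesis using s by (simp add: le_divide_eq)
qed

text \<open>A bounded increasing substitute for \<open>x\<^sup>p\<close>, to which it tends from below as \<open>\<epsilon>\<close> decreases to zero.\<close>
definition soft_powr :: "real \<Rightarrow> real \<Rightarrow> real \<Rightarrow> real" where
  "soft_powr p \<epsilon> x = (x / (1 + \<epsilon> * x)) powr p"

lemma soft_powr_nonneg: "0 \<le> soft_powr p \<epsilon> x"
  by (simp add: soft_powr_def)

lemma soft_ratio_mono:
  fixes x y \<epsilon> :: real
  assumes "0 \<le> x" "x \<le> y" "0 \<le> \<epsilon>"
  shows "x / (1 + \<epsilon> * x) \<le> y / (1 + \<epsilon> * y)"
proof -
  have "0 < 1 + \<epsilon> * x" "0 < 1 + \<epsilon> * y" using assms by (simp_all add: add_pos_nonneg)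
  moreover have "x * (1 + \<epsilon> * y) \<le> y * (1 + \<epsilon> * x)" using assms by (simp add: algebra_simps)
  ultimately show ?thesis by (simp add: divide_le_eq le_divide_eq mult.commute)
qed

lemma soft_powr_mono:
  assumes "0 \<le> x" "x \<le> y" "0 \<le> \<epsilon>" "0 \<le> p"
  shows "soft_powr p \<epsilon> x \<le> soft_powr p \<epsilon> y"
  unfolding soft_powr_def using assms
  by (intro powr_mono2 soft_ratio_mono) auto

lemma soft_powr_le_powr:
  assumes "0 \<le> x" "0 \<le> \<epsilon>" "0 \<le> p"
  shows "soft_powr p \<epsilon> x \<le> x powr p"
  unfolding soft_powr_def using assms
  by (intro powr_mono2) (auto simp: divide_le_eq add_pos_nonneg algebra_simps)

lemma soft_powr_le_const:
  assumes "0 \<le> x" "0 < \<epsilon>" "0 \<le> p"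
  shows "soft_powr p \<epsilon> x \<le> (1 / \<epsilon>) powr p"
proof -
  have "0 < 1 + \<epsilon> * x" using assms by (simp add: add_pos_nonneg)
  then have "x / (1 + \<epsilon> * x) \<le> 1 / \<epsilon>" using assms by (simp add: field_simps)
  then show ?thesis unfolding soft_powr_def using assms by (intro powr_mono2) auto
qed

text \<open>Both \<open>x / (1 + \<epsilon> x)\<close> and \<open>x\<^sup>p\<close> are increasing and subadditive.\<close>
lemma soft_powr_subadditive:
  assumes "0 \<le> x" "0 \<le> y" "0 \<le> \<epsilon>" "0 < p" "p \<le> 1"
  shows "soft_powr p \<epsilon> (x + y) \<le> soft_powr p \<epsilon> x + soft_powr p \<epsilon> y"
proof -
  have p: "0 < 1 + \<epsilon> * x" "0 < 1 + \<epsilon> * y" "0 < 1 + \<epsilon> * (x + y)" using assms by (simp_all add: add_pos_nonneg)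
  have "(x + y) / (1 + \<epsilon> * (x + y)) = x / (1 + \<epsilon> * (x + y)) + y / (1 + \<epsilon> * (x + y))"
    by (rule add_divide_distrib)
  also have "\<dots> \<le> x / (1 + \<epsilon> * x) + y / (1 + \<epsilon> * y)"
    using assms p by (intro add_mono frac_le) (auto simp: algebra_simps)
  finally have "soft_powr p \<epsilon> (x + y) \<le> (x / (1 + \<epsilon> * x) + y / (1 + \<epsilon> * y)) powr p"
    unfolding soft_powr_def using assms p by (intro powr_mono2) auto
  also have "\<dots> \<le> soft_powr p \<epsilon> x + soft_powr p \<epsilon> y"
    unfolding soft_powr_def using assms p by (intro powr_subadditive) auto
  finally show ?thesis .
qed

text \<open>The softened power saturates for \<open>E\<close> much larger than \<open>1 / \<epsilon>\<close>, and then shrinking \<open>E\<close> gains nothing. As long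
  as \<open>\<epsilon> E \<le> 1\<close>, the gain is a factor that does not depend on \<open>\<epsilon>\<close>; this reduces to
  \<open>(1 - l) (1 - \<epsilon> E) \<ge> 0\<close>.\<close>
lemma soft_powr_contract:
  assumes "0 \<le> \<epsilon>" "0 \<le> E" "\<epsilon> * E \<le> 1" "0 \<le> l" "l \<le> 1" "0 \<le> p"
  shows "soft_powr p \<epsilon> (l * E) \<le> (2 * l / (1 + l)) powr p * soft_powr p \<epsilon> E"
proof -
  define y where "y = \<epsilon> * E"
  have y: "0 \<le> y" "y \<le> 1" using assms by (auto simp: y_def)
  have p: "0 < 1 + l" "0 < 1 + y" "0 < 1 + l * y" using assms y by (auto simp: add_pos_nonneg)
  have "0 \<le> (1 - l) * (1 - y)" using assms y by simp
  then have "(1 + y) * (1 + l) \<le> 2 * (1 + l * y)" by (simp add: algebra_simps)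
  then have "1 / (1 + l * y) \<le> 2 / ((1 + l) * (1 + y))"
  proof -
    have "2 / (2 * (1 + l * y)) \<le> 2 / ((1 + l) * (1 + y))"
      using p \<open>(1 + y) * (1 + l) \<le> 2 * (1 + l * y)\<close>
      by (intro divide_left_mono mult_pos_pos) (auto simp: mult.commute)
    moreover have "2 / (2 * x) = 1 / x" for x :: real by simp
    ultimately show ?thesis by (simp only:)
  qed
  then have "(l * E) * (1 / (1 + l * y)) \<le> (l * E) * (2 / ((1 + l) * (1 + y)))"
    using assms by (intro mult_left_mono) auto
  then have "l * E / (1 + \<epsilon> * (l * E)) \<le> (2 * l / (1 + l)) * (E / (1 + \<epsilon> * E))"
    by (simp add: y_def mult_ac)
  then have "soft_powr p \<epsilon> (l * E) \<le> ((2 * l / (1 + l)) * (E / (1 + \<epsilon> * E))) powr p"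
    unfolding soft_powr_def using assms p by (intro powr_mono2) (auto simp: y_def mult_ac)
  also have "\<dots> = (2 * l / (1 + l)) powr p * soft_powr p \<epsilon> E"
    unfolding soft_powr_def using assms p by (intro powr_mult)
  finally show ?thesis .
qed

text \<open>With \<open>r = |\<xi> - \<xi>\<^sub>*|\<close>, the outgoing energies are \<open>E / 2 \<plusminus> (r / 2) (\<xi> + \<xi>\<^sub>*) \<bullet> \<sigma>\<close>, and \<open>r |\<xi> + \<xi>\<^sub>*| \<le> E\<close> because
  \<open>r\<^sup>2 + |\<xi> + \<xi>\<^sub>*|\<^sup>2 = 2 E\<close>.\<close>
lemma post_norm_le:
  fixes \<xi> \<xi>s \<sigma> :: "'a::euclidean_space"
  assumes "norm \<sigma> = 1"
  defines "E \<equiv> (norm \<xi>)\<^sup>2 + (norm \<xi>s)\<^sup>2" and "\<tau> \<equiv> \<bar>sgn (\<xi> + \<xi>s) \<bullet> \<sigma>\<bar>"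
  shows "(norm (post1 \<xi> \<xi>s \<sigma>))\<^sup>2 \<le> (1 + \<tau>) / 2 * E" "(norm (post2 \<xi> \<xi>s \<sigma>))\<^sup>2 \<le> (1 + \<tau>) / 2 * E"
proof -
  define r s where "r = norm (\<xi> - \<xi>s)" and "s = norm (\<xi> + \<xi>s)"
  have ss: "\<sigma> \<bullet> \<sigma> = 1" using assms by (simp add: norm_eq_1)
  have r: "r * r = (\<xi> - \<xi>s) \<bullet> (\<xi> - \<xi>s)" by (simp add: r_def power2_norm_eq_inner[symmetric] power2_eq_square)
  have s: "s * s = (\<xi> + \<xi>s) \<bullet> (\<xi> + \<xi>s)" by (simp add: s_def power2_norm_eq_inner[symmetric] power2_eq_square)
  have rs: "r * r + s * s = 2 * E"
    unfolding r s E_def power2_norm_eq_inner by (simp add: algebra_simps inner_commute)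
  have e1: "(norm (post1 \<xi> \<xi>s \<sigma>))\<^sup>2 = E / 2 + r / 2 * ((\<xi> + \<xi>s) \<bullet> \<sigma>)"
    and e2: "(norm (post2 \<xi> \<xi>s \<sigma>))\<^sup>2 = E / 2 - r / 2 * ((\<xi> + \<xi>s) \<bullet> \<sigma>)"
    unfolding post1_def post2_def power2_norm_eq_inner r_def[symmetric] E_def
    using r ss by (simp_all add: algebra_simps inner_commute)
  have "(\<xi> + \<xi>s) \<bullet> \<sigma> = s * (sgn (\<xi> + \<xi>s) \<bullet> \<sigma>)"
    by (cases "\<xi> + \<xi>s = 0") (simp_all add: s_def sgn_div_norm)
  then have "\<bar>r / 2 * ((\<xi> + \<xi>s) \<bullet> \<sigma>)\<bar> = r * s / 2 * \<tau>"
    by (simp add: abs_mult \<tau>_def r_def s_def)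
  also have "\<dots> \<le> E / 2 * \<tau>"
  proof -
    have "0 \<le> (r - s) * (r - s)" by simp
    then have "r * s \<le> E" using rs by (simp add: algebra_simps)
    then show ?thesis by (intro mult_right_mono) (auto simp: \<tau>_def)
  qed
  finally have "\<bar>r / 2 * ((\<xi> + \<xi>s) \<bullet> \<sigma>)\<bar> \<le> E / 2 * \<tau>" .
  moreover have "(1 + \<tau>) / 2 * E = E / 2 + E / 2 * \<tau>" by (simp add: field_simps)
  ultimately show "(norm (post1 \<xi> \<xi>s \<sigma>))\<^sup>2 \<le> (1 + \<tau>) / 2 * E" "(norm (post2 \<xi> \<xi>s \<sigma>))\<^sup>2 \<le> (1 + \<tau>) / 2 * E"
    unfolding e1 e2 by linarith+
qed

context angular_kernel
begin

text \<open>Exchanging the incoming particles reverses the relative velocity, and \<open>\<sigma> \<mapsto> -\<sigma>\<close> undoes this.\<close>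
lemma average_swap:
  assumes [measurable]: "\<rho> \<in> borel_measurable borel"
  shows "average \<rho> \<xi>s \<xi> = (LINT \<sigma>|surface_measure. b (sgn (\<xi> - \<xi>s) \<bullet> \<sigma>) * \<rho> (post2 \<xi> \<xi>s \<sigma>))"
proof -
  have s: "sgn (\<xi>s - \<xi>) = - sgn (\<xi> - \<xi>s)" using sgn_minus[of "\<xi> - \<xi>s"] by simp
  have "average \<rho> \<xi>s \<xi> = (LINT \<sigma>|distr surface_measure borel uminus. b (sgn (\<xi>s - \<xi>) \<bullet> \<sigma>) * \<rho> (post1 \<xi>s \<xi> \<sigma>))"
    unfolding average_def by (simp only: distr_surface_measure_uminus)
  also have "\<dots> = (LINT \<sigma>|surface_measure. b (sgn (\<xi>s - \<xi>) \<bullet> (- \<sigma>)) * \<rho> (post1 \<xi>s \<xi> (- \<sigma>)))"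
    by (rule integral_distr) measurable
  also have "\<dots> = (LINT \<sigma>|surface_measure. b (sgn (\<xi> - \<xi>s) \<bullet> \<sigma>) * \<rho> (post2 \<xi> \<xi>s \<sigma>))"
    by (simp add: post2_swap(2) s)
  finally show ?thesis .
qed

lemma post2_average_integrable:
  fixes \<rho> :: "'a \<Rightarrow> real"
  assumes \<rho>: "quadratic_growth C \<rho>"
  shows "integrable surface_measure (\<lambda>\<sigma>. b (sgn (\<xi> - \<xi>s) \<bullet> \<sigma>) * \<rho> (post2 \<xi> \<xi>s \<sigma>))"
proof -
  note [measurable] = quadratic_growth_measurable[OF \<rho>]
  have s: "sgn (\<xi>s - \<xi>) = - sgn (\<xi> - \<xi>s)" using sgn_minus[of "\<xi> - \<xi>s"] by simp
  have "integrable (distr surface_measure borel uminus) (\<lambda>\<sigma>. b (sgn (\<xi>s - \<xi>) \<bullet> \<sigma>) * \<rho> (post1 \<xi>s \<xi> \<sigma>))"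
    unfolding distr_surface_measure_uminus by (rule average_integrable[OF \<rho>])
  then have "integrable surface_measure (\<lambda>\<sigma>. b (sgn (\<xi>s - \<xi>) \<bullet> (- \<sigma>)) * \<rho> (post1 \<xi>s \<xi> (- \<sigma>)))"
    by (subst (asm) integrable_distr_eq) auto
  then show ?thesis by (simp add: post2_swap(2) s)
qed

lemma average_add_swap:
  assumes \<rho>: "quadratic_growth C \<rho>"
  shows "average \<rho> \<xi> \<xi>s + average \<rho> \<xi>s \<xi>
    = (LINT \<sigma>|surface_measure. b (sgn (\<xi> - \<xi>s) \<bullet> \<sigma>) * (\<rho> (post1 \<xi> \<xi>s \<sigma>) + \<rho> (post2 \<xi> \<xi>s \<sigma>)))"
  using average_integrable[OF \<rho>] post2_average_integrable[OF \<rho>]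
  by (subst average_swap[OF quadratic_growth_measurable[OF \<rho>]])
     (simp add: average_def distrib_left)

text \<open>The axis \<open>e\<close> of \<open>b\<close> and the axis \<open>z\<close> of the caps are unrelated, and \<open>b\<close> may be unbounded. Cut \<open>b\<close> at
  a level \<open>K\<close>: the part above \<open>K\<close> has small integral over the whole sphere, and the part below \<open>K\<close> is at
  most \<open>K\<close> times the area of the caps. Neither integral depends on its axis, which makes \<open>\<eta>\<close> uniform.\<close>
lemma uniformly_small_polar_caps:
  obtains \<eta> where "0 < \<eta>" "\<eta> < 1"
    "\<And>e z :: 'a. norm e = 1 \<Longrightarrow> norm z = 1 \<Longrightarrow>
      (\<integral>\<^sup>+\<sigma>. ennreal (b (e \<bullet> \<sigma>)) * indicator {1 - \<eta><..} \<bar>z \<bullet> \<sigma>\<bar> \<partial>surface_measure) \<le> ennreal (1/2)"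
proof -
  obtain e0 :: 'a where "e0 \<in> Basis" using nonempty_Basis by blast
  then have e0: "norm e0 = 1" by (rule norm_Basis)
  define L where "L = distr (surface_measure :: 'a measure) borel (\<lambda>\<sigma>. e0 \<bullet> \<sigma>)"
  have sL[simp, measurable_cong]: "sets L = sets borel" by (simp add: L_def)
  have L: "(\<integral>\<^sup>+\<sigma>. h (e \<bullet> \<sigma>) \<partial>surface_measure) = (\<integral>\<^sup>+t. h t \<partial>L)"
    if "norm e = 1" and [measurable]: "h \<in> borel_measurable borel" for e :: 'a and h :: "real \<Rightarrow> ennreal"
    using nn_integral_sphere_slice[OF dim that(1), of h] nn_integral_sphere_slice[OF dim e0, of h]
    by (simp add: L_def nn_integral_distr nn_integral_surface_measure)
  have bL: "(\<integral>\<^sup>+t. ennreal (b t) \<partial>L) = 1" using L[OF e0, of "\<lambda>t. ennreal (b t)"] nn_integral_b[OF e0] by simp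
  have fL: "(\<integral>\<^sup>+t. 1 \<partial>L) < \<infinity>"
  proof -
    have "(\<integral>\<^sup>+\<sigma>. (1::ennreal) \<partial>(surface_measure :: 'a measure)) < \<infinity>"
      by (simp add: emeasure_surface_measure)
    then show ?thesis using L[OF e0, of "\<lambda>t. 1"] by (simp only: borel_measurable_const)
  qed
  have cap0: "AE t in L. \<bar>t\<bar> < 1"
  proof -
    have "(\<integral>\<^sup>+t. indicator {t. \<not> \<bar>t\<bar> < 1} t \<partial>L) = 0"
    proof -
      have z: "(\<integral>\<^sup>+t. indicator {t. \<not> \<bar>t\<bar> < 1} t * ennreal ((1 - t\<^sup>2) powr ((real DIM('a) - 3) / 2)) * indicator {-1..1} t \<partial>lborel) = 0"
      proof (rule trans[OF nn_integral_cong_AE])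
        show "AE t in lborel. indicator {t. \<not> \<bar>t\<bar> < 1} t * ennreal ((1 - t\<^sup>2) powr ((real DIM('a) - 3) / 2)) * indicator {-1..1} t = (0::ennreal)"
          by (rule eventually_mono[OF eventually_conj[OF AE_lborel_singleton[of "1::real"] AE_lborel_singleton[of "-1::real"]]])
             (auto simp: indicator_def)
      qed simp
      have [measurable]: "{t::real. \<not> \<bar>t\<bar> < 1} \<in> sets borel" by measurable
      show ?thesis
        using L[OF e0, of "indicator {t. \<not> \<bar>t\<bar> < 1}"] nn_integral_sphere_slice[OF dim e0, of "indicator {t. \<not> \<bar>t\<bar> < 1}"] z
        by (simp add: nn_integral_surface_measure)
    qed
    then have "AE t in L. indicator {t. \<not> \<bar>t\<bar> < 1} t = (0::ennreal)"
      by (subst (asm) nn_integral_0_iff_AE) auto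
    then show ?thesis by eventually_elim (auto simp: indicator_def split: if_splits)
  qed
  have "(\<lambda>n. \<integral>\<^sup>+t. ennreal (b t) * indicator {real n<..} (b t) \<partial>L) \<longlonglongrightarrow> (\<integral>\<^sup>+t. 0 \<partial>L)"
  proof (rule nn_integral_dominated_convergence[where w="\<lambda>t. ennreal (b t)"])
    show "AE t in L. (\<lambda>n. ennreal (b t) * indicator {real n<..} (b t)) \<longlonglongrightarrow> 0"
    proof (rule AE_I2)
      fix t
      obtain N where N: "b t \<le> real N" using real_arch_simple by blast
      have "eventually (\<lambda>n. ennreal (b t) * indicator {real n<..} (b t) = 0) sequentially"
        by (rule eventually_mono[OF eventually_ge_at_top[of N]]) (use N in \<open>auto simp: indicator_def\<close>)
      then show "(\<lambda>n. ennreal (b t) * indicator {real n<..} (b t)) \<longlonglongrightarrow> 0"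
        by (rule tendsto_eventually)
    qed
  qed (use bL in \<open>auto simp: indicator_def intro!: AE_I2\<close>)
  then have "eventually (\<lambda>n. (\<integral>\<^sup>+t. ennreal (b t) * indicator {real n<..} (b t) \<partial>L) < ennreal (1/4)) sequentially"
    by (intro order_tendstoD(2)) auto
  then obtain K where K: "K \<ge> 1" "(\<integral>\<^sup>+t. ennreal (b t) * indicator {real K<..} (b t) \<partial>L) < ennreal (1/4)"
    unfolding eventually_sequentially by (metis le_add1 le_add2)
  have "(\<lambda>n. \<integral>\<^sup>+t. indicator {1 - 1 / real (n + 2)<..} \<bar>t\<bar> \<partial>L) \<longlonglongrightarrow> (\<integral>\<^sup>+t. 0 \<partial>L)"
  proof (rule nn_integral_dominated_convergence[where w="\<lambda>t. 1"])
    show "AE t in L. (\<lambda>n. indicator {1 - 1 / real (n + 2)<..} \<bar>t\<bar>) \<longlonglongrightarrow> (0::ennreal)"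
      using cap0
    proof eventually_elim
      case (elim t)
      obtain N where N: "1 / (1 - \<bar>t\<bar>) < real N" using reals_Archimedean2 by blast
      have "eventually (\<lambda>n. indicator {1 - 1 / real (n + 2)<..} \<bar>t\<bar> = (0::ennreal)) sequentially"
        using eventually_ge_at_top[of N]
      proof eventually_elim
        case (elim n)
        then have "1 / (1 - \<bar>t\<bar>) \<le> real (n + 2)" using N by simp
        then have "1 / real (n + 2) \<le> 1 - \<bar>t\<bar>" using \<open>\<bar>t\<bar> < 1\<close> by (simp add: field_simps)
        then show ?case by simp
      qed
      then show ?case by (rule tendsto_eventually)
    qed
  qed (use fL in \<open>auto simp: indicator_def intro!: AE_I2\<close>)
  then have "eventually (\<lambda>n. (\<integral>\<^sup>+t. indicator {1 - 1 / real (n + 2)<..} \<bar>t\<bar> \<partial>L) < ennreal (1 / (4 * real K))) sequentially"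
    using K by (intro order_tendstoD(2)) auto
  then obtain N where N: "(\<integral>\<^sup>+t. indicator {1 - 1 / real (N + 2)<..} \<bar>t\<bar> \<partial>L) < ennreal (1 / (4 * real K))"
    unfolding eventually_sequentially by blast
  define \<eta> where "\<eta> = 1 / real (N + 2)"
  have \<eta>: "0 < \<eta>" "\<eta> < 1" by (auto simp: \<eta>_def)
  have "(\<integral>\<^sup>+\<sigma>. ennreal (b (e \<bullet> \<sigma>)) * indicator {1 - \<eta><..} \<bar>z \<bullet> \<sigma>\<bar> \<partial>surface_measure) \<le> ennreal (1/2)"
    if e: "norm e = 1" and z: "norm z = 1" for e z :: 'a
  proof -
    have "(\<integral>\<^sup>+\<sigma>. ennreal (b (e \<bullet> \<sigma>)) * indicator {1 - \<eta><..} \<bar>z \<bullet> \<sigma>\<bar> \<partial>surface_measure)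
      \<le> (\<integral>\<^sup>+\<sigma>. ennreal (b (e \<bullet> \<sigma>)) * indicator {real K<..} (b (e \<bullet> \<sigma>))
          + ennreal (real K) * indicator {1 - \<eta><..} \<bar>z \<bullet> \<sigma>\<bar> \<partial>surface_measure)"
      by (intro nn_integral_mono) (auto simp: indicator_def not_less intro: ennreal_leI)
    also have "\<dots> = (\<integral>\<^sup>+\<sigma>. ennreal (b (e \<bullet> \<sigma>)) * indicator {real K<..} (b (e \<bullet> \<sigma>)) \<partial>surface_measure)
          + ennreal (real K) * (\<integral>\<^sup>+\<sigma>. indicator {1 - \<eta><..} \<bar>z \<bullet> \<sigma>\<bar> \<partial>surface_measure)"
      by (simp add: nn_integral_add nn_integral_cmult)
    also have "\<dots> = (\<integral>\<^sup>+t. ennreal (b t) * indicator {real K<..} (b t) \<partial>L)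
          + ennreal (real K) * (\<integral>\<^sup>+t. indicator {1 - \<eta><..} \<bar>t\<bar> \<partial>L)"
      by (simp add: L[OF e, of "\<lambda>t. ennreal (b t) * indicator {real K<..} (b t)"]
          L[OF z, of "\<lambda>t. indicator {1 - \<eta><..} \<bar>t\<bar>"])
    also have "\<dots> \<le> ennreal (1/4) + ennreal (real K) * ennreal (1 / (4 * real K))"
      using K(2) N by (intro add_mono mult_left_mono) (auto simp: \<eta>_def)
    also have "\<dots> = ennreal (1/2)"
      using K(1) by (simp add: ennreal_mult[symmetric] ennreal_plus[symmetric] del: ennreal_plus)
    finally show ?thesis .
  qed
  with \<eta> show ?thesis using that by blast
qed

text \<open>The substitute for \<open>|\<xi>|\<^bsup>2+\<gamma>\<^esup>\<close> with quadratic growth.\<close>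
definition soft_moment :: "real \<Rightarrow> 'a \<Rightarrow> real" where
  "soft_moment \<epsilon> \<xi> = (norm \<xi>)\<^sup>2 * soft_powr (\<gamma> / 2) \<epsilon> ((norm \<xi>)\<^sup>2)"

lemma soft_moment_nonneg: "0 \<le> soft_moment \<epsilon> \<xi>"
  by (simp add: soft_moment_def soft_powr_nonneg)

lemma soft_moment_quadratic_growth:
  assumes "\<epsilon> > 0"
  shows "quadratic_growth ((1 / \<epsilon>) powr (\<gamma> / 2)) (soft_moment \<epsilon>)"
  unfolding quadratic_growth_def
proof (intro conjI allI)
  show "soft_moment \<epsilon> \<in> borel_measurable borel"
    unfolding soft_moment_def soft_powr_def by measurable
  fix \<xi> :: 'a
  have "\<bar>soft_moment \<epsilon> \<xi>\<bar> = (norm \<xi>)\<^sup>2 * soft_powr (\<gamma> / 2) \<epsilon> ((norm \<xi>)\<^sup>2)"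
    by (simp add: soft_moment_def soft_powr_nonneg)
  also have "\<dots> \<le> (1 + (norm \<xi>)\<^sup>2) * (1 / \<epsilon>) powr (\<gamma> / 2)"
    using assms \<gamma>_pos by (intro mult_mono soft_powr_le_const) (auto simp: soft_powr_nonneg)
  finally show "\<bar>soft_moment \<epsilon> \<xi>\<bar> \<le> (1 / \<epsilon>) powr (\<gamma> / 2) * (1 + (norm \<xi>)\<^sup>2)"
    by (simp add: mult.commute)
qed

text \<open>Both softened powers are bounded by their value at the common bound for the outgoing energies, and
  what is left adds up to \<open>E\<close>.\<close>
lemma soft_moment_post_le:
  fixes \<xi> \<xi>s \<sigma> :: 'a
  assumes \<sigma>: "norm \<sigma> = 1" and \<epsilon>: "\<epsilon> > 0"
  defines "E \<equiv> (norm \<xi>)\<^sup>2 + (norm \<xi>s)\<^sup>2" and "\<tau> \<equiv> \<bar>sgn (\<xi> + \<xi>s) \<bullet> \<sigma>\<bar>"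
  shows "soft_moment \<epsilon> (post1 \<xi> \<xi>s \<sigma>) + soft_moment \<epsilon> (post2 \<xi> \<xi>s \<sigma>)
    \<le> E * soft_powr (\<gamma> / 2) \<epsilon> ((1 + \<tau>) / 2 * E)"
proof -
  have "soft_moment \<epsilon> (post1 \<xi> \<xi>s \<sigma>) + soft_moment \<epsilon> (post2 \<xi> \<xi>s \<sigma>)
    \<le> (norm (post1 \<xi> \<xi>s \<sigma>))\<^sup>2 * soft_powr (\<gamma> / 2) \<epsilon> ((1 + \<tau>) / 2 * E)
      + (norm (post2 \<xi> \<xi>s \<sigma>))\<^sup>2 * soft_powr (\<gamma> / 2) \<epsilon> ((1 + \<tau>) / 2 * E)"
    unfolding soft_moment_def E_def \<tau>_def using \<epsilon> \<gamma>_pos post_norm_le[OF \<sigma>, of \<xi> \<xi>s]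
    by (intro add_mono mult_left_mono soft_powr_mono) auto
  also have "\<dots> = E * soft_powr (\<gamma> / 2) \<epsilon> ((1 + \<tau>) / 2 * E)"
    unfolding distrib_right[symmetric] post_energy[OF \<sigma>] E_def ..
  finally show ?thesis .
qed

text \<open>At most half of the mass of \<open>b\<close> lies on directions \<open>\<sigma>\<close> within the caps around \<open>\<plusminus>(\<xi> + \<xi>\<^sub>*)\<close>; outside of
  them the outgoing energies are both at most \<open>(1 - \<eta> / 2) E\<close>, which gains a fixed factor where the
  softened power is not saturated. The constant \<open>\<kappa>\<close> does not depend on \<open>\<epsilon>\<close>.\<close>
lemma povzner:
  obtains \<kappa> where "0 \<le> \<kappa>" "\<kappa> < 1"
    "\<And>\<epsilon> \<xi> \<xi>s. \<epsilon> > 0 \<Longrightarrow> \<xi> \<noteq> \<xi>s \<Longrightarrow>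
      average (soft_moment \<epsilon>) \<xi> \<xi>s + average (soft_moment \<epsilon>) \<xi>s \<xi>
        \<le> ((norm \<xi>)\<^sup>2 + (norm \<xi>s)\<^sup>2) * soft_powr (\<gamma> / 2) \<epsilon> ((norm \<xi>)\<^sup>2 + (norm \<xi>s)\<^sup>2)"
    "\<And>\<epsilon> \<xi> \<xi>s. \<epsilon> > 0 \<Longrightarrow> \<xi> \<noteq> \<xi>s \<Longrightarrow> \<epsilon> * ((norm \<xi>)\<^sup>2 + (norm \<xi>s)\<^sup>2) \<le> 1 \<Longrightarrow>
      average (soft_moment \<epsilon>) \<xi> \<xi>s + average (soft_moment \<epsilon>) \<xi>s \<xi>
        \<le> \<kappa> * (((norm \<xi>)\<^sup>2 + (norm \<xi>s)\<^sup>2) * soft_powr (\<gamma> / 2) \<epsilon> ((norm \<xi>)\<^sup>2 + (norm \<xi>s)\<^sup>2))"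
proof -
  obtain \<eta> where \<eta>: "0 < \<eta>" "\<eta> < 1" and cap: "\<And>e z :: 'a. norm e = 1 \<Longrightarrow> norm z = 1 \<Longrightarrow>
      (\<integral>\<^sup>+\<sigma>. ennreal (b (e \<bullet> \<sigma>)) * indicator {1 - \<eta><..} \<bar>z \<bullet> \<sigma>\<bar> \<partial>surface_measure) \<le> ennreal (1/2)"
    using uniformly_small_polar_caps by blast
  \<comment> \<open>\<open>w\<close> is the contraction factor at \<open>\<tau> = 1 - \<eta>\<close>, that is, for \<open>l = 1 - \<eta> / 2\<close>.\<close>
  define w where "w = ((4 - 2 * \<eta>) / (4 - \<eta>)) powr (\<gamma> / 2)"
  have w: "0 \<le> w" "w < 1"
  proof -
    show "0 \<le> w" by (simp add: w_def)
    have "(4 - 2 * \<eta>) / (4 - \<eta>) < 1" "0 \<le> (4 - 2 * \<eta>) / (4 - \<eta>)" using \<eta> by auto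
    then have "w < 1 powr (\<gamma> / 2)" unfolding w_def using \<gamma>_pos by (intro powr_less_mono2) auto
    then show "w < 1" by simp
  qed
  have gen: "average (soft_moment \<epsilon>) \<xi> \<xi>s + average (soft_moment \<epsilon>) \<xi>s \<xi>
      \<le> (LINT \<sigma>|surface_measure. b (sgn (\<xi> - \<xi>s) \<bullet> \<sigma>) * h \<sigma>)"
    if "\<epsilon> > 0" and h: "\<And>\<sigma>. norm \<sigma> = 1 \<Longrightarrow> soft_moment \<epsilon> (post1 \<xi> \<xi>s \<sigma>) + soft_moment \<epsilon> (post2 \<xi> \<xi>s \<sigma>) \<le> h \<sigma>"
      and i: "integrable surface_measure (\<lambda>\<sigma>. b (sgn (\<xi> - \<xi>s) \<bullet> \<sigma>) * h \<sigma>)" for \<epsilon> \<xi> \<xi>s h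
    unfolding average_add_swap[OF soft_moment_quadratic_growth[OF that(1)]]
  proof (rule integral_mono_AE)
    show "integrable surface_measure (\<lambda>\<sigma>. b (sgn (\<xi> - \<xi>s) \<bullet> \<sigma>) * (soft_moment \<epsilon> (post1 \<xi> \<xi>s \<sigma>) + soft_moment \<epsilon> (post2 \<xi> \<xi>s \<sigma>)))"
      using average_integrable[OF soft_moment_quadratic_growth[OF that(1)], of \<xi> \<xi>s]
        post2_average_integrable[OF soft_moment_quadratic_growth[OF that(1)], of \<xi> \<xi>s]
      by (simp add: distrib_left)
    show "AE \<sigma> in surface_measure. b (sgn (\<xi> - \<xi>s) \<bullet> \<sigma>) * (soft_moment \<epsilon> (post1 \<xi> \<xi>s \<sigma>) + soft_moment \<epsilon> (post2 \<xi> \<xi>s \<sigma>))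
      \<le> b (sgn (\<xi> - \<xi>s) \<bullet> \<sigma>) * h \<sigma>"
      using AE_surface_measure_norm by eventually_elim (intro mult_left_mono h b_nonneg)
  qed (rule i)
  have p0: "0 \<le> \<gamma> / 2" using \<gamma>_pos by simp
  have \<tau>1: "\<bar>sgn (\<xi> + \<xi>s) \<bullet> \<sigma>\<bar> \<le> 1" if "norm \<sigma> = 1" for \<xi> \<xi>s \<sigma> :: 'a
    using Cauchy_Schwarz_ineq2[of "sgn (\<xi> + \<xi>s)" \<sigma>] that by (simp add: norm_sgn split: if_splits)
  show ?thesis
  proof (rule that[of "(1 + w) / 2"])
    show "0 \<le> (1 + w) / 2" "(1 + w) / 2 < 1" using w by auto
  next
    fix \<epsilon> :: real and \<xi> \<xi>s :: 'a assume \<epsilon>: "\<epsilon> > 0" and ne: "\<xi> \<noteq> \<xi>s"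
    define E where "E = (norm \<xi>)\<^sup>2 + (norm \<xi>s)\<^sup>2"
    have E0: "0 \<le> E" by (simp add: E_def)
    have "average (soft_moment \<epsilon>) \<xi> \<xi>s + average (soft_moment \<epsilon>) \<xi>s \<xi>
      \<le> (LINT \<sigma>|surface_measure. b (sgn (\<xi> - \<xi>s) \<bullet> \<sigma>) * (E * soft_powr (\<gamma> / 2) \<epsilon> E))"
    proof (rule gen[OF \<epsilon>])
      fix \<sigma> :: 'a assume \<sigma>: "norm \<sigma> = 1"
      have "(1 + \<bar>sgn (\<xi> + \<xi>s) \<bullet> \<sigma>\<bar>) / 2 * E \<le> 1 * E"
        using \<tau>1[OF \<sigma>, of \<xi> \<xi>s] E0 by (intro mult_right_mono) auto
      then have "E * soft_powr (\<gamma> / 2) \<epsilon> ((1 + \<bar>sgn (\<xi> + \<xi>s) \<bullet> \<sigma>\<bar>) / 2 * E) \<le> E * soft_powr (\<gamma> / 2) \<epsilon> E"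
        using E0 \<epsilon> p0 by (intro mult_left_mono soft_powr_mono) auto
      then show "soft_moment \<epsilon> (post1 \<xi> \<xi>s \<sigma>) + soft_moment \<epsilon> (post2 \<xi> \<xi>s \<sigma>) \<le> E * soft_powr (\<gamma> / 2) \<epsilon> E"
        using soft_moment_post_le[OF \<sigma> \<epsilon>, of \<xi> \<xi>s] unfolding E_def by linarith
    qed (intro integrable_mult_left integrable_b)
    then show "average (soft_moment \<epsilon>) \<xi> \<xi>s + average (soft_moment \<epsilon>) \<xi>s \<xi>
        \<le> ((norm \<xi>)\<^sup>2 + (norm \<xi>s)\<^sup>2) * soft_powr (\<gamma> / 2) \<epsilon> ((norm \<xi>)\<^sup>2 + (norm \<xi>s)\<^sup>2)"
      using ne by (simp add: integral_b E_def)
    assume small: "\<epsilon> * ((norm \<xi>)\<^sup>2 + (norm \<xi>s)\<^sup>2) \<le> 1"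
    define z where "z = sgn (\<xi> + \<xi>s)"
    define P where "P = E * soft_powr (\<gamma> / 2) \<epsilon> E"
    have P0: "0 \<le> P" using E0 by (simp add: P_def soft_powr_nonneg)
    have icap: "integrable surface_measure (\<lambda>\<sigma>. b (sgn (\<xi> - \<xi>s) \<bullet> \<sigma>) * indicator {1 - \<eta><..} \<bar>z \<bullet> \<sigma>\<bar>)"
      by (rule Bochner_Integration.integrable_bound[OF integrable_b[of "\<xi> - \<xi>s"]])
         (auto simp: indicator_def b_nonneg intro!: AE_I2)
    have "average (soft_moment \<epsilon>) \<xi> \<xi>s + average (soft_moment \<epsilon>) \<xi>s \<xi>
      \<le> (LINT \<sigma>|surface_measure. b (sgn (\<xi> - \<xi>s) \<bullet> \<sigma>) * (P * (w + (1 - w) * indicator {1 - \<eta><..} \<bar>z \<bullet> \<sigma>\<bar>)))"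
    proof (rule gen[OF \<epsilon>])
      fix \<sigma> :: 'a assume \<sigma>: "norm \<sigma> = 1"
      define \<tau> where "\<tau> = \<bar>z \<bullet> \<sigma>\<bar>"
      define l where "l = (1 + \<tau>) / 2"
      have \<tau>: "0 \<le> \<tau>" "\<tau> \<le> 1" using \<tau>1[OF \<sigma>, of \<xi> \<xi>s] by (auto simp: \<tau>_def z_def)
      have l: "0 \<le> l" "l \<le> 1" using \<tau> by (auto simp: l_def)
      have "soft_moment \<epsilon> (post1 \<xi> \<xi>s \<sigma>) + soft_moment \<epsilon> (post2 \<xi> \<xi>s \<sigma>) \<le> E * soft_powr (\<gamma> / 2) \<epsilon> (l * E)"
        using soft_moment_post_le[OF \<sigma> \<epsilon>, of \<xi> \<xi>s] by (simp add: E_def l_def \<tau>_def z_def)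
      also have "\<dots> \<le> E * ((2 * l / (1 + l)) powr (\<gamma> / 2) * soft_powr (\<gamma> / 2) \<epsilon> E)"
        using small \<epsilon> E0 l p0 by (intro mult_left_mono soft_powr_contract) (auto simp: E_def)
      also have "\<dots> = P * (2 * l / (1 + l)) powr (\<gamma> / 2)" by (simp add: P_def)
      also have "\<dots> \<le> P * (w + (1 - w) * indicator {1 - \<eta><..} \<tau>)"
      proof (rule mult_left_mono[OF _ P0])
        show "(2 * l / (1 + l)) powr (\<gamma> / 2) \<le> w + (1 - w) * indicator {1 - \<eta><..} \<tau>"
        proof (cases "1 - \<eta> < \<tau>")
          case True
          have "(2 * l / (1 + l)) powr (\<gamma> / 2) \<le> 1 powr (\<gamma> / 2)"
            using l p0 by (intro powr_mono2) (auto simp: divide_le_eq)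
          then show ?thesis using True by simp
        next
          case False
          have q: "2 * l / (1 + l) = 2 - 4 / (3 + \<tau>)"
            using \<tau> by (simp add: l_def field_simps)
          have "4 / (4 - \<eta>) \<le> 4 / (3 + \<tau>)" using False \<tau> \<eta> by (intro divide_left_mono) auto
          then have "2 * l / (1 + l) \<le> 2 - 4 / (4 - \<eta>)" unfolding q by simp
          also have "2 - 4 / (4 - \<eta>) = (4 - 2 * \<eta>) / (4 - \<eta>)" using \<eta> by (simp add: field_simps)
          finally have "(2 * l / (1 + l)) powr (\<gamma> / 2) \<le> w"
            unfolding w_def using l p0 by (intro powr_mono2) auto
          then show ?thesis using False by simp
        qed
      qed
      finally show "soft_moment \<epsilon> (post1 \<xi> \<xi>s \<sigma>) + soft_moment \<epsilon> (post2 \<xi> \<xi>s \<sigma>)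
        \<le> P * (w + (1 - w) * indicator {1 - \<eta><..} \<bar>z \<bullet> \<sigma>\<bar>)" by (simp add: \<tau>_def)
    next
      have "integrable surface_measure (\<lambda>\<sigma>. (P * w) * b (sgn (\<xi> - \<xi>s) \<bullet> \<sigma>)
          + (P * (1 - w)) * (b (sgn (\<xi> - \<xi>s) \<bullet> \<sigma>) * indicator {1 - \<eta><..} \<bar>z \<bullet> \<sigma>\<bar>))"
        by (intro Bochner_Integration.integrable_add integrable_mult_right integrable_b icap)
      then show "integrable surface_measure (\<lambda>\<sigma>. b (sgn (\<xi> - \<xi>s) \<bullet> \<sigma>) * (P * (w + (1 - w) * indicator {1 - \<eta><..} \<bar>z \<bullet> \<sigma>\<bar>)))"
        by (simp add: algebra_simps)
    qed
    also have "\<dots> = (LINT \<sigma>|surface_measure. (P * w) * b (sgn (\<xi> - \<xi>s) \<bullet> \<sigma>)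
          + (P * (1 - w)) * (b (sgn (\<xi> - \<xi>s) \<bullet> \<sigma>) * indicator {1 - \<eta><..} \<bar>z \<bullet> \<sigma>\<bar>))"
      by (intro Bochner_Integration.integral_cong) (auto simp: algebra_simps)
    also have "\<dots> = P * w + (P * (1 - w)) * (LINT \<sigma>|surface_measure. b (sgn (\<xi> - \<xi>s) \<bullet> \<sigma>) * indicator {1 - \<eta><..} \<bar>z \<bullet> \<sigma>\<bar>)"
      using ne by (subst Bochner_Integration.integral_add) (auto simp: integral_b icap intro!: integrable_mult_right integrable_b)
    also have "\<dots> \<le> P * w + (P * (1 - w)) * (1 / 2)"
    proof (intro add_left_mono mult_left_mono)
      show "(LINT \<sigma>|surface_measure. b (sgn (\<xi> - \<xi>s) \<bullet> \<sigma>) * indicator {1 - \<eta><..} \<bar>z \<bullet> \<sigma>\<bar>) \<le> 1 / 2"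
      proof (cases "\<xi> + \<xi>s = 0")
        case True
        then show ?thesis using \<eta> by (simp add: z_def)
      next
        case False
        then have nz: "norm z = 1" "norm (sgn (\<xi> - \<xi>s)) = 1" using ne by (auto simp: z_def norm_sgn)
        have "ennreal (LINT \<sigma>|surface_measure. b (sgn (\<xi> - \<xi>s) \<bullet> \<sigma>) * indicator {1 - \<eta><..} \<bar>z \<bullet> \<sigma>\<bar>)
          = (\<integral>\<^sup>+\<sigma>. ennreal (b (sgn (\<xi> - \<xi>s) \<bullet> \<sigma>) * indicator {1 - \<eta><..} \<bar>z \<bullet> \<sigma>\<bar>) \<partial>surface_measure)"
          using icap b_nonneg by (intro nn_integral_eq_integral[symmetric]) (auto intro!: AE_I2)
        also have "\<dots> = (\<integral>\<^sup>+\<sigma>. ennreal (b (sgn (\<xi> - \<xi>s) \<bullet> \<sigma>)) * indicator {1 - \<eta><..} \<bar>z \<bullet> \<sigma>\<bar> \<partial>surface_measure)"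
          by (intro nn_integral_cong) (auto simp: indicator_def)
        also have "\<dots> \<le> ennreal (1/2)" by (rule cap[OF nz(2,1)])
        finally show ?thesis by (subst (asm) ennreal_le_iff) auto
      qed
    qed (use w P0 in auto)
    also have "\<dots> = (1 + w) / 2 * P" by (simp add: field_simps)
    finally show "average (soft_moment \<epsilon>) \<xi> \<xi>s + average (soft_moment \<epsilon>) \<xi>s \<xi>
        \<le> (1 + w) / 2 * (((norm \<xi>)\<^sup>2 + (norm \<xi>s)\<^sup>2) * soft_powr (\<gamma> / 2) \<epsilon> ((norm \<xi>)\<^sup>2 + (norm \<xi>s)\<^sup>2))"
      by (simp add: P_def E_def)
  qed
qed

end

section \<open>Collision terms as pairings with \<open>f \<otimes> f\<close>\<close>

lemma bracket_ge_1: "1 \<le> bracket \<xi>"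
  by (simp add: bracket_def)

lemma bracket_pos: "0 < bracket \<xi>"
  using bracket_ge_1[of \<xi>] by linarith

lemma bracket_powr_2: "bracket \<xi> powr 2 = 1 + (norm \<xi>)\<^sup>2"
proof -
  have "bracket \<xi> powr 2 = (bracket \<xi>)\<^sup>2" by (rule powr_numeral[OF less_imp_le[OF bracket_pos]])
  then show ?thesis by (simp add: bracket_def add_nonneg_nonneg)
qed

lemma bracket_measurable [measurable]: "bracket \<in> borel_measurable borel"
  unfolding bracket_def by measurable

lemma norm_le_bracket: "norm \<xi> \<le> bracket \<xi>"
  unfolding bracket_def by (rule real_le_rsqrt) simp

lemma bracket_powr_mono: "a \<le> c \<Longrightarrow> bracket \<xi> powr a \<le> bracket \<xi> powr c"
  using bracket_ge_1[of \<xi>] by (rule powr_mono[rotated])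

lemma norm_powr_le_bracket: "0 \<le> a \<Longrightarrow> norm \<xi> powr a \<le> bracket \<xi> powr a"
  by (intro powr_mono2 norm_le_bracket) auto

lemma integrable_tensor:
  fixes F :: "'a::euclidean_space \<Rightarrow> real" and G :: "'a \<Rightarrow> real"
  assumes F: "integrable lborel F" and G: "integrable lborel G"
  shows "integrable (lborel \<Otimes>\<^sub>M lborel) (\<lambda>z. F (fst z) * G (snd z))"
    "(LINT z|(lborel \<Otimes>\<^sub>M lborel). F (fst z) * G (snd z)) = (LINT x|lborel. F x) * (LINT x|lborel. G x)"
proof -
  have [measurable]: "F \<in> borel_measurable borel" "G \<in> borel_measurable borel" using F G by auto
  have "integrable (lborel \<Otimes>\<^sub>M lborel) (\<lambda>(x, y). F x * G y)"
  proof (rule lborel_pair.Fubini_integrable)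
    show "integrable lborel (\<lambda>x. LINT y|lborel. norm (case (x, y) of (x, y) \<Rightarrow> F x * G y))"
      using F G by (simp add: abs_mult)
  qed (use G in auto)
  then show i: "integrable (lborel \<Otimes>\<^sub>M lborel) (\<lambda>z. F (fst z) * G (snd z))"
    by (simp add: split_beta')
  show "(LINT z|(lborel \<Otimes>\<^sub>M lborel). F (fst z) * G (snd z)) = (LINT x|lborel. F x) * (LINT x|lborel. G x)"
    using lborel_pair.integral_fst'[OF i] by simp
qed

definition pairing :: "('a::euclidean_space \<Rightarrow> real) \<Rightarrow> ('a \<Rightarrow> real) \<Rightarrow> real" where
  "pairing f \<rho> = (LINT \<xi>|lborel. f \<xi> * \<rho> \<xi>)"

definition pairing2 :: "('a::euclidean_space \<Rightarrow> real) \<Rightarrow> ('a \<Rightarrow> 'a \<Rightarrow> real) \<Rightarrow> real" where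
  "pairing2 f H = (LINT z|(lborel \<Otimes>\<^sub>M lborel). f (fst z) * f (snd z) * H (fst z) (snd z))"

definition integrable2 :: "('a::euclidean_space \<Rightarrow> real) \<Rightarrow> ('a \<Rightarrow> 'a \<Rightarrow> real) \<Rightarrow> bool" where
  "integrable2 f H \<longleftrightarrow> integrable (lborel \<Otimes>\<^sub>M lborel) (\<lambda>z. f (fst z) * f (snd z) * H (fst z) (snd z))"

lemma pairing2_add:
  "integrable2 f H \<Longrightarrow> integrable2 f H' \<Longrightarrow> pairing2 f (\<lambda>x y. H x y + H' x y) = pairing2 f H + pairing2 f H'"
  "integrable2 f H \<Longrightarrow> integrable2 f H' \<Longrightarrow> integrable2 f (\<lambda>x y. H x y + H' x y)"
  by (simp_all add: pairing2_def integrable2_def distrib_left)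

lemma pairing2_diff:
  "integrable2 f H \<Longrightarrow> integrable2 f H' \<Longrightarrow> pairing2 f (\<lambda>x y. H x y - H' x y) = pairing2 f H - pairing2 f H'"
  "integrable2 f H \<Longrightarrow> integrable2 f H' \<Longrightarrow> integrable2 f (\<lambda>x y. H x y - H' x y)"
  by (simp_all add: pairing2_def integrable2_def right_diff_distrib)

lemma pairing2_cmult:
  "pairing2 f (\<lambda>x y. c * H x y) = c * pairing2 f H"
  "integrable2 f H \<Longrightarrow> integrable2 f (\<lambda>x y. c * H x y)"
proof -
  have e: "f (fst z) * f (snd z) * (c * H (fst z) (snd z)) = c * (f (fst z) * f (snd z) * H (fst z) (snd z))" for z
    by simp
  show "pairing2 f (\<lambda>x y. c * H x y) = c * pairing2 f H" by (simp only: pairing2_def e integral_mult_right_zero)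
  show "integrable2 f H \<Longrightarrow> integrable2 f (\<lambda>x y. c * H x y)"
    unfolding integrable2_def e by (rule integrable_mult_right)
qed

lemma pairing2_swap:
  "pairing2 f (\<lambda>x y. H y x) = pairing2 f (H :: 'a::euclidean_space \<Rightarrow> 'a \<Rightarrow> real)"
  "integrable2 f H \<Longrightarrow> integrable2 f (\<lambda>x y. H y x)"
proof -
  have d: "distr (lborel \<Otimes>\<^sub>M lborel) (lborel \<Otimes>\<^sub>M lborel) (\<lambda>(x, y). (y, x)) = (lborel \<Otimes>\<^sub>M lborel :: ('a \<times> 'a) measure)"
    by (rule lborel_pair.distr_pair_swap[symmetric])
  have e: "(\<lambda>z. f (fst z) * f (snd z) * H (snd z) (fst z))
      = (\<lambda>(x, y). f (fst (y, x)) * f (snd (y, x)) * H (fst (y, x)) (snd (y, x)))"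
    by (auto simp: fun_eq_iff)
  show i: "integrable2 f H \<Longrightarrow> integrable2 f (\<lambda>x y. H y x)"
    unfolding integrable2_def e by (rule lborel_pair.integrable_product_swap)
  show "pairing2 f (\<lambda>x y. H y x) = pairing2 f H"
  proof (cases "integrable2 f H")
    case True
    then show ?thesis
      unfolding pairing2_def e integrable2_def
      by (intro lborel_pair.integral_product_swap) simp
  next
    case False
    moreover have "\<not> integrable2 f (\<lambda>x y. H y x)"
    proof
      assume "integrable2 f (\<lambda>x y. H y x)"
      then have "integrable (lborel \<Otimes>\<^sub>M lborel) (\<lambda>(x, y). (\<lambda>z. f (fst z) * f (snd z) * H (snd z) (fst z)) (y, x))"
        unfolding integrable2_def by (rule lborel_pair.integrable_product_swap)
      then show False using False by (simp add: integrable2_def split_beta' mult.commute[of "f (snd _)"])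
    qed
    ultimately show ?thesis by (simp add: pairing2_def integrable2_def not_integrable_integral_eq)
  qed
qed

text \<open>The weight dominating every collision term: an integral against it is a product of the \<open>L\<^sup>1\<^sub>k\<close> and
  the \<open>L\<^sup>1\<^sub>2\<close> norm, and such products are integrable in time.\<close>
definition weight2 :: "real \<Rightarrow> 'a::euclidean_space \<Rightarrow> 'a \<Rightarrow> real" where
  "weight2 k \<xi> \<xi>s = bracket \<xi> powr k * bracket \<xi>s powr 2 + bracket \<xi> powr 2 * bracket \<xi>s powr k"

lemma weight2_nonneg: "0 \<le> weight2 k \<xi> \<xi>s"
  by (simp add: weight2_def)

definition admissible :: "real \<Rightarrow> ('a::euclidean_space \<Rightarrow> real) \<Rightarrow> bool" where
  "admissible k f \<longleftrightarrow> f \<in> borel_measurable borel \<and> (AE \<xi> in lborel. 0 \<le> f \<xi>) \<and> f \<in> weighted_L1 k"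

lemma admissible_measurable [measurable_dest]: "admissible k f \<Longrightarrow> f \<in> borel_measurable borel"
  by (simp add: admissible_def)

lemma admissible_integrable:
  fixes f h :: "'a::euclidean_space \<Rightarrow> real"
  assumes f: "admissible k f" and [measurable]: "h \<in> borel_measurable borel"
    and h: "\<And>\<xi>. \<bar>h \<xi>\<bar> \<le> C * bracket \<xi> powr k"
  shows "integrable lborel (\<lambda>\<xi>. f \<xi> * h \<xi>)"
proof (rule Bochner_Integration.integrable_bound)
  note [measurable] = admissible_measurable[OF f]
  show "integrable lborel (\<lambda>\<xi>. C * (f \<xi> * bracket \<xi> powr k))"
    using f by (intro integrable_mult_right) (simp add: admissible_def weighted_L1_def)
  show "AE \<xi> in lborel. norm (f \<xi> * h \<xi>) \<le> norm (C * (f \<xi> * bracket \<xi> powr k))"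
  proof (rule AE_I2)
    fix \<xi> :: 'a
    have C: "0 \<le> C"
    proof -
      have "0 \<le> C * bracket \<xi> powr k" using h[of \<xi>] abs_ge_zero order_trans by blast
      then show ?thesis using bracket_pos[of \<xi>] by (simp add: zero_le_mult_iff)
    qed
    have "\<bar>f \<xi>\<bar> * \<bar>h \<xi>\<bar> \<le> \<bar>f \<xi>\<bar> * (C * bracket \<xi> powr k)" by (intro mult_left_mono h) simp
    then show "norm (f \<xi> * h \<xi>) \<le> norm (C * (f \<xi> * bracket \<xi> powr k))" using C by (simp add: abs_mult mult_ac)
  qed
  show "(\<lambda>\<xi>. f \<xi> * h \<xi>) \<in> borel_measurable lborel" by measurable
qed

lemma admissible_mono:
  assumes f: "admissible k f" and "j \<le> k"
  shows "admissible j f"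
proof -
  have "integrable lborel (\<lambda>\<xi>. f \<xi> * bracket \<xi> powr j)"
    using bracket_powr_mono[OF assms(2)] by (intro admissible_integrable[OF f, where C=1]) auto
  then show ?thesis using f by (simp add: admissible_def weighted_L1_def)
qed

lemma weighted_L1_norm_eq:
  assumes "admissible k f"
  shows "weighted_L1_norm j f = pairing f (\<lambda>\<xi>. bracket \<xi> powr j)"
proof -
  note [measurable] = admissible_measurable[OF assms]
  have "AE \<xi> in lborel. 0 \<le> f \<xi>" using assms by (simp add: admissible_def)
  then show ?thesis unfolding weighted_L1_norm_def pairing_def
    by (intro integral_cong_AE) (auto elim: eventually_mono)
qed

lemma AE_pair_nonneg:
  fixes f :: "'a::euclidean_space \<Rightarrow> real"
  assumes "admissible k f"
  shows "AE z in lborel \<Otimes>\<^sub>M lborel. 0 \<le> f (fst z) * f (snd z)"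
proof (rule lborel_pair.AE_pair_measure)
  note [measurable] = admissible_measurable[OF assms]
  show "{z \<in> space (lborel \<Otimes>\<^sub>M lborel). 0 \<le> f (fst z) * f (snd z)} \<in> sets (lborel \<Otimes>\<^sub>M lborel)"
    by measurable
  have n: "AE \<xi> in lborel. 0 \<le> f \<xi>" using assms by (simp add: admissible_def)
  then show "AE x in lborel. AE y in lborel. 0 \<le> f (fst (x, y)) * f (snd (x, y))"
  proof eventually_elim
    case (elim x)
    show ?case using n by eventually_elim (simp add: elim)
  qed
qed

lemma pairing2_tensor:
  fixes f :: "'a::euclidean_space \<Rightarrow> real"
  assumes "integrable lborel (\<lambda>\<xi>. f \<xi> * g \<xi>)" "integrable lborel (\<lambda>\<xi>. f \<xi> * h \<xi>)"
  shows "integrable2 f (\<lambda>x y. g x * h y)" "pairing2 f (\<lambda>x y. g x * h y) = pairing f g * pairing f h"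
  using integrable_tensor[OF assms] by (simp_all add: integrable2_def pairing2_def pairing_def mult_ac)

lemma pairing2_weight2:
  fixes f :: "'a::euclidean_space \<Rightarrow> real"
  assumes f: "admissible k f" and k: "2 \<le> k"
  shows "integrable2 f (weight2 k)" "pairing2 f (weight2 k) = 2 * (weighted_L1_norm k f * weighted_L1_norm 2 f)"
proof -
  have i: "integrable lborel (\<lambda>\<xi>. f \<xi> * bracket \<xi> powr k)" using f by (simp add: admissible_def weighted_L1_def)
  have j: "integrable lborel (\<lambda>\<xi>. f \<xi> * bracket \<xi> powr 2)"
    using admissible_mono[OF f k] by (simp add: admissible_def weighted_L1_def)
  note t = pairing2_tensor[OF i j] pairing2_tensor[OF j i]
  show "integrable2 f (weight2 k)"
    unfolding weight2_def[abs_def] by (rule pairing2_add(2)[OF t(1) t(3)])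
  show "pairing2 f (weight2 k) = 2 * (weighted_L1_norm k f * weighted_L1_norm 2 f)"
    unfolding weight2_def[abs_def] weighted_L1_norm_eq[OF f]
    using pairing2_add(1)[OF t(1) t(3)] t(2) t(4) by simp
qed

lemma pairing2_bound:
  fixes f :: "'a::euclidean_space \<Rightarrow> real"
  assumes f: "admissible k f" and k: "2 \<le> k"
    and [measurable]: "(\<lambda>z. H (fst z) (snd z)) \<in> borel_measurable (borel \<Otimes>\<^sub>M borel)"
    and H: "\<And>x y. \<bar>H x y\<bar> \<le> C * weight2 k x y"
  shows "integrable2 f H" "\<bar>pairing2 f H\<bar> \<le> C * (2 * (weighted_L1_norm k f * weighted_L1_norm 2 f))"
proof -
  note [measurable] = admissible_measurable[OF f]
  have w: "integrable (lborel \<Otimes>\<^sub>M lborel) (\<lambda>z. f (fst z) * f (snd z) * (C * weight2 k (fst z) (snd z)))"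
    using pairing2_cmult(2)[OF pairing2_weight2(1)[OF f k], of C] by (simp add: integrable2_def)
  have ae: "AE z in lborel \<Otimes>\<^sub>M lborel. norm (f (fst z) * f (snd z) * H (fst z) (snd z))
      \<le> f (fst z) * f (snd z) * (C * weight2 k (fst z) (snd z))"
    using AE_pair_nonneg[OF f]
  proof eventually_elim
    case (elim z)
    then show ?case using mult_left_mono[OF H[of "fst z" "snd z"] elim]
      by (simp only: real_norm_def abs_mult[of "f (fst z) * f (snd z)"] abs_of_nonneg)
  qed
  show i: "integrable2 f H" unfolding integrable2_def
    by (rule Bochner_Integration.integrable_bound[OF w]) (measurable, use ae in \<open>auto elim: eventually_mono\<close>)
  have "\<bar>pairing2 f H\<bar> \<le> (LINT z|(lborel \<Otimes>\<^sub>M lborel). norm (f (fst z) * f (snd z) * H (fst z) (snd z)))"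
    unfolding pairing2_def using integral_norm_bound by simp
  also have "\<dots> \<le> (LINT z|(lborel \<Otimes>\<^sub>M lborel). f (fst z) * f (snd z) * (C * weight2 k (fst z) (snd z)))"
    using i w ae unfolding integrable2_def by (intro integral_mono_AE integrable_norm)
  also have "\<dots> = C * (2 * (weighted_L1_norm k f * weighted_L1_norm 2 f))"
    using pairing2_cmult(1)[of f C "weight2 k"] pairing2_weight2(2)[OF f k] by (simp add: pairing2_def)
  finally show "\<bar>pairing2 f H\<bar> \<le> C * (2 * (weighted_L1_norm k f * weighted_L1_norm 2 f))" .
qed

lemma pairing2_mono:
  fixes f :: "'a::euclidean_space \<Rightarrow> real"
  assumes f: "admissible k f" and "integrable2 f H" "integrable2 f H'" and "\<And>x y. H x y \<le> H' x y"
  shows "pairing2 f H \<le> pairing2 f H'"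
  unfolding pairing2_def
proof (rule integral_mono_AE)
  show "AE z in lborel \<Otimes>\<^sub>M lborel. f (fst z) * f (snd z) * H (fst z) (snd z) \<le> f (fst z) * f (snd z) * H' (fst z) (snd z)"
    using AE_pair_nonneg[OF f] by eventually_elim (intro mult_left_mono assms)
qed (use assms in \<open>auto simp: integrable2_def\<close>)

lemma pairing_mono:
  fixes f :: "'a::euclidean_space \<Rightarrow> real"
  assumes f: "admissible k f" and "integrable lborel (\<lambda>\<xi>. f \<xi> * g \<xi>)" "integrable lborel (\<lambda>\<xi>. f \<xi> * h \<xi>)"
    and "\<And>x. g x \<le> h x"
  shows "pairing f g \<le> pairing f h"
  unfolding pairing_def
proof (rule integral_mono_AE)
  have "AE \<xi> in lborel. 0 \<le> f \<xi>" using f by (simp add: admissible_def)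
  then show "AE x in lborel. f x * g x \<le> f x * h x"
    by eventually_elim (intro mult_left_mono assms)
qed (use assms in auto)

lemma pairing_nonneg:
  fixes f :: "'a::euclidean_space \<Rightarrow> real"
  assumes f: "admissible k f" and "\<And>x. 0 \<le> h x"
  shows "0 \<le> pairing f h"
  unfolding pairing_def
proof (rule integral_nonneg_AE)
  have "AE \<xi> in lborel. 0 \<le> f \<xi>" using f by (simp add: admissible_def)
  then show "AE x in lborel. 0 \<le> f x * h x" by eventually_elim (simp add: assms)
qed

lemma quadratic_growth_integrable:
  fixes f \<rho> :: "'a::euclidean_space \<Rightarrow> real"
  assumes f: "admissible k f" and k: "2 \<le> k" and \<rho>: "quadratic_growth C \<rho>"
  shows "integrable lborel (\<lambda>\<xi>. f \<xi> * \<rho> \<xi>)" "\<bar>pairing f \<rho>\<bar> \<le> C * weighted_L1_norm 2 f"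
proof -
  note [measurable] = quadratic_growth_measurable[OF \<rho>] admissible_measurable[OF f]
  have f2: "admissible 2 f" by (rule admissible_mono[OF f k])
  have b: "\<bar>\<rho> \<xi>\<bar> \<le> C * bracket \<xi> powr 2" for \<xi> using \<rho> by (simp add: quadratic_growth_def bracket_powr_2)
  show i: "integrable lborel (\<lambda>\<xi>. f \<xi> * \<rho> \<xi>)" by (rule admissible_integrable[OF f2 _ b]) simp
  have n: "AE \<xi> in lborel. 0 \<le> f \<xi>" using f by (simp add: admissible_def)
  have "\<bar>pairing f \<rho>\<bar> \<le> (LINT \<xi>|lborel. norm (f \<xi> * \<rho> \<xi>))"
    unfolding pairing_def using integral_norm_bound by simp
  also have "\<dots> \<le> (LINT \<xi>|lborel. C * (\<bar>f \<xi>\<bar> * bracket \<xi> powr 2))"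
  proof (rule integral_mono_AE)
    show "integrable lborel (\<lambda>\<xi>. C * (\<bar>f \<xi>\<bar> * bracket \<xi> powr 2))"
    proof (rule integrable_mult_right)
      have "integrable lborel (\<lambda>\<xi>. f \<xi> * bracket \<xi> powr 2)" using f2 by (simp add: admissible_def weighted_L1_def)
      from integrable_norm[OF this] show "integrable lborel (\<lambda>\<xi>. \<bar>f \<xi>\<bar> * bracket \<xi> powr 2)" by (simp add: abs_mult)
    qed
    show "AE \<xi> in lborel. norm (f \<xi> * \<rho> \<xi>) \<le> C * (\<bar>f \<xi>\<bar> * bracket \<xi> powr 2)"
    proof (rule AE_I2)
      fix \<xi>
      show "norm (f \<xi> * \<rho> \<xi>) \<le> C * (\<bar>f \<xi>\<bar> * bracket \<xi> powr 2)"
        using mult_left_mono[OF b[of \<xi>], of "\<bar>f \<xi>\<bar>"] by (simp add: abs_mult mult_ac)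
    qed
  qed (use i in simp)
  also have "\<dots> = C * weighted_L1_norm 2 f" by (simp add: weighted_L1_norm_def)
  finally show "\<bar>pairing f \<rho>\<bar> \<le> C * weighted_L1_norm 2 f" .
qed

context angular_kernel
begin

lemma relative_speed_powr_le:
  fixes \<xi> \<xi>s :: 'a
  shows "norm (\<xi> - \<xi>s) powr \<gamma> \<le> norm \<xi> powr \<gamma> + norm \<xi>s powr \<gamma>"
proof -
  have "norm (\<xi> - \<xi>s) powr \<gamma> \<le> (norm \<xi> + norm \<xi>s) powr \<gamma>"
    using \<gamma>_pos by (intro powr_mono2 norm_triangle_ineq4) auto
  also have "\<dots> \<le> norm \<xi> powr \<gamma> + norm \<xi>s powr \<gamma>"
    using \<gamma>_pos \<gamma>_le by (intro powr_subadditive) auto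
  finally show ?thesis .
qed

lemma collision_weight_le:
  fixes \<xi> \<xi>s :: 'a
  shows "norm (\<xi> - \<xi>s) powr \<gamma> * (1 + (norm \<xi>)\<^sup>2 + (norm \<xi>s)\<^sup>2) \<le> 2 * weight2 (2 + \<gamma>) \<xi> \<xi>s"
proof -
  define x y where "x = bracket \<xi>" and "y = bracket \<xi>s"
  have x: "1 \<le> x" "1 \<le> y" by (simp_all add: x_def y_def bracket_ge_1)
  have g: "1 \<le> x powr a" "1 \<le> y powr a" if "0 \<le> a" for a using x that by (simp_all add: ge_one_powr_ge_zero)
  have m: "x powr \<gamma> \<le> x powr (2 + \<gamma>)" "y powr \<gamma> \<le> y powr (2 + \<gamma>)" using x by (simp_all add: powr_mono)
  have "norm (\<xi> - \<xi>s) powr \<gamma> \<le> x powr \<gamma> + y powr \<gamma>"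
    using relative_speed_powr_le[of \<xi> \<xi>s] norm_powr_le_bracket[of \<gamma> \<xi>] norm_powr_le_bracket[of \<gamma> \<xi>s] \<gamma>_pos
    by (simp add: x_def y_def)
  moreover have "1 + (norm \<xi>)\<^sup>2 + (norm \<xi>s)\<^sup>2 \<le> x powr 2 + y powr 2"
    unfolding x_def y_def bracket_powr_2 by simp
  ultimately have "norm (\<xi> - \<xi>s) powr \<gamma> * (1 + (norm \<xi>)\<^sup>2 + (norm \<xi>s)\<^sup>2) \<le> (x powr \<gamma> + y powr \<gamma>) * (x powr 2 + y powr 2)"
    by (intro mult_mono) auto
  also have "\<dots> = x powr (2 + \<gamma>) * 1 + y powr (2 + \<gamma>) * 1 + x powr \<gamma> * y powr 2 + x powr 2 * y powr \<gamma>"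
    using x by (simp add: algebra_simps powr_add)
  also have "\<dots> \<le> x powr (2 + \<gamma>) * y powr 2 + y powr (2 + \<gamma>) * x powr 2 + x powr (2 + \<gamma>) * y powr 2 + x powr 2 * y powr (2 + \<gamma>)"
    using g[of 2] m by (intro add_mono mult_mono) auto
  also have "\<dots> = 2 * weight2 (2 + \<gamma>) \<xi> \<xi>s" by (simp add: weight2_def x_def y_def mult_ac)
  finally show ?thesis .
qed

lemma relative_speed_growth:
  fixes h :: "'a \<Rightarrow> 'a \<Rightarrow> real"
  assumes "\<bar>h \<xi> \<xi>s\<bar> \<le> C * (1 + (norm \<xi>)\<^sup>2 + (norm \<xi>s)\<^sup>2) \<or> \<xi> = \<xi>s" "0 \<le> C"
  shows "\<bar>norm (\<xi> - \<xi>s) powr \<gamma> * h \<xi> \<xi>s\<bar> \<le> 2 * C * weight2 (2 + \<gamma>) \<xi> \<xi>s"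
proof (cases "\<xi> = \<xi>s")
  case True
  then show ?thesis using assms(2) by (simp add: weight2_nonneg)
next
  case False
  then have "norm (\<xi> - \<xi>s) powr \<gamma> * \<bar>h \<xi> \<xi>s\<bar> \<le> norm (\<xi> - \<xi>s) powr \<gamma> * (C * (1 + (norm \<xi>)\<^sup>2 + (norm \<xi>s)\<^sup>2))"
    using assms(1) by (intro mult_left_mono) auto
  also have "\<dots> = C * (norm (\<xi> - \<xi>s) powr \<gamma> * (1 + (norm \<xi>)\<^sup>2 + (norm \<xi>s)\<^sup>2))" by simp
  also have "\<dots> \<le> C * (2 * weight2 (2 + \<gamma>) \<xi> \<xi>s)" by (intro mult_left_mono collision_weight_le assms)
  finally show ?thesis by (simp add: abs_mult)
qed

lemma two_le_k: "2 \<le> 2 + \<gamma>" using \<gamma>_pos by simp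

text \<open>Pairings of \<open>f \<otimes> f\<close> with a collision kernel of hard potential type.\<close>
definition interaction :: "('a \<Rightarrow> real) \<Rightarrow> ('a \<Rightarrow> 'a \<Rightarrow> real) \<Rightarrow> real" where
  "interaction f h = pairing2 f (\<lambda>\<xi> \<xi>s. norm (\<xi> - \<xi>s) powr \<gamma> * h \<xi> \<xi>s)"

text \<open>The diagonal is left out because \<open>average\<close> is not a mean there, the direction of the relative velocity
  being undefined; \<open>interaction\<close> does not see the diagonal.\<close>
definition growth2 :: "real \<Rightarrow> ('a \<Rightarrow> 'a \<Rightarrow> real) \<Rightarrow> bool" where
  "growth2 C h \<longleftrightarrow> 0 \<le> C \<and> (\<lambda>z. h (fst z) (snd z)) \<in> borel_measurable (borel \<Otimes>\<^sub>M borel) \<and>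
     (\<forall>\<xi> \<xi>s. \<xi> \<noteq> \<xi>s \<longrightarrow> \<bar>h \<xi> \<xi>s\<bar> \<le> C * (1 + (norm \<xi>)\<^sup>2 + (norm \<xi>s)\<^sup>2))"

lemma interaction_bound:
  assumes f: "admissible (2 + \<gamma>) f" and h: "growth2 C h"
  shows "integrable2 f (\<lambda>\<xi> \<xi>s. norm (\<xi> - \<xi>s) powr \<gamma> * h \<xi> \<xi>s)"
    "\<bar>interaction f h\<bar> \<le> 4 * C * (weighted_L1_norm (2 + \<gamma>) f * weighted_L1_norm 2 f)"
proof -
  have [measurable]: "(\<lambda>z. h (fst z) (snd z)) \<in> borel_measurable (borel \<Otimes>\<^sub>M borel)" using h by (simp add: growth2_def)
  have m: "(\<lambda>z. norm (fst z - snd z) powr \<gamma> * h (fst z) (snd z)) \<in> borel_measurable (borel \<Otimes>\<^sub>M borel)" by measurable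
  have "\<bar>norm (\<xi> - \<xi>s) powr \<gamma> * h \<xi> \<xi>s\<bar> \<le> 2 * C * weight2 (2 + \<gamma>) \<xi> \<xi>s" for \<xi> \<xi>s
    by (rule relative_speed_growth) (use h in \<open>auto simp: growth2_def\<close>)
  from pairing2_bound[OF f two_le_k m this]
  show "integrable2 f (\<lambda>\<xi> \<xi>s. norm (\<xi> - \<xi>s) powr \<gamma> * h \<xi> \<xi>s)"
    "\<bar>interaction f h\<bar> \<le> 4 * C * (weighted_L1_norm (2 + \<gamma>) f * weighted_L1_norm 2 f)"
    by (simp_all add: interaction_def)
qed

lemma interaction_add:
  assumes "admissible (2 + \<gamma>) f" "growth2 C h" "growth2 C' h'"
  shows "interaction f (\<lambda>x y. h x y + h' x y) = interaction f h + interaction f h'"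
  using pairing2_add(1)[OF interaction_bound(1)[OF assms(1,2)] interaction_bound(1)[OF assms(1,3)]]
  by (simp add: interaction_def distrib_left)

lemma interaction_diff:
  assumes "admissible (2 + \<gamma>) f" "growth2 C h" "growth2 C' h'"
  shows "interaction f (\<lambda>x y. h x y - h' x y) = interaction f h - interaction f h'"
  using pairing2_diff(1)[OF interaction_bound(1)[OF assms(1,2)] interaction_bound(1)[OF assms(1,3)]]
  by (simp add: interaction_def right_diff_distrib)

lemma interaction_cmult: "interaction f (\<lambda>x y. c * h x y) = c * interaction f h"
  using pairing2_cmult(1)[of f c "\<lambda>\<xi> \<xi>s. norm (\<xi> - \<xi>s) powr \<gamma> * h \<xi> \<xi>s"] by (simp add: interaction_def mult.left_commute)

lemma interaction_swap: "interaction f (\<lambda>x y. h y x) = interaction f h"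
  using pairing2_swap(1)[of f "\<lambda>\<xi> \<xi>s. norm (\<xi> - \<xi>s) powr \<gamma> * h \<xi> \<xi>s"] by (simp add: interaction_def norm_minus_commute)

lemma interaction_cong:
  assumes "\<And>x y. x \<noteq> y \<Longrightarrow> h x y = h' x y"
  shows "interaction f h = interaction f h'"
proof -
  have "(\<lambda>x y. norm (x - y) powr \<gamma> * h x y) = (\<lambda>x y. norm (x - y) powr \<gamma> * h' x y)"
  proof (intro ext)
    fix x y
    show "norm (x - y) powr \<gamma> * h x y = norm (x - y) powr \<gamma> * h' x y"
      using assms[of x y] by (cases "x = y") auto
  qed
  then show ?thesis by (simp only: interaction_def)
qed

lemma interaction_mono:
  assumes f: "admissible (2 + \<gamma>) f" and h: "growth2 C h" "growth2 C' h'" and le: "\<And>x y. x \<noteq> y \<Longrightarrow> h x y \<le> h' x y"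
  shows "interaction f h \<le> interaction f h'"
  unfolding interaction_def
proof (rule pairing2_mono[OF f interaction_bound(1)[OF f h(1)] interaction_bound(1)[OF f h(2)]])
  fix x y :: 'a
  show "norm (x - y) powr \<gamma> * h x y \<le> norm (x - y) powr \<gamma> * h' x y"
    using le[of x y] by (cases "x = y") (auto intro: mult_left_mono)
qed

lemma growth2_fst: "quadratic_growth C \<rho> \<Longrightarrow> growth2 C (\<lambda>\<xi> \<xi>s. \<rho> \<xi>)"
proof -
  assume \<rho>: "quadratic_growth C \<rho>"
  note [measurable] = quadratic_growth_measurable[OF \<rho>]
  note C = quadratic_growth_nonneg[OF \<rho>]
  have "\<bar>\<rho> \<xi>\<bar> \<le> C * (1 + (norm \<xi>)\<^sup>2 + (norm \<xi>s)\<^sup>2)" for \<xi> \<xi>s :: 'a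
  proof -
    have "\<bar>\<rho> \<xi>\<bar> \<le> C * (1 + (norm \<xi>)\<^sup>2)" using \<rho> by (simp add: quadratic_growth_def)
    also have "\<dots> \<le> C * (1 + (norm \<xi>)\<^sup>2 + (norm \<xi>s)\<^sup>2)" by (intro mult_left_mono C) simp
    finally show ?thesis .
  qed
  then show ?thesis using C by (simp add: growth2_def)
qed

lemma growth2_swap: "growth2 C h \<Longrightarrow> growth2 C (\<lambda>\<xi> \<xi>s. h \<xi>s \<xi>)"
proof -
  assume h: "growth2 C h"
  have m: "(\<lambda>z. h (fst z) (snd z)) \<in> borel_measurable (borel \<Otimes>\<^sub>M borel)" using h by (simp add: growth2_def)
  have "(\<lambda>z. h (snd z) (fst z)) \<in> borel_measurable (borel \<Otimes>\<^sub>M borel)"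
    using measurable_compose[OF measurable_Pair[OF measurable_snd measurable_fst] m] by simp
  moreover have "\<bar>h \<xi>s \<xi>\<bar> \<le> C * (1 + (norm \<xi>)\<^sup>2 + (norm \<xi>s)\<^sup>2)" if "\<xi> \<noteq> \<xi>s" for \<xi> \<xi>s
  proof -
    have "\<bar>h \<xi>s \<xi>\<bar> \<le> C * (1 + (norm \<xi>s)\<^sup>2 + (norm \<xi>)\<^sup>2)"
      using h that[symmetric] by (simp add: growth2_def)
    then show ?thesis by (simp only: add_ac)
  qed
  ultimately show ?thesis using h by (auto simp: growth2_def)
qed

lemma growth2_average: "quadratic_growth C \<rho> \<Longrightarrow> growth2 C (average \<rho>)"
proof -
  assume \<rho>: "quadratic_growth C \<rho>"
  note [measurable] = quadratic_growth_measurable[OF \<rho>]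
  have "(\<lambda>z. average \<rho> (fst z) (snd z)) \<in> borel_measurable (borel \<Otimes>\<^sub>M borel)" by measurable
  then show ?thesis using quadratic_growth_nonneg[OF \<rho>] average_bound[OF \<rho>] by (auto simp: growth2_def)
qed

lemma growth2_add:
  assumes h: "growth2 C h" and h': "growth2 C' h'"
  shows "growth2 (C + C') (\<lambda>x y. h x y + h' x y)"
proof -
  have [measurable]: "(\<lambda>z. h (fst z) (snd z)) \<in> borel_measurable (borel \<Otimes>\<^sub>M borel)"
    "(\<lambda>z. h' (fst z) (snd z)) \<in> borel_measurable (borel \<Otimes>\<^sub>M borel)" using h h' by (simp_all add: growth2_def)
  have m: "(\<lambda>z. h (fst z) (snd z) + h' (fst z) (snd z)) \<in> borel_measurable (borel \<Otimes>\<^sub>M borel)" by measurable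
  have "\<bar>h x y + h' x y\<bar> \<le> (C + C') * (1 + (norm x)\<^sup>2 + (norm y)\<^sup>2)" if "x \<noteq> y" for x y
  proof -
    have "\<bar>h x y\<bar> \<le> C * (1 + (norm x)\<^sup>2 + (norm y)\<^sup>2)" "\<bar>h' x y\<bar> \<le> C' * (1 + (norm x)\<^sup>2 + (norm y)\<^sup>2)"
      using h h' that by (simp_all add: growth2_def)
    then show ?thesis unfolding distrib_right by linarith
  qed
  moreover have "0 \<le> C + C'" using h h' by (simp add: growth2_def)
  ultimately show ?thesis using m by (simp only: growth2_def) blast
qed

lemma growth2_diff:
  assumes h: "growth2 C h" and h': "growth2 C' h'"
  shows "growth2 (C + C') (\<lambda>x y. h x y - h' x y)"
proof -
  have [measurable]: "(\<lambda>z. h (fst z) (snd z)) \<in> borel_measurable (borel \<Otimes>\<^sub>M borel)"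
    "(\<lambda>z. h' (fst z) (snd z)) \<in> borel_measurable (borel \<Otimes>\<^sub>M borel)" using h h' by (simp_all add: growth2_def)
  have m: "(\<lambda>z. h (fst z) (snd z) - h' (fst z) (snd z)) \<in> borel_measurable (borel \<Otimes>\<^sub>M borel)" by measurable
  have "\<bar>h x y - h' x y\<bar> \<le> (C + C') * (1 + (norm x)\<^sup>2 + (norm y)\<^sup>2)" if "x \<noteq> y" for x y
  proof -
    have "\<bar>h x y\<bar> \<le> C * (1 + (norm x)\<^sup>2 + (norm y)\<^sup>2)" "\<bar>h' x y\<bar> \<le> C' * (1 + (norm x)\<^sup>2 + (norm y)\<^sup>2)"
      using h h' that by (simp_all add: growth2_def)
    then show ?thesis unfolding distrib_right by linarith
  qed
  moreover have "0 \<le> C + C'" using h h' by (simp add: growth2_def)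
  ultimately show ?thesis using m by (simp only: growth2_def) blast
qed

lemma growth2_cmult:
  assumes h: "growth2 C h"
  shows "growth2 (\<bar>c\<bar> * C) (\<lambda>x y. c * h x y)"
proof -
  have [measurable]: "(\<lambda>z. h (fst z) (snd z)) \<in> borel_measurable (borel \<Otimes>\<^sub>M borel)" using h by (simp add: growth2_def)
  have m: "(\<lambda>z. c * h (fst z) (snd z)) \<in> borel_measurable (borel \<Otimes>\<^sub>M borel)" by measurable
  have "\<bar>c * h x y\<bar> \<le> \<bar>c\<bar> * C * (1 + (norm x)\<^sup>2 + (norm y)\<^sup>2)" if "x \<noteq> y" for x y
    using h that unfolding abs_mult mult.assoc by (intro mult_left_mono) (simp_all add: growth2_def)
  moreover have "0 \<le> \<bar>c\<bar> * C" using h by (simp add: growth2_def)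
  ultimately show ?thesis using m by (simp only: growth2_def) blast
qed

lemma integral_Q_minus:
  fixes f \<rho> :: "'a \<Rightarrow> real"
  assumes f: "admissible (2 + \<gamma>) f" and \<rho>: "quadratic_growth C \<rho>"
  shows "integrable lborel (\<lambda>\<xi>. \<rho> \<xi> * Q_minus \<gamma> f \<xi>)"
    "(LINT \<xi>|lborel. \<rho> \<xi> * Q_minus \<gamma> f \<xi>) = interaction f (\<lambda>\<xi> \<xi>s. \<rho> \<xi>)"
proof -
  have i: "integrable (lborel \<Otimes>\<^sub>M lborel) (\<lambda>z. f (fst z) * f (snd z) * (norm (fst z - snd z) powr \<gamma> * \<rho> (fst z)))"
    using interaction_bound(1)[OF f growth2_fst[OF \<rho>]] by (simp add: integrable2_def)
  have e: "(LINT y|lborel. f (fst (x, y)) * f (snd (x, y)) * (norm (fst (x, y) - snd (x, y)) powr \<gamma> * \<rho> (fst (x, y))))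
      = \<rho> x * Q_minus \<gamma> f x" for x
  proof -
    have "(\<lambda>y. f x * f y * (norm (x - y) powr \<gamma> * \<rho> x)) = (\<lambda>y. (\<rho> x * f x) * (norm (x - y) powr \<gamma> * f y))"
      by (simp only: mult_ac)
    then show ?thesis by (simp only: Q_minus_def fst_conv snd_conv integral_mult_right_zero mult.assoc)
  qed
  show "integrable lborel (\<lambda>\<xi>. \<rho> \<xi> * Q_minus \<gamma> f \<xi>)"
    using lborel_pair.integrable_fst'[OF i] unfolding e .
  show "(LINT \<xi>|lborel. \<rho> \<xi> * Q_minus \<gamma> f \<xi>) = interaction f (\<lambda>\<xi> \<xi>s. \<rho> \<xi>)"
    using lborel_pair.integral_fst'[OF i] unfolding e by (simp add: interaction_def pairing2_def)
qed

definition collision_rate :: "('a \<Rightarrow> real) \<Rightarrow> real" where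
  "collision_rate f = interaction f (\<lambda>\<xi> \<xi>s. 1)"

definition energy_rate :: "('a \<Rightarrow> real) \<Rightarrow> real" where
  "energy_rate f = interaction f (\<lambda>\<xi> \<xi>s. (norm \<xi>)\<^sup>2)"

lemma quadratic_growth_1: "quadratic_growth 1 (\<lambda>\<xi>::'a. 1)"
  by (simp add: quadratic_growth_def)

lemma quadratic_growth_norm2: "quadratic_growth 1 (\<lambda>\<xi>::'a. (norm \<xi>)\<^sup>2)"
  by (simp add: quadratic_growth_def)

lemma integral_affine_Q_minus:
  assumes f: "admissible (2 + \<gamma>) f"
  shows "(LINT \<xi>|lborel. (c - 2 * (norm \<xi>)\<^sup>2) * Q_minus \<gamma> f \<xi>) = c * collision_rate f - 2 * energy_rate f"
proof -
  have "(\<lambda>\<xi>. (c - 2 * (norm \<xi>)\<^sup>2) * Q_minus \<gamma> f \<xi>)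
    = (\<lambda>\<xi>. c * (1 * Q_minus \<gamma> f \<xi>) - 2 * ((norm \<xi>)\<^sup>2 * Q_minus \<gamma> f \<xi>))"
    by (auto simp: algebra_simps)
  then show ?thesis
    using integral_Q_minus[OF f quadratic_growth_1] integral_Q_minus[OF f quadratic_growth_norm2]
    by (simp add: collision_rate_def energy_rate_def)
qed

lemma B_coeff_eq:
  assumes f: "admissible (2 + \<gamma>) f"
  shows "B_coeff \<alpha> \<gamma> f = - (\<alpha> / 2) * collision_rate f + (\<alpha> / real DIM('a)) * energy_rate f"
  unfolding B_coeff_def integral_affine_Q_minus[OF f] using dim by (simp add: field_simps)

lemma A_minus_B_coeff_eq:
  assumes f: "admissible (2 + \<gamma>) f"
  shows "A_coeff \<alpha> \<gamma> f - real DIM('a) * B_coeff \<alpha> \<gamma> f = - \<alpha> * collision_rate f"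
  unfolding A_coeff_def B_coeff_eq[OF f] integral_affine_Q_minus[OF f] using dim by (simp add: field_simps)

lemma integral_collision:
  fixes f \<rho> :: "'a \<Rightarrow> real"
  assumes f: "admissible (2 + \<gamma>) f" and \<rho>: "quadratic_growth C \<rho>"
  shows "(LINT \<xi>|lborel. collision \<alpha> \<gamma> b f \<xi> * \<rho> \<xi>)
    = (1 - \<alpha>) * interaction f (average \<rho>) - interaction f (\<lambda>\<xi> \<xi>s. \<rho> \<xi>)"
proof -
  have "growth2 1 (\<lambda>\<xi> \<xi>s :: 'a. 1 + (norm \<xi>)\<^sup>2 + (norm \<xi>s)\<^sup>2)" by (simp add: growth2_def)
  from interaction_bound(1)[OF f this]
  have fin: "integrable (lborel \<Otimes>\<^sub>M lborel) (\<lambda>(\<xi>, \<xi>s). f \<xi> * f \<xi>s * (norm (\<xi> - \<xi>s) powr \<gamma> * (1 + (norm \<xi>)\<^sup>2 + (norm \<xi>s)\<^sup>2)))"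
    by (simp add: integrable2_def split_beta')
  note w = weak_form_Q_plus[OF admissible_measurable[OF f] \<rho> fin]
  have "(\<lambda>\<xi>. collision \<alpha> \<gamma> b f \<xi> * \<rho> \<xi>) = (\<lambda>\<xi>. (1 - \<alpha>) * (Q_plus \<gamma> b f \<xi> * \<rho> \<xi>) - \<rho> \<xi> * Q_minus \<gamma> f \<xi>)"
    by (auto simp: collision_def algebra_simps)
  then show ?thesis
    using w(1) w(3) integral_Q_minus[OF f \<rho>]
    by (simp add: interaction_def pairing2_def split_beta')
qed

end

section \<open>Regularity in time\<close>

lemma integrable_mult_bounded:
  fixes f h :: "'a::euclidean_space \<Rightarrow> real"
  assumes f: "integrable lborel f" and [measurable]: "h \<in> borel_measurable borel" and h: "\<And>\<xi>. \<bar>h \<xi>\<bar> \<le> C"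
  shows "integrable lborel (\<lambda>\<xi>. f \<xi> * h \<xi>)"
proof (rule Bochner_Integration.integrable_bound)
  have [measurable]: "f \<in> borel_measurable borel" using f by auto
  show "integrable lborel (\<lambda>\<xi>. C * f \<xi>)" using f by simp
  show "(\<lambda>\<xi>. f \<xi> * h \<xi>) \<in> borel_measurable lborel" by measurable
  show "AE \<xi> in lborel. norm (f \<xi> * h \<xi>) \<le> norm (C * f \<xi>)"
  proof (rule AE_I2)
    fix \<xi>
    have "\<bar>h \<xi>\<bar> * \<bar>f \<xi>\<bar> \<le> \<bar>C\<bar> * \<bar>f \<xi>\<bar>" using h[of \<xi>] by (intro mult_right_mono) auto
    then show "norm (f \<xi> * h \<xi>) \<le> norm (C * f \<xi>)" by (simp add: abs_mult mult.commute)
  qed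
qed

lemma weakly_continuous_pairing:
  fixes h :: "'a::euclidean_space \<Rightarrow> real"
  assumes \<psi>: "weakly_continuous_L1 I \<psi>" and [measurable]: "h \<in> borel_measurable borel" and h: "\<And>\<xi>. \<bar>h \<xi>\<bar> \<le> C"
  shows "continuous_on I (\<lambda>s. pairing (\<psi> s) h)"
proof -
  have "L1_functional (\<lambda>f. pairing f h)"
    unfolding L1_functional_def
  proof (intro conjI allI impI exI)
    fix f g :: "'a \<Rightarrow> real" assume "integrable lborel f" "integrable lborel g"
    then show "pairing (\<lambda>\<xi>. f \<xi> + g \<xi>) h = pairing f h + pairing g h"
      using integrable_mult_bounded[of f h C] integrable_mult_bounded[of g h C] h by (simp add: pairing_def distrib_right)
  next
    fix c :: real and f :: "'a \<Rightarrow> real" assume "integrable lborel f"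
    show "pairing (\<lambda>\<xi>. c * f \<xi>) h = c * pairing f h" by (simp add: pairing_def mult.assoc)
  next
    fix f :: "'a \<Rightarrow> real" assume f: "integrable lborel f"
    have "\<bar>pairing f h\<bar> \<le> (LINT \<xi>|lborel. \<bar>f \<xi> * h \<xi>\<bar>)" unfolding pairing_def by (rule integral_abs_bound)
    also have "\<dots> \<le> (LINT \<xi>|lborel. C * \<bar>f \<xi>\<bar>)"
    proof (rule integral_mono)
      show "integrable lborel (\<lambda>\<xi>. \<bar>f \<xi> * h \<xi>\<bar>)" using integrable_mult_bounded[OF f, of h C] h by simp
      show "\<bar>f \<xi> * h \<xi>\<bar> \<le> C * \<bar>f \<xi>\<bar>" for \<xi>
        using mult_left_mono[OF h[of \<xi>], of "\<bar>f \<xi>\<bar>"] by (simp add: abs_mult mult.commute)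
    qed (use f in simp)
    finally show "\<bar>pairing f h\<bar> \<le> C * (LINT \<xi>|lborel. \<bar>f \<xi>\<bar>)" by simp
  qed
  then show ?thesis using \<psi> unfolding weakly_continuous_L1_def by blast
qed

text \<open>The integral of a real function is the difference of its positive and negative parts exactly when it
  converges absolutely, which is a measurable condition on the parameter, and zero otherwise.\<close>
lemma borel_measurable_kernel_lebesgue_integral:
  fixes h :: "'b \<Rightarrow> 'c \<Rightarrow> real"
  assumes h[measurable]: "(\<lambda>(x, y). h x y) \<in> borel_measurable (M \<Otimes>\<^sub>M N)"
    and L[measurable]: "L \<in> measurable M (subprob_algebra N)"
  shows "(\<lambda>x. LINT y|L x. h x y) \<in> borel_measurable M"
proof -
  have s: "sets (L x) = sets N" if "x \<in> space M" for x
    using measurable_space[OF L that] by (simp add: space_subprob_algebra)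
  have "(LINT y|L x. h x y) = (if (\<integral>\<^sup>+y. ennreal (norm (h x y)) \<partial>L x) < \<infinity>
      then enn2real (\<integral>\<^sup>+y. ennreal (h x y) \<partial>L x) - enn2real (\<integral>\<^sup>+y. ennreal (- h x y) \<partial>L x) else 0)"
    if x: "x \<in> space M" for x
  proof -
    have "h x \<in> borel_measurable N" using measurable_Pair2[OF h x] by simp
    then have "h x \<in> borel_measurable (L x)" using s[OF x] by (simp cong: measurable_cong_sets)
    then have i: "integrable (L x) (h x) \<longleftrightarrow> (\<integral>\<^sup>+y. ennreal (norm (h x y)) \<partial>L x) < \<infinity>"
      by (simp add: integrable_iff_bounded)
    show ?thesis
      using real_lebesgue_integral_def[of "L x" "h x"] i not_integrable_integral_eq[of "L x" "h x"] by auto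
  qed
  moreover have "(\<lambda>x. if (\<integral>\<^sup>+y. ennreal (norm (h x y)) \<partial>L x) < \<infinity>
      then enn2real (\<integral>\<^sup>+y. ennreal (h x y) \<partial>L x) - enn2real (\<integral>\<^sup>+y. ennreal (- h x y) \<partial>L x) else 0) \<in> borel_measurable M"
  proof -
    have [measurable]: "(\<lambda>x. \<integral>\<^sup>+y. ennreal (norm (h x y)) \<partial>L x) \<in> borel_measurable M"
      "(\<lambda>x. \<integral>\<^sup>+y. ennreal (h x y) \<partial>L x) \<in> borel_measurable M"
      "(\<lambda>x. \<integral>\<^sup>+y. ennreal (- h x y) \<partial>L x) \<in> borel_measurable M"
      using h by (auto intro!: nn_integral_measurable_subprob_algebra2[OF _ L] simp: split_beta')
    show ?thesis by measurable
  qed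
  ultimately show ?thesis by (simp cong: measurable_cong)
qed

text \<open>Divided by one more than its mass, \<open>\<psi> s\<close> is a subprobability density. Weak continuity makes it a
  measurable kernel, and this gives the measurability of the integrals over time.\<close>
definition density_kernel :: "(real \<Rightarrow> 'a::euclidean_space \<Rightarrow> real) \<Rightarrow> real \<Rightarrow> 'a measure" where
  "density_kernel \<psi> s = density lborel
     (\<lambda>\<xi>. ennreal (\<psi> (max 0 s) \<xi> / (1 + pairing (\<psi> (max 0 s)) (\<lambda>_. 1))))"

lemma pairing_1_nonneg:
  assumes "AE \<xi> in lborel. 0 \<le> f \<xi>"
  shows "0 \<le> pairing f (\<lambda>_. 1)"
  unfolding pairing_def using assms by (intro integral_nonneg_AE) (auto elim: eventually_mono)

lemma emeasure_density_kernel: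
  fixes \<psi> :: "real \<Rightarrow> 'a::euclidean_space \<Rightarrow> real"
  assumes wc: "weakly_continuous_L1 {0..} \<psi>" and nn: "\<And>s. 0 \<le> s \<Longrightarrow> AE \<xi> in lborel. 0 \<le> \<psi> s \<xi>"
    and [measurable]: "A \<in> sets borel"
  shows "emeasure (density_kernel \<psi> s) A
    = ennreal (pairing (\<psi> (max 0 s)) (indicator A) / (1 + pairing (\<psi> (max 0 s)) (\<lambda>_. 1)))"
proof -
  define q where "q = 1 + pairing (\<psi> (max 0 s)) (\<lambda>_. 1)"
  have i: "integrable lborel (\<psi> (max 0 s))" using wc by (auto simp: weakly_continuous_L1_def)
  then have [measurable]: "\<psi> (max 0 s) \<in> borel_measurable borel" by auto
  have n: "AE \<xi> in lborel. 0 \<le> \<psi> (max 0 s) \<xi>" by (rule nn) simp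
  have q: "0 < q" using pairing_1_nonneg[OF n] by (simp add: q_def)
  have "emeasure (density_kernel \<psi> s) A = (\<integral>\<^sup>+\<xi>. ennreal (\<psi> (max 0 s) \<xi> * indicator A \<xi> / q) \<partial>lborel)"
    unfolding density_kernel_def q_def
    by (subst emeasure_density) (auto intro!: nn_integral_cong simp: indicator_def)
  also have "\<dots> = ennreal (LINT \<xi>|lborel. \<psi> (max 0 s) \<xi> * indicator A \<xi> / q)"
  proof (rule nn_integral_eq_integral)
    show "integrable lborel (\<lambda>\<xi>. \<psi> (max 0 s) \<xi> * indicator A \<xi> / q)"
      by (intro integrable_divide integrable_mult_bounded[OF i, where C=1]) auto
    show "AE \<xi> in lborel. 0 \<le> \<psi> (max 0 s) \<xi> * indicator A \<xi> / q"
      by (rule eventually_mono[OF n]) (use q in simp)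
  qed
  also have "(LINT \<xi>|lborel. \<psi> (max 0 s) \<xi> * indicator A \<xi> / q) = pairing (\<psi> (max 0 s)) (indicator A) / q"
    by (simp add: pairing_def)
  finally show ?thesis by (simp add: q_def)
qed

lemma density_kernel_measurable:
  fixes \<psi> :: "real \<Rightarrow> 'a::euclidean_space \<Rightarrow> real"
  assumes wc: "weakly_continuous_L1 {0..} \<psi>" and nn: "\<And>s. 0 \<le> s \<Longrightarrow> AE \<xi> in lborel. 0 \<le> \<psi> s \<xi>"
  shows "density_kernel \<psi> \<in> measurable borel (subprob_algebra borel)"
proof (rule measurable_subprob_algebra)
  have p0: "0 \<le> pairing (\<psi> (max 0 s)) (\<lambda>_. 1)" for s by (intro pairing_1_nonneg nn) simp
  {
    fix s :: real
    show "sets (density_kernel \<psi> s) = sets borel" by (simp add: density_kernel_def)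
    show "subprob_space (density_kernel \<psi> s)"
    proof (rule subprob_spaceI)
      have sp: "space (density_kernel \<psi> s) = UNIV" by (simp add: density_kernel_def)
      have "pairing (\<psi> (max 0 s)) (indicator UNIV) / (1 + pairing (\<psi> (max 0 s)) (\<lambda>_. 1)) \<le> 1"
        using p0[of s] by (simp add: indicator_UNIV divide_le_eq)
      then show "emeasure (density_kernel \<psi> s) (space (density_kernel \<psi> s)) \<le> 1"
        unfolding sp by (subst emeasure_density_kernel[OF wc nn]) (auto simp: ennreal_le_1)
      show "space (density_kernel \<psi> s) \<noteq> {}" by (simp add: sp)
    qed
  }
  fix A :: "'a set" assume A[measurable]: "A \<in> sets borel"
  have c: "continuous_on UNIV (\<lambda>s. pairing (\<psi> (max 0 s)) h)"
    if [measurable]: "h \<in> borel_measurable borel" and "\<And>\<xi>. \<bar>h \<xi>\<bar> \<le> 1" for h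
    by (rule continuous_on_compose2[OF weakly_continuous_pairing[OF wc that]]) (auto intro!: continuous_intros)
  have "continuous_on UNIV (\<lambda>s. pairing (\<psi> (max 0 s)) (indicator A) / (1 + pairing (\<psi> (max 0 s)) (\<lambda>_. 1)))"
  proof (intro continuous_intros c)
    show "\<forall>s\<in>UNIV. 1 + pairing (\<psi> (max 0 s)) (\<lambda>_. 1) \<noteq> 0"
    proof
      fix s show "1 + pairing (\<psi> (max 0 s)) (\<lambda>_. 1) \<noteq> 0" using p0[of s] by linarith
    qed
  qed (auto simp: indicator_def)
  then have "(\<lambda>s. pairing (\<psi> (max 0 s)) (indicator A) / (1 + pairing (\<psi> (max 0 s)) (\<lambda>_. 1))) \<in> borel_measurable borel"
    by (rule borel_measurable_continuous_onI)
  from measurable_compose[OF this measurable_ennreal]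
  show "(\<lambda>s. emeasure (density_kernel \<psi> s) A) \<in> borel_measurable borel"
    by (simp only: emeasure_density_kernel[OF wc nn A])
qed

text \<open>Up to a normalizing factor that is continuous in time, these are integrals against the kernel
  \<open>density_kernel\<close> and against its product with itself.\<close>
lemma pairing_time_measurable:
  fixes \<psi> :: "real \<Rightarrow> 'a::euclidean_space \<Rightarrow> real"
  assumes wc: "weakly_continuous_L1 {0..} \<psi>" and nn: "\<And>s. 0 \<le> s \<Longrightarrow> AE \<xi> in lborel. 0 \<le> \<psi> s \<xi>"
  shows "h \<in> borel_measurable borel \<Longrightarrow> (\<lambda>s. pairing (\<psi> (max 0 s)) h) \<in> borel_measurable borel"
    and "(\<lambda>z. H (fst z) (snd z)) \<in> borel_measurable (borel \<Otimes>\<^sub>M borel) \<Longrightarrow>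
      (\<And>s. 0 \<le> s \<Longrightarrow> integrable2 (\<psi> s) H) \<Longrightarrow> (\<lambda>s. pairing2 (\<psi> (max 0 s)) H) \<in> borel_measurable borel"
proof -
  define q where "q = (\<lambda>s. 1 + pairing (\<psi> (max 0 s)) (\<lambda>_. 1))"
  note K[measurable] = density_kernel_measurable[OF wc nn]
  have i: "integrable lborel (\<psi> (max 0 s))" for s using wc by (auto simp: weakly_continuous_L1_def)
  then have [measurable]: "\<psi> (max 0 s) \<in> borel_measurable borel" for s by auto
  have n: "AE \<xi> in lborel. 0 \<le> \<psi> (max 0 s) \<xi>" for s by (rule nn) simp
  have p0: "0 \<le> pairing (\<psi> (max 0 s)) (\<lambda>_. 1)" for s by (rule pairing_1_nonneg[OF n])
  have q: "1 \<le> q s" for s using p0[of s] by (simp add: q_def)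
  have "continuous_on UNIV (\<lambda>s. pairing (\<psi> (max 0 s)) (\<lambda>_. 1))"
    by (rule continuous_on_compose2[OF weakly_continuous_pairing[OF wc, where C=1]]) (auto intro!: continuous_intros)
  then have [measurable]: "q \<in> borel_measurable borel" unfolding q_def by (intro borel_measurable_continuous_onI continuous_intros)
  have eq: "pairing (\<psi> (max 0 s)) h = q s * (LINT \<xi>|density_kernel \<psi> s. h \<xi>)" if [measurable]: "h \<in> borel_measurable borel" for s h
  proof -
    have "(LINT \<xi>|density_kernel \<psi> s. h \<xi>) = (LINT \<xi>|lborel. (\<psi> (max 0 s) \<xi> / q s) *\<^sub>R h \<xi>)"
    proof -
      have "density_kernel \<psi> s = density lborel (\<lambda>\<xi>. ennreal (\<psi> (max 0 s) \<xi> / q s))"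
        by (simp add: density_kernel_def q_def)
      moreover have "AE \<xi> in lborel. 0 \<le> \<psi> (max 0 s) \<xi> / q s"
        by (rule eventually_mono[OF n[of s]]) (use q[of s] in simp)
      ultimately show ?thesis by (simp add: integral_density del: scaleR_conv_of_real real_scaleR_def)
    qed
    also have "\<dots> = (LINT \<xi>|lborel. \<psi> (max 0 s) \<xi> * h \<xi> / q s)" by simp
    also have "\<dots> = pairing (\<psi> (max 0 s)) h / q s" by (simp add: pairing_def)
    finally show ?thesis using q[of s] by simp
  qed
  show "(\<lambda>s. pairing (\<psi> (max 0 s)) h) \<in> borel_measurable borel" if [measurable]: "h \<in> borel_measurable borel"
  proof -
    have "(\<lambda>(s, \<xi>). h \<xi>) \<in> borel_measurable ((borel :: real measure) \<Otimes>\<^sub>M borel)" by measurable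
    from borel_measurable_kernel_lebesgue_integral[OF this K]
    have [measurable]: "(\<lambda>s. LINT \<xi>|density_kernel \<psi> s. h \<xi>) \<in> borel_measurable borel" .
    show ?thesis unfolding eq[OF that] by measurable
  qed
  show "(\<lambda>s. pairing2 (\<psi> (max 0 s)) H) \<in> borel_measurable borel"
    if H: "(\<lambda>z. H (fst z) (snd z)) \<in> borel_measurable (borel \<Otimes>\<^sub>M borel)" and int: "\<And>s. 0 \<le> s \<Longrightarrow> integrable2 (\<psi> s) H"
  proof -
    have H': "(\<lambda>(x, y). H x y) \<in> borel_measurable (borel \<Otimes>\<^sub>M borel)" using H by (simp add: split_beta')
    have Hx[measurable]: "H x \<in> borel_measurable borel" for x using measurable_Pair2[OF H', of x] by simp
    have "(\<lambda>(z, y). H (snd z) y) \<in> borel_measurable (((borel :: real measure) \<Otimes>\<^sub>M borel) \<Otimes>\<^sub>M borel)"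
      using measurable_Pair_compose_split[OF H', of "\<lambda>x. snd (fst x)" "(borel \<Otimes>\<^sub>M borel) \<Otimes>\<^sub>M borel" snd] by (simp add: split_beta')
    from borel_measurable_kernel_lebesgue_integral[OF this measurable_compose[OF measurable_fst K]]
    have "(\<lambda>z. LINT y|density_kernel \<psi> (fst z). H (snd z) y) \<in> borel_measurable ((borel :: real measure) \<Otimes>\<^sub>M borel)" .
    then have in1: "(\<lambda>(s, x). LINT y|density_kernel \<psi> s. H x y) \<in> borel_measurable ((borel :: real measure) \<Otimes>\<^sub>M borel)"
      by (simp add: split_beta')
    from borel_measurable_kernel_lebesgue_integral[OF in1 K]
    have [measurable]: "(\<lambda>s. LINT x|density_kernel \<psi> s. LINT y|density_kernel \<psi> s. H x y) \<in> borel_measurable borel" .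
    have "pairing2 (\<psi> (max 0 s)) H = q s * q s * (LINT x|density_kernel \<psi> s. LINT y|density_kernel \<psi> s. H x y)" for s
    proof -
      have it: "integrable (lborel \<Otimes>\<^sub>M lborel) (\<lambda>z. \<psi> (max 0 s) (fst z) * \<psi> (max 0 s) (snd z) * H (fst z) (snd z))"
        using int[of "max 0 s"] by (simp add: integrable2_def)
      have m: "(\<lambda>x. LINT y|density_kernel \<psi> s. H x y) \<in> borel_measurable borel"
        using measurable_Pair2[OF in1, of s] by simp
      have "pairing2 (\<psi> (max 0 s)) H = (LINT x|lborel. LINT y|lborel. \<psi> (max 0 s) x * \<psi> (max 0 s) y * H x y)"
        unfolding pairing2_def using lborel_pair.integral_fst'[OF it] by simp
      also have "\<dots> = (LINT x|lborel. \<psi> (max 0 s) x * pairing (\<psi> (max 0 s)) (H x))"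
        by (simp add: pairing_def mult.assoc)
      also have "\<dots> = pairing (\<psi> (max 0 s)) (\<lambda>x. q s * (LINT y|density_kernel \<psi> s. H x y))"
        by (simp add: pairing_def[of _ "\<lambda>x. q s * _ x"] eq[OF Hx])
      also have "\<dots> = q s * pairing (\<psi> (max 0 s)) (\<lambda>x. LINT y|density_kernel \<psi> s. H x y)"
        by (simp add: pairing_def mult.left_commute[of _ "q s"])
      also have "\<dots> = q s * (q s * (LINT x|density_kernel \<psi> s. LINT y|density_kernel \<psi> s. H x y))"
        by (simp only: eq[OF m])
      finally show ?thesis by simp
    qed
    then show ?thesis by simp
  qed
qed

lemma AE_interval_le_imp_le:
  fixes y :: "real \<Rightarrow> real"
  assumes c: "continuous_on {a..b} y" and ae: "AE s in lborel. s \<in> {a..b} \<longrightarrow> y s \<le> C" and t: "a < t" "t < b"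
  shows "y t \<le> C"
proof (rule ccontr)
  assume "\<not> y t \<le> C"
  then have gt: "C < y t" by simp
  have "continuous (at t) y"
    using c t by (simp add: continuous_on_interior)
  then have "eventually (\<lambda>s. C < y s) (at t)"
    using gt unfolding continuous_at by (rule order_tendstoD(1))
  then obtain d where d: "d > 0" "\<And>s. s \<noteq> t \<Longrightarrow> dist s t < d \<Longrightarrow> C < y s"
    unfolding eventually_at by blast
  define e where "e = min d (b - t)"
  have e: "e > 0" using d t by (simp add: e_def)
  obtain N where N: "N \<in> null_sets lborel" "{s. \<not> (s \<in> {a..b} \<longrightarrow> y s \<le> C)} \<subseteq> N"
    using ae by (auto simp: eventually_ae_filter)
  have "{t<..<t + e} \<subseteq> N"
  proof
    fix s assume s: "s \<in> {t<..<t + e}"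
    then have "C < y s" by (intro d(2)) (auto simp: dist_real_def e_def)
    moreover have "s \<in> {a..b}" using s t by (auto simp: e_def)
    ultimately show "s \<in> N" using N(2) by auto
  qed
  then have "emeasure lborel {t<..<t + e} \<le> emeasure lborel N" using N(1) by (intro emeasure_mono) auto
  then show False using N(1) e by (simp add: null_setsD1)
qed

text \<open>A truncated moment is continuous in time, so a bound for almost every time near \<open>t\<close> holds at \<open>t\<close> too; Fatou's
  lemma removes the truncation. Thus no exceptional times remain.\<close>
lemma weighted_L1_at_every_time:
  fixes \<psi> :: "real \<Rightarrow> 'a::euclidean_space \<Rightarrow> real"
  assumes wc: "weakly_continuous_L1 {0..} \<psi>" and nn: "\<And>s. 0 \<le> s \<Longrightarrow> AE \<xi> in lborel. 0 \<le> \<psi> s \<xi>"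
    and loc: "Linf_loc_L1 k \<psi>" and t: "0 < t"
  shows "\<psi> t \<in> weighted_L1 k"
proof -
  have "compact {t/2..2*t}" "{t/2..2*t} \<subseteq> {0<..}" using t by auto
  then obtain C where C: "AE s in lborel. s \<in> {t/2..2*t} \<longrightarrow> \<psi> s \<in> weighted_L1 k \<and> weighted_L1_norm k (\<psi> s) \<le> C"
    using loc unfolding Linf_loc_L1_def Linf_L1_def by blast
  have i: "integrable lborel (\<psi> s)" if "0 \<le> s" for s using wc that by (auto simp: weakly_continuous_L1_def)
  then have [measurable]: "\<psi> t \<in> borel_measurable borel" using t by auto
  define w where "w = (\<lambda>(n::nat) (\<xi>::'a). min (bracket \<xi> powr k) (real n))"
  have [measurable]: "w n \<in> borel_measurable borel" for n unfolding w_def by measurable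
  have w: "\<bar>w n \<xi>\<bar> \<le> real n" "0 \<le> w n \<xi>" for n \<xi> by (auto simp: w_def)
  have le: "pairing (\<psi> t) (w n) \<le> C" for n
  proof (rule AE_interval_le_imp_le[where a="t/2" and b="2*t" and y="\<lambda>s. pairing (\<psi> s) (w n)"])
    show "continuous_on {t/2..2*t} (\<lambda>s. pairing (\<psi> s) (w n))"
      by (rule continuous_on_subset[OF weakly_continuous_pairing[OF wc _ w(1)]]) (use t in auto)
    show "AE s in lborel. s \<in> {t/2..2*t} \<longrightarrow> pairing (\<psi> s) (w n) \<le> C"
      using C
    proof eventually_elim
      case (elim s)
      show ?case
      proof
        assume s: "s \<in> {t/2..2*t}"
        then have s0: "0 \<le> s" using t by auto
        have wi: "integrable lborel (\<lambda>\<xi>. \<psi> s \<xi> * bracket \<xi> powr k)" using elim s by (simp add: weighted_L1_def)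
        have "pairing (\<psi> s) (w n) \<le> (LINT \<xi>|lborel. \<bar>\<psi> s \<xi>\<bar> * bracket \<xi> powr k)"
          unfolding pairing_def
        proof (rule integral_mono)
          show "integrable lborel (\<lambda>\<xi>. \<psi> s \<xi> * w n \<xi>)" by (rule integrable_mult_bounded[OF i[OF s0] _ w(1)]) simp
          show "integrable lborel (\<lambda>\<xi>. \<bar>\<psi> s \<xi>\<bar> * bracket \<xi> powr k)"
            using integrable_norm[OF wi] by (simp add: abs_mult)
          show "\<psi> s \<xi> * w n \<xi> \<le> \<bar>\<psi> s \<xi>\<bar> * bracket \<xi> powr k" for \<xi>
            using w(2)[of n \<xi>] by (intro mult_mono) (auto simp: w_def)
        qed
        then show "pairing (\<psi> s) (w n) \<le> C" using elim s by (simp add: weighted_L1_norm_def)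
      qed
    qed
  qed (use t in auto)
  have ae: "AE \<xi> in lborel. 0 \<le> \<psi> t \<xi>" using nn t by simp
  have "integrable lborel (\<lambda>\<xi>. \<psi> t \<xi> * bracket \<xi> powr k)"
  proof (rule integrableI_bounded)
    have "(\<integral>\<^sup>+\<xi>. ennreal (norm (\<psi> t \<xi> * bracket \<xi> powr k)) \<partial>lborel)
        = (\<integral>\<^sup>+\<xi>. liminf (\<lambda>n. ennreal (norm (\<psi> t \<xi> * w n \<xi>))) \<partial>lborel)"
    proof (rule nn_integral_cong)
      fix \<xi> :: 'a
      obtain N where N: "bracket \<xi> powr k \<le> real N" using real_arch_simple by blast
      have "eventually (\<lambda>n. ennreal (norm (\<psi> t \<xi> * w n \<xi>)) = ennreal (norm (\<psi> t \<xi> * bracket \<xi> powr k))) sequentially"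
        by (rule eventually_mono[OF eventually_ge_at_top[of N]]) (use N in \<open>auto simp: w_def\<close>)
      then have "(\<lambda>n. ennreal (norm (\<psi> t \<xi> * w n \<xi>))) \<longlonglongrightarrow> ennreal (norm (\<psi> t \<xi> * bracket \<xi> powr k))"
        by (rule tendsto_eventually)
      then show "ennreal (norm (\<psi> t \<xi> * bracket \<xi> powr k)) = liminf (\<lambda>n. ennreal (norm (\<psi> t \<xi> * w n \<xi>)))"
        by (intro lim_imp_Liminf[symmetric]) simp_all
    qed
    also have "\<dots> \<le> liminf (\<lambda>n. \<integral>\<^sup>+\<xi>. ennreal (norm (\<psi> t \<xi> * w n \<xi>)) \<partial>lborel)"
      by (rule nn_integral_liminf) measurable
    also have "\<dots> \<le> ennreal C"
    proof -
      have "(\<integral>\<^sup>+\<xi>. ennreal (norm (\<psi> t \<xi> * w n \<xi>)) \<partial>lborel) \<le> ennreal C" for n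
      proof -
        have "(\<integral>\<^sup>+\<xi>. ennreal (norm (\<psi> t \<xi> * w n \<xi>)) \<partial>lborel) = (\<integral>\<^sup>+\<xi>. ennreal (\<psi> t \<xi> * w n \<xi>) \<partial>lborel)"
        proof (rule nn_integral_cong_AE)
          show "AE \<xi> in lborel. ennreal (norm (\<psi> t \<xi> * w n \<xi>)) = ennreal (\<psi> t \<xi> * w n \<xi>)"
            using ae by eventually_elim (simp add: w(2))
        qed
        also have "\<dots> = ennreal (pairing (\<psi> t) (w n))"
          unfolding pairing_def
        proof (rule nn_integral_eq_integral)
          show "integrable lborel (\<lambda>\<xi>. \<psi> t \<xi> * w n \<xi>)" by (rule integrable_mult_bounded[OF i _ w(1)]) (use t in auto)
          show "AE \<xi> in lborel. 0 \<le> \<psi> t \<xi> * w n \<xi>" using ae by eventually_elim (simp add: w(2))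
        qed
        also have "\<dots> \<le> ennreal C" using le by (rule ennreal_leI)
        finally show ?thesis .
      qed
      then show ?thesis by (intro Liminf_le) auto
    qed
    also have "ennreal C < \<infinity>" by simp
    finally show "(\<integral>\<^sup>+\<xi>. ennreal (norm (\<psi> t \<xi> * bracket \<xi> powr k)) \<partial>lborel) < \<infinity>" .
  qed measurable
  then show ?thesis by (simp add: weighted_L1_def)
qed

section \<open>Test functions of quadratic growth\<close>

lemma pairing_tendsto:
  fixes f :: "'a::euclidean_space \<Rightarrow> real" and \<rho>s :: "nat \<Rightarrow> 'a \<Rightarrow> real"
  assumes f: "admissible k f" and m: "\<And>n. \<rho>s n \<in> borel_measurable borel"
    and b: "\<And>n \<xi>. \<bar>\<rho>s n \<xi>\<bar> \<le> C * bracket \<xi> powr k" and lim: "\<And>\<xi>. (\<lambda>n. \<rho>s n \<xi>) \<longlonglongrightarrow> \<rho> \<xi>"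
  shows "(\<lambda>n. pairing f (\<rho>s n)) \<longlonglongrightarrow> pairing f \<rho>"
  unfolding pairing_def
proof (rule integral_dominated_convergence[where w="\<lambda>\<xi>. \<bar>f \<xi> * (C * bracket \<xi> powr k)\<bar>"])
  note [measurable] = m admissible_measurable[OF f]
  have [measurable]: "\<rho> \<in> borel_measurable borel" by (rule borel_measurable_LIMSEQ_real[OF lim m])
  show "(\<lambda>\<xi>. f \<xi> * \<rho> \<xi>) \<in> borel_measurable lborel" by measurable
  show "(\<lambda>\<xi>. f \<xi> * \<rho>s n \<xi>) \<in> borel_measurable lborel" for n by measurable
  have "integrable lborel (\<lambda>\<xi>. f \<xi> * (C * bracket \<xi> powr k))"
    by (rule admissible_integrable[OF f, where C="\<bar>C\<bar>"]) (auto simp: abs_mult)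
  then show "integrable lborel (\<lambda>\<xi>. \<bar>f \<xi> * (C * bracket \<xi> powr k)\<bar>)" by simp
  show "AE \<xi> in lborel. (\<lambda>n. f \<xi> * \<rho>s n \<xi>) \<longlonglongrightarrow> f \<xi> * \<rho> \<xi>"
    using lim by (intro AE_I2 tendsto_intros) auto
  show "AE \<xi> in lborel. norm (f \<xi> * \<rho>s n \<xi>) \<le> \<bar>f \<xi> * (C * bracket \<xi> powr k)\<bar>" for n
  proof (rule AE_I2)
    fix \<xi>
    have "\<bar>\<rho>s n \<xi>\<bar> \<le> \<bar>C * bracket \<xi> powr k\<bar>" using b[of n \<xi>] by linarith
    then show "norm (f \<xi> * \<rho>s n \<xi>) \<le> \<bar>f \<xi> * (C * bracket \<xi> powr k)\<bar>"
      unfolding real_norm_def abs_mult[of "f \<xi>"] by (rule mult_left_mono) simp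
  qed
qed

lemma pairing2_tendsto:
  fixes f :: "'a::euclidean_space \<Rightarrow> real"
  assumes f: "admissible k f" and k: "2 \<le> k"
    and m: "\<And>n. (\<lambda>z. Hs n (fst z) (snd z)) \<in> borel_measurable (borel \<Otimes>\<^sub>M borel)"
    and H: "(\<lambda>z. H (fst z) (snd z)) \<in> borel_measurable (borel \<Otimes>\<^sub>M borel)"
    and b: "\<And>n x y. \<bar>Hs n x y\<bar> \<le> C * weight2 k x y" and lim: "\<And>x y. (\<lambda>n. Hs n x y) \<longlonglongrightarrow> H x y"
  shows "(\<lambda>n. pairing2 f (Hs n)) \<longlonglongrightarrow> pairing2 f H"
  unfolding pairing2_def
proof (rule integral_dominated_convergence[where w="\<lambda>z. \<bar>f (fst z) * f (snd z) * (C * weight2 k (fst z) (snd z))\<bar>"])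
  note [measurable] = m H admissible_measurable[OF f]
  show "(\<lambda>z. f (fst z) * f (snd z) * H (fst z) (snd z)) \<in> borel_measurable (lborel \<Otimes>\<^sub>M lborel)" by measurable
  show "(\<lambda>z. f (fst z) * f (snd z) * Hs n (fst z) (snd z)) \<in> borel_measurable (lborel \<Otimes>\<^sub>M lborel)" for n by measurable
  show "integrable (lborel \<Otimes>\<^sub>M lborel) (\<lambda>z. \<bar>f (fst z) * f (snd z) * (C * weight2 k (fst z) (snd z))\<bar>)"
    using pairing2_cmult(2)[OF pairing2_weight2(1)[OF f k], of C] unfolding integrable2_def by (rule integrable_abs)
  show "AE z in lborel \<Otimes>\<^sub>M lborel. (\<lambda>n. f (fst z) * f (snd z) * Hs n (fst z) (snd z)) \<longlonglongrightarrow> f (fst z) * f (snd z) * H (fst z) (snd z)"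
    using lim by (intro AE_I2 tendsto_intros) auto
  show "AE z in lborel \<Otimes>\<^sub>M lborel. norm (f (fst z) * f (snd z) * Hs n (fst z) (snd z))
      \<le> \<bar>f (fst z) * f (snd z) * (C * weight2 k (fst z) (snd z))\<bar>" for n
  proof (rule AE_I2)
    fix z :: "'a \<times> 'a"
    have "\<bar>Hs n (fst z) (snd z)\<bar> \<le> \<bar>C * weight2 k (fst z) (snd z)\<bar>" using b[of n "fst z" "snd z"] by linarith
    then show "norm (f (fst z) * f (snd z) * Hs n (fst z) (snd z)) \<le> \<bar>f (fst z) * f (snd z) * (C * weight2 k (fst z) (snd z))\<bar>"
      unfolding real_norm_def abs_mult[of "f (fst z) * f (snd z)"] by (rule mult_left_mono) simp
  qed
qed

context angular_kernel
begin

lemma pairing_tendsto_quadratic: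
  fixes f :: "'a \<Rightarrow> real" and \<rho>s :: "nat \<Rightarrow> 'a \<Rightarrow> real"
  assumes f: "admissible (2 + \<gamma>) f" and \<rho>s: "\<And>n. quadratic_growth C (\<rho>s n)"
    and lim: "\<And>\<xi>. (\<lambda>n. \<rho>s n \<xi>) \<longlonglongrightarrow> \<rho> \<xi>"
  shows "(\<lambda>n. pairing f (\<rho>s n)) \<longlonglongrightarrow> pairing f \<rho>"
  by (rule pairing_tendsto[OF admissible_mono[OF f two_le_k] quadratic_growth_measurable[OF \<rho>s] _ lim, where C=C])
     (use \<rho>s in \<open>simp add: quadratic_growth_def bracket_powr_2\<close>)

lemma average_tendsto:
  fixes \<rho>s :: "nat \<Rightarrow> 'a \<Rightarrow> real"
  assumes \<rho>s: "\<And>n. quadratic_growth C (\<rho>s n)" and lim: "\<And>\<xi>. (\<lambda>n. \<rho>s n \<xi>) \<longlonglongrightarrow> \<rho> \<xi>"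
  shows "(\<lambda>n. average (\<rho>s n) \<xi> \<xi>s) \<longlonglongrightarrow> average \<rho> \<xi> \<xi>s"
  unfolding average_def
proof (rule integral_dominated_convergence[where w="\<lambda>\<sigma>. b (sgn (\<xi> - \<xi>s) \<bullet> \<sigma>) * (C * (1 + (norm \<xi>)\<^sup>2 + (norm \<xi>s)\<^sup>2))"])
  have m: "\<rho>s n \<in> borel_measurable borel" for n by (rule quadratic_growth_measurable[OF \<rho>s])
  note [measurable] = m
  have [measurable]: "\<rho> \<in> borel_measurable borel" by (rule borel_measurable_LIMSEQ_real[OF lim m])
  show "(\<lambda>\<sigma>. b (sgn (\<xi> - \<xi>s) \<bullet> \<sigma>) * \<rho> (post1 \<xi> \<xi>s \<sigma>)) \<in> borel_measurable surface_measure" by measurable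
  show "(\<lambda>\<sigma>. b (sgn (\<xi> - \<xi>s) \<bullet> \<sigma>) * \<rho>s n (post1 \<xi> \<xi>s \<sigma>)) \<in> borel_measurable surface_measure" for n by measurable
  show "integrable surface_measure (\<lambda>\<sigma>. b (sgn (\<xi> - \<xi>s) \<bullet> \<sigma>) * (C * (1 + (norm \<xi>)\<^sup>2 + (norm \<xi>s)\<^sup>2)))"
    by (intro integrable_mult_left integrable_b)
  show "AE \<sigma> in surface_measure. (\<lambda>n. b (sgn (\<xi> - \<xi>s) \<bullet> \<sigma>) * \<rho>s n (post1 \<xi> \<xi>s \<sigma>)) \<longlonglongrightarrow> b (sgn (\<xi> - \<xi>s) \<bullet> \<sigma>) * \<rho> (post1 \<xi> \<xi>s \<sigma>)"
    using lim by (intro AE_I2 tendsto_intros) auto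
  show "AE \<sigma> in surface_measure. norm (b (sgn (\<xi> - \<xi>s) \<bullet> \<sigma>) * \<rho>s n (post1 \<xi> \<xi>s \<sigma>))
      \<le> b (sgn (\<xi> - \<xi>s) \<bullet> \<sigma>) * (C * (1 + (norm \<xi>)\<^sup>2 + (norm \<xi>s)\<^sup>2))" for n
    using AE_surface_measure_norm
  proof eventually_elim
    case (elim \<sigma>)
    from post_quadratic_growth[OF \<rho>s[of n] this, of \<xi> \<xi>s]
    show ?case by (simp add: abs_mult mult_left_mono b_nonneg)
  qed
qed

lemma interaction_tendsto:
  assumes f: "admissible (2 + \<gamma>) f" and hs: "\<And>n. growth2 C (hs n)"
    and h: "(\<lambda>z. h (fst z) (snd z)) \<in> borel_measurable (borel \<Otimes>\<^sub>M borel)"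
    and lim: "\<And>\<xi> \<xi>s. \<xi> \<noteq> \<xi>s \<Longrightarrow> (\<lambda>n. hs n \<xi> \<xi>s) \<longlonglongrightarrow> h \<xi> \<xi>s"
  shows "(\<lambda>n. interaction f (hs n)) \<longlonglongrightarrow> interaction f h"
  unfolding interaction_def
proof (rule pairing2_tendsto[OF f two_le_k, where C="2 * C"])
  have m: "(\<lambda>z. hs n (fst z) (snd z)) \<in> borel_measurable (borel \<Otimes>\<^sub>M borel)" for n
    using hs[of n] by (simp add: growth2_def)
  note [measurable] = m h
  show "(\<lambda>z. norm (fst z - snd z) powr \<gamma> * h (fst z) (snd z)) \<in> borel_measurable (borel \<Otimes>\<^sub>M borel)" by measurable
  show "(\<lambda>z. norm (fst z - snd z) powr \<gamma> * hs n (fst z) (snd z)) \<in> borel_measurable (borel \<Otimes>\<^sub>M borel)" for n by measurable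
  show "(\<lambda>n. norm (x - y) powr \<gamma> * hs n x y) \<longlonglongrightarrow> norm (x - y) powr \<gamma> * h x y" for x y
    using lim[of x y] by (cases "x = y") (auto intro!: tendsto_intros)
  show "\<bar>norm (x - y) powr \<gamma> * hs n x y\<bar> \<le> 2 * C * weight2 (2 + \<gamma>) x y" for n x y
    by (rule relative_speed_growth) (use hs[of n] in \<open>auto simp: growth2_def\<close>)
qed

end

lemma DERIV_pos_part_square: "((\<lambda>y::real. (max 0 y)\<^sup>2) has_real_derivative 2 * max 0 y) (at y)"
proof (cases y "0::real" rule: linorder_cases)
  case less
  have "((\<lambda>y::real. 0) has_real_derivative 2 * max 0 y) (at y)" using less by simp
  then show ?thesis
    by (rule has_field_derivative_transform_within_open[where S="{..<0}"]) (use less in auto)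
next
  case greater
  have "((\<lambda>y::real. y\<^sup>2) has_real_derivative 2 * max 0 y) (at y)"
    using greater by (auto intro!: derivative_eq_intros)
  then show ?thesis
    by (rule has_field_derivative_transform_within_open[where S="{0<..}"]) (use greater in auto)
next
  case equal
  have "(\<lambda>h::real. (max 0 h)\<^sup>2 / h) \<midarrow>0\<rightarrow> 0"
  proof (rule tendsto_rabs_zero_cancel, rule tendsto_sandwich)
    show "eventually (\<lambda>h::real. 0 \<le> \<bar>(max 0 h)\<^sup>2 / h\<bar>) (at 0)" by simp
    show "eventually (\<lambda>h::real. \<bar>(max 0 h)\<^sup>2 / h\<bar> \<le> \<bar>h\<bar>) (at 0)"
      by (intro always_eventually allI) (auto simp: max_def power2_eq_square)
    show "(\<lambda>h::real. \<bar>h\<bar>) \<midarrow>0\<rightarrow> 0" by (rule tendsto_rabs_zero) (rule tendsto_ident_at)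
  qed auto
  then show ?thesis using equal by (simp add: DERIV_def)
qed

lemma GDERIV_norm2: "GDERIV (\<lambda>\<xi>::'a::euclidean_space. (norm \<xi>)\<^sup>2) \<xi> :> 2 *\<^sub>R \<xi>"
proof -
  have "((\<lambda>\<xi>::'a. \<xi> \<bullet> \<xi>) has_derivative (\<lambda>h. \<xi> \<bullet> h + h \<bullet> \<xi>)) (at \<xi>)"
    by (rule has_derivative_inner[OF has_derivative_ident has_derivative_ident])
  then show ?thesis unfolding gderiv_def by (simp add: power2_norm_eq_inner inner_commute)
qed

text \<open>The square makes the function continuously differentiable across the boundary of its support.\<close>
definition cutoff :: "nat \<Rightarrow> 'a::euclidean_space \<Rightarrow> real" where
  "cutoff n \<xi> = (max 0 (1 - (norm \<xi>)\<^sup>2 / real (Suc n)))\<^sup>2"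

definition cutoff_gradient :: "nat \<Rightarrow> 'a::euclidean_space \<Rightarrow> 'a" where
  "cutoff_gradient n \<xi> = (2 * max 0 (1 - (norm \<xi>)\<^sup>2 / real (Suc n))) *\<^sub>R (- (2 / real (Suc n)) *\<^sub>R \<xi>)"

lemma GDERIV_cutoff: "GDERIV (cutoff n) \<xi> :> cutoff_gradient n \<xi>"
proof -
  have "GDERIV (\<lambda>\<xi>::'a. 1 - (norm \<xi>)\<^sup>2 / real (Suc n)) \<xi> :> - (2 / real (Suc n)) *\<^sub>R \<xi>"
  proof -
    have d: "((\<lambda>x::real. 1 - x / real (Suc n)) has_real_derivative - (1 / real (Suc n))) (at ((norm \<xi>)\<^sup>2))"
      by (auto intro!: derivative_eq_intros)
    from GDERIV_DERIV_compose[OF GDERIV_norm2 d] show ?thesis by (simp add: mult.commute)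
  qed
  from GDERIV_DERIV_compose[OF this DERIV_pos_part_square]
  show ?thesis unfolding cutoff_def[abs_def] cutoff_gradient_def .
qed

lemma cutoff_bounds: "0 \<le> cutoff n \<xi>" "cutoff n \<xi> \<le> 1"
proof -
  show "0 \<le> cutoff n \<xi>" by (simp add: cutoff_def)
  have "max 0 (1 - (norm \<xi>)\<^sup>2 / real (Suc n)) \<le> 1" by simp
  then show "cutoff n \<xi> \<le> 1" unfolding cutoff_def by (intro power_le_one) auto
qed

lemma cutoff_support: "cutoff n \<xi> \<noteq> 0 \<Longrightarrow> (norm \<xi>)\<^sup>2 \<le> real (Suc n)"
  by (rule ccontr) (simp add: cutoff_def max_def divide_le_eq split: if_splits)

lemma continuous_cutoff [continuous_intros]: "continuous_on UNIV (cutoff n)" "continuous_on UNIV (cutoff_gradient n)"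
  unfolding cutoff_def[abs_def] cutoff_gradient_def[abs_def] by (auto intro!: continuous_intros)

lemma cutoff_tendsto: "(\<lambda>n. cutoff n \<xi>) \<longlonglongrightarrow> 1" "(\<lambda>n. \<xi> \<bullet> cutoff_gradient n \<xi>) \<longlonglongrightarrow> 0"
proof -
  have i: "(\<lambda>n. (norm \<xi>)\<^sup>2 * inverse (real (Suc n))) \<longlonglongrightarrow> (norm \<xi>)\<^sup>2 * 0"
    by (intro tendsto_intros LIMSEQ_inverse_real_of_nat)
  then have q: "(\<lambda>n. max 0 (1 - (norm \<xi>)\<^sup>2 / real (Suc n))) \<longlonglongrightarrow> max 0 (1 - 0)"
    by (intro tendsto_intros) (simp add: divide_inverse)
  from tendsto_power[OF this, of 2] show "(\<lambda>n. cutoff n \<xi>) \<longlonglongrightarrow> 1" by (simp add: cutoff_def)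
  have "\<xi> \<bullet> cutoff_gradient n \<xi> = (- 4 * max 0 (1 - (norm \<xi>)\<^sup>2 / real (Suc n))) * ((norm \<xi>)\<^sup>2 * inverse (real (Suc n)))" for n
    by (simp add: cutoff_gradient_def power2_norm_eq_inner divide_inverse)
  then show "(\<lambda>n. \<xi> \<bullet> cutoff_gradient n \<xi>) \<longlonglongrightarrow> 0"
    using tendsto_mult[OF tendsto_mult[OF tendsto_const[of "-4"] q] i] by simp
qed

text \<open>The cutoff is a fixed function of \<open>|\<xi>|\<^sup>2 / (n + 1)\<close>, so its radial derivative is scale invariant.\<close>
lemma cutoff_gradient_bound: "\<bar>\<xi> \<bullet> cutoff_gradient n \<xi>\<bar> \<le> 4"
proof -
  define y where "y = (norm \<xi>)\<^sup>2 / real (Suc n)"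
  have y: "0 \<le> y" by (simp add: y_def)
  have "\<xi> \<bullet> cutoff_gradient n \<xi> = - 4 * (max 0 (1 - y) * y)"
    by (simp add: cutoff_gradient_def power2_norm_eq_inner y_def)
  moreover have "0 \<le> max 0 (1 - y) * y" using y by simp
  moreover have "max 0 (1 - y) * y \<le> 1"
  proof (cases "y \<le> 1")
    case True
    have "max 0 (1 - y) * y \<le> 1 * 1" using True y by (intro mult_mono) auto
    then show ?thesis by simp
  qed simp
  ultimately show ?thesis by simp
qed

text \<open>The initial datum enters only through \<open>\<psi> 0\<close>, and \<open>adm\<close> holds at every time, so that the integrals over
  the velocities converge at every time and not just almost every time.\<close>
locale annihilation_solution = angular_kernel b \<gamma> velocity_space
  for b :: "real \<Rightarrow> real" and \<gamma> :: real and velocity_space :: "'a::euclidean_space itself" +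
  fixes \<alpha> :: real and \<psi> :: "real \<Rightarrow> 'a \<Rightarrow> real"
  assumes \<alpha>: "0 < \<alpha>" "\<alpha> < 1"
    and adm: "\<And>s. 0 \<le> s \<Longrightarrow> admissible (2 + \<gamma>) (\<psi> s)"
    and wc: "weakly_continuous_L1 {0..} \<psi>"
    and N2: "\<And>T. 0 < T \<Longrightarrow> \<exists>C. AE s in lborel. s \<in> {0<..<T} \<longrightarrow> weighted_L1_norm 2 (\<psi> s) \<le> C"
    and Nk: "\<And>T. 0 < T \<Longrightarrow> set_integrable lborel {0<..<T} (\<lambda>s. weighted_L1_norm (2 + \<gamma>) (\<psi> s))"
    and mass0: "pairing (\<psi> 0) (\<lambda>_. 1) = 1"
    and energy0: "pairing (\<psi> 0) (\<lambda>\<xi>. (norm \<xi>)\<^sup>2) = real DIM('a) / 2"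
    and weak: "\<And>\<rho> g t. C1c_gradient \<rho> g \<Longrightarrow> 0 < t \<Longrightarrow>
      pairing (\<psi> t) \<rho> + (LINT s:{0..t}|lborel. (A_coeff \<alpha> \<gamma> (\<psi> s) - real DIM('a) * B_coeff \<alpha> \<gamma> (\<psi> s)) * pairing (\<psi> s) \<rho>)
      = (LINT s:{0..t}|lborel. B_coeff \<alpha> \<gamma> (\<psi> s) * pairing (\<psi> s) (\<lambda>\<xi>. \<xi> \<bullet> g \<xi>))
      + pairing (\<psi> 0) \<rho> + (LINT s:{0..t}|lborel. (LINT \<xi>|lborel. collision \<alpha> \<gamma> b (\<psi> s) \<xi> * \<rho> \<xi>))"
begin

abbreviation Nn :: "real \<Rightarrow> real \<Rightarrow> real" where "Nn k s \<equiv> weighted_L1_norm k (\<psi> s)"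

lemma nn: "0 \<le> s \<Longrightarrow> AE \<xi> in lborel. 0 \<le> \<psi> s \<xi>"
  using adm[of s] by (simp add: admissible_def)

lemma Nn_nonneg: "0 \<le> Nn k s"
  unfolding weighted_L1_norm_def by (rule integral_nonneg_AE) simp

text \<open>Dominates, up to constants, every term of the weak formulation with a test function of quadratic growth:
  either a collision term or the product of a collision term and a pairing.\<close>
definition collision_bound :: "real \<Rightarrow> real" where
  "collision_bound s = Nn (2 + \<gamma>) s * (1 + Nn 2 s)\<^sup>2"

lemma time_bound:
  assumes T: "0 < T"
  obtains w where "integrable lborel w" "AE s in lborel. s \<in> {0..<T} \<longrightarrow> collision_bound s \<le> w s" "\<And>s. 0 \<le> w s"
proof -
  obtain C where C: "AE s in lborel. s \<in> {0<..<T} \<longrightarrow> Nn 2 s \<le> C" using N2[OF T] by blast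
  define w where "w = (\<lambda>s. (1 + \<bar>C\<bar>)\<^sup>2 * (indicator {0<..<T} s * Nn (2 + \<gamma>) s))"
  have "integrable lborel w"
    using Nk[OF T] unfolding w_def set_integrable_def by (intro integrable_mult_right) simp
  moreover have "AE s in lborel. s \<in> {0..<T} \<longrightarrow> collision_bound s \<le> w s"
    using C AE_lborel_singleton[of "0::real"]
  proof eventually_elim
    case (elim s)
    show ?case
    proof
      assume "s \<in> {0..<T}"
      then have s: "s \<in> {0<..<T}" using elim by auto
      then have "(1 + Nn 2 s)\<^sup>2 \<le> (1 + \<bar>C\<bar>)\<^sup>2" using elim Nn_nonneg[of 2 s] by (intro power_mono) auto
      then have "Nn (2 + \<gamma>) s * (1 + Nn 2 s)\<^sup>2 \<le> Nn (2 + \<gamma>) s * (1 + \<bar>C\<bar>)\<^sup>2"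
        by (intro mult_left_mono Nn_nonneg)
      then show "collision_bound s \<le> w s" using s by (simp add: collision_bound_def w_def mult.commute)
    qed
  qed
  moreover have "0 \<le> w s" for s by (simp add: w_def Nn_nonneg)
  ultimately show ?thesis using that by blast
qed

lemma time_integrable:
  assumes m: "(\<lambda>s. G (max 0 s)) \<in> borel_measurable borel" and G: "\<And>s. 0 \<le> s \<Longrightarrow> \<bar>G s\<bar> \<le> c * collision_bound s"
    and c: "0 \<le> c"
  shows "set_integrable lborel {0..t} G"
proof -
  obtain w where w: "integrable lborel w" "AE s in lborel. s \<in> {0..<\<bar>t\<bar> + 1} \<longrightarrow> collision_bound s \<le> w s" "\<And>s. 0 \<le> w s"
    by (rule time_bound[of "\<bar>t\<bar> + 1"]) auto
  have e: "indicator {0..t} s *\<^sub>R G s = indicator {0..t} s * G (max 0 s)" for s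
    by (auto simp: indicator_def max_def)
  show ?thesis unfolding set_integrable_def e
  proof (rule Bochner_Integration.integrable_bound[OF integrable_mult_right[OF w(1), of c]])
    note [measurable] = m
    show "(\<lambda>s. indicator {0..t} s * G (max 0 s)) \<in> borel_measurable lborel" by measurable
    show "AE s in lborel. norm (indicator {0..t} s * G (max 0 s)) \<le> norm (c * w s)"
      using w(2)
    proof eventually_elim
      case (elim s)
      show ?case
      proof (cases "s \<in> {0..t}")
        case True
        then have "\<bar>G s\<bar> \<le> c * collision_bound s" "collision_bound s \<le> w s" using G[of s] elim by auto
        then have "\<bar>G s\<bar> \<le> c * w s" using c by (meson mult_left_mono order_trans)
        then show ?thesis using True by (simp add: max_def)
      qed simp
    qed
  qed
qed

lemma interaction_time_measurable:
  assumes h: "growth2 C h"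
  shows "(\<lambda>s. interaction (\<psi> (max 0 s)) h) \<in> borel_measurable borel"
  unfolding interaction_def
proof (rule pairing_time_measurable(2)[OF wc nn])
  have [measurable]: "(\<lambda>z. h (fst z) (snd z)) \<in> borel_measurable (borel \<Otimes>\<^sub>M borel)" using h by (simp add: growth2_def)
  show "(\<lambda>z. norm (fst z - snd z) powr \<gamma> * h (fst z) (snd z)) \<in> borel_measurable (borel \<Otimes>\<^sub>M borel)" by measurable
  show "integrable2 (\<psi> s) (\<lambda>\<xi> \<xi>s. norm (\<xi> - \<xi>s) powr \<gamma> * h \<xi> \<xi>s)" if "0 \<le> s" for s
    by (rule interaction_bound(1)[OF adm[OF that] h])
qed

text \<open>The coefficient \<open>B\<close> in terms of the collision rates.\<close>
definition drift :: "real \<Rightarrow> real" where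
  "drift s = - (\<alpha> / 2) * collision_rate (\<psi> s) + (\<alpha> / real DIM('a)) * energy_rate (\<psi> s)"

definition gain_loss :: "('a \<Rightarrow> real) \<Rightarrow> real \<Rightarrow> real" where
  "gain_loss \<rho> s = (1 - \<alpha>) * interaction (\<psi> s) (average \<rho>) - interaction (\<psi> s) (\<lambda>\<xi> \<xi>s. \<rho> \<xi>)"

text \<open>The terms of the weak formulation at one time; \<open>\<rho>h\<close> stands for \<open>\<xi> \<bullet> \<nabla>\<rho>(\<xi>)\<close>. Taking it as a
  separate argument allows the limits of both to be treated alike.\<close>
definition source :: "('a \<Rightarrow> real) \<Rightarrow> ('a \<Rightarrow> real) \<Rightarrow> real \<Rightarrow> real" where
  "source \<rho> \<rho>h s = \<alpha> * collision_rate (\<psi> s) * pairing (\<psi> s) \<rho> + drift s * pairing (\<psi> s) \<rho>h + gain_loss \<rho> s"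

lemma Nn_product_le:
  "Nn (2 + \<gamma>) s * Nn 2 s \<le> collision_bound s" "Nn (2 + \<gamma>) s * Nn 2 s * Nn 2 s \<le> collision_bound s"
  unfolding collision_bound_def mult.assoc
  by (intro mult_left_mono Nn_nonneg; simp add: power2_eq_square algebra_simps Nn_nonneg)+

lemma growth2_one: "growth2 1 (\<lambda>\<xi> \<xi>s::'a. 1)" by (rule growth2_fst[OF quadratic_growth_1])
lemma growth2_norm2: "growth2 1 (\<lambda>\<xi> \<xi>s::'a. (norm \<xi>)\<^sup>2)" by (rule growth2_fst[OF quadratic_growth_norm2])

lemma rate_bounds:
  assumes "0 \<le> s"
  shows "\<bar>collision_rate (\<psi> s)\<bar> \<le> 4 * (Nn (2 + \<gamma>) s * Nn 2 s)" "\<bar>energy_rate (\<psi> s)\<bar> \<le> 4 * (Nn (2 + \<gamma>) s * Nn 2 s)"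
    "\<bar>drift s\<bar> \<le> 4 * (Nn (2 + \<gamma>) s * Nn 2 s)"
proof -
  show a: "\<bar>collision_rate (\<psi> s)\<bar> \<le> 4 * (Nn (2 + \<gamma>) s * Nn 2 s)"
    using interaction_bound(2)[OF adm[OF assms] growth2_one] by (simp add: collision_rate_def)
  show e: "\<bar>energy_rate (\<psi> s)\<bar> \<le> 4 * (Nn (2 + \<gamma>) s * Nn 2 s)"
    using interaction_bound(2)[OF adm[OF assms] growth2_norm2] by (simp add: energy_rate_def)
  have c1: "\<bar>(\<alpha> / 2) * collision_rate (\<psi> s)\<bar> \<le> 1 / 2 * (4 * (Nn (2 + \<gamma>) s * Nn 2 s))"
    unfolding abs_mult using \<alpha> a by (intro mult_mono) auto
  have e1: "\<bar>(\<alpha> / real DIM('a)) * energy_rate (\<psi> s)\<bar> \<le> 1 / 2 * (4 * (Nn (2 + \<gamma>) s * Nn 2 s))"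
    unfolding abs_mult
  proof (intro mult_mono e)
    have "\<alpha> / real DIM('a) \<le> 1 / 2" using \<alpha> dim by (intro frac_le) auto
    then show "\<bar>\<alpha> / real DIM('a)\<bar> \<le> 1 / 2" using \<alpha> by simp
  qed auto
  have "drift s = (\<alpha> / real DIM('a)) * energy_rate (\<psi> s) - (\<alpha> / 2) * collision_rate (\<psi> s)"
    by (simp add: drift_def)
  with c1 e1 show "\<bar>drift s\<bar> \<le> 4 * (Nn (2 + \<gamma>) s * Nn 2 s)" by linarith
qed

lemma source_terms:
  assumes s: "0 \<le> s" and \<rho>: "quadratic_growth C \<rho>"
  shows "\<bar>\<alpha> * collision_rate (\<psi> s) * pairing (\<psi> s) \<rho>\<bar> \<le> 4 * C * collision_bound s"
    "\<bar>drift s * pairing (\<psi> s) \<rho>\<bar> \<le> 4 * C * collision_bound s"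
    "\<bar>gain_loss \<rho> s\<bar> \<le> 8 * C * collision_bound s"
proof -
  have C: "0 \<le> C" by (rule quadratic_growth_nonneg[OF \<rho>])
  note p = quadratic_growth_integrable(2)[OF adm[OF s] two_le_k \<rho>]
  have M: "4 * (Nn (2 + \<gamma>) s * Nn 2 s) * (C * Nn 2 s) \<le> 4 * C * collision_bound s"
    using mult_left_mono[OF Nn_product_le(2)[of s], of "4 * C"] C by (simp add: mult_ac)
  have "\<bar>\<alpha> * collision_rate (\<psi> s)\<bar> \<le> 1 * (4 * (Nn (2 + \<gamma>) s * Nn 2 s))"
    unfolding abs_mult using \<alpha> rate_bounds(1)[OF s] by (intro mult_mono) auto
  then have "\<bar>\<alpha> * collision_rate (\<psi> s) * pairing (\<psi> s) \<rho>\<bar> \<le> 4 * (Nn (2 + \<gamma>) s * Nn 2 s) * (C * Nn 2 s)"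
    unfolding abs_mult[of "\<alpha> * _"] by (intro mult_mono p) (auto simp: Nn_nonneg)
  with M show "\<bar>\<alpha> * collision_rate (\<psi> s) * pairing (\<psi> s) \<rho>\<bar> \<le> 4 * C * collision_bound s" by linarith
  have "\<bar>drift s * pairing (\<psi> s) \<rho>\<bar> \<le> 4 * (Nn (2 + \<gamma>) s * Nn 2 s) * (C * Nn 2 s)"
    unfolding abs_mult by (intro mult_mono p rate_bounds s) (auto simp: Nn_nonneg)
  with M show "\<bar>drift s * pairing (\<psi> s) \<rho>\<bar> \<le> 4 * C * collision_bound s" by linarith
  have i: "\<bar>interaction (\<psi> s) h\<bar> \<le> 4 * C * collision_bound s" if "growth2 C h" for h
    using interaction_bound(2)[OF adm[OF s] that] mult_left_mono[OF Nn_product_le(1)[of s], of "4 * C"] C by linarith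
  have "\<bar>(1 - \<alpha>) * interaction (\<psi> s) (average \<rho>)\<bar> \<le> 1 * (4 * C * collision_bound s)"
    unfolding abs_mult using \<alpha> i[OF growth2_average[OF \<rho>]] by (intro mult_mono) auto
  with i[OF growth2_fst[OF \<rho>]] show "\<bar>gain_loss \<rho> s\<bar> \<le> 8 * C * collision_bound s"
    unfolding gain_loss_def by linarith
qed

lemma source_measurable_terms:
  assumes \<rho>: "quadratic_growth C \<rho>"
  shows "(\<lambda>s. \<alpha> * collision_rate (\<psi> (max 0 s)) * pairing (\<psi> (max 0 s)) \<rho>) \<in> borel_measurable borel"
    "(\<lambda>s. drift (max 0 s) * pairing (\<psi> (max 0 s)) \<rho>) \<in> borel_measurable borel"
    "(\<lambda>s. gain_loss \<rho> (max 0 s)) \<in> borel_measurable borel"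
    "(\<lambda>s. pairing (\<psi> (max 0 s)) \<rho>) \<in> borel_measurable borel"
proof -
  note [measurable] = interaction_time_measurable[OF growth2_one] interaction_time_measurable[OF growth2_norm2]
    interaction_time_measurable[OF growth2_average[OF \<rho>]] interaction_time_measurable[OF growth2_fst[OF \<rho>]]
  show [measurable]: "(\<lambda>s. pairing (\<psi> (max 0 s)) \<rho>) \<in> borel_measurable borel"
    by (rule pairing_time_measurable(1)[OF wc nn quadratic_growth_measurable[OF \<rho>]])
  show "(\<lambda>s. \<alpha> * collision_rate (\<psi> (max 0 s)) * pairing (\<psi> (max 0 s)) \<rho>) \<in> borel_measurable borel"
    unfolding collision_rate_def by measurable
  show "(\<lambda>s. drift (max 0 s) * pairing (\<psi> (max 0 s)) \<rho>) \<in> borel_measurable borel"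
    unfolding drift_def collision_rate_def energy_rate_def by measurable
  show "(\<lambda>s. gain_loss \<rho> (max 0 s)) \<in> borel_measurable borel"
    unfolding gain_loss_def by measurable
qed

lemma source_integrable_terms:
  assumes \<rho>: "quadratic_growth C \<rho>"
  shows "set_integrable lborel {0..t} (\<lambda>s. \<alpha> * collision_rate (\<psi> s) * pairing (\<psi> s) \<rho>)"
    "set_integrable lborel {0..t} (\<lambda>s. drift s * pairing (\<psi> s) \<rho>)"
    "set_integrable lborel {0..t} (gain_loss \<rho>)"
  using quadratic_growth_nonneg[OF \<rho>] source_terms[OF _ \<rho>]
  by (auto intro!: time_integrable source_measurable_terms[OF \<rho>])

lemma source_integrable:
  assumes "quadratic_growth C \<rho>" "quadratic_growth C \<rho>h"
  shows "set_integrable lborel {0..t} (source \<rho> \<rho>h)"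
  unfolding source_def[abs_def]
  by (intro set_integral_add(1) source_integrable_terms(1,3)[OF assms(1)] source_integrable_terms(2)[OF assms(2)])

lemma weak_source_compact:
  assumes \<rho>g: "C1c_gradient \<rho> g" and t: "0 < t" and \<rho>: "quadratic_growth C \<rho>" and \<rho>h: "quadratic_growth C (\<lambda>\<xi>. \<xi> \<bullet> g \<xi>)"
  shows "pairing (\<psi> t) \<rho> = pairing (\<psi> 0) \<rho> + (LINT s:{0..t}|lborel. source \<rho> (\<lambda>\<xi>. \<xi> \<bullet> g \<xi>) s)"
proof -
  let ?\<rho>h = "\<lambda>\<xi>. \<xi> \<bullet> g \<xi>"
  have 1: "(LINT s:{0..t}|lborel. (A_coeff \<alpha> \<gamma> (\<psi> s) - real DIM('a) * B_coeff \<alpha> \<gamma> (\<psi> s)) * pairing (\<psi> s) \<rho>)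
      = (LINT s:{0..t}|lborel. - (\<alpha> * collision_rate (\<psi> s) * pairing (\<psi> s) \<rho>))"
    by (rule set_lebesgue_integral_cong) (simp_all add: A_minus_B_coeff_eq[OF adm])
  have 2: "(LINT s:{0..t}|lborel. B_coeff \<alpha> \<gamma> (\<psi> s) * pairing (\<psi> s) ?\<rho>h) = (LINT s:{0..t}|lborel. drift s * pairing (\<psi> s) ?\<rho>h)"
    by (rule set_lebesgue_integral_cong) (simp_all add: B_coeff_eq[OF adm] drift_def)
  have 3: "(LINT s:{0..t}|lborel. (LINT \<xi>|lborel. collision \<alpha> \<gamma> b (\<psi> s) \<xi> * \<rho> \<xi>)) = (LINT s:{0..t}|lborel. gain_loss \<rho> s)"
    by (rule set_lebesgue_integral_cong) (simp_all add: integral_collision[OF adm \<rho>] gain_loss_def)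
  note i = source_integrable_terms(1)[OF \<rho>, of t] source_integrable_terms(2)[OF \<rho>h, of t] source_integrable_terms(3)[OF \<rho>, of t]
  have "(LINT s:{0..t}|lborel. source \<rho> ?\<rho>h s)
    = (LINT s:{0..t}|lborel. \<alpha> * collision_rate (\<psi> s) * pairing (\<psi> s) \<rho>)
    + (LINT s:{0..t}|lborel. drift s * pairing (\<psi> s) ?\<rho>h) + (LINT s:{0..t}|lborel. gain_loss \<rho> s)"
    unfolding source_def using i by (simp add: set_integral_add)
  moreover have "(LINT s:{0..t}|lborel. - (\<alpha> * collision_rate (\<psi> s) * pairing (\<psi> s) \<rho>))
    = - (LINT s:{0..t}|lborel. \<alpha> * collision_rate (\<psi> s) * pairing (\<psi> s) \<rho>)"
    by (rule set_integral_uminus[OF i(1)])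
  ultimately show ?thesis using weak[OF \<rho>g t] unfolding 1 2 3 by linarith
qed

text \<open>Cut off \<open>\<rho>\<close> and pass to the limit, by dominated convergence first in the velocities at each fixed
  time and then in time. The radial derivatives of the cutoffs are bounded and tend to zero.\<close>
theorem weak_source:
  assumes d: "\<And>\<xi>. GDERIV \<rho> \<xi> :> g \<xi>" and g: "continuous_on UNIV g"
    and \<rho>: "quadratic_growth C \<rho>" and \<rho>h: "quadratic_growth C (\<lambda>\<xi>. \<xi> \<bullet> g \<xi>)" and t: "0 \<le> t"
  shows "pairing (\<psi> t) \<rho> = pairing (\<psi> 0) \<rho> + (LINT s:{0..t}|lborel. source \<rho> (\<lambda>\<xi>. \<xi> \<bullet> g \<xi>) s)"
proof (cases "t = 0")
  case True
  have "(LINT s:{0..0}|lborel. source \<rho> (\<lambda>\<xi>. \<xi> \<bullet> g \<xi>) s) = 0"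
    unfolding set_lebesgue_integral_def
    by (rule integral_eq_zero_AE, rule eventually_mono[OF AE_lborel_singleton[of "0::real"]]) simp
  then show ?thesis using True by simp
next
  case False
  then have t: "0 < t" using t by simp
  have C: "0 \<le> C" by (rule quadratic_growth_nonneg[OF \<rho>])
  let ?\<rho>h = "\<lambda>\<xi>. \<xi> \<bullet> g \<xi>"
  define \<rho>s where "\<rho>s = (\<lambda>n \<xi>. \<rho> \<xi> * cutoff n \<xi>)"
  define gs where "gs = (\<lambda>n \<xi>. \<rho> \<xi> *\<^sub>R cutoff_gradient n \<xi> + cutoff n \<xi> *\<^sub>R g \<xi>)"
  define \<rho>hs where "\<rho>hs = (\<lambda>n \<xi>. \<xi> \<bullet> gs n \<xi>)"
  have \<rho>hs: "\<rho>hs n \<xi> = \<rho> \<xi> * (\<xi> \<bullet> cutoff_gradient n \<xi>) + cutoff n \<xi> * (\<xi> \<bullet> g \<xi>)" for n \<xi>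
    by (simp add: \<rho>hs_def gs_def inner_add_right)
  have ctr: "continuous_on UNIV \<rho>"
    using d unfolding gderiv_def by (intro continuous_at_imp_continuous_on ballI has_derivative_continuous) blast
  have C1c: "C1c_gradient (\<rho>s n) (gs n)" for n
    unfolding C1c_gradient_def
  proof (intro conjI allI)
    show "GDERIV (\<rho>s n) \<xi> :> gs n \<xi>" for \<xi>
      unfolding \<rho>s_def gs_def by (rule GDERIV_mult[OF d GDERIV_cutoff])
    show "continuous_on UNIV (gs n)" unfolding gs_def by (intro continuous_intros ctr g)
    have "{\<xi>. \<rho>s n \<xi> \<noteq> 0} \<subseteq> cball 0 (sqrt (real (Suc n)))"
    proof
      fix \<xi> assume "\<xi> \<in> {\<xi>. \<rho>s n \<xi> \<noteq> 0}"
      then have "(norm \<xi>)\<^sup>2 \<le> real (Suc n)" by (intro cutoff_support) (auto simp: \<rho>s_def)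
      then show "\<xi> \<in> cball 0 (sqrt (real (Suc n)))" by (simp add: real_le_rsqrt)
    qed
    then have "bounded {\<xi>. \<rho>s n \<xi> \<noteq> 0}" using bounded_cball bounded_subset by blast
    then show "compact (closure {\<xi>. \<rho>s n \<xi> \<noteq> 0})" by (simp add: compact_closure)
  qed
  note [measurable] = quadratic_growth_measurable[OF \<rho>] quadratic_growth_measurable[OF \<rho>h]
    borel_measurable_continuous_onI[OF continuous_cutoff(1)] borel_measurable_continuous_onI[OF continuous_cutoff(2)]
    borel_measurable_continuous_onI[OF g]
  have q\<rho>: "\<bar>\<rho> \<xi>\<bar> \<le> C * (1 + (norm \<xi>)\<^sup>2)" "\<bar>\<xi> \<bullet> g \<xi>\<bar> \<le> C * (1 + (norm \<xi>)\<^sup>2)" for \<xi>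
    using \<rho> \<rho>h by (auto simp: quadratic_growth_def)
  have qs: "quadratic_growth (5 * C) (\<rho>s n)" for n
    unfolding quadratic_growth_def
  proof (intro conjI allI)
    show "\<rho>s n \<in> borel_measurable borel" unfolding \<rho>s_def by measurable
    fix \<xi>
    have "\<bar>\<rho> \<xi>\<bar> * \<bar>cutoff n \<xi>\<bar> \<le> C * (1 + (norm \<xi>)\<^sup>2) * 1"
      using cutoff_bounds[of n \<xi>] q\<rho>(1)[of \<xi>] C by (intro mult_mono) auto
    also have "\<dots> \<le> 5 * C * (1 + (norm \<xi>)\<^sup>2)" using C by simp
    finally show "\<bar>\<rho>s n \<xi>\<bar> \<le> 5 * C * (1 + (norm \<xi>)\<^sup>2)" by (simp add: \<rho>s_def abs_mult)
  qed
  have qhs: "quadratic_growth (5 * C) (\<rho>hs n)" for n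
    unfolding quadratic_growth_def
  proof (intro conjI allI)
    show "\<rho>hs n \<in> borel_measurable borel" unfolding \<rho>hs_def gs_def by measurable
    fix \<xi>
    have "\<bar>\<rho> \<xi> * (\<xi> \<bullet> cutoff_gradient n \<xi>)\<bar> \<le> C * (1 + (norm \<xi>)\<^sup>2) * 4"
      unfolding abs_mult using cutoff_gradient_bound[of \<xi> n] q\<rho>(1)[of \<xi>] C by (intro mult_mono) auto
    moreover have "\<bar>cutoff n \<xi> * (\<xi> \<bullet> g \<xi>)\<bar> \<le> 1 * (C * (1 + (norm \<xi>)\<^sup>2))"
      unfolding abs_mult using cutoff_bounds[of n \<xi>] q\<rho>(2)[of \<xi>] C by (intro mult_mono) auto
    moreover have "5 * C * (1 + (norm \<xi>)\<^sup>2) = C * (1 + (norm \<xi>)\<^sup>2) * 4 + 1 * (C * (1 + (norm \<xi>)\<^sup>2))" by simp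
    ultimately show "\<bar>\<rho>hs n \<xi>\<bar> \<le> 5 * C * (1 + (norm \<xi>)\<^sup>2)" unfolding \<rho>hs by linarith
  qed
  have l\<rho>: "(\<lambda>n. \<rho>s n \<xi>) \<longlonglongrightarrow> \<rho> \<xi>" for \<xi>
    unfolding \<rho>s_def using tendsto_mult[OF tendsto_const cutoff_tendsto(1)] by simp
  have lh: "(\<lambda>n. \<rho>hs n \<xi>) \<longlonglongrightarrow> \<xi> \<bullet> g \<xi>" for \<xi>
    unfolding \<rho>hs
    using tendsto_add[OF tendsto_mult[OF tendsto_const cutoff_tendsto(2)] tendsto_mult[OF cutoff_tendsto(1) tendsto_const]] by simp
  have lp: "(\<lambda>n. pairing (\<psi> s) (\<rho>s n)) \<longlonglongrightarrow> pairing (\<psi> s) \<rho>" if "0 \<le> s" for s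
    by (rule pairing_tendsto_quadratic[OF adm[OF that] qs l\<rho>])
  have lsrc: "(\<lambda>n. source (\<rho>s n) (\<rho>hs n) s) \<longlonglongrightarrow> source \<rho> ?\<rho>h s" if s: "0 \<le> s" for s
    unfolding source_def gain_loss_def
  proof (intro tendsto_intros lp s)
    show "(\<lambda>n. pairing (\<psi> s) (\<rho>hs n)) \<longlonglongrightarrow> pairing (\<psi> s) ?\<rho>h"
      by (rule pairing_tendsto_quadratic[OF adm[OF s] qhs lh])
    show "(\<lambda>n. interaction (\<psi> s) (average (\<rho>s n))) \<longlonglongrightarrow> interaction (\<psi> s) (average \<rho>)"
      by (rule interaction_tendsto[OF adm[OF s] growth2_average[OF qs]]) (measurable, rule average_tendsto[OF qs l\<rho>])
    show "(\<lambda>n. interaction (\<psi> s) (\<lambda>\<xi> \<xi>s. \<rho>s n \<xi>)) \<longlonglongrightarrow> interaction (\<psi> s) (\<lambda>\<xi> \<xi>s. \<rho> \<xi>)"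
      by (rule interaction_tendsto[OF adm[OF s] growth2_fst[OF qs]]) (measurable, rule l\<rho>)
  qed
  obtain w where w: "integrable lborel w" "AE s in lborel. s \<in> {0..<t + 1} \<longrightarrow> collision_bound s \<le> w s" "\<And>s. 0 \<le> w s"
    by (rule time_bound[of "t + 1"]) (use t in auto)
  have lint: "(\<lambda>n. LINT s:{0..t}|lborel. source (\<rho>s n) (\<rho>hs n) s) \<longlonglongrightarrow> (LINT s:{0..t}|lborel. source \<rho> ?\<rho>h s)"
    unfolding set_lebesgue_integral_def
  proof (rule integral_dominated_convergence[where w="\<lambda>s. 80 * C * w s"])
    show "(\<lambda>s. indicator {0..t} s *\<^sub>R source \<rho> ?\<rho>h s) \<in> borel_measurable lborel"
      using source_integrable[OF \<rho> \<rho>h, of t] by (simp add: set_integrable_def)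
    show "(\<lambda>s. indicator {0..t} s *\<^sub>R source (\<rho>s n) (\<rho>hs n) s) \<in> borel_measurable lborel" for n
      using source_integrable[OF qs qhs, of t] by (simp add: set_integrable_def)
    show "integrable lborel (\<lambda>s. 80 * C * w s)" using w(1) by simp
    show "AE s in lborel. (\<lambda>n. indicator {0..t} s *\<^sub>R source (\<rho>s n) (\<rho>hs n) s) \<longlonglongrightarrow> indicator {0..t} s *\<^sub>R source \<rho> ?\<rho>h s"
    proof (rule AE_I2)
      fix s :: real
      show "(\<lambda>n. indicator {0..t} s *\<^sub>R source (\<rho>s n) (\<rho>hs n) s) \<longlonglongrightarrow> indicator {0..t} s *\<^sub>R source \<rho> ?\<rho>h s"
        using lsrc[of s] by (cases "s \<in> {0..t}") auto
    qed
    show "AE s in lborel. norm (indicator {0..t} s *\<^sub>R source (\<rho>s n) (\<rho>hs n) s) \<le> 80 * C * w s" for n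
      using w(2)
    proof eventually_elim
      case (elim s)
      show ?case
      proof (cases "s \<in> {0..t}")
        case True
        then have s: "0 \<le> s" and cw: "collision_bound s \<le> w s" using elim by auto
        have "\<bar>source (\<rho>s n) (\<rho>hs n) s\<bar> \<le> 80 * C * collision_bound s"
          unfolding source_def using source_terms(1)[OF s qs, of n] source_terms(2)[OF s qhs, of n] source_terms(3)[OF s qs, of n] by linarith
        also have "\<dots> \<le> 80 * C * w s" using C cw by (intro mult_left_mono) auto
        finally show ?thesis using True by simp
      qed (use C w(3) in simp)
    qed
  qed
  have "pairing (\<psi> t) (\<rho>s n) = pairing (\<psi> 0) (\<rho>s n) + (LINT s:{0..t}|lborel. source (\<rho>s n) (\<rho>hs n) s)" for n
    unfolding \<rho>hs_def by (rule weak_source_compact[OF C1c t qs]) (use qhs[of n] in \<open>simp add: \<rho>hs_def[abs_def]\<close>)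
  then have "(\<lambda>n. pairing (\<psi> t) (\<rho>s n)) \<longlonglongrightarrow> pairing (\<psi> 0) \<rho> + (LINT s:{0..t}|lborel. source \<rho> ?\<rho>h s)"
    using tendsto_add[OF lp[of 0] lint] by simp
  then show ?thesis using lp[of t] t LIMSEQ_unique by fastforce
qed

end

section \<open>Conservation of mass and energy\<close>

lemma LINT_split:
  fixes f :: "real \<Rightarrow> real"
  assumes f: "set_integrable lborel {0..t} f" and "0 \<le> s" "s \<le> t"
  shows "(LINT x:{0..t}|lborel. f x) = (LINT x:{0..s}|lborel. f x) + (LINT x:{s<..t}|lborel. f x)"
    "set_integrable lborel {0..s} f" "set_integrable lborel {s<..t} f"
proof -
  show i: "set_integrable lborel {0..s} f" "set_integrable lborel {s<..t} f"
    using assms by (auto intro: set_integrable_subset[OF f])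
  have "{0..t} = {0..s} \<union> {s<..t}" using assms by auto
  then show "(LINT x:{0..t}|lborel. f x) = (LINT x:{0..s}|lborel. f x) + (LINT x:{s<..t}|lborel. f x)"
    using set_integral_Un[OF ivl_disj_int_two(8) i] by simp
qed

text \<open>A form of Gronwall's lemma for a coefficient \<open>\<beta>\<close> that is merely integrable and a function \<open>y\<close> that is merely
  bounded; the factor depends on nothing but \<open>\<beta>\<close> and \<open>T\<close>. On a time step on which \<open>\<beta>\<close> has integral at
  most \<open>1/2\<close> the integral term is absorbed by the supremum of \<open>y\<close>, and finitely many steps suffice.\<close>
lemma gronwall:
  fixes \<beta> :: "real \<Rightarrow> real"
  assumes T: "0 \<le> T" and \<beta>: "set_integrable lborel {0..T} \<beta>" and \<beta>0: "\<And>s. 0 \<le> s \<Longrightarrow> 0 \<le> \<beta> s"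
  obtains C where "0 \<le> C"
    "\<And>y K t. 0 \<le> K \<Longrightarrow> set_integrable lborel {0..T} (\<lambda>s. \<beta> s * y s) \<Longrightarrow> bdd_above (y ` {0..T}) \<Longrightarrow>
      (\<And>t. t \<in> {0..T} \<Longrightarrow> y t \<le> K + (LINT s:{0..t}|lborel. \<beta> s * y s)) \<Longrightarrow> t \<in> {0..T} \<Longrightarrow> y t \<le> C * K"
proof -
  define P where "P = (\<lambda>t. LINT s:{0..t}|lborel. \<beta> s)"
  have Peq: "P t = integral {0..t} \<beta>" if "t \<in> {0..T}" for t
    unfolding P_def using that
    by (intro set_borel_integral_eq_integral(2) set_integrable_subset[OF \<beta>]) auto
  have "continuous_on {0..T} (\<lambda>t. integral {0..t} \<beta>)"
    by (rule indefinite_integral_continuous_1[OF set_borel_integral_eq_integral(1)[OF \<beta>]])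
  then have "continuous_on {0..T} P" by (simp only: continuous_on_cong[OF refl Peq])
  then have "uniformly_continuous_on {0..T} P" by (rule compact_uniformly_continuous) simp
  then obtain \<delta> where \<delta>: "\<delta> > 0" "\<And>s t. s \<in> {0..T} \<Longrightarrow> t \<in> {0..T} \<Longrightarrow> dist t s < \<delta> \<Longrightarrow> dist (P t) (P s) < 1/2"
    unfolding uniformly_continuous_on_def by (metis half_gt_zero_iff zero_less_one)
  obtain N :: nat where N: "T / \<delta> < real N" using reals_Archimedean2 by blast
  have N0: "N > 0" using N T \<delta>(1) by (metis divide_nonneg_pos gr0I not_le of_nat_0)
  define h where "h = T / real N"
  have h: "0 \<le> h" "h < \<delta>" "real N * h = T" using N N0 T \<delta>(1) by (auto simp: h_def field_simps)
  have P0: "0 \<le> P T" unfolding P_def set_lebesgue_integral_def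
    using \<beta>0 by (intro integral_nonneg_AE AE_I2) (auto simp: indicator_def)
  \<comment> \<open>\<open>c j\<close> is the bound after \<open>j\<close> steps; \<open>2 (1 + P T c)\<close> comes from solving \<open>S \<le> K + P T c K + S / 2\<close> for \<open>S\<close>.\<close>
  define c where "c = rec_nat (1::real) (\<lambda>_ c. c + 2 * (1 + P T * c))"
  have c_0: "c 0 = 1" and c_Suc: "c (Suc j) = c j + 2 * (1 + P T * c j)" for j by (simp_all add: c_def)
  have c1: "1 \<le> c j" for j
  proof (induction j)
    case (Suc j)
    have "0 \<le> P T * c j" using P0 Suc by simp
    then show ?case using Suc by (simp add: c_Suc)
  qed (simp add: c_0)
  show ?thesis
  proof (rule that[of "c N"])
    show "0 \<le> c N" using c1[of N] by simp
    fix y :: "real \<Rightarrow> real" and K t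
    assume K: "0 \<le> K" and i: "set_integrable lborel {0..T} (\<lambda>s. \<beta> s * y s)" and bdd: "bdd_above (y ` {0..T})"
      and y: "\<And>t. t \<in> {0..T} \<Longrightarrow> y t \<le> K + (LINT s:{0..t}|lborel. \<beta> s * y s)" and t: "t \<in> {0..T}"
    have "\<forall>s\<in>{0..real j * h}. y s \<le> c j * K" if "j \<le> N" for j
      using that
    proof (induction j)
      case 0
      have "(LINT s:{0..0}|lborel. \<beta> s * y s) = 0"
        unfolding set_lebesgue_integral_def
        by (rule integral_eq_zero_AE, rule eventually_mono[OF AE_lborel_singleton[of "0::real"]]) simp
      then show ?case using y[of 0] T by (simp add: c_0)
    next
      case (Suc j)
      define a where "a = real j * h"
      define e where "e = real (Suc j) * h"
      have ae: "0 \<le> a" "a \<le> e" "e \<le> T" "e - a = h"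
      proof -
        show "0 \<le> a" "a \<le> e" using h(1) by (auto simp: a_def e_def algebra_simps)
        have "real (Suc j) * h \<le> real N * h" using Suc.prems h(1) by (intro mult_right_mono) auto
        then show "e \<le> T" using h(3) by (simp add: e_def)
        show "e - a = h" by (simp add: a_def e_def algebra_simps)
      qed
      have IH: "y s \<le> c j * K" if "s \<in> {0..a}" for s using Suc that by (auto simp: a_def)
      define S where "S = (SUP s\<in>{a..e}. y s)"
      have bd: "bdd_above (y ` {a..e})" using ae by (intro bdd_above_mono[OF bdd] image_mono) auto
      have yS: "y s \<le> S" if "s \<in> {a..e}" for s unfolding S_def by (rule cSUP_upper[OF that bd])
      define S' where "S' = max S 0"
      have step: "y s \<le> K + P T * (c j * K) + 1/2 * S'" if s: "s \<in> {a..e}" for s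
      proof -
        have s': "s \<in> {0..T}" "a \<le> s" "0 \<le> a" using s ae by auto
        have isy: "set_integrable lborel {0..s} (\<lambda>s. \<beta> s * y s)" using s' by (intro set_integrable_subset[OF i]) auto
        have b: "set_integrable lborel {0..s} \<beta>" using s' by (intro set_integrable_subset[OF \<beta>]) auto
        note sp = LINT_split[OF isy s'(3,2)] and spb = LINT_split[OF b s'(3,2)]
        have "(LINT x:{0..a}|lborel. \<beta> x * y x) \<le> (LINT x:{0..a}|lborel. \<beta> x * (c j * K))"
          using sp(2) spb(2) IH \<beta>0 by (intro set_integral_mono) (auto intro: mult_left_mono)
        also have "\<dots> = P a * (c j * K)" by (simp add: P_def)
        also have "\<dots> \<le> P T * (c j * K)"
        proof (rule mult_right_mono)
          have "0 \<le> (LINT x:{a<..T}|lborel. \<beta> x)" unfolding set_lebesgue_integral_def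
            using \<beta>0 ae by (intro integral_nonneg_AE AE_I2) (auto simp: indicator_def)
          then show "P a \<le> P T" using LINT_split(1)[OF \<beta>, of a] ae by (simp add: P_def)
          show "0 \<le> c j * K" using c1[of j] K by simp
        qed
        finally have 1: "(LINT x:{0..a}|lborel. \<beta> x * y x) \<le> P T * (c j * K)" .
        have "(LINT x:{a<..s}|lborel. \<beta> x * y x) \<le> (LINT x:{a<..s}|lborel. \<beta> x * S')"
          using sp(3) spb(3)
        proof (intro set_integral_mono)
          fix x assume x: "x \<in> {a<..s}"
          then have "y x \<le> S'" using yS[of x] s by (auto simp: S'_def)
          then show "\<beta> x * y x \<le> \<beta> x * S'" using x ae by (intro mult_left_mono \<beta>0) auto
        qed auto
        also have "\<dots> = (P s - P a) * S'" using spb(1) by (simp add: P_def)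
        also have "\<dots> \<le> 1/2 * S'"
        proof (rule mult_right_mono)
          have "dist (P s) (P a) < 1/2" using s ae h(2) by (intro \<delta>(2)) (auto simp: dist_real_def)
          then show "P s - P a \<le> 1/2" unfolding dist_real_def by linarith
        qed (simp add: S'_def)
        finally have 2: "(LINT x:{a<..s}|lborel. \<beta> x * y x) \<le> 1/2 * S'" .
        show ?thesis using y[OF s'(1)] sp(1) 1 2 by linarith
      qed
      have "S \<le> K + P T * (c j * K) + 1/2 * S'"
        unfolding S_def using step ae by (intro cSUP_least) auto
      moreover have "0 \<le> K + P T * (c j * K)" using K P0 c1[of j] by simp
      ultimately have S2: "S \<le> 2 * (K + P T * (c j * K))" by (auto simp: S'_def max_def split: if_splits)
      have "y s \<le> c (Suc j) * K" if s: "s \<in> {0..e}" for s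
      proof (cases "s \<le> a")
        case True
        have "0 \<le> 2 * (1 + P T * c j) * K" using K P0 c1[of j] by simp
        then show ?thesis using IH[of s] s True by (simp add: c_Suc algebra_simps)
      next
        case False
        have "0 \<le> c j * K" using K c1[of j] by simp
        then show ?thesis using yS[of s] s False S2 by (simp add: c_Suc algebra_simps)
      qed
      then show ?case by (simp add: e_def)
    qed
    from this[of N] show "y t \<le> c N * K" using t h(3) by simp
  qed
qed

context annihilation_solution
begin

lemma collision_rate_nonneg: "0 \<le> s \<Longrightarrow> 0 \<le> collision_rate (\<psi> s)"
  using interaction_mono[OF adm, of s 0 "\<lambda>_ _. 0" 1 "\<lambda>_ _. 1"] growth2_one
  by (simp add: collision_rate_def growth2_def) (simp add: interaction_def pairing2_def)

lemma energy_rate_nonneg: "0 \<le> s \<Longrightarrow> 0 \<le> energy_rate (\<psi> s)"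
  using interaction_mono[OF adm, of s 0 "\<lambda>_ _. 0" 1 "\<lambda>x _. (norm x)\<^sup>2"] growth2_norm2
  by (simp add: energy_rate_def growth2_def) (simp add: interaction_def pairing2_def)

lemma rate_set_integrable:
  "set_integrable lborel {0..t} (\<lambda>s. collision_rate (\<psi> s))" "set_integrable lborel {0..t} (\<lambda>s. energy_rate (\<psi> s))"
proof -
  show "set_integrable lborel {0..t} (\<lambda>s. collision_rate (\<psi> s))"
  proof (rule time_integrable[where c=4])
    show "(\<lambda>s. collision_rate (\<psi> (max 0 s))) \<in> borel_measurable borel"
      unfolding collision_rate_def by (rule interaction_time_measurable[OF growth2_one])
    show "\<bar>collision_rate (\<psi> s)\<bar> \<le> 4 * collision_bound s" if "0 \<le> s" for s
      using rate_bounds(1)[OF that] Nn_product_le(1)[of s] by linarith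
  qed simp
  show "set_integrable lborel {0..t} (\<lambda>s. energy_rate (\<psi> s))"
  proof (rule time_integrable[where c=4])
    show "(\<lambda>s. energy_rate (\<psi> (max 0 s))) \<in> borel_measurable borel"
      unfolding energy_rate_def by (rule interaction_time_measurable[OF growth2_norm2])
    show "\<bar>energy_rate (\<psi> s)\<bar> \<le> 4 * collision_bound s" if "0 \<le> s" for s
      using rate_bounds(2)[OF that] Nn_product_le(1)[of s] by linarith
  qed simp
qed

lemma rate_pairing_set_integrable:
  assumes \<rho>: "quadratic_growth C \<rho>"
  shows "set_integrable lborel {0..t} (\<lambda>s. collision_rate (\<psi> s) * pairing (\<psi> s) \<rho>)"
    "set_integrable lborel {0..t} (\<lambda>s. energy_rate (\<psi> s) * pairing (\<psi> s) \<rho>)"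
proof -
  have C: "0 \<le> C" by (rule quadratic_growth_nonneg[OF \<rho>])
  note [measurable] = source_measurable_terms(4)[OF \<rho>] interaction_time_measurable[OF growth2_one]
    interaction_time_measurable[OF growth2_norm2]
  have b: "\<bar>r * pairing (\<psi> s) \<rho>\<bar> \<le> 4 * C * collision_bound s"
    if s: "0 \<le> s" and r: "\<bar>r\<bar> \<le> 4 * (Nn (2 + \<gamma>) s * Nn 2 s)" for r s
  proof -
    have "\<bar>r * pairing (\<psi> s) \<rho>\<bar> \<le> 4 * (Nn (2 + \<gamma>) s * Nn 2 s) * (C * Nn 2 s)"
      unfolding abs_mult using quadratic_growth_integrable(2)[OF adm[OF s] two_le_k \<rho>]
      by (intro mult_mono r) (auto simp: Nn_nonneg)
    also have "\<dots> \<le> 4 * C * collision_bound s"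
      using mult_left_mono[OF Nn_product_le(2)[of s], of "4 * C"] C by (simp add: mult_ac)
    finally show ?thesis .
  qed
  show "set_integrable lborel {0..t} (\<lambda>s. collision_rate (\<psi> s) * pairing (\<psi> s) \<rho>)"
    using C by (intro time_integrable[where c="4 * C"] b rate_bounds) (auto simp: collision_rate_def)
  show "set_integrable lborel {0..t} (\<lambda>s. energy_rate (\<psi> s) * pairing (\<psi> s) \<rho>)"
    using C by (intro time_integrable[where c="4 * C"] b rate_bounds) (auto simp: energy_rate_def)
qed

lemma pairing_bounded:
  assumes d: "\<And>\<xi>. GDERIV \<rho> \<xi> :> g \<xi>" and g: "continuous_on UNIV g"
    and \<rho>: "quadratic_growth C \<rho>" and \<rho>h: "quadratic_growth C (\<lambda>\<xi>. \<xi> \<bullet> g \<xi>)"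
  shows "bdd_above ((\<lambda>t. \<bar>pairing (\<psi> t) \<rho> - c\<bar>) ` {0..T})"
proof (rule bdd_aboveI2)
  fix t assume t: "t \<in> {0..T}"
  note i = source_integrable[OF \<rho> \<rho>h]
  have "\<bar>LINT s:{0..t}|lborel. source \<rho> (\<lambda>\<xi>. \<xi> \<bullet> g \<xi>) s\<bar> \<le> (LINT s:{0..t}|lborel. \<bar>source \<rho> (\<lambda>\<xi>. \<xi> \<bullet> g \<xi>) s\<bar>)"
    using set_integral_norm_bound[OF i[of t]] by simp
  also have "\<dots> \<le> (LINT s:{0..T}|lborel. \<bar>source \<rho> (\<lambda>\<xi>. \<xi> \<bullet> g \<xi>) s\<bar>)"
  proof -
    have "0 \<le> (LINT s:{t<..T}|lborel. \<bar>source \<rho> (\<lambda>\<xi>. \<xi> \<bullet> g \<xi>) s\<bar>)"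
      unfolding set_lebesgue_integral_def by (intro integral_nonneg_AE AE_I2) simp
    then show ?thesis using LINT_split(1)[OF set_integrable_abs[OF i[of T]], of t] t by simp
  qed
  finally show "\<bar>pairing (\<psi> t) \<rho> - c\<bar> \<le> \<bar>pairing (\<psi> 0) \<rho>\<bar> + \<bar>c\<bar> + (LINT s:{0..T}|lborel. \<bar>source \<rho> (\<lambda>\<xi>. \<xi> \<bullet> g \<xi>) s\<bar>)"
    using weak_source[OF d g \<rho> \<rho>h, of t] t by auto
qed

text \<open>The deviation of the pairing from its initial value solves a linear homogeneous integral equation, so
  Gronwall's lemma with \<open>K = 0\<close> applies to its absolute value.\<close>
lemma pairing_conserved:
  assumes d: "\<And>\<xi>. GDERIV \<rho> \<xi> :> g \<xi>" and g: "continuous_on UNIV g"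
    and \<rho>: "quadratic_growth C \<rho>" and \<rho>h: "quadratic_growth C (\<lambda>\<xi>. \<xi> \<bullet> g \<xi>)"
    and src: "\<And>s. 0 \<le> s \<Longrightarrow> source \<rho> (\<lambda>\<xi>. \<xi> \<bullet> g \<xi>) s = \<beta> s * (pairing (\<psi> s) \<rho> - c)"
    and \<beta>: "\<And>t. set_integrable lborel {0..t} \<beta>" "\<And>s. 0 \<le> s \<Longrightarrow> 0 \<le> \<beta> s"
    and init: "pairing (\<psi> 0) \<rho> = c" and t: "0 \<le> t"
  shows "pairing (\<psi> t) \<rho> = c"
proof -
  define y where "y = (\<lambda>s. \<bar>pairing (\<psi> s) \<rho> - c\<bar>)"
  obtain G where G: "0 \<le> G"
    "\<And>y K s. 0 \<le> K \<Longrightarrow> set_integrable lborel {0..t} (\<lambda>s. \<beta> s * y s) \<Longrightarrow> bdd_above (y ` {0..t}) \<Longrightarrow>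
      (\<And>s. s \<in> {0..t} \<Longrightarrow> y s \<le> K + (LINT r:{0..s}|lborel. \<beta> r * y r)) \<Longrightarrow> s \<in> {0..t} \<Longrightarrow> y s \<le> G * K"
    using gronwall[OF t \<beta>(1) \<beta>(2)] by blast
  have sy: "\<bar>source \<rho> (\<lambda>\<xi>. \<xi> \<bullet> g \<xi>) s\<bar> = \<beta> s * y s" if "0 \<le> s" for s
    using src[OF that] \<beta>(2)[OF that] by (simp add: y_def abs_mult)
  have i: "set_integrable lborel {0..s} (\<lambda>s. \<beta> s * y s)" for s
  proof -
    have "set_integrable lborel {0..s} (\<lambda>s. \<bar>source \<rho> (\<lambda>\<xi>. \<xi> \<bullet> g \<xi>) s\<bar>)"
      by (rule set_integrable_abs[OF source_integrable[OF \<rho> \<rho>h]])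
    moreover have "set_integrable lborel {0..s} (\<lambda>s. \<bar>source \<rho> (\<lambda>\<xi>. \<xi> \<bullet> g \<xi>) s\<bar>) = set_integrable lborel {0..s} (\<lambda>s. \<beta> s * y s)"
      using sy by (intro set_integrable_cong) auto
    ultimately show ?thesis by simp
  qed
  have "y t \<le> G * 0"
  proof (rule G(2)[where y=y and K=0 and s=t])
    show "bdd_above (y ` {0..t})" unfolding y_def by (rule pairing_bounded[OF d g \<rho> \<rho>h])
    fix s assume s: "s \<in> {0..t}"
    have "y s = \<bar>LINT r:{0..s}|lborel. source \<rho> (\<lambda>\<xi>. \<xi> \<bullet> g \<xi>) r\<bar>"
      using weak_source[OF d g \<rho> \<rho>h, of s] s init by (simp add: y_def)
    also have "\<dots> \<le> (LINT r:{0..s}|lborel. \<bar>source \<rho> (\<lambda>\<xi>. \<xi> \<bullet> g \<xi>) r\<bar>)"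
      using set_integral_norm_bound[OF source_integrable[OF \<rho> \<rho>h], of s] by simp
    also have "\<dots> = (LINT r:{0..s}|lborel. \<beta> r * y r)"
      using sy by (intro set_lebesgue_integral_cong) auto
    finally show "y s \<le> 0 + (LINT r:{0..s}|lborel. \<beta> r * y r)" by simp
  qed (use i t in auto)
  then show ?thesis by (simp add: y_def)
qed

lemma average_one: "\<xi> \<noteq> \<xi>s \<Longrightarrow> average (\<lambda>_. 1) \<xi> \<xi>s = 1"
  by (simp add: average_def integral_b)

lemma interaction_average:
  assumes \<rho>: "quadratic_growth C \<rho>" and s: "0 \<le> s"
  shows "interaction (\<psi> s) (average \<rho>) = 1/2 * interaction (\<psi> s) (\<lambda>x y. average \<rho> x y + average \<rho> y x)"
  using interaction_add[OF adm[OF s] growth2_average[OF \<rho>] growth2_swap[OF growth2_average[OF \<rho>]]]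
    interaction_swap[of "\<psi> s" "average \<rho>"] by simp

lemma average_norm2:
  assumes "\<xi> \<noteq> \<xi>s"
  shows "average (\<lambda>\<xi>. (norm \<xi>)\<^sup>2) \<xi> \<xi>s + average (\<lambda>\<xi>. (norm \<xi>)\<^sup>2) \<xi>s \<xi> = (norm \<xi>)\<^sup>2 + (norm \<xi>s)\<^sup>2"
proof -
  have "average (\<lambda>\<xi>. (norm \<xi>)\<^sup>2) \<xi> \<xi>s + average (\<lambda>\<xi>. (norm \<xi>)\<^sup>2) \<xi>s \<xi>
      = (LINT \<sigma>|surface_measure. b (sgn (\<xi> - \<xi>s) \<bullet> \<sigma>) * ((norm \<xi>)\<^sup>2 + (norm \<xi>s)\<^sup>2))"
    unfolding average_add_swap[OF quadratic_growth_norm2]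
  proof (rule integral_cong_AE)
    show "AE \<sigma> in surface_measure. b (sgn (\<xi> - \<xi>s) \<bullet> \<sigma>) * ((norm (post1 \<xi> \<xi>s \<sigma>))\<^sup>2 + (norm (post2 \<xi> \<xi>s \<sigma>))\<^sup>2)
      = b (sgn (\<xi> - \<xi>s) \<bullet> \<sigma>) * ((norm \<xi>)\<^sup>2 + (norm \<xi>s)\<^sup>2)"
      using AE_surface_measure_norm by eventually_elim (simp add: post_energy)
  qed measurable
  then show ?thesis using assms by (simp add: integral_b)
qed

text \<open>A collision loses the fraction \<open>\<alpha>\<close> of the colliding mass. The rescaling by \<open>A - d B\<close> returns it exactly
  when the mass is one.\<close>
lemma mass_conserved: "0 \<le> t \<Longrightarrow> pairing (\<psi> t) (\<lambda>_. 1) = 1"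
proof (rule pairing_conserved[where C=1 and g="\<lambda>_. 0" and \<beta>="\<lambda>s. \<alpha> * collision_rate (\<psi> s)"])
  show "quadratic_growth 1 (\<lambda>\<xi>::'a. \<xi> \<bullet> 0)" by (simp add: quadratic_growth_def)
  show "quadratic_growth 1 (\<lambda>_::'a. 1)" by (rule quadratic_growth_1)
  show "source (\<lambda>_. 1) (\<lambda>\<xi>. \<xi> \<bullet> 0) s = \<alpha> * collision_rate (\<psi> s) * (pairing (\<psi> s) (\<lambda>_. 1) - 1)" if s: "0 \<le> s" for s
  proof -
    have "interaction (\<psi> s) (average (\<lambda>_. 1)) = collision_rate (\<psi> s)"
      unfolding collision_rate_def by (rule interaction_cong) (simp add: average_one)
    then have "gain_loss (\<lambda>_. 1) s = - \<alpha> * collision_rate (\<psi> s)"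
      by (simp add: gain_loss_def collision_rate_def[symmetric] algebra_simps)
    then show ?thesis by (simp add: source_def pairing_def algebra_simps)
  qed
  show "set_integrable lborel {0..t} (\<lambda>s. \<alpha> * collision_rate (\<psi> s))" for t
    using rate_set_integrable(1) by simp
  show "0 \<le> \<alpha> * collision_rate (\<psi> s)" if "0 \<le> s" for s using \<alpha> collision_rate_nonneg[OF that] by simp
qed (auto simp: mass0 GDERIV_const)

text \<open>Collisions lose energy at the rate \<open>\<alpha> e\<close>, with \<open>e\<close> the \<open>energy_rate\<close>. The contributions of
  \<open>collision_rate\<close> to the two rescaling terms cancel for a test function that is homogeneous of degree two,
  and the remaining drift compensates the loss when the energy is \<open>d / 2\<close>.\<close>
lemma energy_conserved: "0 \<le> t \<Longrightarrow> pairing (\<psi> t) (\<lambda>\<xi>. (norm \<xi>)\<^sup>2) = real DIM('a) / 2"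
proof (rule pairing_conserved[where C=2 and g="\<lambda>\<xi>. 2 *\<^sub>R \<xi>" and \<beta>="\<lambda>s. 2 * \<alpha> / real DIM('a) * energy_rate (\<psi> s)"])
  have e: "\<xi> \<bullet> 2 *\<^sub>R \<xi> = 2 * (norm \<xi>)\<^sup>2" for \<xi> :: 'a by (simp add: power2_norm_eq_inner)
  show "quadratic_growth 2 (\<lambda>\<xi>::'a. \<xi> \<bullet> 2 *\<^sub>R \<xi>)" unfolding e by (simp add: quadratic_growth_def)
  show "quadratic_growth 2 (\<lambda>\<xi>::'a. (norm \<xi>)\<^sup>2)" by (simp add: quadratic_growth_def)
  show "source (\<lambda>\<xi>. (norm \<xi>)\<^sup>2) (\<lambda>\<xi>. \<xi> \<bullet> 2 *\<^sub>R \<xi>) s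
      = 2 * \<alpha> / real DIM('a) * energy_rate (\<psi> s) * (pairing (\<psi> s) (\<lambda>\<xi>. (norm \<xi>)\<^sup>2) - real DIM('a) / 2)" if s: "0 \<le> s" for s
  proof -
    have "interaction (\<psi> s) (average (\<lambda>\<xi>. (norm \<xi>)\<^sup>2))
        = 1/2 * interaction (\<psi> s) (\<lambda>x y. (norm x)\<^sup>2 + (norm y)\<^sup>2)"
      unfolding interaction_average[OF quadratic_growth_norm2 s]
      by (intro arg_cong[where f="\<lambda>x. 1/2 * x"] interaction_cong average_norm2)
    also have "\<dots> = energy_rate (\<psi> s)"
      using interaction_add[OF adm[OF s] growth2_norm2 growth2_swap[OF growth2_norm2]]
        interaction_swap[of "\<psi> s" "\<lambda>x y. (norm x)\<^sup>2"] by (simp add: energy_rate_def)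
    finally have g: "gain_loss (\<lambda>\<xi>. (norm \<xi>)\<^sup>2) s = - \<alpha> * energy_rate (\<psi> s)"
      by (simp add: gain_loss_def energy_rate_def[symmetric] algebra_simps)
    have p: "pairing (\<psi> s) (\<lambda>\<xi>. \<xi> \<bullet> 2 *\<^sub>R \<xi>) = 2 * pairing (\<psi> s) (\<lambda>\<xi>. (norm \<xi>)\<^sup>2)"
      unfolding e by (simp add: pairing_def mult.left_commute[of _ 2])
    show ?thesis
      unfolding source_def g p drift_def using dim by (simp add: field_simps)
  qed
  show "set_integrable lborel {0..t} (\<lambda>s. 2 * \<alpha> / real DIM('a) * energy_rate (\<psi> s))" for t
    using rate_set_integrable(2) by simp
  show "0 \<le> 2 * \<alpha> / real DIM('a) * energy_rate (\<psi> s)" if "0 \<le> s" for s using \<alpha> energy_rate_nonneg[OF that] by simp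
qed (auto simp: energy0 GDERIV_norm2 intro!: continuous_intros)

end

section \<open>The softened moment\<close>

lemma DERIV_soft_powr:
  assumes x: "0 < x" and \<epsilon>: "0 < \<epsilon>"
  shows "((\<lambda>x. x * soft_powr p \<epsilon> x) has_real_derivative soft_powr p \<epsilon> x * (1 + p / (1 + \<epsilon> * x))) (at x)"
proof -
  define u where "u = 1 + \<epsilon> * x"
  have u: "0 < u" using x \<epsilon> by (simp add: u_def add_pos_pos)
  have r: "((\<lambda>x. x / (1 + \<epsilon> * x)) has_real_derivative 1 / u\<^sup>2) (at x)"
  proof -
    have "((\<lambda>x. 1 + \<epsilon> * x) has_real_derivative \<epsilon>) (at x)" by (auto intro!: derivative_eq_intros)
    from DERIV_divide[OF DERIV_ident this] u
    have "((\<lambda>x. x / (1 + \<epsilon> * x)) has_real_derivative (1 * u - x * \<epsilon>) / (u * u)) (at x)" by (simp add: u_def)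
    moreover have "1 * u - x * \<epsilon> = 1" by (simp add: u_def)
    ultimately show ?thesis by (simp add: power2_eq_square)
  qed
  have q: "0 < x / u" using x u by simp
  have "((\<lambda>x. soft_powr p \<epsilon> x) has_real_derivative p * (x / u) powr (p - 1) * (1 / u\<^sup>2)) (at x)"
    unfolding soft_powr_def
    using DERIV_chain2[OF has_real_derivative_powr r, of p] q by (simp add: u_def)
  from DERIV_mult[OF DERIV_ident this]
  have "((\<lambda>x. x * soft_powr p \<epsilon> x) has_real_derivative 1 * soft_powr p \<epsilon> x + p * (x / u) powr (p - 1) * (1 / u\<^sup>2) * x) (at x)" .
  moreover have "p * (x / u) powr (p - 1) * (1 / u\<^sup>2) * x = soft_powr p \<epsilon> x * (p / u)"
  proof -
    have "(x / u) powr (p - 1) = (x / u) powr p / (x / u)" using x u by (simp add: powr_diff)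
    then show ?thesis using x u by (simp add: soft_powr_def u_def[symmetric] power2_eq_square)
  qed
  ultimately show ?thesis by (simp add: u_def distrib_left)
qed

context angular_kernel
begin

definition soft_gradient :: "real \<Rightarrow> 'a \<Rightarrow> 'a" where
  "soft_gradient \<epsilon> \<xi> = (2 * (soft_powr (\<gamma> / 2) \<epsilon> ((norm \<xi>)\<^sup>2) * (1 + \<gamma> / 2 / (1 + \<epsilon> * (norm \<xi>)\<^sup>2)))) *\<^sub>R \<xi>"

lemma GDERIV_soft_moment:
  assumes \<epsilon>: "0 < \<epsilon>"
  shows "GDERIV (soft_moment \<epsilon>) \<xi> :> soft_gradient \<epsilon> \<xi>"
proof (cases "\<xi> = 0")
  case False
  then have "0 < (norm \<xi>)\<^sup>2" by simp
  from GDERIV_DERIV_compose[OF GDERIV_norm2 DERIV_soft_powr[OF this \<epsilon>, of "\<gamma> / 2"]]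
  show ?thesis unfolding soft_moment_def[abs_def] soft_gradient_def by (simp add: mult.commute)
next
  case True
  define c where "c = (1 / \<epsilon>) powr (\<gamma> / 2)"
  have b: "norm (soft_moment \<epsilon> y) \<le> c * (norm y * norm y)" for y :: 'a
  proof -
    have "norm (soft_moment \<epsilon> y) = (norm y)\<^sup>2 * soft_powr (\<gamma> / 2) \<epsilon> ((norm y)\<^sup>2)"
      by (simp add: soft_moment_def soft_powr_nonneg)
    also have "\<dots> \<le> (norm y)\<^sup>2 * c"
      unfolding c_def using \<epsilon> \<gamma>_pos by (intro mult_left_mono soft_powr_le_const) auto
    finally show ?thesis by (simp add: power2_eq_square mult_ac)
  qed
  have "(soft_moment \<epsilon> has_derivative (\<lambda>h. 0)) (at (0::'a))"
    unfolding has_derivative_at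
  proof (intro conjI)
    show "(\<lambda>h. norm (soft_moment \<epsilon> (0 + h) - soft_moment \<epsilon> 0 - 0) / norm h) \<midarrow>0::'a\<rightarrow> 0"
    proof (rule tendsto_sandwich)
      show "eventually (\<lambda>h::'a. 0 \<le> norm (soft_moment \<epsilon> (0 + h) - soft_moment \<epsilon> 0 - 0) / norm h) (at 0)" by simp
      show "eventually (\<lambda>h::'a. norm (soft_moment \<epsilon> (0 + h) - soft_moment \<epsilon> 0 - 0) / norm h \<le> c * norm h) (at 0)"
      proof (rule eventually_mono[OF eventually_neq_at_within[of "0::'a"]])
        fix h :: 'a assume "h \<noteq> 0"
        then show "norm (soft_moment \<epsilon> (0 + h) - soft_moment \<epsilon> 0 - 0) / norm h \<le> c * norm h"
          using b[of h] by (simp add: divide_le_eq soft_moment_def[of _ 0] mult.assoc)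
      qed
      have "((\<lambda>h::'a. c * norm h) \<longlongrightarrow> c * norm (0::'a)) (at 0)" by (intro tendsto_intros)
      then show "(\<lambda>h::'a. c * norm h) \<midarrow>0\<rightarrow> 0" by simp
    qed simp
  qed simp
  then show ?thesis using True by (simp add: gderiv_def soft_gradient_def)
qed

lemma continuous_soft_gradient:
  assumes "0 < \<epsilon>"
  shows "continuous_on UNIV (soft_gradient \<epsilon>)"
proof -
  have p: "0 < 1 + \<epsilon> * (norm x)\<^sup>2" for x :: 'a using assms by (intro add_pos_nonneg) auto
  then have nz: "1 + \<epsilon> * (norm x)\<^sup>2 \<noteq> 0" for x :: 'a by (metis less_irrefl)
  have c: "continuous_on UNIV (\<lambda>x::'a. ((norm x)\<^sup>2 / (1 + \<epsilon> * (norm x)\<^sup>2)) powr (\<gamma> / 2))"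
    using p \<gamma>_pos nz by (intro continuous_on_powr' continuous_intros) (auto intro!: divide_nonneg_pos)
  have c2: "continuous_on UNIV (\<lambda>x::'a. 1 + \<gamma> / 2 / (1 + \<epsilon> * (norm x)\<^sup>2))"
    using nz by (intro continuous_intros) auto
  show ?thesis
    unfolding soft_gradient_def soft_powr_def
    by (intro continuous_on_scaleR continuous_on_mult c c2 continuous_on_const continuous_on_id)
qed

text \<open>The derivative of \<open>ln (x (x / (1 + \<epsilon> x))\<^bsup>\<gamma>/2\<^esup>)\<close> with respect to \<open>ln x\<close> lies between \<open>1\<close> and
  \<open>1 + \<gamma> / 2\<close>; here \<open>x = |\<xi>|\<^sup>2\<close>, which doubles both.\<close>
lemma soft_radial_derivative:
  assumes "0 < \<epsilon>"
  shows "2 * soft_moment \<epsilon> \<xi> \<le> \<xi> \<bullet> soft_gradient \<epsilon> \<xi>" "\<xi> \<bullet> soft_gradient \<epsilon> \<xi> \<le> (2 + \<gamma>) * soft_moment \<epsilon> \<xi>"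
proof -
  define c where "c = 1 / (1 + \<epsilon> * (norm \<xi>)\<^sup>2)"
  have u: "1 \<le> 1 + \<epsilon> * (norm \<xi>)\<^sup>2" using assms by simp
  have c: "0 \<le> c" "c \<le> 1" using u by (auto simp: c_def divide_le_eq)
  have e: "\<xi> \<bullet> soft_gradient \<epsilon> \<xi> = soft_moment \<epsilon> \<xi> * (2 + \<gamma> * c)"
  proof -
    have "soft_gradient \<epsilon> \<xi> = (2 * (soft_powr (\<gamma> / 2) \<epsilon> ((norm \<xi>)\<^sup>2) * (1 + \<gamma> / 2 * c))) *\<^sub>R \<xi>"
      by (simp add: soft_gradient_def c_def)
    moreover have "\<xi> \<bullet> \<xi> = (norm \<xi>)\<^sup>2" by (simp add: power2_norm_eq_inner)
    ultimately show ?thesis by (simp only: inner_scaleR_right soft_moment_def) (simp add: algebra_simps)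
  qed
  show "2 * soft_moment \<epsilon> \<xi> \<le> \<xi> \<bullet> soft_gradient \<epsilon> \<xi>" unfolding e
    using mult_left_mono[OF _ soft_moment_nonneg, of 2 "2 + \<gamma> * c" \<epsilon> \<xi>] c \<gamma>_pos by (simp add: mult.commute)
  have "\<gamma> * c \<le> \<gamma>" using c \<gamma>_pos by (simp add: mult_left_le)
  then show "\<xi> \<bullet> soft_gradient \<epsilon> \<xi> \<le> (2 + \<gamma>) * soft_moment \<epsilon> \<xi>" unfolding e
    using mult_left_mono[OF _ soft_moment_nonneg, of "2 + \<gamma> * c" "2 + \<gamma>" \<epsilon> \<xi>] by (simp add: mult.commute)
qed

text \<open>One growth constant for the softened moment and its radial derivative.\<close>
definition soft_growth :: "real \<Rightarrow> real" where
  "soft_growth \<epsilon> = (2 + \<gamma>) * (1 / \<epsilon>) powr (\<gamma> / 2)"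

lemma soft_quadratic_growth:
  assumes \<epsilon>: "0 < \<epsilon>"
  shows "quadratic_growth (soft_growth \<epsilon>) (soft_moment \<epsilon>)" "quadratic_growth (soft_growth \<epsilon>) (\<lambda>\<xi>. \<xi> \<bullet> soft_gradient \<epsilon> \<xi>)"
proof -
  define c where "c = (1 / \<epsilon>) powr (\<gamma> / 2)"
  note q = soft_moment_quadratic_growth[OF \<epsilon>, folded c_def]
  have b: "\<bar>soft_moment \<epsilon> \<xi>\<bar> \<le> c * (1 + (norm \<xi>)\<^sup>2)" for \<xi> using q by (simp add: quadratic_growth_def)
  have le: "(2 + \<gamma>) * soft_moment \<epsilon> \<xi> \<le> (2 + \<gamma>) * c * (1 + (norm \<xi>)\<^sup>2)" for \<xi>
    using b[of \<xi>] \<gamma>_pos soft_moment_nonneg[of \<epsilon> \<xi>] unfolding mult.assoc by (intro mult_left_mono) auto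
  have "soft_moment \<epsilon> \<xi> \<le> (2 + \<gamma>) * soft_moment \<epsilon> \<xi>" for \<xi>
    using \<gamma>_pos soft_moment_nonneg[of \<epsilon> \<xi>] by (simp add: mult_le_cancel_right1)
  then have "\<bar>soft_moment \<epsilon> \<xi>\<bar> \<le> soft_growth \<epsilon> * (1 + (norm \<xi>)\<^sup>2)" for \<xi>
    using le[of \<xi>] soft_moment_nonneg[of \<epsilon> \<xi>] order_trans unfolding soft_growth_def c_def[symmetric] by fastforce
  then show "quadratic_growth (soft_growth \<epsilon>) (soft_moment \<epsilon>)"
    using quadratic_growth_measurable[OF q] by (simp add: quadratic_growth_def)
  have "\<bar>\<xi> \<bullet> soft_gradient \<epsilon> \<xi>\<bar> \<le> soft_growth \<epsilon> * (1 + (norm \<xi>)\<^sup>2)" for \<xi>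
    using soft_radial_derivative[OF \<epsilon>, of \<xi>] le[of \<xi>] soft_moment_nonneg[of \<epsilon> \<xi>]
    unfolding soft_growth_def c_def[symmetric] by linarith
  moreover have "(\<lambda>\<xi>. \<xi> \<bullet> soft_gradient \<epsilon> \<xi>) \<in> borel_measurable borel"
    by (intro borel_measurable_continuous_onI continuous_intros continuous_soft_gradient \<epsilon>)
  ultimately show "quadratic_growth (soft_growth \<epsilon>) (\<lambda>\<xi>. \<xi> \<bullet> soft_gradient \<epsilon> \<xi>)"
    by (simp add: quadratic_growth_def)
qed

lemma norm_powr_split: "norm (\<xi>::'a) powr (2 + \<gamma>) = (norm \<xi>)\<^sup>2 * norm \<xi> powr \<gamma>"
  by (cases "\<xi> = 0") (simp_all add: powr_add)

lemma norm2_powr_half: "((norm (\<xi>::'a))\<^sup>2) powr (\<gamma> / 2) = norm \<xi> powr \<gamma>"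
proof (cases "\<xi> = 0")
  case False
  then have "(norm \<xi>)\<^sup>2 = norm \<xi> powr 2" by simp
  then show ?thesis by (simp only: powr_powr) simp
qed simp

lemma soft_moment_le: "0 \<le> \<epsilon> \<Longrightarrow> soft_moment \<epsilon> \<xi> \<le> norm \<xi> powr (2 + \<gamma>)"
  unfolding norm_powr_split soft_moment_def norm2_powr_half[symmetric]
  using \<gamma>_pos by (intro mult_left_mono soft_powr_le_powr) auto

lemma soft_moment_tendsto: "(\<lambda>n. soft_moment (inverse (real (Suc n))) \<xi>) \<longlonglongrightarrow> norm \<xi> powr (2 + \<gamma>)"
proof -
  have "(\<lambda>n. (norm \<xi>)\<^sup>2 / (1 + inverse (real (Suc n)) * (norm \<xi>)\<^sup>2)) \<longlonglongrightarrow> (norm \<xi>)\<^sup>2 / (1 + 0 * (norm \<xi>)\<^sup>2)"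
    by (intro tendsto_intros LIMSEQ_inverse_real_of_nat) simp
  then have "(\<lambda>n. ((norm \<xi>)\<^sup>2 / (1 + inverse (real (Suc n)) * (norm \<xi>)\<^sup>2)) powr (\<gamma> / 2)) \<longlonglongrightarrow> ((norm \<xi>)\<^sup>2) powr (\<gamma> / 2)"
    using \<gamma>_pos by (intro tendsto_powr') (auto intro!: always_eventually divide_nonneg_pos add_pos_nonneg)
  then show ?thesis
    unfolding norm_powr_split soft_moment_def norm2_powr_half[symmetric] soft_powr_def
    by (rule tendsto_mult[OF tendsto_const])
qed

lemma soft_radial_le: "0 \<le> \<epsilon> \<Longrightarrow> soft_powr (\<gamma> / 2) \<epsilon> ((norm (\<xi>::'a))\<^sup>2) \<le> norm \<xi> powr \<gamma>"
  unfolding norm2_powr_half[symmetric] using \<gamma>_pos by (intro soft_powr_le_powr) auto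

text \<open>Subadditivity splits \<open>E \<theta>(E)\<close>, with \<open>\<theta>\<close> the softened power, into the incoming moments and cross terms. Only
  the latter survive when the Povzner factor is one; where it is \<open>\<kappa>\<close>, the share \<open>1 - \<kappa>\<close> of the
  incoming moments is left over as dissipation.\<close>
lemma povzner_deficit:
  fixes \<xi> \<xi>s :: 'a
  assumes \<epsilon>: "0 < \<epsilon>" and \<kappa>: "0 \<le> \<kappa>" "\<kappa> < 1" and \<alpha>: "0 \<le> \<alpha>" "\<alpha> \<le> 1" and A0: "0 \<le> A"
    and A1: "A \<le> ((norm \<xi>)\<^sup>2 + (norm \<xi>s)\<^sup>2) * soft_powr (\<gamma> / 2) \<epsilon> ((norm \<xi>)\<^sup>2 + (norm \<xi>s)\<^sup>2)"
    and A2: "\<epsilon> * ((norm \<xi>)\<^sup>2 + (norm \<xi>s)\<^sup>2) \<le> 1 \<Longrightarrow>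
      A \<le> \<kappa> * (((norm \<xi>)\<^sup>2 + (norm \<xi>s)\<^sup>2) * soft_powr (\<gamma> / 2) \<epsilon> ((norm \<xi>)\<^sup>2 + (norm \<xi>s)\<^sup>2))"
  shows "(1 - \<alpha>) * A - (soft_moment \<epsilon> \<xi> + soft_moment \<epsilon> \<xi>s)
    \<le> ((norm \<xi>)\<^sup>2 * norm \<xi>s powr \<gamma> + (norm \<xi>s)\<^sup>2 * norm \<xi> powr \<gamma>)
      - (1 - \<kappa>) * (indicator {..1} (\<epsilon> * ((norm \<xi>)\<^sup>2 + (norm \<xi>s)\<^sup>2)) * (soft_moment \<epsilon> \<xi> + soft_moment \<epsilon> \<xi>s))"
proof -
  define x y where "x = (norm \<xi>)\<^sup>2" and "y = (norm \<xi>s)\<^sup>2"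
  define \<theta> where "\<theta> = soft_powr (\<gamma> / 2) \<epsilon>"
  define D where "D = x * norm \<xi>s powr \<gamma> + y * norm \<xi> powr \<gamma>"
  have xy: "0 \<le> x" "0 \<le> y" by (simp_all add: x_def y_def)
  have th: "\<theta> x \<le> norm \<xi> powr \<gamma>" "\<theta> y \<le> norm \<xi>s powr \<gamma>" "0 \<le> \<theta> x" "0 \<le> \<theta> y"
    unfolding \<theta>_def x_def y_def using \<epsilon> by (auto intro!: soft_radial_le soft_powr_nonneg)
  have "\<theta> (x + y) \<le> \<theta> x + \<theta> y"
    unfolding \<theta>_def using xy \<epsilon> \<gamma>_pos \<gamma>_le by (intro soft_powr_subadditive) auto
  then have "(x + y) * \<theta> (x + y) \<le> (x + y) * (\<theta> x + \<theta> y)" using xy by (intro mult_left_mono) auto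
  also have "\<dots> = x * \<theta> x + y * \<theta> y + (x * \<theta> y + y * \<theta> x)" by (simp add: algebra_simps)
  also have "\<dots> \<le> x * \<theta> x + y * \<theta> y + D"
    unfolding D_def using th xy by (intro add_left_mono add_mono mult_left_mono) auto
  finally have E: "(x + y) * \<theta> (x + y) \<le> (x * \<theta> x + y * \<theta> y) + D" .
  have D0: "0 \<le> D" unfolding D_def using xy by simp
  have S: "soft_moment \<epsilon> \<xi> + soft_moment \<epsilon> \<xi>s = x * \<theta> x + y * \<theta> y"
    by (simp add: soft_moment_def x_def y_def \<theta>_def)
  define S where "S = x * \<theta> x + y * \<theta> y"
  have le: "(1 - \<alpha>) * A \<le> A" using \<alpha> A0 by (simp add: mult_left_le_one_le)
  show ?thesis
  proof (cases "\<epsilon> * (x + y) \<le> 1")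
    case True
    have "A \<le> \<kappa> * ((x + y) * \<theta> (x + y))" using A2 True by (simp add: x_def y_def \<theta>_def)
    also have "\<dots> \<le> \<kappa> * (S + D)" unfolding S_def using \<kappa> E by (intro mult_left_mono) auto
    finally have "A \<le> \<kappa> * S + \<kappa> * D" by (simp add: distrib_left)
    moreover have "\<kappa> * D \<le> D" using \<kappa> D0 by (simp add: mult_left_le_one_le)
    ultimately have "(1 - \<alpha>) * A - S \<le> D - (1 - \<kappa>) * S" using le by (simp add: algebra_simps)
    then show ?thesis using True unfolding S S_def[symmetric] D_def by (simp add: x_def y_def)
  next
    case False
    have "A \<le> S + D" using A1 E unfolding S_def by (simp add: x_def y_def \<theta>_def)
    then have "(1 - \<alpha>) * A - S \<le> D" using le by linarith
    then show ?thesis using False unfolding S S_def[symmetric] D_def by (simp add: x_def y_def)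
  qed
qed

lemma norm_powr_le_1_plus: "0 \<le> a \<Longrightarrow> a \<le> 2 \<Longrightarrow> norm (\<xi>::'a) powr a \<le> 1 + (norm \<xi>)\<^sup>2"
proof -
  assume a: "0 \<le> a" "a \<le> 2"
  have "norm \<xi> powr a \<le> bracket \<xi> powr a" by (rule norm_powr_le_bracket[OF a(1)])
  also have "\<dots> \<le> bracket \<xi> powr 2" by (rule bracket_powr_mono[OF a(2)])
  finally show ?thesis by (simp add: bracket_powr_2)
qed

lemma mixed_weight_le:
  fixes \<xi> \<xi>s :: 'a
  shows "norm (\<xi> - \<xi>s) powr \<gamma> * ((norm \<xi>)\<^sup>2 * norm \<xi>s powr \<gamma>)
      \<le> norm \<xi> powr (2 + \<gamma>) * norm \<xi>s powr \<gamma> + (norm \<xi>)\<^sup>2 * norm \<xi>s powr (2 * \<gamma>)"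
    "norm \<xi> powr (2 + \<gamma>) * norm \<xi>s powr \<gamma> + (norm \<xi>)\<^sup>2 * norm \<xi>s powr (2 * \<gamma>) \<le> weight2 (2 + \<gamma>) \<xi> \<xi>s"
proof -
  have "norm (\<xi> - \<xi>s) powr \<gamma> * ((norm \<xi>)\<^sup>2 * norm \<xi>s powr \<gamma>)
      \<le> (norm \<xi> powr \<gamma> + norm \<xi>s powr \<gamma>) * ((norm \<xi>)\<^sup>2 * norm \<xi>s powr \<gamma>)"
    by (intro mult_right_mono relative_speed_powr_le) simp
  also have "\<dots> = norm \<xi> powr (2 + \<gamma>) * norm \<xi>s powr \<gamma> + (norm \<xi>)\<^sup>2 * (norm \<xi>s powr \<gamma> * norm \<xi>s powr \<gamma>)"
    by (simp only: norm_powr_split) (simp add: algebra_simps)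
  also have "norm \<xi>s powr \<gamma> * norm \<xi>s powr \<gamma> = norm \<xi>s powr (2 * \<gamma>)"
    by (simp add: powr_add[symmetric])
  finally show "norm (\<xi> - \<xi>s) powr \<gamma> * ((norm \<xi>)\<^sup>2 * norm \<xi>s powr \<gamma>)
      \<le> norm \<xi> powr (2 + \<gamma>) * norm \<xi>s powr \<gamma> + (norm \<xi>)\<^sup>2 * norm \<xi>s powr (2 * \<gamma>)" .
  have "(norm \<xi>)\<^sup>2 \<le> bracket \<xi> powr 2" by (simp add: bracket_powr_2)
  moreover have "norm \<xi>s powr (2 * \<gamma>) \<le> bracket \<xi>s powr (2 + \<gamma>)"
    using norm_powr_le_bracket[of "2 * \<gamma>" \<xi>s] bracket_powr_mono[of "2 * \<gamma>" "2 + \<gamma>" \<xi>s] \<gamma>_pos \<gamma>_le by linarith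
  moreover have "norm \<xi>s powr \<gamma> \<le> bracket \<xi>s powr 2"
    using norm_powr_le_1_plus[of \<gamma> \<xi>s] \<gamma>_pos \<gamma>_le by (simp add: bracket_powr_2)
  moreover have "norm \<xi> powr (2 + \<gamma>) \<le> bracket \<xi> powr (2 + \<gamma>)" using \<gamma>_pos by (intro norm_powr_le_bracket) simp
  ultimately show "norm \<xi> powr (2 + \<gamma>) * norm \<xi>s powr \<gamma> + (norm \<xi>)\<^sup>2 * norm \<xi>s powr (2 * \<gamma>) \<le> weight2 (2 + \<gamma>) \<xi> \<xi>s"
    unfolding weight2_def by (intro add_mono mult_mono) auto
qed

end

section \<open>Local boundedness of the moment\<close>

text \<open>The constant \<open>\<kappa>\<close> is a parameter because it has to be chosen before \<open>\<alpha>\<close> and \<open>\<psi>\<close>: it belongs to the kernel \<open>b\<close>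
  alone. Likewise \<open>d\<close> is a parameter so that the constants built from it do not refer to a solution.\<close>
locale annihilation_moments = annihilation_solution b \<gamma> velocity_space \<alpha> \<psi>
  for b :: "real \<Rightarrow> real" and \<gamma> :: real and velocity_space :: "'a::euclidean_space itself"
    and \<alpha> :: real and \<psi> :: "real \<Rightarrow> 'a \<Rightarrow> real" +
  fixes \<kappa> d :: real
  assumes d_eq: "d = real DIM('a)" and \<kappa>: "0 \<le> \<kappa>" "\<kappa> < 1"
    and povzner1: "\<And>\<epsilon> (\<xi>::'a) \<xi>s. \<epsilon> > 0 \<Longrightarrow> \<xi> \<noteq> \<xi>s \<Longrightarrow>
      average (soft_moment \<epsilon>) \<xi> \<xi>s + average (soft_moment \<epsilon>) \<xi>s \<xi>
        \<le> ((norm \<xi>)\<^sup>2 + (norm \<xi>s)\<^sup>2) * soft_powr (\<gamma> / 2) \<epsilon> ((norm \<xi>)\<^sup>2 + (norm \<xi>s)\<^sup>2)"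
    and povzner2: "\<And>\<epsilon> (\<xi>::'a) \<xi>s. \<epsilon> > 0 \<Longrightarrow> \<xi> \<noteq> \<xi>s \<Longrightarrow> \<epsilon> * ((norm \<xi>)\<^sup>2 + (norm \<xi>s)\<^sup>2) \<le> 1 \<Longrightarrow>
      average (soft_moment \<epsilon>) \<xi> \<xi>s + average (soft_moment \<epsilon>) \<xi>s \<xi>
        \<le> \<kappa> * (((norm \<xi>)\<^sup>2 + (norm \<xi>s)\<^sup>2) * soft_powr (\<gamma> / 2) \<epsilon> ((norm \<xi>)\<^sup>2 + (norm \<xi>s)\<^sup>2))"
    and small: "\<alpha> * (2 + \<gamma>) \<le> 1 - \<kappa>"
begin

definition moment :: "real \<Rightarrow> real" where
  "moment s = pairing (\<psi> s) (\<lambda>\<xi>. norm \<xi> powr (2 + \<gamma>))"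

text \<open>Bounds all moments of order at most two, since \<open>|\<xi>|\<^sup>a \<le> 1 + |\<xi>|\<^sup>2\<close>.\<close>
definition C1 :: real where "C1 = 1 + d / 2"
definition C2 :: real where "C2 = d / 2 * C1"

lemma d_ge_2: "2 \<le> d" using dim by (simp add: d_eq)
lemma C12: "0 \<le> C1" "0 \<le> C2" using d_ge_2 by (simp_all add: C1_def C2_def)

lemma powr_integrable:
  assumes "0 \<le> s" "0 \<le> a" "a \<le> 2 + \<gamma>"
  shows "integrable lborel (\<lambda>\<xi>. \<psi> s \<xi> * norm \<xi> powr a)"
proof (rule admissible_integrable[OF adm[OF assms(1)], where C=1])
  show "\<bar>norm \<xi> powr a\<bar> \<le> 1 * bracket \<xi> powr (2 + \<gamma>)" for \<xi> :: 'a
    using norm_powr_le_bracket[OF assms(2), of \<xi>] bracket_powr_mono[OF assms(3), of \<xi>] by simp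
qed measurable

lemma norm2_integrable: "0 \<le> s \<Longrightarrow> integrable lborel (\<lambda>\<xi>. \<psi> s \<xi> * (norm \<xi>)\<^sup>2)"
  by (rule quadratic_growth_integrable(1)[OF adm two_le_k quadratic_growth_norm2])

lemma one_integrable: "0 \<le> s \<Longrightarrow> integrable lborel (\<lambda>\<xi>. \<psi> s \<xi> * 1)"
  by (rule quadratic_growth_integrable(1)[OF adm two_le_k quadratic_growth_1])

lemma moment_nonneg: "0 \<le> s \<Longrightarrow> 0 \<le> moment s"
  unfolding moment_def by (rule pairing_nonneg[OF adm]) auto

lemma low_moment:
  assumes s: "0 \<le> s" and a: "0 \<le> a" "a \<le> 2"
  shows "0 \<le> pairing (\<psi> s) (\<lambda>\<xi>. norm \<xi> powr a)" "pairing (\<psi> s) (\<lambda>\<xi>. norm \<xi> powr a) \<le> C1"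
proof -
  show "0 \<le> pairing (\<psi> s) (\<lambda>\<xi>. norm \<xi> powr a)" by (rule pairing_nonneg[OF adm[OF s]]) simp
  have i: "integrable lborel (\<lambda>\<xi>. \<psi> s \<xi> * (1 + (norm \<xi>)\<^sup>2))"
    unfolding distrib_left by (intro Bochner_Integration.integrable_add norm2_integrable one_integrable s)
  have "pairing (\<psi> s) (\<lambda>\<xi>. norm \<xi> powr a) \<le> pairing (\<psi> s) (\<lambda>\<xi>. 1 + (norm \<xi>)\<^sup>2)"
    using a \<gamma>_pos by (intro pairing_mono[OF adm[OF s] _ i] powr_integrable norm_powr_le_1_plus s) auto
  also have "\<dots> = pairing (\<psi> s) (\<lambda>_. 1) + pairing (\<psi> s) (\<lambda>\<xi>. (norm \<xi>)\<^sup>2)"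
    unfolding pairing_def distrib_left
    by (intro Bochner_Integration.integral_add norm2_integrable one_integrable s)
  finally show "pairing (\<psi> s) (\<lambda>\<xi>. norm \<xi> powr a) \<le> C1"
    using mass_conserved[OF s] energy_conserved[OF s, folded d_eq] by (simp add: C1_def)
qed

text \<open>The cross terms of the Povzner inequality. Expanded, no velocity carries more than the power \<open>2 + \<gamma>\<close>, so they are only
  affine in the moment.\<close>
definition mixed :: "real \<Rightarrow> real" where
  "mixed s = interaction (\<psi> s) (\<lambda>x y. (norm x)\<^sup>2 * norm y powr \<gamma>)"

lemma mixed_integrable2:
  assumes s: "0 \<le> s"
  shows "integrable2 (\<psi> s) (\<lambda>x y. norm (x - y) powr \<gamma> * ((norm x)\<^sup>2 * norm y powr \<gamma>))"
    "\<bar>mixed s\<bar> \<le> 2 * collision_bound s"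
proof -
  have m: "(\<lambda>z::'a \<times> 'a. norm (fst z - snd z) powr \<gamma> * ((norm (fst z))\<^sup>2 * norm (snd z) powr \<gamma>)) \<in> borel_measurable (borel \<Otimes>\<^sub>M borel)"
    by measurable
  have b: "\<bar>norm (x - y) powr \<gamma> * ((norm x)\<^sup>2 * norm y powr \<gamma>)\<bar> \<le> 1 * weight2 (2 + \<gamma>) x y" for x y :: 'a
    using mixed_weight_le[of x y] by simp
  show "integrable2 (\<psi> s) (\<lambda>x y. norm (x - y) powr \<gamma> * ((norm x)\<^sup>2 * norm y powr \<gamma>))"
    by (rule pairing2_bound(1)[OF adm[OF s] two_le_k m b])
  show "\<bar>mixed s\<bar> \<le> 2 * collision_bound s"
    using pairing2_bound(2)[OF adm[OF s] two_le_k m b] Nn_product_le(1)[of s] by (simp add: mixed_def interaction_def)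
qed

lemma mixed_nonneg:
  assumes s: "0 \<le> s"
  shows "0 \<le> mixed s"
proof -
  have "pairing2 (\<psi> s) (\<lambda>_ _. 0) \<le> mixed s" unfolding mixed_def interaction_def
    by (rule pairing2_mono[OF adm[OF s] _ mixed_integrable2(1)[OF s]]) (simp_all add: integrable2_def)
  then show ?thesis by (simp add: pairing2_def)
qed

lemma mixed_le:
  assumes s: "0 \<le> s"
  shows "mixed s \<le> C1 * moment s + C2"
proof -
  have g: "0 \<le> 2 * \<gamma>" "2 * \<gamma> \<le> 2" "2 * \<gamma> \<le> 2 + \<gamma>" "0 \<le> \<gamma>" "\<gamma> \<le> 2" "\<gamma> \<le> 2 + \<gamma>" "0 \<le> 2 + \<gamma>" using \<gamma>_pos \<gamma>_le by auto
  note t1 = pairing2_tensor[OF powr_integrable[OF s g(7) order_refl] powr_integrable[OF s g(4,6)]]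
  note t2 = pairing2_tensor[OF norm2_integrable[OF s] powr_integrable[OF s g(1,3)]]
  have "mixed s \<le> pairing2 (\<psi> s) (\<lambda>x y. norm x powr (2 + \<gamma>) * norm y powr \<gamma> + (norm x)\<^sup>2 * norm y powr (2 * \<gamma>))"
    unfolding mixed_def interaction_def
    by (rule pairing2_mono[OF adm[OF s] mixed_integrable2(1)[OF s] pairing2_add(2)[OF t1(1) t2(1)] mixed_weight_le(1)])
  also have "\<dots> = moment s * pairing (\<psi> s) (\<lambda>\<xi>. norm \<xi> powr \<gamma>) + d / 2 * pairing (\<psi> s) (\<lambda>\<xi>. norm \<xi> powr (2 * \<gamma>))"
    unfolding pairing2_add(1)[OF t1(1) t2(1)] t1(2) t2(2) by (simp add: moment_def energy_conserved[OF s, folded d_eq])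
  also have "\<dots> \<le> moment s * C1 + d / 2 * C1"
    using low_moment[OF s g(4,5)] low_moment[OF s g(1,2)] moment_nonneg[OF s] d_ge_2
    by (intro add_mono mult_left_mono) auto
  finally show ?thesis by (simp add: C2_def mult.commute)
qed

lemma energy_rate_le:
  assumes s: "0 \<le> s"
  shows "energy_rate (\<psi> s) \<le> moment s + C2"
proof -
  have g: "0 \<le> \<gamma>" "\<gamma> \<le> 2" "\<gamma> \<le> 2 + \<gamma>" "0 \<le> 2 + \<gamma>" using \<gamma>_pos \<gamma>_le by auto
  note t1 = pairing2_tensor[OF powr_integrable[OF s g(4) order_refl] one_integrable[OF s]]
  note t2 = pairing2_tensor[OF norm2_integrable[OF s] powr_integrable[OF s g(1,3)]]
  have "energy_rate (\<psi> s) \<le> pairing2 (\<psi> s) (\<lambda>x y. norm x powr (2 + \<gamma>) * 1 + (norm x)\<^sup>2 * norm y powr \<gamma>)"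
    unfolding energy_rate_def interaction_def
  proof (rule pairing2_mono[OF adm[OF s] interaction_bound(1)[OF adm[OF s] growth2_norm2] pairing2_add(2)[OF t1(1) t2(1)]])
    fix x y :: 'a
    have "norm (x - y) powr \<gamma> * (norm x)\<^sup>2 \<le> (norm x powr \<gamma> + norm y powr \<gamma>) * (norm x)\<^sup>2"
      by (intro mult_right_mono relative_speed_powr_le) simp
    also have "\<dots> = norm x powr (2 + \<gamma>) * 1 + (norm x)\<^sup>2 * norm y powr \<gamma>"
      by (simp only: norm_powr_split) (simp add: algebra_simps)
    finally show "norm (x - y) powr \<gamma> * (norm x)\<^sup>2 \<le> norm x powr (2 + \<gamma>) * 1 + (norm x)\<^sup>2 * norm y powr \<gamma>" .
  qed
  also have "\<dots> = moment s * 1 + d / 2 * pairing (\<psi> s) (\<lambda>\<xi>. norm \<xi> powr \<gamma>)"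
    unfolding pairing2_add(1)[OF t1(1) t2(1)] t1(2) t2(2)
    by (simp add: moment_def energy_conserved[OF s, folded d_eq] mass_conserved[OF s])
  also have "\<dots> \<le> moment s * 1 + d / 2 * C1"
    using low_moment[OF s g(1,2)] moment_nonneg[OF s] d_ge_2 by (intro add_mono mult_left_mono) auto
  finally show ?thesis by (simp add: C2_def)
qed

definition soft :: "real \<Rightarrow> real \<Rightarrow> real" where
  "soft \<epsilon> s = pairing (\<psi> s) (soft_moment \<epsilon>)"

text \<open>Selects the pairs at which the softened power is not saturated.\<close>
definition near :: "real \<Rightarrow> 'a \<Rightarrow> 'a \<Rightarrow> real" where
  "near \<epsilon> x y = indicator {..1} (\<epsilon> * ((norm x)\<^sup>2 + (norm y)\<^sup>2))"

lemma near: "0 \<le> near \<epsilon> x y" "near \<epsilon> x y \<le> 1" "near \<epsilon> y x = near \<epsilon> x y"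
  by (auto simp: near_def indicator_def add.commute)

text \<open>What the strict Povzner inequality gains from the pairs in \<open>near\<close>.\<close>
definition dissipation :: "real \<Rightarrow> real \<Rightarrow> real" where
  "dissipation \<epsilon> s = interaction (\<psi> s) (\<lambda>x y. near \<epsilon> x y * soft_moment \<epsilon> x)"

lemma growth2_near_soft:
  assumes \<epsilon>: "0 < \<epsilon>"
  shows "growth2 (soft_growth \<epsilon>) (\<lambda>x y. near \<epsilon> x y * soft_moment \<epsilon> x)"
proof -
  note q = soft_quadratic_growth(1)[OF \<epsilon>]
  note [measurable] = quadratic_growth_measurable[OF q]
  have g: "growth2 (soft_growth \<epsilon>) (\<lambda>x y. soft_moment \<epsilon> x)" by (rule growth2_fst[OF q])
  have m: "(\<lambda>z. near \<epsilon> (fst z) (snd z) * soft_moment \<epsilon> (fst z)) \<in> borel_measurable (borel \<Otimes>\<^sub>M borel)"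
    unfolding near_def by measurable
  have "\<bar>near \<epsilon> x y * soft_moment \<epsilon> x\<bar> \<le> soft_growth \<epsilon> * (1 + (norm x)\<^sup>2 + (norm y)\<^sup>2)" if "x \<noteq> y" for x y
  proof -
    have "\<bar>near \<epsilon> x y * soft_moment \<epsilon> x\<bar> \<le> 1 * \<bar>soft_moment \<epsilon> x\<bar>"
      unfolding abs_mult using near[of \<epsilon> x y] by (intro mult_right_mono) auto
    also have "\<dots> \<le> soft_growth \<epsilon> * (1 + (norm x)\<^sup>2 + (norm y)\<^sup>2)" using g that by (simp add: growth2_def)
    finally show ?thesis .
  qed
  then show ?thesis using m quadratic_growth_nonneg[OF q] by (simp add: growth2_def)
qed

lemma dissipation_nonneg:
  assumes s: "0 \<le> s" and \<epsilon>: "0 < \<epsilon>"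
  shows "0 \<le> dissipation \<epsilon> s"
proof -
  have "growth2 0 (\<lambda>_ _::'a. 0)" by (simp add: growth2_def)
  from interaction_mono[OF adm[OF s] this growth2_near_soft[OF \<epsilon>]]
  have "interaction (\<psi> s) (\<lambda>_ _. 0) \<le> dissipation \<epsilon> s"
    unfolding dissipation_def using near soft_moment_nonneg by simp
  then show ?thesis by (simp add: interaction_def pairing2_def)
qed

lemma soft_nonneg: "0 \<le> s \<Longrightarrow> 0 \<le> soft \<epsilon> s"
  unfolding soft_def by (rule pairing_nonneg[OF adm]) (auto simp: soft_moment_nonneg)

lemma soft_le_moment: "0 \<le> s \<Longrightarrow> 0 < \<epsilon> \<Longrightarrow> soft \<epsilon> s \<le> moment s"
  unfolding soft_def moment_def using \<gamma>_pos
  by (intro pairing_mono[OF adm quadratic_growth_integrable(1)[OF adm two_le_k soft_quadratic_growth(1)] powr_integrable])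
     (auto simp: soft_moment_le)

text \<open>Symmetrize in the two particles, which turns the mean outgoing moment of one into that of both, and insert
  the Povzner inequality.\<close>
lemma gain_loss_soft_le:
  assumes s: "0 \<le> s" and \<epsilon>: "0 < \<epsilon>"
  shows "gain_loss (soft_moment \<epsilon>) s \<le> mixed s - (1 - \<kappa>) * dissipation \<epsilon> s"
proof -
  let ?\<rho> = "soft_moment \<epsilon> :: 'a \<Rightarrow> real"
  let ?u = "\<lambda>x y :: 'a. norm (x - y) powr \<gamma>"
  note q = soft_quadratic_growth(1)[OF \<epsilon>]
  note f = adm[OF s]
  have gA: "growth2 (soft_growth \<epsilon> + soft_growth \<epsilon>) (\<lambda>x y. average ?\<rho> x y + average ?\<rho> y x)"
    by (rule growth2_add[OF growth2_average[OF q] growth2_swap[OF growth2_average[OF q]]])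
  have gR: "growth2 (soft_growth \<epsilon> + soft_growth \<epsilon>) (\<lambda>x y. ?\<rho> x + ?\<rho> y)"
    by (rule growth2_add[OF growth2_fst[OF q] growth2_swap[OF growth2_fst[OF q]]])
  have gAc: "growth2 (\<bar>1 - \<alpha>\<bar> * (soft_growth \<epsilon> + soft_growth \<epsilon>)) (\<lambda>x y. (1 - \<alpha>) * (average ?\<rho> x y + average ?\<rho> y x))"
    by (rule growth2_cmult[OF gA])
  note gK = growth2_diff[OF gAc gR]
  have R: "interaction (\<psi> s) (\<lambda>x y. ?\<rho> x + ?\<rho> y) = 2 * interaction (\<psi> s) (\<lambda>x y. ?\<rho> x)"
    using interaction_add[OF f growth2_fst[OF q] growth2_swap[OF growth2_fst[OF q]]]
      interaction_swap[of "\<psi> s" "\<lambda>x y. ?\<rho> x"] by simp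
  have gl: "gain_loss ?\<rho> s = 1/2 * interaction (\<psi> s) (\<lambda>x y. (1 - \<alpha>) * (average ?\<rho> x y + average ?\<rho> y x) - (?\<rho> x + ?\<rho> y))"
  proof -
    have "(1 - \<alpha>) * (1/2 * x) - r = 1/2 * ((1 - \<alpha>) * x - 2 * r)" for x r :: real by (simp add: field_simps)
    then show ?thesis
      unfolding gain_loss_def interaction_diff[OF f gAc gR] interaction_cmult R interaction_average[OF q s] .
  qed
  define D where "D = (\<lambda>(x::'a) (y::'a). (norm x)\<^sup>2 * norm y powr \<gamma>)"
  define G where "G = (\<lambda>(x::'a) (y::'a). near \<epsilon> x y * ?\<rho> x)"
  have iD: "integrable2 (\<psi> s) (\<lambda>x y. ?u x y * D x y)" using mixed_integrable2(1)[OF s] by (simp add: D_def)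
  have iD': "integrable2 (\<psi> s) (\<lambda>x y. ?u x y * D y x)" using pairing2_swap(2)[OF iD] by (simp add: norm_minus_commute)
  have gG: "growth2 (soft_growth \<epsilon>) G" unfolding G_def by (rule growth2_near_soft[OF \<epsilon>])
  have iG: "integrable2 (\<psi> s) (\<lambda>x y. ?u x y * G x y)" by (rule interaction_bound(1)[OF f gG])
  have iG': "integrable2 (\<psi> s) (\<lambda>x y. ?u x y * G y x)" by (rule interaction_bound(1)[OF f growth2_swap[OF gG]])
  note iDD = pairing2_add[OF iD iD'] and iGG = pairing2_add[OF iG iG']
  note iT = pairing2_diff[OF iDD(2) pairing2_cmult(2)[OF iGG(2), of "1 - \<kappa>"]]
  have vD: "pairing2 (\<psi> s) (\<lambda>x y. ?u x y * D x y) = mixed s" by (simp add: mixed_def interaction_def D_def)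
  have vD': "pairing2 (\<psi> s) (\<lambda>x y. ?u x y * D y x) = mixed s"
    using interaction_swap[of "\<psi> s" D] vD by (simp add: interaction_def)
  have vG: "pairing2 (\<psi> s) (\<lambda>x y. ?u x y * G x y) = dissipation \<epsilon> s" by (simp add: dissipation_def interaction_def G_def)
  have vG': "pairing2 (\<psi> s) (\<lambda>x y. ?u x y * G y x) = dissipation \<epsilon> s"
    using interaction_swap[of "\<psi> s" G] vG by (simp add: interaction_def)
  have "interaction (\<psi> s) (\<lambda>x y. (1 - \<alpha>) * (average ?\<rho> x y + average ?\<rho> y x) - (?\<rho> x + ?\<rho> y))
    \<le> pairing2 (\<psi> s) (\<lambda>x y. (?u x y * D x y + ?u x y * D y x) - (1 - \<kappa>) * (?u x y * G x y + ?u x y * G y x))"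
    unfolding interaction_def
  proof (rule pairing2_mono[OF f interaction_bound(1)[OF f gK] iT(2)])
    fix x y :: 'a
    show "?u x y * ((1 - \<alpha>) * (average ?\<rho> x y + average ?\<rho> y x) - (?\<rho> x + ?\<rho> y))
      \<le> (?u x y * D x y + ?u x y * D y x) - (1 - \<kappa>) * (?u x y * G x y + ?u x y * G y x)"
    proof (cases "x = y")
      case False
      have A0: "0 \<le> average ?\<rho> x y + average ?\<rho> y x"
        unfolding average_def by (intro add_nonneg_nonneg integral_nonneg_AE AE_I2) (simp_all add: b_nonneg soft_moment_nonneg)
      have "(1 - \<alpha>) * (average ?\<rho> x y + average ?\<rho> y x) - (?\<rho> x + ?\<rho> y)
        \<le> ((norm x)\<^sup>2 * norm y powr \<gamma> + (norm y)\<^sup>2 * norm x powr \<gamma>)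
          - (1 - \<kappa>) * (indicator {..1} (\<epsilon> * ((norm x)\<^sup>2 + (norm y)\<^sup>2)) * (?\<rho> x + ?\<rho> y))"
        using \<alpha> by (intro povzner_deficit[OF \<epsilon> \<kappa> _ _ A0 povzner1[OF \<epsilon> False] povzner2[OF \<epsilon> False]]) auto
      also have "\<dots> = (D x y + D y x) - (1 - \<kappa>) * (G x y + G y x)"
        unfolding D_def G_def near_def add.commute[of "(norm y)\<^sup>2"] by (simp only: distrib_left)
      finally have "?u x y * ((1 - \<alpha>) * (average ?\<rho> x y + average ?\<rho> y x) - (?\<rho> x + ?\<rho> y))
        \<le> ?u x y * ((D x y + D y x) - (1 - \<kappa>) * (G x y + G y x))" by (intro mult_left_mono) auto
      then show ?thesis by (simp add: algebra_simps)
    qed simp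
  qed
  also have "\<dots> = 2 * mixed s - (1 - \<kappa>) * (2 * dissipation \<epsilon> s)"
    unfolding iT(1) iDD(1) pairing2_cmult(1) iGG(1) vD vD' vG vG' by simp
  finally show ?thesis unfolding gl by simp
qed

text \<open>The radial derivative is at least twice the softened moment, so the terms with \<open>collision_rate\<close> together
  are nonpositive; and it is at most \<open>2 + \<gamma>\<close> times the softened moment, which bounds the term with \<open>energy_rate\<close>.\<close>
lemma source_soft_le:
  assumes s: "0 \<le> s" and \<epsilon>: "0 < \<epsilon>"
  shows "source (soft_moment \<epsilon>) (\<lambda>\<xi>. \<xi> \<bullet> soft_gradient \<epsilon> \<xi>) s
    \<le> \<alpha> * (2 + \<gamma>) / d * energy_rate (\<psi> s) * soft \<epsilon> s + mixed s - (1 - \<kappa>) * dissipation \<epsilon> s"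
proof -
  note q = soft_quadratic_growth[OF \<epsilon>]
  note f = adm[OF s]
  define r where "r = pairing (\<psi> s) (\<lambda>\<xi>. \<xi> \<bullet> soft_gradient \<epsilon> \<xi>)"
  have i: "integrable lborel (\<lambda>\<xi>. \<psi> s \<xi> * (c * soft_moment \<epsilon> \<xi>))" for c
    using integrable_mult_right[OF quadratic_growth_integrable(1)[OF f two_le_k q(1)], of c] by (simp add: mult.left_commute)
  have p: "pairing (\<psi> s) (\<lambda>\<xi>. c * soft_moment \<epsilon> \<xi>) = c * soft \<epsilon> s" for c
    by (simp add: pairing_def soft_def mult.left_commute)
  have r: "2 * soft \<epsilon> s \<le> r" "r \<le> (2 + \<gamma>) * soft \<epsilon> s"
    unfolding r_def p[symmetric]
    using soft_radial_derivative[OF \<epsilon>]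
    by (auto intro!: pairing_mono[OF f i quadratic_growth_integrable(1)[OF f two_le_k q(2)]]
        pairing_mono[OF f quadratic_growth_integrable(1)[OF f two_le_k q(2)] i])
  have a: "\<alpha> * collision_rate (\<psi> s) * soft \<epsilon> s \<le> (\<alpha> / 2) * collision_rate (\<psi> s) * r"
    using mult_left_mono[OF r(1), of "\<alpha> / 2 * collision_rate (\<psi> s)"] \<alpha> collision_rate_nonneg[OF s] by simp
  have e: "(\<alpha> / d) * energy_rate (\<psi> s) * r \<le> (\<alpha> / d) * energy_rate (\<psi> s) * ((2 + \<gamma>) * soft \<epsilon> s)"
    using \<alpha> d_ge_2 energy_rate_nonneg[OF s] by (intro mult_left_mono r) auto
  have "source (soft_moment \<epsilon>) (\<lambda>\<xi>. \<xi> \<bullet> soft_gradient \<epsilon> \<xi>) s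
    = \<alpha> * collision_rate (\<psi> s) * soft \<epsilon> s - (\<alpha> / 2) * collision_rate (\<psi> s) * r
      + (\<alpha> / d) * energy_rate (\<psi> s) * r + gain_loss (soft_moment \<epsilon>) s"
    by (simp add: source_def soft_def r_def drift_def d_eq algebra_simps)
  also have "\<dots> \<le> (\<alpha> / d) * energy_rate (\<psi> s) * ((2 + \<gamma>) * soft \<epsilon> s) + mixed s - (1 - \<kappa>) * dissipation \<epsilon> s"
    using a e gain_loss_soft_le[OF s \<epsilon>] by linarith
  finally show ?thesis by (simp add: mult_ac)
qed

lemma mixed_set_integrable: "set_integrable lborel {0..t} mixed"
proof (rule time_integrable[where c=2])
  show "(\<lambda>s. mixed (max 0 s)) \<in> borel_measurable borel"
    unfolding mixed_def interaction_def
    by (rule pairing_time_measurable(2)[OF wc nn]) (measurable, rule mixed_integrable2(1))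
qed (auto simp: mixed_integrable2(2))

definition \<epsilon>s :: "nat \<Rightarrow> real" where "\<epsilon>s n = inverse (real (Suc n))"

lemma \<epsilon>s_pos: "0 < \<epsilon>s n" by (simp add: \<epsilon>s_def)

lemma soft_tendsto:
  assumes s: "0 \<le> s"
  shows "(\<lambda>n. soft (\<epsilon>s n) s) \<longlonglongrightarrow> moment s"
  unfolding soft_def moment_def
proof (rule pairing_tendsto[OF adm[OF s], where C=1])
  show "soft_moment (\<epsilon>s n) \<in> borel_measurable borel" for n
    by (rule quadratic_growth_measurable[OF soft_quadratic_growth(1)[OF \<epsilon>s_pos]])
  show "(\<lambda>n. soft_moment (\<epsilon>s n) \<xi>) \<longlonglongrightarrow> norm \<xi> powr (2 + \<gamma>)" for \<xi>
    unfolding \<epsilon>s_def by (rule soft_moment_tendsto)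
  show "\<bar>soft_moment (\<epsilon>s n) \<xi>\<bar> \<le> 1 * bracket \<xi> powr (2 + \<gamma>)" for n \<xi>
    using soft_moment_le[of "\<epsilon>s n" \<xi>] \<epsilon>s_pos[of n] norm_powr_le_bracket[of "2 + \<gamma>" \<xi>] \<gamma>_pos soft_moment_nonneg[of "\<epsilon>s n" \<xi>]
    by simp
qed

text \<open>Without the dissipation the inequality for the softened moment is linear, with coefficient and
  inhomogeneity integrable in time and independent of \<open>\<epsilon>\<close>. So Gronwall's lemma bounds the softened moments
  uniformly in \<open>\<epsilon>\<close>.\<close>
lemma moment_bounded:
  assumes T: "0 \<le> T"
  obtains B where "0 \<le> B" "\<And>t. 0 \<le> t \<Longrightarrow> t \<le> T \<Longrightarrow> moment t \<le> B"
proof -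
  define \<beta> where "\<beta> = (\<lambda>s. \<alpha> * (2 + \<gamma>) / d * energy_rate (\<psi> s))"
  have \<beta>i: "set_integrable lborel {0..t} \<beta>" for t unfolding \<beta>_def using rate_set_integrable(2) by simp
  have \<beta>0: "0 \<le> \<beta> s" if "0 \<le> s" for s unfolding \<beta>_def using \<alpha> \<gamma>_pos d_ge_2 energy_rate_nonneg[OF that] by simp
  obtain G where G: "0 \<le> G"
    "\<And>y K s. 0 \<le> K \<Longrightarrow> set_integrable lborel {0..T} (\<lambda>s. \<beta> s * y s) \<Longrightarrow> bdd_above (y ` {0..T}) \<Longrightarrow>
      (\<And>s. s \<in> {0..T} \<Longrightarrow> y s \<le> K + (LINT r:{0..s}|lborel. \<beta> r * y r)) \<Longrightarrow> s \<in> {0..T} \<Longrightarrow> y s \<le> G * K"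
    using gronwall[OF T \<beta>i \<beta>0] by blast
  define K where "K = moment 0 + (LINT s:{0..T}|lborel. mixed s)"
  have iM: "0 \<le> (LINT s:{a<..T}|lborel. mixed s)" if "0 \<le> a" for a
    unfolding set_lebesgue_integral_def using that mixed_nonneg by (intro integral_nonneg_AE AE_I2) (auto simp: indicator_def)
  have iM0: "0 \<le> (LINT s:{0..T}|lborel. mixed s)"
    unfolding set_lebesgue_integral_def using mixed_nonneg by (intro integral_nonneg_AE AE_I2) (auto simp: indicator_def)
  have K0: "0 \<le> K" using iM0 moment_nonneg[of 0] by (simp add: K_def)
  have soft: "soft \<epsilon> t \<le> G * K" if \<epsilon>: "0 < \<epsilon>" and t: "t \<in> {0..T}" for \<epsilon> t
  proof (rule G(2)[where y="soft \<epsilon>" and K=K and s=t])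
    note q = soft_quadratic_growth[OF \<epsilon>]
    have i: "set_integrable lborel {0..s} (\<lambda>s. \<beta> s * soft \<epsilon> s)" for s
    proof -
      have "set_integrable lborel {0..s} (\<lambda>s. \<alpha> * (2 + \<gamma>) / d * (energy_rate (\<psi> s) * pairing (\<psi> s) (soft_moment \<epsilon>)))"
        using rate_pairing_set_integrable(2)[OF q(1)] by simp
      then show ?thesis by (simp add: \<beta>_def soft_def mult.assoc)
    qed
    show "set_integrable lborel {0..T} (\<lambda>s. \<beta> s * soft \<epsilon> s)" by (rule i)
    have "bdd_above ((\<lambda>t. \<bar>pairing (\<psi> t) (soft_moment \<epsilon>) - 0\<bar>) ` {0..T})"
      by (rule pairing_bounded[OF GDERIV_soft_moment[OF \<epsilon>] continuous_soft_gradient[OF \<epsilon>] q])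
    then obtain u where "\<forall>x \<in> (\<lambda>t. \<bar>pairing (\<psi> t) (soft_moment \<epsilon>) - 0\<bar>) ` {0..T}. x \<le> u"
      unfolding bdd_above_def by blast
    then have u: "\<bar>soft \<epsilon> t\<bar> \<le> u" if "t \<in> {0..T}" for t using that by (simp add: soft_def)
    show "bdd_above (soft \<epsilon> ` {0..T})"
    proof (rule bdd_aboveI2)
      fix t assume "t \<in> {0..T}"
      then show "soft \<epsilon> t \<le> u" using u[of t] by simp
    qed
    fix s assume s: "s \<in> {0..T}"
    have "soft \<epsilon> s = soft \<epsilon> 0 + (LINT r:{0..s}|lborel. source (soft_moment \<epsilon>) (\<lambda>\<xi>. \<xi> \<bullet> soft_gradient \<epsilon> \<xi>) r)"
      unfolding soft_def by (rule weak_source[OF GDERIV_soft_moment[OF \<epsilon>] continuous_soft_gradient[OF \<epsilon>] q]) (use s in simp)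
    also have "\<dots> \<le> soft \<epsilon> 0 + (LINT r:{0..s}|lborel. \<beta> r * soft \<epsilon> r + mixed r)"
    proof (intro add_left_mono set_integral_mono)
      show "set_integrable lborel {0..s} (source (soft_moment \<epsilon>) (\<lambda>\<xi>. \<xi> \<bullet> soft_gradient \<epsilon> \<xi>))" by (rule source_integrable[OF q])
      show "set_integrable lborel {0..s} (\<lambda>r. \<beta> r * soft \<epsilon> r + mixed r)" by (intro set_integral_add(1) i mixed_set_integrable)
      fix r assume "r \<in> {0..s}"
      then have r: "0 \<le> r" by simp
      have "0 \<le> (1 - \<kappa>) * dissipation \<epsilon> r" using \<kappa> dissipation_nonneg[OF r \<epsilon>] by simp
      then show "source (soft_moment \<epsilon>) (\<lambda>\<xi>. \<xi> \<bullet> soft_gradient \<epsilon> \<xi>) r \<le> \<beta> r * soft \<epsilon> r + mixed r"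
        using source_soft_le[OF r \<epsilon>] unfolding \<beta>_def by linarith
    qed
    also have "(LINT r:{0..s}|lborel. \<beta> r * soft \<epsilon> r + mixed r) = (LINT r:{0..s}|lborel. \<beta> r * soft \<epsilon> r) + (LINT r:{0..s}|lborel. mixed r)"
      by (rule set_integral_add(2)[OF i mixed_set_integrable])
    also have "(LINT r:{0..s}|lborel. mixed r) \<le> (LINT r:{0..T}|lborel. mixed r)"
      using LINT_split(1)[OF mixed_set_integrable, of s T] iM[of s] s by simp
    finally show "soft \<epsilon> s \<le> K + (LINT r:{0..s}|lborel. \<beta> r * soft \<epsilon> r)"
      using soft_le_moment[of 0 \<epsilon>] \<epsilon> by (simp add: K_def)
  qed (use K0 t in auto)
  show ?thesis
  proof (rule that[of "G * K"])
    show "0 \<le> G * K" using G K0 by simp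
    show "moment t \<le> G * K" if "0 \<le> t" "t \<le> T" for t
      by (rule LIMSEQ_le_const2[OF soft_tendsto[OF that(1)]]) (use soft[OF \<epsilon>s_pos] that in auto)
  qed
qed

end

section \<open>The moment inequality\<close>

text \<open>Suppose that \<open>m t\<close> exceeds the level and let \<open>s0\<close> be the supremum of the earlier times at which \<open>m\<close> does not. After \<open>s0\<close>
  the rate is nonpositive, so from a time \<open>s\<close> just before \<open>s0\<close> the increase of \<open>m\<close> is at most
  \<open>C (s0 - s)\<close>, less than the gap. No continuity of \<open>m\<close> is involved.\<close>
lemma barrier:
  fixes m F :: "real \<Rightarrow> real"
  assumes inc: "\<And>s t. 0 \<le> s \<Longrightarrow> s \<le> t \<Longrightarrow> m t - m s \<le> (LINT x:{s<..t}|lborel. F x)"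
    and int: "\<And>s t. 0 \<le> s \<Longrightarrow> set_integrable lborel {s<..t} F"
    and C: "\<And>x. 0 \<le> x \<Longrightarrow> F x \<le> C" "0 \<le> C"
    and neg: "\<And>x. 0 \<le> x \<Longrightarrow> M \<le> m x \<Longrightarrow> F x \<le> 0" and t: "0 \<le> t"
  shows "m t \<le> max (m 0) M"
proof (rule ccontr)
  define L where "L = max (m 0) M"
  assume "\<not> m t \<le> max (m 0) M"
  then have gt: "L < m t" unfolding L_def by linarith
  define S where "S = {s \<in> {0..t}. m s \<le> L}"
  define s0 where "s0 = Sup S"
  have S0: "0 \<in> S" using t by (simp add: S_def L_def)
  have bdd: "bdd_above S" unfolding S_def by (rule bdd_aboveI[of _ t]) auto
  have s0: "0 \<le> s0" "s0 \<le> t"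
  proof -
    show "0 \<le> s0" unfolding s0_def by (rule cSup_upper[OF S0 bdd])
    show "s0 \<le> t" unfolding s0_def using S0 by (intro cSup_least) (auto simp: S_def)
  qed
  have above: "F x \<le> 0" if "s0 < x" "x \<le> t" for x
  proof -
    have "x \<notin> S" using that cSup_upper[OF _ bdd, of x] unfolding s0_def by auto
    then have "L < m x" using that s0 by (auto simp: S_def)
    then show ?thesis using that s0 by (intro neg) (auto simp: L_def)
  qed
  define e where "e = (m t - L) / (C + 1)"
  have e: "0 < e" using gt C(2) by (simp add: e_def)
  obtain s where s: "s \<in> S" "s0 - e < s"
    using less_cSup_iff[of S "s0 - e"] S0 bdd e unfolding s0_def by (metis diff_less_eq empty_iff less_add_same_cancel1)
  have s': "0 \<le> s" "s \<le> s0" "m s \<le> L" using s cSup_upper[OF s(1) bdd] by (auto simp: S_def s0_def)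
  have ie: "indicator {s<..t} x *\<^sub>R (C * indicator {..s0} x) = C * indicator {s<..s0} x" for x :: real
    using s0 by (auto simp: indicator_def)
  have "m t - m s \<le> (LINT x:{s<..t}|lborel. F x)" using s' s0 by (intro inc) auto
  also have "\<dots> \<le> (LINT x:{s<..t}|lborel. C * indicator {..s0} x)"
  proof (rule set_integral_mono)
    show "set_integrable lborel {s<..t} F" by (rule int[OF s'(1)])
    show "set_integrable lborel {s<..t} (\<lambda>x. C * indicator {..s0} x)"
      unfolding set_integrable_def ie using s' by (intro integrable_mult_right integrable_real_indicator) auto
    show "F x \<le> C * indicator {..s0} x" if "x \<in> {s<..t}" for x
      using C(1)[of x] above[of x] that s' by (cases "x \<le> s0") auto
  qed
  also have "\<dots> = C * (s0 - s)" unfolding set_lebesgue_integral_def ie using s' by simp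
  also have "\<dots> \<le> C * e" using s(2) C(2) by (intro mult_left_mono) auto
  also have "\<dots> < m t - L"
  proof -
    have "C * e < (C + 1) * e" using e by simp
    also have "\<dots> = m t - L" using C(2) by (simp add: e_def)
    finally show ?thesis .
  qed
  finally show False using s'(3) by simp
qed

context annihilation_moments
begin

text \<open>The three pairings in the lower bound for the dissipation. They contain no relative speed and no power
  above \<open>2 + \<gamma>\<close> of either velocity.\<close>
definition near1 :: "nat \<Rightarrow> real \<Rightarrow> real" where
  "near1 n s = pairing2 (\<psi> s) (\<lambda>x y. near (\<epsilon>s n) x y * soft_moment (\<epsilon>s n) x)"
definition near2 :: "nat \<Rightarrow> real \<Rightarrow> real" where
  "near2 n s = pairing2 (\<psi> s) (\<lambda>x y. near (\<epsilon>s n) x y * (norm x)\<^sup>2)"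
definition near3 :: "nat \<Rightarrow> real \<Rightarrow> real" where
  "near3 n s = pairing2 (\<psi> s) (\<lambda>x y. near (\<epsilon>s n) x y * (norm y powr \<gamma> * soft_moment (\<epsilon>s n) x))"

lemma soft_measurable [measurable]: "soft_moment (\<epsilon>s n) \<in> borel_measurable borel"
  by (rule quadratic_growth_measurable[OF soft_quadratic_growth(1)[OF \<epsilon>s_pos]])

lemma weight2_dominates:
  "norm (x::'a) powr (2 + \<gamma>) \<le> weight2 (2 + \<gamma>) x y" "(norm x)\<^sup>2 \<le> weight2 (2 + \<gamma>) x y"
  "norm y powr \<gamma> * norm x powr (2 + \<gamma>) \<le> weight2 (2 + \<gamma>) x (y::'a)"
proof -
  define p q p2 q2 where "p = bracket x powr (2 + \<gamma>)" and "q = bracket y powr (2 + \<gamma>)"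
    and "p2 = bracket x powr 2" and "q2 = bracket y powr 2"
  have g: "1 \<le> p" "1 \<le> q" "1 \<le> p2" "1 \<le> q2"
    unfolding p_def q_def p2_def q2_def using \<gamma>_pos bracket_ge_1[of x] bracket_ge_1[of y] by (auto intro!: ge_one_powr_ge_zero)
  have w: "weight2 (2 + \<gamma>) x y = p * q2 + p2 * q" by (simp add: weight2_def p_def q_def p2_def q2_def)
  have "p * 1 \<le> p * q2" "p2 * 1 \<le> p2 * q" using g by (auto intro!: mult_left_mono)
  moreover have "0 \<le> p * q2" "0 \<le> p2 * q" using g by auto
  moreover have np: "norm x powr (2 + \<gamma>) \<le> p" unfolding p_def using \<gamma>_pos by (intro norm_powr_le_bracket) simp
  moreover have "(norm x)\<^sup>2 \<le> p2" by (simp add: p2_def bracket_powr_2)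
  ultimately show "norm x powr (2 + \<gamma>) \<le> weight2 (2 + \<gamma>) x y" "(norm x)\<^sup>2 \<le> weight2 (2 + \<gamma>) x y"
    unfolding w by linarith+
  have "norm y powr \<gamma> \<le> q2" using norm_powr_le_1_plus[of \<gamma> y] \<gamma>_pos \<gamma>_le by (simp add: q2_def bracket_powr_2)
  then have "norm y powr \<gamma> * norm x powr (2 + \<gamma>) \<le> q2 * p" using np g by (intro mult_mono) auto
  then show "norm y powr \<gamma> * norm x powr (2 + \<gamma>) \<le> weight2 (2 + \<gamma>) x y"
    unfolding w using g by (simp add: mult.commute add_increasing2)
qed

lemma near_kernels:
  "(\<lambda>z. near (\<epsilon>s n) (fst z) (snd z) * soft_moment (\<epsilon>s n) (fst z)) \<in> borel_measurable (borel \<Otimes>\<^sub>M borel)"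
  "(\<lambda>z. near (\<epsilon>s n) (fst z) (snd z) * (norm (fst z))\<^sup>2) \<in> borel_measurable (borel \<Otimes>\<^sub>M borel)"
  "(\<lambda>z. near (\<epsilon>s n) (fst z) (snd z) * (norm (snd z) powr \<gamma> * soft_moment (\<epsilon>s n) (fst z))) \<in> borel_measurable (borel \<Otimes>\<^sub>M borel)"
  "\<bar>near (\<epsilon>s n) x y * soft_moment (\<epsilon>s n) x\<bar> \<le> 1 * weight2 (2 + \<gamma>) x y"
  "\<bar>near (\<epsilon>s n) x y * (norm x)\<^sup>2\<bar> \<le> 1 * weight2 (2 + \<gamma>) x y"
  "\<bar>near (\<epsilon>s n) x y * (norm y powr \<gamma> * soft_moment (\<epsilon>s n) x)\<bar> \<le> 1 * weight2 (2 + \<gamma>) x y"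
proof -
  show "(\<lambda>z. near (\<epsilon>s n) (fst z) (snd z) * soft_moment (\<epsilon>s n) (fst z)) \<in> borel_measurable (borel \<Otimes>\<^sub>M borel)"
    "(\<lambda>z. near (\<epsilon>s n) (fst z) (snd z) * (norm (fst z))\<^sup>2) \<in> borel_measurable (borel \<Otimes>\<^sub>M borel)"
    "(\<lambda>z. near (\<epsilon>s n) (fst z) (snd z) * (norm (snd z) powr \<gamma> * soft_moment (\<epsilon>s n) (fst z))) \<in> borel_measurable (borel \<Otimes>\<^sub>M borel)"
    unfolding near_def by measurable
  have sm: "soft_moment (\<epsilon>s n) x \<le> norm x powr (2 + \<gamma>)" using \<epsilon>s_pos[of n] by (intro soft_moment_le) simp
  have n: "\<bar>near (\<epsilon>s n) x y * h\<bar> \<le> 1 * h" if "0 \<le> h" for h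
    unfolding abs_mult using near[of "\<epsilon>s n" x y] that by (intro mult_mono) auto
  show "\<bar>near (\<epsilon>s n) x y * soft_moment (\<epsilon>s n) x\<bar> \<le> 1 * weight2 (2 + \<gamma>) x y"
    using n[OF soft_moment_nonneg, of "\<epsilon>s n" x] sm weight2_dominates(1)[of x y] by linarith
  show "\<bar>near (\<epsilon>s n) x y * (norm x)\<^sup>2\<bar> \<le> 1 * weight2 (2 + \<gamma>) x y"
    using n[OF zero_le_power2, of "norm x"] weight2_dominates(2)[of x y] by linarith
  have "norm y powr \<gamma> * soft_moment (\<epsilon>s n) x \<le> norm y powr \<gamma> * norm x powr (2 + \<gamma>)" by (intro mult_left_mono sm) simp
  moreover have "0 \<le> norm y powr \<gamma> * soft_moment (\<epsilon>s n) x" using soft_moment_nonneg[of "\<epsilon>s n" x] by simp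
  ultimately show "\<bar>near (\<epsilon>s n) x y * (norm y powr \<gamma> * soft_moment (\<epsilon>s n) x)\<bar> \<le> 1 * weight2 (2 + \<gamma>) x y"
    using n[of "norm y powr \<gamma> * soft_moment (\<epsilon>s n) x"] weight2_dominates(3)[of y x] by linarith
qed

lemma near_integrable2:
  assumes s: "0 \<le> s"
  shows "integrable2 (\<psi> s) (\<lambda>x y. near (\<epsilon>s n) x y * soft_moment (\<epsilon>s n) x)"
    "integrable2 (\<psi> s) (\<lambda>x y. near (\<epsilon>s n) x y * (norm x)\<^sup>2)"
    "integrable2 (\<psi> s) (\<lambda>x y. near (\<epsilon>s n) x y * (norm y powr \<gamma> * soft_moment (\<epsilon>s n) x))"
  by (rule pairing2_bound(1)[OF adm[OF s] two_le_k near_kernels(1) near_kernels(4)]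
      pairing2_bound(1)[OF adm[OF s] two_le_k near_kernels(2) near_kernels(5)]
      pairing2_bound(1)[OF adm[OF s] two_le_k near_kernels(3) near_kernels(6)])+

lemma near_bounds:
  assumes s: "0 \<le> s"
  shows "\<bar>near1 n s\<bar> \<le> 2 * (Nn (2 + \<gamma>) s * Nn 2 s)" "\<bar>near2 n s\<bar> \<le> 2 * (Nn (2 + \<gamma>) s * Nn 2 s)"
    "\<bar>near3 n s\<bar> \<le> 2 * (Nn (2 + \<gamma>) s * Nn 2 s)"
  unfolding near1_def near2_def near3_def
  using pairing2_bound(2)[OF adm[OF s] two_le_k near_kernels(1) near_kernels(4)]
      pairing2_bound(2)[OF adm[OF s] two_le_k near_kernels(2) near_kernels(5)]
      pairing2_bound(2)[OF adm[OF s] two_le_k near_kernels(3) near_kernels(6)] by simp_all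

lemma near_measurable:
  "(\<lambda>s. near1 n (max 0 s)) \<in> borel_measurable borel" "(\<lambda>s. near2 n (max 0 s)) \<in> borel_measurable borel"
  "(\<lambda>s. near3 n (max 0 s)) \<in> borel_measurable borel"
  unfolding near1_def near2_def near3_def
  by (rule pairing_time_measurable(2)[OF wc nn near_kernels(1) near_integrable2(1)]
      pairing_time_measurable(2)[OF wc nn near_kernels(2) near_integrable2(2)]
      pairing_time_measurable(2)[OF wc nn near_kernels(3) near_integrable2(3)]; assumption)+

lemma near_tendsto_1: "(\<lambda>n. near (\<epsilon>s n) x y) \<longlonglongrightarrow> 1"
proof (rule tendsto_eventually)
  define E where "E = (norm x)\<^sup>2 + (norm y)\<^sup>2"
  obtain N :: nat where N: "E < real N" using reals_Archimedean2 by blast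
  show "eventually (\<lambda>n. near (\<epsilon>s n) x y = 1) sequentially"
  proof (rule eventually_mono[OF eventually_ge_at_top[of N]])
    fix n assume "N \<le> n"
    then have "E \<le> real (Suc n)" using N by simp
    then have "\<epsilon>s n * E \<le> 1" by (simp add: \<epsilon>s_def divide_inverse[symmetric] mult.commute[of "inverse _"])
    then show "near (\<epsilon>s n) x y = 1" by (simp add: near_def E_def)
  qed
qed

lemma near_limits:
  assumes s: "0 \<le> s"
  shows "(\<lambda>n. near1 n s) \<longlonglongrightarrow> moment s" "(\<lambda>n. near2 n s) \<longlonglongrightarrow> d / 2"
    "(\<lambda>n. near3 n s) \<longlonglongrightarrow> moment s * pairing (\<psi> s) (\<lambda>\<xi>. norm \<xi> powr \<gamma>)"
proof -
  have g: "0 \<le> \<gamma>" "\<gamma> \<le> 2 + \<gamma>" "0 \<le> 2 + \<gamma>" using \<gamma>_pos \<gamma>_le by auto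
  note t1 = pairing2_tensor[OF powr_integrable[OF s g(3) order_refl] one_integrable[OF s]]
  note t2 = pairing2_tensor[OF norm2_integrable[OF s] one_integrable[OF s]]
  note t3 = pairing2_tensor[OF powr_integrable[OF s g(3) order_refl] powr_integrable[OF s g(1,2)]]
  have lm: "(\<lambda>n. soft_moment (\<epsilon>s n) x) \<longlonglongrightarrow> norm x powr (2 + \<gamma>)" for x :: 'a
    unfolding \<epsilon>s_def by (rule soft_moment_tendsto)
  have "(\<lambda>n. near1 n s) \<longlonglongrightarrow> pairing2 (\<psi> s) (\<lambda>x y. norm x powr (2 + \<gamma>) * 1)"
    unfolding near1_def
  proof (rule pairing2_tendsto[OF adm[OF s] two_le_k near_kernels(1) _ near_kernels(4)])
    show "(\<lambda>z::'a \<times> 'a. norm (fst z) powr (2 + \<gamma>) * 1) \<in> borel_measurable (borel \<Otimes>\<^sub>M borel)" by measurable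
    show "(\<lambda>n. near (\<epsilon>s n) x y * soft_moment (\<epsilon>s n) x) \<longlonglongrightarrow> norm x powr (2 + \<gamma>) * 1" for x y
      using tendsto_mult[OF near_tendsto_1[of x y] lm[of x]] by simp
  qed
  then show "(\<lambda>n. near1 n s) \<longlonglongrightarrow> moment s"
    unfolding t1(2) by (simp add: moment_def mass_conserved[OF s])
  have "(\<lambda>n. near2 n s) \<longlonglongrightarrow> pairing2 (\<psi> s) (\<lambda>x y. (norm x)\<^sup>2 * 1)"
    unfolding near2_def
  proof (rule pairing2_tendsto[OF adm[OF s] two_le_k near_kernels(2) _ near_kernels(5)])
    show "(\<lambda>z::'a \<times> 'a. (norm (fst z))\<^sup>2 * 1) \<in> borel_measurable (borel \<Otimes>\<^sub>M borel)" by measurable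
    show "(\<lambda>n. near (\<epsilon>s n) x y * (norm x)\<^sup>2) \<longlonglongrightarrow> (norm x)\<^sup>2 * 1" for x y
      using tendsto_mult[OF near_tendsto_1[of x y] tendsto_const] by simp
  qed
  then show "(\<lambda>n. near2 n s) \<longlonglongrightarrow> d / 2"
    unfolding t2(2) by (simp add: mass_conserved[OF s] energy_conserved[OF s, folded d_eq])
  have "(\<lambda>n. near3 n s) \<longlonglongrightarrow> pairing2 (\<psi> s) (\<lambda>x y. norm x powr (2 + \<gamma>) * norm y powr \<gamma>)"
    unfolding near3_def
  proof (rule pairing2_tendsto[OF adm[OF s] two_le_k near_kernels(3) _ near_kernels(6)])
    show "(\<lambda>z::'a \<times> 'a. norm (fst z) powr (2 + \<gamma>) * norm (snd z) powr \<gamma>) \<in> borel_measurable (borel \<Otimes>\<^sub>M borel)" by measurable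
    show "(\<lambda>n. near (\<epsilon>s n) x y * (norm y powr \<gamma> * soft_moment (\<epsilon>s n) x)) \<longlonglongrightarrow> norm x powr (2 + \<gamma>) * norm y powr \<gamma>" for x y
      using tendsto_mult[OF near_tendsto_1[of x y] tendsto_mult[OF tendsto_const lm[of x]]] by (simp add: mult.commute)
  qed
  then show "(\<lambda>n. near3 n s) \<longlonglongrightarrow> moment s * pairing (\<psi> s) (\<lambda>\<xi>. norm \<xi> powr \<gamma>)"
    unfolding t3(2) by (simp add: moment_def)
qed

text \<open>With \<open>|\<xi> - \<xi>\<^sub>*|\<^sup>\<gamma> \<ge> |\<xi>|\<^sup>\<gamma> - |\<xi>\<^sub>*|\<^sup>\<gamma>\<close> the dissipation is bounded below by the pairing of \<open>|\<xi>|\<^sup>2 \<theta> |\<xi>|\<^sup>\<gamma>\<close>, up to \<open>near3\<close>,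
  where \<open>\<theta>\<close> is the softened power. As \<open>\<epsilon>\<close> tends to zero this pairing approaches the possibly infinite moment of order
  \<open>2 + 2 \<gamma>\<close>. So it is bounded below by means of \<open>\<theta> |\<xi>|\<^sup>\<gamma> \<ge> \<theta>\<^sup>2 \<ge> 2 c \<theta> - c\<^sup>2\<close>, which is linear in \<open>\<theta>\<close>; optimizing \<open>c\<close>
  later recovers the Cauchy-Schwarz inequality.\<close>
lemma dissipation_ge:
  assumes s: "0 \<le> s"
  shows "2 * c * near1 n s - c\<^sup>2 * near2 n s - near3 n s \<le> dissipation (\<epsilon>s n) s"
proof -
  let ?\<rho> = "soft_moment (\<epsilon>s n) :: 'a \<Rightarrow> real"
  note i = near_integrable2[OF s, of n]
  note d12 = pairing2_diff[OF pairing2_cmult(2)[OF i(1), of "2 * c"] pairing2_cmult(2)[OF i(2), of "c\<^sup>2"]]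
  note d123 = pairing2_diff[OF d12(2) i(3)]
  have "2 * c * near1 n s - c\<^sup>2 * near2 n s - near3 n s
    = pairing2 (\<psi> s) (\<lambda>x y. 2 * c * (near (\<epsilon>s n) x y * ?\<rho> x) - c\<^sup>2 * (near (\<epsilon>s n) x y * (norm x)\<^sup>2)
        - near (\<epsilon>s n) x y * (norm y powr \<gamma> * ?\<rho> x))"
    unfolding d123(1) d12(1) pairing2_cmult(1) near1_def near2_def near3_def ..
  also have "\<dots> \<le> dissipation (\<epsilon>s n) s"
    unfolding dissipation_def interaction_def
  proof (rule pairing2_mono[OF adm[OF s] d123(2) interaction_bound(1)[OF adm[OF s] growth2_near_soft[OF \<epsilon>s_pos]]])
    fix x y :: 'a
    define \<theta> where "\<theta> = soft_powr (\<gamma> / 2) (\<epsilon>s n) ((norm x)\<^sup>2)"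
    have th: "0 \<le> \<theta>" "\<theta> \<le> norm x powr \<gamma>"
      unfolding \<theta>_def using \<epsilon>s_pos[of n] by (auto intro!: soft_powr_nonneg soft_radial_le)
    have \<rho>: "?\<rho> x = (norm x)\<^sup>2 * \<theta>" by (simp add: soft_moment_def \<theta>_def)
    have "norm x powr \<gamma> = norm ((x - y) - (- y)) powr \<gamma>" by simp
    also have "\<dots> \<le> norm (x - y) powr \<gamma> + norm (- y) powr \<gamma>" by (rule relative_speed_powr_le)
    finally have tri: "norm x powr \<gamma> - norm y powr \<gamma> \<le> norm (x - y) powr \<gamma>" by simp
    have "0 \<le> (\<theta> - c)\<^sup>2" by simp
    then have "2 * c * \<theta> - c\<^sup>2 \<le> \<theta> * \<theta>" by (simp add: power2_eq_square algebra_simps)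
    also have "\<dots> \<le> \<theta> * norm x powr \<gamma>" using th by (intro mult_left_mono) auto
    finally have "(norm x)\<^sup>2 * (2 * c * \<theta> - c\<^sup>2) \<le> (norm x)\<^sup>2 * (\<theta> * norm x powr \<gamma>)" by (intro mult_left_mono) auto
    then have "2 * c * ?\<rho> x - c\<^sup>2 * (norm x)\<^sup>2 \<le> ?\<rho> x * norm x powr \<gamma>" unfolding \<rho> by (simp add: algebra_simps)
    moreover have "?\<rho> x * (norm x powr \<gamma> - norm y powr \<gamma>) \<le> ?\<rho> x * norm (x - y) powr \<gamma>"
      by (intro mult_left_mono tri soft_moment_nonneg)
    ultimately have "2 * c * ?\<rho> x - c\<^sup>2 * (norm x)\<^sup>2 - norm y powr \<gamma> * ?\<rho> x \<le> ?\<rho> x * norm (x - y) powr \<gamma>"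
      by (simp add: algebra_simps)
    then have "near (\<epsilon>s n) x y * (2 * c * ?\<rho> x - c\<^sup>2 * (norm x)\<^sup>2 - norm y powr \<gamma> * ?\<rho> x)
        \<le> near (\<epsilon>s n) x y * (?\<rho> x * norm (x - y) powr \<gamma>)" by (intro mult_left_mono near)
    then show "2 * c * (near (\<epsilon>s n) x y * ?\<rho> x) - c\<^sup>2 * (near (\<epsilon>s n) x y * (norm x)\<^sup>2)
        - near (\<epsilon>s n) x y * (norm y powr \<gamma> * ?\<rho> x) \<le> norm (x - y) powr \<gamma> * (near (\<epsilon>s n) x y * ?\<rho> x)"
      by (simp add: algebra_simps)
  qed
  finally show ?thesis .
qed

lemma norm_bounds:
  assumes s: "0 \<le> s"
  shows "Nn 2 s = C1" "Nn (2 + \<gamma>) s \<le> 2 * C1 + moment s"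
proof -
  have g: "0 \<le> \<gamma>" "\<gamma> \<le> 2" "\<gamma> \<le> 2 + \<gamma>" "0 \<le> 2 + \<gamma>" using \<gamma>_pos \<gamma>_le by auto
  note i1 = one_integrable[OF s] and i2 = norm2_integrable[OF s] and i3 = powr_integrable[OF s g(1,3)]
    and i4 = powr_integrable[OF s g(4) order_refl]
  show "Nn 2 s = C1"
    unfolding weighted_L1_norm_eq[OF adm[OF s]] bracket_powr_2 C1_def
    using Bochner_Integration.integral_add[OF i1 i2] mass_conserved[OF s] energy_conserved[OF s, folded d_eq]
    by (simp add: pairing_def distrib_left)
  have i12: "integrable lborel (\<lambda>\<xi>. \<psi> s \<xi> * 1 + \<psi> s \<xi> * (norm \<xi>)\<^sup>2)" by (intro Bochner_Integration.integrable_add i1 i2)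
  have i34: "integrable lborel (\<lambda>\<xi>. \<psi> s \<xi> * norm \<xi> powr \<gamma> + \<psi> s \<xi> * norm \<xi> powr (2 + \<gamma>))" by (intro Bochner_Integration.integrable_add i3 i4)
  have iall: "integrable lborel (\<lambda>\<xi>. \<psi> s \<xi> * ((1 + (norm \<xi>)\<^sup>2) + (norm \<xi> powr \<gamma> + norm \<xi> powr (2 + \<gamma>))))"
    using Bochner_Integration.integrable_add[OF i12 i34] by (simp add: distrib_left)
  have "Nn (2 + \<gamma>) s \<le> pairing (\<psi> s) (\<lambda>\<xi>. (1 + (norm \<xi>)\<^sup>2) + (norm \<xi> powr \<gamma> + norm \<xi> powr (2 + \<gamma>)))"
    unfolding weighted_L1_norm_eq[OF adm[OF s]]
  proof (rule pairing_mono[OF adm[OF s] _ iall])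
    show "integrable lborel (\<lambda>\<xi>. \<psi> s \<xi> * bracket \<xi> powr (2 + \<gamma>))"
      using adm[OF s] by (simp add: admissible_def weighted_L1_def)
    fix x :: 'a
    have "bracket x powr \<gamma> = (bracket x powr 2) powr (\<gamma> / 2)" by (simp add: powr_powr)
    also have "\<dots> \<le> 1 powr (\<gamma> / 2) + ((norm x)\<^sup>2) powr (\<gamma> / 2)"
      unfolding bracket_powr_2 using \<gamma>_pos \<gamma>_le by (intro powr_subadditive) auto
    finally have "bracket x powr \<gamma> \<le> 1 + norm x powr \<gamma>" by (simp add: norm2_powr_half)
    then have "bracket x powr 2 * bracket x powr \<gamma> \<le> (1 + (norm x)\<^sup>2) * (1 + norm x powr \<gamma>)"
      unfolding bracket_powr_2 by (intro mult_left_mono) auto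
    also have "bracket x powr 2 * bracket x powr \<gamma> = bracket x powr (2 + \<gamma>)" by (simp only: powr_add)
    finally show "bracket x powr (2 + \<gamma>) \<le> (1 + (norm x)\<^sup>2) + (norm x powr \<gamma> + norm x powr (2 + \<gamma>))"
      by (simp only: norm_powr_split) (simp add: algebra_simps)
  qed
  also have "\<dots> = (pairing (\<psi> s) (\<lambda>_. 1) + pairing (\<psi> s) (\<lambda>\<xi>. (norm \<xi>)\<^sup>2))
      + (pairing (\<psi> s) (\<lambda>\<xi>. norm \<xi> powr \<gamma>) + moment s)"
    unfolding pairing_def moment_def distrib_left
    by (simp only: Bochner_Integration.integral_add[OF i12 i34] Bochner_Integration.integral_add[OF i1 i2] Bochner_Integration.integral_add[OF i3 i4])
  finally show "Nn (2 + \<gamma>) s \<le> 2 * C1 + moment s"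
    using mass_conserved[OF s] energy_conserved[OF s, folded d_eq] low_moment(2)[OF s g(1,2)] by (simp add: C1_def)
qed

lemma moment_measurable: "(\<lambda>s. moment (max 0 s)) \<in> borel_measurable borel"
  unfolding moment_def by (rule pairing_time_measurable(1)[OF wc nn]) measurable

text \<open>The choice \<open>c = 2 m / d\<close>, the moment over the energy, is optimal in the limit.\<close>
definition rate :: "nat \<Rightarrow> real \<Rightarrow> real" where
  "rate n s = \<alpha> * (2 + \<gamma>) / d * (moment s + C2) * soft (\<epsilon>s n) s + (C1 * moment s + C2)
    - (1 - \<kappa>) * (2 * (2 * moment s / d) * near1 n s - (2 * moment s / d)\<^sup>2 * near2 n s - near3 n s)"

definition limit_rate :: "real \<Rightarrow> real" where
  "limit_rate s = \<alpha> * (2 + \<gamma>) / d * (moment s + C2) * moment s + (C1 * moment s + C2)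
    - (1 - \<kappa>) * (2 * (2 * moment s / d) * moment s - (2 * moment s / d)\<^sup>2 * (d / 2)
      - moment s * pairing (\<psi> s) (\<lambda>\<xi>. norm \<xi> powr \<gamma>))"

lemma source_le_rate:
  assumes s: "0 \<le> s"
  shows "source (soft_moment (\<epsilon>s n)) (\<lambda>\<xi>. \<xi> \<bullet> soft_gradient (\<epsilon>s n) \<xi>) s \<le> rate n s"
proof -
  have "\<alpha> * (2 + \<gamma>) / d * energy_rate (\<psi> s) * soft (\<epsilon>s n) s \<le> \<alpha> * (2 + \<gamma>) / d * (moment s + C2) * soft (\<epsilon>s n) s"
    using \<alpha> \<gamma>_pos d_ge_2 by (intro mult_right_mono mult_left_mono energy_rate_le s soft_nonneg) auto
  moreover have "(1 - \<kappa>) * (2 * (2 * moment s / d) * near1 n s - (2 * moment s / d)\<^sup>2 * near2 n s - near3 n s)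
      \<le> (1 - \<kappa>) * dissipation (\<epsilon>s n) s" using \<kappa> by (intro mult_left_mono dissipation_ge s) auto
  ultimately show ?thesis
    using source_soft_le[OF s \<epsilon>s_pos, of n] mixed_le[OF s] unfolding rate_def by linarith
qed

lemma rate_tendsto:
  assumes s: "0 \<le> s"
  shows "(\<lambda>n. rate n s) \<longlonglongrightarrow> limit_rate s"
  unfolding rate_def limit_rate_def by (intro tendsto_intros soft_tendsto near_limits s)

lemma rate_bounded:
  assumes T: "0 \<le> T"
  obtains R where "0 \<le> R" "\<And>n s. 0 \<le> s \<Longrightarrow> s \<le> T \<Longrightarrow> \<bar>rate n s\<bar> \<le> R"
proof -
  obtain B where B: "0 \<le> B" "\<And>t. 0 \<le> t \<Longrightarrow> t \<le> T \<Longrightarrow> moment t \<le> B" using moment_bounded[OF T] by blast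
  define Q where "Q = 2 * ((2 * C1 + B) * C1)"
  have Q0: "0 \<le> Q" using B C12 by (simp add: Q_def)
  define c where "c = 2 * B / d"
  have c0: "0 \<le> c" using B d_ge_2 by (simp add: c_def)
  define a where "a = \<alpha> * (2 + \<gamma>) / d"
  have a0: "0 \<le> a" using \<alpha> \<gamma>_pos d_ge_2 by (simp add: a_def)
  define R where "R = a * (B + C2) * B + (C1 * B + C2) + (2 * c * Q + c\<^sup>2 * Q + Q)"
  have "\<bar>rate n s\<bar> \<le> R" if s: "0 \<le> s" "s \<le> T" for n s
  proof -
    define \<mu> where "\<mu> = moment s"
    have \<mu>: "0 \<le> \<mu>" "\<mu> \<le> B" using moment_nonneg[OF s(1)] B(2)[OF s] by (simp_all add: \<mu>_def)
    have N: "2 * (Nn (2 + \<gamma>) s * Nn 2 s) \<le> Q"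
      unfolding norm_bounds(1)[OF s(1)] Q_def using norm_bounds(2)[OF s(1)] \<mu> C12 unfolding \<mu>_def
      by (intro mult_left_mono mult_right_mono) auto
    define z where "z = 2 * \<mu> / d"
    have z: "0 \<le> z" "z \<le> c" using \<mu> d_ge_2 by (auto simp: z_def c_def divide_right_mono)
    have y: "0 \<le> soft (\<epsilon>s n) s" "soft (\<epsilon>s n) s \<le> B"
      using soft_nonneg[OF s(1)] soft_le_moment[OF s(1) \<epsilon>s_pos, of n] \<mu> unfolding \<mu>_def by (auto intro: order_trans)
    have ab: "0 \<le> a * (\<mu> + C2)" "a * (\<mu> + C2) \<le> a * (B + C2)" using a0 \<mu> C12 by (simp_all add: mult_left_mono)
    have "0 \<le> a * (\<mu> + C2) * soft (\<epsilon>s n) s" by (rule mult_nonneg_nonneg[OF ab(1) y(1)])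
    moreover have "a * (\<mu> + C2) * soft (\<epsilon>s n) s \<le> a * (B + C2) * B" 
      by (rule mult_mono[OF ab(2) y(2) _ y(1)]) (use ab in linarith)
    ultimately have 1: "0 \<le> a * (\<mu> + C2) * soft (\<epsilon>s n) s" "a * (\<mu> + C2) * soft (\<epsilon>s n) s \<le> a * (B + C2) * B" .
    have 2: "0 \<le> C1 * \<mu> + C2" "C1 * \<mu> + C2 \<le> C1 * B + C2" using \<mu> C12 by (simp_all add: mult_left_mono)
    note nb = order_trans[OF near_bounds(1)[OF s(1), of n] N] order_trans[OF near_bounds(2)[OF s(1), of n] N]
      order_trans[OF near_bounds(3)[OF s(1), of n] N]
    have "\<bar>2 * z * near1 n s\<bar> = (2 * z) * \<bar>near1 n s\<bar>" using z by (simp add: abs_mult)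
    also have "\<dots> \<le> (2 * c) * Q" using z nb(1) Q0 by (intro mult_mono) linarith+
    finally have 31: "\<bar>2 * z * near1 n s\<bar> \<le> 2 * c * Q" .
    have "\<bar>z\<^sup>2 * near2 n s\<bar> = z\<^sup>2 * \<bar>near2 n s\<bar>" by (simp add: abs_mult)
    also have "\<dots> \<le> c\<^sup>2 * Q" using z nb(2) by (intro mult_mono power_mono) auto
    finally have 32: "\<bar>z\<^sup>2 * near2 n s\<bar> \<le> c\<^sup>2 * Q" .
    have 3: "\<bar>2 * z * near1 n s - z\<^sup>2 * near2 n s - near3 n s\<bar> \<le> 2 * c * Q + c\<^sup>2 * Q + Q"
      using 31 32 nb(3) by linarith
    have "\<bar>(1 - \<kappa>) * (2 * z * near1 n s - z\<^sup>2 * near2 n s - near3 n s)\<bar> \<le> 1 * (2 * c * Q + c\<^sup>2 * Q + Q)"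
      unfolding abs_mult[of "1 - \<kappa>"] using \<kappa> 3 by (intro mult_mono) auto
    moreover have "\<bar>p + q - r\<bar> \<le> P + V + U" if "\<bar>r\<bar> \<le> 1 * U" "0 \<le> p" "p \<le> P" "0 \<le> q" "q \<le> V" for p q r P V U :: real
      using that by linarith
    ultimately show ?thesis using 1 2 unfolding rate_def R_def \<mu>_def[symmetric] z_def[symmetric] a_def[symmetric] by blast
  qed
  moreover have "0 \<le> R" unfolding R_def using a0 B C12 c0 Q0 by simp
  ultimately show ?thesis using that by blast
qed

lemma rate_measurable: "(\<lambda>s. rate n (max 0 s)) \<in> borel_measurable borel"
proof -
  note [measurable] = moment_measurable near_measurable
    source_measurable_terms(4)[OF soft_quadratic_growth(1)[OF \<epsilon>s_pos], folded soft_def]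
  show ?thesis unfolding rate_def by measurable
qed

lemma limit_rate_measurable: "(\<lambda>s. limit_rate (max 0 s)) \<in> borel_measurable borel"
  by (rule borel_measurable_LIMSEQ_real[OF rate_tendsto rate_measurable]) simp

lemma bounded_set_integrable:
  assumes m: "(\<lambda>s. G (max 0 s)) \<in> borel_measurable borel" and G: "\<And>s. 0 \<le> s \<Longrightarrow> s \<le> t \<Longrightarrow> \<bar>G s\<bar> \<le> R" and r: "0 \<le> r"
  shows "set_integrable lborel {r<..t} (G :: real \<Rightarrow> real)"
proof -
  have e: "indicator {r<..t} s *\<^sub>R G s = indicator {r<..t} s * G (max 0 s)" for s
    using r by (auto simp: indicator_def max_def)
  have f: "emeasure lborel {r<..t} < \<infinity>" by (cases "r \<le> t") auto
  show ?thesis unfolding set_integrable_def e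
  proof (rule Bochner_Integration.integrable_bound)
    show "integrable lborel (\<lambda>s. R * indicator {r<..t} s)" using f by (intro integrable_mult_right integrable_real_indicator) auto
    note [measurable] = m
    show "(\<lambda>s. indicator {r<..t} s * G (max 0 s)) \<in> borel_measurable lborel" by measurable
    show "AE s in lborel. norm (indicator {r<..t} s * G (max 0 s)) \<le> norm (R * indicator {r<..t} s)"
    proof (rule AE_I2)
      fix s
      show "norm (indicator {r<..t} s * G (max 0 s)) \<le> norm (R * indicator {r<..t} s)"
        using G[of s] r by (cases "s \<in> {r<..t}") (auto simp: max_def)
    qed
  qed
qed

lemma limit_rate_bounded:
  assumes T: "0 \<le> T"
  obtains R where "0 \<le> R" "\<And>s. 0 \<le> s \<Longrightarrow> s \<le> T \<Longrightarrow> \<bar>limit_rate s\<bar> \<le> R"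
proof -
  obtain R where R: "0 \<le> R" "\<And>n s. 0 \<le> s \<Longrightarrow> s \<le> T \<Longrightarrow> \<bar>rate n s\<bar> \<le> R" using rate_bounded[OF T] by blast
  have "\<bar>limit_rate s\<bar> \<le> R" if "0 \<le> s" "s \<le> T" for s
    by (rule LIMSEQ_le_const2[OF tendsto_rabs[OF rate_tendsto[OF that(1)]]]) (use R(2)[OF that] in auto)
  with R(1) show ?thesis using that by blast
qed

lemma limit_rate_set_integrable:
  assumes "0 \<le> s"
  shows "set_integrable lborel {s<..t} limit_rate"
proof (cases "0 \<le> t")
  case True
  obtain R where "\<And>s. 0 \<le> s \<Longrightarrow> s \<le> t \<Longrightarrow> \<bar>limit_rate s\<bar> \<le> R" using limit_rate_bounded[OF True] by blast
  then show ?thesis using assms by (intro bounded_set_integrable[OF limit_rate_measurable])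
next
  case False
  then have "{s<..t} = {}" using assms by auto
  then show ?thesis by (simp add: set_integrable_def)
qed

text \<open>On bounded time intervals the rates are bounded uniformly in \<open>n\<close>, because the moment is.\<close>
theorem moment_increment:
  assumes s: "0 \<le> s" and st: "s \<le> t"
  shows "moment t - moment s \<le> (LINT r:{s<..t}|lborel. limit_rate r)"
proof -
  have t: "0 \<le> t" using s st by simp
  obtain R where R: "0 \<le> R" "\<And>n s. 0 \<le> s \<Longrightarrow> s \<le> t \<Longrightarrow> \<bar>rate n s\<bar> \<le> R" using rate_bounded[OF t] by blast
  have ri: "set_integrable lborel {s<..t} (rate n)" for n
    by (rule bounded_set_integrable[OF rate_measurable R(2) s])
  have inc: "soft (\<epsilon>s n) t - soft (\<epsilon>s n) s \<le> (LINT r:{s<..t}|lborel. rate n r)" for n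
  proof -
    note q = soft_quadratic_growth[OF \<epsilon>s_pos, of n]
    note w = weak_source[OF GDERIV_soft_moment[OF \<epsilon>s_pos] continuous_soft_gradient[OF \<epsilon>s_pos] q, folded soft_def]
    note sp = LINT_split[OF source_integrable[OF q] s st]
    have "soft (\<epsilon>s n) t - soft (\<epsilon>s n) s = (LINT r:{s<..t}|lborel. source (soft_moment (\<epsilon>s n)) (\<lambda>\<xi>. \<xi> \<bullet> soft_gradient (\<epsilon>s n) \<xi>) r)"
      using w[OF s] w[OF t] sp(1) by linarith
    also have "\<dots> \<le> (LINT r:{s<..t}|lborel. rate n r)"
      by (rule set_integral_mono[OF sp(3) ri]) (use s source_le_rate in auto)
    finally show ?thesis .
  qed
  have "(\<lambda>n. LINT r:{s<..t}|lborel. rate n r) \<longlonglongrightarrow> (LINT r:{s<..t}|lborel. limit_rate r)"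
    unfolding set_lebesgue_integral_def
  proof (rule integral_dominated_convergence[where w="\<lambda>r. R * indicator {s<..t} r"])
    show "(\<lambda>r. indicator {s<..t} r *\<^sub>R limit_rate r) \<in> borel_measurable lborel"
      using limit_rate_set_integrable[OF s, of t] by (simp add: set_integrable_def)
    show "(\<lambda>r. indicator {s<..t} r *\<^sub>R rate n r) \<in> borel_measurable lborel" for n
      using ri[of n] by (simp add: set_integrable_def)
    show "integrable lborel (\<lambda>r. R * indicator {s<..t} r)"
      using st by (intro integrable_mult_right integrable_real_indicator) auto
    show "AE r in lborel. (\<lambda>n. indicator {s<..t} r *\<^sub>R rate n r) \<longlonglongrightarrow> indicator {s<..t} r *\<^sub>R limit_rate r"
    proof (rule AE_I2)
      fix r
      show "(\<lambda>n. indicator {s<..t} r *\<^sub>R rate n r) \<longlonglongrightarrow> indicator {s<..t} r *\<^sub>R limit_rate r"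
        using rate_tendsto[of r] s by (cases "r \<in> {s<..t}") auto
    qed
    show "AE r in lborel. norm (indicator {s<..t} r *\<^sub>R rate n r) \<le> R * indicator {s<..t} r" for n
    proof (rule AE_I2)
      fix r
      show "norm (indicator {s<..t} r *\<^sub>R rate n r) \<le> R * indicator {s<..t} r"
        using R(2)[of r n] s by (cases "r \<in> {s<..t}") auto
    qed
  qed
  from LIMSEQ_le[OF tendsto_diff[OF soft_tendsto[OF t] soft_tendsto[OF s]] this]
  show ?thesis using inc by blast
qed

text \<open>Beyond \<open>d (2 C1 + 2 C2) / (1 - \<kappa>)\<close> the quadratic term beats \<open>(2 C1 + 2 C2) m\<close>, and the summand one
  ensures \<open>m \<ge> 1\<close>, so that the constant \<open>C2\<close> is at most \<open>C2 m\<close>.\<close>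
definition moment_barrier :: real where
  "moment_barrier = d * (2 * C1 + 2 * C2) / (1 - \<kappa>) + 1"

text \<open>The dissipation contributes \<open>2 (1 - \<kappa>) m\<^sup>2 / d\<close>; since \<open>\<alpha> (2 + \<gamma>) \<le> 1 - \<kappa>\<close>, the energy
  rate consumes at most half of it.\<close>
lemma limit_rate_le:
  assumes s: "0 \<le> s"
  shows "limit_rate s \<le> - ((1 - \<kappa>) / d) * (moment s)\<^sup>2 + (C2 + 2 * C1) * moment s + C2"
proof -
  define \<mu> where "\<mu> = moment s"
  define \<nu> where "\<nu> = pairing (\<psi> s) (\<lambda>\<xi>. norm \<xi> powr \<gamma>)"
  have \<mu>: "0 \<le> \<mu>" using moment_nonneg[OF s] by (simp add: \<mu>_def)
  have \<nu>: "0 \<le> \<nu>" "\<nu> \<le> C1" using low_moment[OF s, of \<gamma>] \<gamma>_pos \<gamma>_le by (simp_all add: \<nu>_def)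
  define k where "k = 1 - \<kappa>"
  have k: "0 < k" "k \<le> 1" using \<kappa> by (simp_all add: k_def)
  have "\<alpha> * (2 + \<gamma>) / d \<le> k / d" using small d_ge_2 by (intro divide_right_mono) (auto simp: k_def)
  then have 1: "\<alpha> * (2 + \<gamma>) / d * ((\<mu> + C2) * \<mu>) \<le> k / d * ((\<mu> + C2) * \<mu>)"
    using \<mu> C12 by (intro mult_right_mono) auto
  have "k / d \<le> 1" using k d_ge_2 by (simp add: divide_le_eq)
  then have 2: "k / d * (C2 * \<mu>) \<le> 1 * (C2 * \<mu>)" using \<mu> C12 by (intro mult_right_mono) auto
  have 3: "k * (\<mu> * \<nu>) \<le> 1 * (\<mu> * C1)" using k \<mu> \<nu> by (intro mult_mono) auto
  have 4: "2 * (2 * \<mu> / d) * \<mu> - (2 * \<mu> / d)\<^sup>2 * (d / 2) = 2 * (\<mu>\<^sup>2 / d)"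
    using d_ge_2 by (simp add: power2_eq_square field_simps)
  have "limit_rate s = \<alpha> * (2 + \<gamma>) / d * ((\<mu> + C2) * \<mu>) + (C1 * \<mu> + C2) - k * (2 * (\<mu>\<^sup>2 / d) - \<mu> * \<nu>)"
    unfolding limit_rate_def \<mu>_def[symmetric] \<nu>_def[symmetric] k_def[symmetric] 4 by (simp only: mult.assoc)
  also have "\<dots> \<le> k / d * ((\<mu> + C2) * \<mu>) + (C1 * \<mu> + C2) - k * (2 * (\<mu>\<^sup>2 / d)) + k * (\<mu> * \<nu>)"
    using 1 by (simp add: right_diff_distrib)
  also have "k / d * ((\<mu> + C2) * \<mu>) = k / d * \<mu>\<^sup>2 + k / d * (C2 * \<mu>)"
    by (simp add: power2_eq_square distrib_left distrib_right)
  also have "k * (2 * (\<mu>\<^sup>2 / d)) = 2 * (k / d * \<mu>\<^sup>2)" by simp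
  finally have L: "limit_rate s \<le> k / d * \<mu>\<^sup>2 + k / d * (C2 * \<mu>) + (C1 * \<mu> + C2) - 2 * (k / d * \<mu>\<^sup>2) + k * (\<mu> * \<nu>)" .
  have "l \<le> - w + q + p + c + p'" if "l \<le> w + u + (p + c) - 2 * w + v" "u \<le> 1 * q" "v \<le> 1 * p'"
    for l w u v p c q p' :: real using that by linarith
  from this[OF L 2 3] have "limit_rate s \<le> - (k / d * \<mu>\<^sup>2) + C2 * \<mu> + C1 * \<mu> + C2 + \<mu> * C1" .
  then show ?thesis unfolding \<mu>_def[symmetric] k_def[symmetric] by (simp add: algebra_simps)
qed

theorem moment_le:
  assumes t: "0 \<le> t"
  shows "moment t \<le> max (moment 0) moment_barrier"
proof (rule barrier[where F=limit_rate and C="(C2 + 2 * C1) * moment_barrier + C2"])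
  define k where "k = 1 - \<kappa>"
  have k: "0 < k" using \<kappa> by (simp add: k_def)
  have M: "1 \<le> moment_barrier" unfolding moment_barrier_def using k d_ge_2 C12 by (simp add: k_def)
  show "moment t - moment s \<le> (LINT x:{s<..t}|lborel. limit_rate x)" if "0 \<le> s" "s \<le> t" for s t
    by (rule moment_increment[OF that])
  show "set_integrable lborel {s<..t} limit_rate" if "0 \<le> s" for s t by (rule limit_rate_set_integrable[OF that])
  show neg: "limit_rate x \<le> 0" if x: "0 \<le> x" and ge: "moment_barrier \<le> moment x" for x
  proof -
    define \<mu> where "\<mu> = moment x"
    have \<mu>: "1 \<le> \<mu>" "d * (2 * C1 + 2 * C2) / k \<le> \<mu>" using M ge by (simp_all add: \<mu>_def moment_barrier_def k_def)
    have "2 * C1 + 2 * C2 \<le> k / d * \<mu>" using \<mu>(2) k d_ge_2 by (simp add: field_simps)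
    then have "(2 * C1 + 2 * C2) * \<mu> \<le> k / d * \<mu> * \<mu>" using \<mu>(1) by (intro mult_right_mono) auto
    moreover have "C2 * 1 \<le> C2 * \<mu>" using \<mu>(1) C12 by (intro mult_left_mono) auto
    moreover have "limit_rate x \<le> - (k / d) * \<mu>\<^sup>2 + (C2 + 2 * C1) * \<mu> + C2"
      using limit_rate_le[OF x] by (simp add: \<mu>_def k_def)
    ultimately show ?thesis by (simp add: power2_eq_square algebra_simps)
  qed
  have c: "0 \<le> (C2 + 2 * C1) * moment_barrier + C2" using M C12 by simp
  then show "0 \<le> (C2 + 2 * C1) * moment_barrier + C2" .
  show "limit_rate x \<le> (C2 + 2 * C1) * moment_barrier + C2" if x: "0 \<le> x" for x
  proof (cases "moment_barrier \<le> moment x")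
    case True
    then show ?thesis using neg[OF x] c by linarith
  next
    case False
    have "(C2 + 2 * C1) * moment x \<le> (C2 + 2 * C1) * moment_barrier" using False C12 by (intro mult_left_mono) auto
    moreover have "0 \<le> k / d * (moment x)\<^sup>2" using k d_ge_2 by simp
    ultimately show ?thesis using limit_rate_le[OF x] by (simp add: k_def)
  qed
qed (rule t)

end

section \<open>The uniform moment bound\<close>

text \<open>The integral over \<open>{-1..1}\<close> is nonzero, so it is not the default value of a divergent integral.\<close>
lemma angular_kernel_extend_zero:
  fixes b :: "real \<Rightarrow> real"
  assumes dim: "2 \<le> DIM('a::euclidean_space)" and \<gamma>: "0 < \<gamma>" "\<gamma> \<le> 1"
    and m: "b \<in> borel_measurable (restrict_space borel {-1..1})"
    and nn: "\<And>t. t \<in> {-1..1} \<Longrightarrow> 0 \<le> b t"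
    and mass: "sphere_area (DIM('a) - 2) * (LINT t:{-1..1}|lborel. b t * (1 - t\<^sup>2) powr ((real DIM('a) - 3) / 2)) = 1"
  shows "angular_kernel TYPE('a) (\<lambda>t. indicator {-1..1} t *\<^sub>R b t) \<gamma>"
proof
  show bm: "(\<lambda>t. indicator {-1..1} t *\<^sub>R b t) \<in> borel_measurable borel"
    using m by (subst (asm) borel_measurable_restrict_space_iff) auto
  show b0: "0 \<le> indicator {-1..1} t *\<^sub>R b t" for t :: real using nn[of t] by (simp add: indicator_def)
  define w where "w = (\<lambda>t::real. (1 - t\<^sup>2) powr ((real DIM('a) - 3) / 2))"
  define I where "I = (LINT t|lborel. indicator {-1..1} t *\<^sub>R (b t * w t))"
  have mI: "sphere_area (DIM('a) - 2) * I = 1" using mass by (simp add: I_def w_def set_lebesgue_integral_def)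
  then have "I \<noteq> 0" by auto
  then have int: "integrable lborel (\<lambda>t. indicator {-1..1} t *\<^sub>R (b t * w t))"
    unfolding I_def using not_integrable_integral_eq by blast
  have "(\<integral>\<^sup>+t. ennreal (indicator {-1..1} t *\<^sub>R b t) * ennreal (w t) * indicator {-1..1} t \<partial>lborel)
    = (\<integral>\<^sup>+t. ennreal (indicator {-1..1} t *\<^sub>R (b t * w t)) \<partial>lborel)"
  proof (rule nn_integral_cong)
    fix t :: real
    show "ennreal (indicator {-1..1} t *\<^sub>R b t) * ennreal (w t) * indicator {-1..1} t = ennreal (indicator {-1..1} t *\<^sub>R (b t * w t))"
      using nn[of t] by (cases "t \<in> {-1..1}") (auto simp: ennreal_mult' w_def)
  qed
  also have "\<dots> = ennreal I"
    unfolding I_def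
  proof (rule nn_integral_eq_integral[OF int])
    show "AE t in lborel. 0 \<le> indicator {-1..1} t *\<^sub>R (b t * w t)"
      using nn by (intro AE_I2) (auto simp: indicator_def w_def)
  qed
  finally show "ennreal (sphere_area (DIM('a) - 2)) *
      (\<integral>\<^sup>+t. ennreal (indicator {-1..1} t *\<^sub>R b t) * ennreal ((1 - t\<^sup>2) powr ((real DIM('a) - 3) / 2)) * indicator {-1..1} t \<partial>lborel) = 1"
    using mI by (simp add: w_def ennreal_mult'[symmetric] sphere_area_def)
qed (use dim \<gamma> in auto)

lemma weakly_continuous_L1_measurable:
  "weakly_continuous_L1 I \<psi> \<Longrightarrow> t \<in> I \<Longrightarrow> \<psi> t \<in> borel_measurable borel"
  using borel_measurable_integrable[of lborel "\<psi> t"] by (simp add: weakly_continuous_L1_def)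

lemma pairing_cong_AE:
  assumes "AE \<xi> in lborel. f \<xi> = g \<xi>" "f \<in> borel_measurable borel" "g \<in> borel_measurable borel"
    and [measurable]: "\<rho> \<in> borel_measurable borel"
  shows "pairing f \<rho> = (LINT \<xi>|lborel. g \<xi> * \<rho> \<xi>)"
proof -
  note [measurable] = assms(2,3)
  show ?thesis unfolding pairing_def
    by (rule integral_cong_AE) (use assms(1) in \<open>auto elim: eventually_mono\<close>)
qed

context angular_kernel
begin

text \<open>The two kernels agree at all cosines, and the density at time zero agrees with the initial datum up to a
  null set; so one may be substituted for the other.\<close>
lemma solution_imp_annihilation_solution:
  fixes \<psi> :: "real \<Rightarrow> 'a \<Rightarrow> real" and b0 :: "real \<Rightarrow> real"
  assumes b0: "\<And>t. t \<in> {-1..1} \<Longrightarrow> b0 t = b t"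
    and \<alpha>: "0 < \<alpha>" "\<alpha> < 1"
    and \<psi>0: "\<psi>0 \<in> weighted_L1 (2 + \<gamma>)" "\<psi>0 \<in> borel_measurable borel"
    and eq: "AE \<xi> in lborel. \<psi> 0 \<xi> = \<psi>0 \<xi>"
    and wc: "weakly_continuous_L1 {0..} \<psi>"
    and nn: "\<And>t. 0 \<le> t \<Longrightarrow> AE \<xi> in lborel. 0 \<le> \<psi> t \<xi>"
    and loc: "Linf_loc_L1 (2 + \<gamma>) \<psi>"
    and sol: "global_solution \<alpha> \<gamma> b0 \<psi>0 \<psi>"
  shows "annihilation_solution b \<gamma> \<alpha> \<psi>"
proof
  have m: "\<psi> t \<in> borel_measurable borel" if "0 \<le> t" for t
    using wc that by (intro weakly_continuous_L1_measurable) auto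
  have at0: "pairing (\<psi> 0) \<rho> = (LINT \<xi>|lborel. \<psi>0 \<xi> * \<rho> \<xi>)" if "\<rho> \<in> borel_measurable borel" for \<rho>
    by (rule pairing_cong_AE[OF eq m \<psi>0(2) that]) simp
  have sol: "solution_on \<alpha> \<gamma> b0 T \<psi>0 \<psi>" if "0 < T" for T using sol that by (simp add: global_solution_def)
  have init: "initial_datum \<psi>0" using sol[of 1] by (simp add: solution_on_def)
  show "admissible (2 + \<gamma>) (\<psi> s)" if s: "0 \<le> s" for s
  proof (cases "s = 0")
    case True
    have "integrable lborel (\<lambda>\<xi>. \<psi>0 \<xi> * bracket \<xi> powr (2 + \<gamma>))" using \<psi>0(1) by (simp add: weighted_L1_def)
    moreover have "AE \<xi> in lborel. \<psi>0 \<xi> * bracket \<xi> powr (2 + \<gamma>) = \<psi> 0 \<xi> * bracket \<xi> powr (2 + \<gamma>)"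
      using eq by eventually_elim simp
    moreover note [measurable] = m[of 0]
    ultimately have "integrable lborel (\<lambda>\<xi>. \<psi> 0 \<xi> * bracket \<xi> powr (2 + \<gamma>))"
      by (subst (asm) integrable_cong_AE[where g="\<lambda>\<xi>. \<psi> 0 \<xi> * bracket \<xi> powr (2 + \<gamma>)"]) (use \<psi>0(2) in auto)
    then show ?thesis using m[OF s] nn[OF s] True by (simp add: admissible_def weighted_L1_def)
  next
    case False
    then have "\<psi> s \<in> weighted_L1 (2 + \<gamma>)" using s by (intro weighted_L1_at_every_time[OF wc nn loc]) auto
    then show ?thesis using m[OF s] nn[OF s] by (simp add: admissible_def)
  qed
  show "\<exists>C. AE s in lborel. s \<in> {0<..<T} \<longrightarrow> weighted_L1_norm 2 (\<psi> s) \<le> C" if T: "0 < T" for T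
  proof -
    obtain C where "AE s in lborel. s \<in> {0<..<T} \<longrightarrow> \<psi> s \<in> weighted_L1 2 \<and> weighted_L1_norm 2 (\<psi> s) \<le> C"
      using sol[OF T] unfolding solution_on_def Linf_L1_def by blast
    then have "AE s in lborel. s \<in> {0<..<T} \<longrightarrow> weighted_L1_norm 2 (\<psi> s) \<le> C" by (rule eventually_mono) simp
    then show ?thesis by blast
  qed
  show "set_integrable lborel {0<..<T} (\<lambda>s. weighted_L1_norm (2 + \<gamma>) (\<psi> s))" if T: "0 < T" for T
    using sol[OF T] unfolding solution_on_def L1_L1_def by blast
  show "pairing (\<psi> 0) (\<lambda>_. 1) = 1" using at0[of "\<lambda>_. 1"] init by (simp add: initial_datum_def)
  show "pairing (\<psi> 0) (\<lambda>\<xi>. (norm \<xi>)\<^sup>2) = real DIM('a) / 2"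
    using at0[of "\<lambda>\<xi>. (norm \<xi>)\<^sup>2"] init by (simp add: initial_datum_def)
  fix \<rho> :: "'a \<Rightarrow> real" and g :: "'a \<Rightarrow> 'a" and t :: real
  assume \<rho>: "C1c_gradient \<rho> g" and t: "0 < t"
  have "continuous_on UNIV \<rho>"
    using \<rho> by (auto simp: C1c_gradient_def gderiv_def intro!: continuous_at_imp_continuous_on has_derivative_continuous)
  then have \<rho>m: "\<rho> \<in> borel_measurable borel" by (rule borel_measurable_continuous_onI)
  have coll: "collision \<alpha> \<gamma> b0 f \<xi> = collision \<alpha> \<gamma> b f \<xi>" for f :: "'a \<Rightarrow> real" and \<xi>
    unfolding collision_def by (intro arg_cong2[of _ _ _ _ "(-)"] arg_cong[of _ _ "(*) _"] Q_plus_cong b0 refl)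
  have "solution_on \<alpha> \<gamma> b0 (t + 1) \<psi>0 \<psi>" using t by (intro sol) simp
  then have "(LINT \<xi>|lborel. \<psi> t \<xi> * \<rho> \<xi>)
        + (LINT s:{0..t}|lborel.
             (A_coeff \<alpha> \<gamma> (\<psi> s) - real DIM('a) * B_coeff \<alpha> \<gamma> (\<psi> s))
               * (LINT \<xi>|lborel. \<rho> \<xi> * \<psi> s \<xi>))
        = (LINT s:{0..t}|lborel.
             B_coeff \<alpha> \<gamma> (\<psi> s) * (LINT \<xi>|lborel. \<psi> s \<xi> * (\<xi> \<bullet> g \<xi>)))
        + (LINT \<xi>|lborel. \<rho> \<xi> * \<psi>0 \<xi>)
        + (LINT s:{0..t}|lborel. (LINT \<xi>|lborel. collision \<alpha> \<gamma> b0 (\<psi> s) \<xi> * \<rho> \<xi>))"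
    using \<rho> t unfolding solution_on_def by auto
  then show "pairing (\<psi> t) \<rho> + (LINT s:{0..t}|lborel. (A_coeff \<alpha> \<gamma> (\<psi> s) - real DIM('a) * B_coeff \<alpha> \<gamma> (\<psi> s)) * pairing (\<psi> s) \<rho>)
      = (LINT s:{0..t}|lborel. B_coeff \<alpha> \<gamma> (\<psi> s) * pairing (\<psi> s) (\<lambda>\<xi>. \<xi> \<bullet> g \<xi>))
      + pairing (\<psi> 0) \<rho> + (LINT s:{0..t}|lborel. (LINT \<xi>|lborel. collision \<alpha> \<gamma> b (\<psi> s) \<xi> * \<rho> \<xi>))"
    unfolding at0[OF \<rho>m] coll unfolding pairing_def by (simp only: mult.commute[of "\<rho> _"])
qed (use \<alpha> wc in auto)

end

text \<open>The choices \<open>\<alpha>0 = (1 - \<kappa>) / (2 + \<gamma>)\<close> and \<open>M = moment_barrier\<close> involve \<open>b\<close> only through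
  the constant \<open>\<kappa>\<close> of the Povzner inequality.\<close>
theorem moment_bound:
  fixes b :: "real \<Rightarrow> real"
  assumes hyp: "2 \<le> DIM('a::euclidean_space)" "0 < \<gamma>" "\<gamma> \<le> 1"
    "b \<in> borel_measurable (restrict_space borel {-1..1})" "\<And>t. t \<in> {-1..1} \<Longrightarrow> 0 \<le> b t"
    "sphere_area (DIM('a) - 2) * (LINT t:{-1..1}|lborel. b t * (1 - t\<^sup>2) powr ((real DIM('a) - 3) / 2)) = 1"
  obtains \<alpha>0 M where "0 < \<alpha>0" "\<alpha>0 \<le> 1"
    "\<And>\<alpha> \<psi>0 \<psi>. 0 < \<alpha> \<Longrightarrow> \<alpha> < \<alpha>0 \<Longrightarrow> (\<psi>0 :: 'a \<Rightarrow> real) \<in> weighted_L1 (2 + \<gamma>) \<Longrightarrow> \<psi>0 \<in> borel_measurable borel \<Longrightarrow>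
      weakly_continuous_L1 {0..} \<psi> \<Longrightarrow> Linf_loc_L1 (2 + \<gamma>) \<psi> \<Longrightarrow> (\<And>t. 0 \<le> t \<Longrightarrow> AE \<xi> in lborel. 0 \<le> \<psi> t \<xi>) \<Longrightarrow>
      global_solution \<alpha> \<gamma> b \<psi>0 \<psi> \<Longrightarrow> (AE \<xi> in lborel. \<psi> 0 \<xi> = \<psi>0 \<xi>) \<Longrightarrow>
      (SUP t\<in>{0..}. \<integral>\<^sup>+ \<xi>. ennreal (\<psi> t \<xi> * norm \<xi> powr (2 + \<gamma>)) \<partial>lborel)
        \<le> ennreal (max (LINT \<xi>|lborel. \<psi>0 \<xi> * norm \<xi> powr (2 + \<gamma>)) M)"
proof -
  define b' where "b' = (\<lambda>t. indicator {-1..1} t *\<^sub>R b t)"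
  interpret angular_kernel b' \<gamma> "TYPE('a)"
    unfolding b'_def by (rule angular_kernel_extend_zero[OF hyp])
  obtain \<kappa> where \<kappa>: "0 \<le> \<kappa>" "\<kappa> < 1"
    and povzner: "\<And>\<epsilon> \<xi> \<xi>s. \<epsilon> > 0 \<Longrightarrow> \<xi> \<noteq> \<xi>s \<Longrightarrow>
      average (soft_moment \<epsilon>) \<xi> \<xi>s + average (soft_moment \<epsilon>) \<xi>s \<xi>
        \<le> ((norm \<xi>)\<^sup>2 + (norm \<xi>s)\<^sup>2) * soft_powr (\<gamma> / 2) \<epsilon> ((norm \<xi>)\<^sup>2 + (norm \<xi>s)\<^sup>2)"
    "\<And>\<epsilon> \<xi> \<xi>s. \<epsilon> > 0 \<Longrightarrow> \<xi> \<noteq> \<xi>s \<Longrightarrow> \<epsilon> * ((norm \<xi>)\<^sup>2 + (norm \<xi>s)\<^sup>2) \<le> 1 \<Longrightarrow>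
      average (soft_moment \<epsilon>) \<xi> \<xi>s + average (soft_moment \<epsilon>) \<xi>s \<xi>
        \<le> \<kappa> * (((norm \<xi>)\<^sup>2 + (norm \<xi>s)\<^sup>2) * soft_powr (\<gamma> / 2) \<epsilon> ((norm \<xi>)\<^sup>2 + (norm \<xi>s)\<^sup>2))"
    using povzner by blast
  define \<alpha>0 where "\<alpha>0 = (1 - \<kappa>) / (2 + \<gamma>)"
  have \<alpha>0: "0 < \<alpha>0" "\<alpha>0 \<le> 1" using \<kappa> \<gamma>_pos by (simp_all add: \<alpha>0_def)
  define M where "M = annihilation_moments.moment_barrier \<kappa> (real DIM('a))"
  show thesis
  proof (rule that[OF \<alpha>0, of M])
    fix \<alpha> and \<psi>0 :: "'a \<Rightarrow> real" and \<psi> :: "real \<Rightarrow> 'a \<Rightarrow> real"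
    assume \<alpha>: "0 < \<alpha>" "\<alpha> < \<alpha>0"
      and \<psi>0: "\<psi>0 \<in> weighted_L1 (2 + \<gamma>)" "\<psi>0 \<in> borel_measurable borel"
      and wc: "weakly_continuous_L1 {0..} \<psi>" and loc: "Linf_loc_L1 (2 + \<gamma>) \<psi>"
      and nn: "\<And>t. 0 \<le> t \<Longrightarrow> AE \<xi> in lborel. 0 \<le> \<psi> t \<xi>"
      and sol: "global_solution \<alpha> \<gamma> b \<psi>0 \<psi>" and eq: "AE \<xi> in lborel. \<psi> 0 \<xi> = \<psi>0 \<xi>"
    have sm: "\<alpha> * (2 + \<gamma>) \<le> 1 - \<kappa>" using \<alpha>(2) \<gamma>_pos by (simp add: \<alpha>0_def pos_less_divide_eq)
    have as: "annihilation_solution b' \<gamma> \<alpha> \<psi>"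
      by (rule solution_imp_annihilation_solution[OF _ \<alpha>(1) _ \<psi>0 eq wc nn loc sol]) (use \<alpha> \<alpha>0 in \<open>auto simp: b'_def\<close>)
    interpret annihilation_solution b' \<gamma> "TYPE('a)" \<alpha> \<psi> by (rule as)
    interpret annihilation_moments b' \<gamma> "TYPE('a)" \<alpha> \<psi> \<kappa> "real DIM('a)"
      by unfold_locales (use \<kappa> povzner sm in auto)
    have m0: "moment 0 = (LINT \<xi>|lborel. \<psi>0 \<xi> * norm \<xi> powr (2 + \<gamma>))"
      unfolding moment_def 
      by (rule pairing_cong_AE[OF eq weakly_continuous_L1_measurable[OF wc] \<psi>0(2)]) auto
    show "(SUP t\<in>{0..}. \<integral>\<^sup>+ \<xi>. ennreal (\<psi> t \<xi> * norm \<xi> powr (2 + \<gamma>)) \<partial>lborel)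
        \<le> ennreal (max (LINT \<xi>|lborel. \<psi>0 \<xi> * norm \<xi> powr (2 + \<gamma>)) M)"
    proof (rule SUP_least)
      fix t :: real assume "t \<in> {0..}"
      then have t: "0 \<le> t" by simp
      have "(\<integral>\<^sup>+ \<xi>. ennreal (\<psi> t \<xi> * norm \<xi> powr (2 + \<gamma>)) \<partial>lborel) = ennreal (moment t)"
        unfolding moment_def pairing_def
      proof (rule nn_integral_eq_integral)
        show "integrable lborel (\<lambda>\<xi>. \<psi> t \<xi> * norm \<xi> powr (2 + \<gamma>))" using \<gamma>_pos by (intro powr_integrable t) auto
        show "AE \<xi> in lborel. 0 \<le> \<psi> t \<xi> * norm \<xi> powr (2 + \<gamma>)" using nn[OF t] by eventually_elim simp
      qed
      also have "\<dots> \<le> ennreal (max (LINT \<xi>|lborel. \<psi>0 \<xi> * norm \<xi> powr (2 + \<gamma>)) M)"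
        using moment_le[OF t] unfolding m0 M_def by (rule ennreal_leI)
      finally show "(\<integral>\<^sup>+ \<xi>. ennreal (\<psi> t \<xi> * norm \<xi> powr (2 + \<gamma>)) \<partial>lborel)
        \<le> ennreal (max (LINT \<xi>|lborel. \<psi>0 \<xi> * norm \<xi> powr (2 + \<gamma>)) M)" .
    qed
  qed
qed

theorem theorem1p4:
  fixes \<gamma> :: real and b :: "real \<Rightarrow> real"
  assumes "2 \<le> CARD('n::finite)"
    and "0 < \<gamma>" and "\<gamma> \<le> 1"
    and "b \<in> borel_measurable (restrict_space borel {-1..1})"
    and "\<And>t. t \<in> {-1..1} \<Longrightarrow> 0 \<le> b t"
    and "sphere_area (CARD('n) - 2) *
           (LINT t:{-1..1}|lborel. b t * (1 - t\<^sup>2) powr ((real CARD('n) - 3) / 2)) = 1"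
  shows "\<exists>\<alpha>0. 0 < \<alpha>0 \<and> \<alpha>0 \<le> 1 \<and>
    (\<forall>\<alpha>. 0 < \<alpha> \<and> \<alpha> < \<alpha>0 \<longrightarrow>
      (\<exists>M :: real. \<forall>(p :: real) (\<psi>0 :: real ^ 'n \<Rightarrow> real) (\<psi> :: real \<Rightarrow> real ^ 'n \<Rightarrow> real).
         1 < p \<longrightarrow>
         \<psi>0 \<in> weighted_L1 (2 + \<gamma>) \<inter> Lp_space p \<longrightarrow>
         (AE \<xi> in lborel. 0 \<le> \<psi>0 \<xi>) \<longrightarrow>
         (LINT \<xi>|lborel. \<psi>0 \<xi>) = 1 \<longrightarrow>
         (LINT \<xi>|lborel. \<psi>0 \<xi> * (norm \<xi>)\<^sup>2) = real CARD('n) / 2 \<longrightarrow>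
         weakly_continuous_L1 {0..} \<psi> \<longrightarrow>
         Linf_loc_L1 (2 + \<gamma>) \<psi> \<longrightarrow>
         (\<forall>t\<ge>0. AE \<xi> in lborel. 0 \<le> \<psi> t \<xi>) \<longrightarrow>
         global_solution \<alpha> \<gamma> b \<psi>0 \<psi> \<longrightarrow>
         (AE \<xi> in lborel. \<psi> 0 \<xi> = \<psi>0 \<xi>) \<longrightarrow>
         (SUP t\<in>{0..}. \<integral>\<^sup>+ \<xi>. ennreal (\<psi> t \<xi> * norm \<xi> powr (2 + \<gamma>)) \<partial>lborel)
           \<le> ennreal (max (LINT \<xi>|lborel. \<psi>0 \<xi> * norm \<xi> powr (2 + \<gamma>)) M)))"
proof -
  have D: "DIM(real ^ 'n) = CARD('n)" by simp
  obtain \<alpha>0 M where \<alpha>0: "0 < \<alpha>0" "\<alpha>0 \<le> 1" and bound: "\<And>\<alpha> \<psi>0 \<psi>. 0 < \<alpha> \<Longrightarrow> \<alpha> < \<alpha>0 \<Longrightarrow>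
      (\<psi>0 :: real ^ 'n \<Rightarrow> real) \<in> weighted_L1 (2 + \<gamma>) \<Longrightarrow> \<psi>0 \<in> borel_measurable borel \<Longrightarrow>
      weakly_continuous_L1 {0..} \<psi> \<Longrightarrow> Linf_loc_L1 (2 + \<gamma>) \<psi> \<Longrightarrow> (\<And>t. 0 \<le> t \<Longrightarrow> AE \<xi> in lborel. 0 \<le> \<psi> t \<xi>) \<Longrightarrow>
      global_solution \<alpha> \<gamma> b \<psi>0 \<psi> \<Longrightarrow> (AE \<xi> in lborel. \<psi> 0 \<xi> = \<psi>0 \<xi>) \<Longrightarrow>
      (SUP t\<in>{0..}. \<integral>\<^sup>+ \<xi>. ennreal (\<psi> t \<xi> * norm \<xi> powr (2 + \<gamma>)) \<partial>lborel)
        \<le> ennreal (max (LINT \<xi>|lborel. \<psi>0 \<xi> * norm \<xi> powr (2 + \<gamma>)) M)"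
    using moment_bound[where 'a = "real ^ 'n", unfolded D, OF assms] by blast
  show ?thesis
  proof (rule exI[of _ \<alpha>0], intro conjI \<alpha>0 allI impI, elim conjE, rule exI[of _ M], intro allI impI)
    fix \<alpha> p :: real and \<psi>0 :: "real ^ 'n \<Rightarrow> real" and \<psi> :: "real \<Rightarrow> real ^ 'n \<Rightarrow> real"
    assume \<alpha>: "0 < \<alpha>" "\<alpha> < \<alpha>0" and \<psi>0: "\<psi>0 \<in> weighted_L1 (2 + \<gamma>) \<inter> Lp_space p"
      and wc: "weakly_continuous_L1 {0..} \<psi>" and loc: "Linf_loc_L1 (2 + \<gamma>) \<psi>"
      and nn: "\<forall>t\<ge>0. AE \<xi> in lborel. 0 \<le> \<psi> t \<xi>"
      and sol: "global_solution \<alpha> \<gamma> b \<psi>0 \<psi>" and eq: "AE \<xi> in lborel. \<psi> 0 \<xi> = \<psi>0 \<xi>"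
    show "(SUP t\<in>{0..}. \<integral>\<^sup>+ \<xi>. ennreal (\<psi> t \<xi> * norm \<xi> powr (2 + \<gamma>)) \<partial>lborel)
        \<le> ennreal (max (LINT \<xi>|lborel. \<psi>0 \<xi> * norm \<xi> powr (2 + \<gamma>)) M)"
      using \<psi>0 nn by (intro bound[OF \<alpha> _ _ wc loc _ sol eq]) (auto simp: Lp_space_def)
  qed
qed

end
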